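(* Let $\Bbbk$ be an algebraically closed field of characteristic $0$, let $N\ge 1$, $n\ge 2$ be integers and $\mu,\lambda\in\{1,-1\}$. If $\phi$ is a Hopf algebra automorphism of $A_{Nn}^{\mu\lambda}$, then $\phi$ is one of the following automorphisms, where $s\in\{1,\dots,N\}$ and $t\in\{1,\dots,n-1\}$. (1) $\phi=\Psi_{d_2}^{s,t}$, $d_2\in\Bbbk\setminus\{0\}$, the Hopf algebra automorphism of $A_{Nn}^{\mu\lambda}$ such that $$\Psi_{d_2}^{s,t}(x_{11})=x_{11}^{2s}\chi_{11}^t,\quad \Psi_{d_2}^{s,t}(x_{22})=x_{11}^{2s}\chi_{22}^t,\quad \Psi_{d_2}^{s,t}(x_{12})=d_2x_{12}^{2s}\chi_{12}^t,\quad \Psi_{d_2}^{s,t}(x_{21})=d_2^{-1}x_{12}^{2s}\chi_{21}^t,$$ and one of the following conditions is satisfied: (a) $t$ is odd, $t\neq \frac n2$, $\gcd(N,2s+t)=1=\gcd(t,n)$, and $d_2^{2N}=1=d_2^4$ if $n$ is even, $d_2^2=1$ if $n$ is odd; (b) $t=\frac n2=1$, $d_2^{2N}=1=d_2^4$ and $\gcd(2s+1,N)=1$. (2) $\phi=\Phi_{d_3}^{s,t}$, $d_3\in\Bbbk\setminus\{0\}$, the Hopf algebra automorphism of $A_{Nn}^{\mu\lambda}$ such that $$\Phi_{d_3}^{s,t}(x_{11})=x_{11}^{2s}\chi_{22}^t,\quad \Phi_{d_3}^{s,t}(x_{22})=x_{11}^{2s}\chi_{11}^t,\quad \Phi_{d_3}^{s,t}(x_{12})=d_3x_{12}^{2s}\chi_{21}^t,\quad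 \Phi_{d_3}^{s,t}(x_{21})=d_3^{-1}x_{12}^{2s}\chi_{12}^t,$$ and one of the following conditions is satisfied: (a) $t$ is odd, $t\neq \frac n2$, $\gcd(N,2s+t)=1=\gcd(t,n)$, and $d_3^{2N}=1=d_3^4$ if $n$ is even, $d_3^2=1$ if $n$ is odd; (b) $t=\frac n2=1$, $d_3^{2N}=1=d_3^4$ and $\gcd(2s+1,N)=1$. (3) $\phi=\Gamma^{\zeta_1,\zeta_2}_s$, where this case occurs for $\lambda=1$, $n=2$, $\gcd(2s+1,N)=1$ and $\zeta_1,\zeta_2\in\Bbbk$ satisfying $\zeta_1^4=\zeta_2^4=\mu=1$ if $N$ is even, $\zeta_1^2=\zeta_2^2=\mu$ if $N$ is odd; under these conditions $\Gamma^{\zeta_1,\zeta_2}_s$ is the Hopf algebra automorphism of $A_{N2}^{\mu\lambda}$ (with $\lambda=1$) given by $$\Gamma^{\zeta_1,\zeta_2}_s(x_{11})=\tfrac12\left[x_{11}^{2s}(x_{11}+x_{22})+x_{12}^{2s}(\zeta_2x_{12}+\zeta_2^{-1}x_{21})\right],$$ $$\Gamma^{\zeta_1,\zeta_2}_s(x_{22})=\tfrac12\left[x_{11}^{2s}(x_{11}+x_{22})-x_{12}^{2s}(\zeta_2x_{12}+\zeta_2^{-1}x_{21})\right],$$ $$\Gamma^{\zeta_1,\zeta_2}_s(x_{12})=\tfrac{\zeta_1}2\left[x_{11}^{2s}(x_{11}-x_{22})-x_{12}^{2s}(\zeta_2x_{12}-\zeta_2^{-1}x_{21})\right],$$ $$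\Gamma^{\zeta_1,\zeta_2}_s(x_{21})=\tfrac{\zeta_1^{-1}}2\left[x_{11}^{2s}(x_{11}-x_{22})+x_{12}^{2s}(\zeta_2x_{12}-\zeta_2^{-1}x_{21})\right].$$
   Context: The Suzuki Hopf algebra $A_{Nn}^{\mu\lambda}$ over $\Bbbk$ is the unital associative algebra generated by $x_{11},x_{12},x_{21},x_{22}$ with relations $$x_{11}^2=x_{22}^2,\quad x_{12}^2=x_{21}^2,\quad \chi_{21}^n=\lambda\chi_{12}^n,\quad \chi_{11}^n=\chi_{22}^n,\quad x_{11}^{2N}+\mu x_{12}^{2N}=1,$$ $$x_{ij}x_{kl}=0\ \text{ whenever } i+j+k+l \text{ is odd},$$ where for $m\ge 1$ the symbols $\chi_{ij}^m$ (superscript is not a power) denote the alternating words with $m$ letters: $\chi_{11}^m=x_{11}x_{22}x_{11}\cdots$, $\chi_{22}^m=x_{22}x_{11}x_{22}\cdots$, $\chi_{12}^m=x_{12}x_{21}x_{12}\cdots$, $\chi_{21}^m=x_{21}x_{12}x_{21}\cdots$. The Hopf structure is $\Delta(x_{ij})=x_{i1}\otimes x_{1j}+x_{i2}\otimes x_{2j}$ (more generally $\Delta(\chi_{ij}^k)=\chi_{i1}^k\otimes\chi_{1j}^k+\chi_{i2}^k\otimes\chi_{2j}^k$ for $k\ge1$), $\varepsilon(x_{ij})=\delta_{ij}$, $S(x_{ij})=x_{ji}^{4N-1}$. It has dimension $4Nn$, with basis $\{x_{11}^s\chi_{22}^t,\ x_{12}^s\chi_{21}^t\mid 1\le s\le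 2N,\ 0\le t\le n-1\}$ (where $\chi^0$ is the empty word). *)

theory Defs
  imports
    "HOL-Algebra.Bij"
    "HOL-Algebra.Module"
    "HOL-Algebra.QuotRing"
    "HOL-Computational_Algebra.Polynomial"
    "HOL-Library.Poly_Mapping"
begin

hide_const (open) Polynomial.smult

section \<open>Associative algebras over a field\<close>

text \<open>
  Associative unital algebras over the ground field \<open>'k\<close> are represented by the record
  \<^typ>\<open>('k, 'a) module\<close>. (The locale \<open>algebra\<close> of HOL-Algebra covers commutative algebras only.)
\<close>

definition ground_algebra :: "('k::field, 'k) module"
  where "ground_algebra =
    \<lparr>carrier = UNIV, monoid.mult = (*), one = 1, zero = 0, add = (+), smult = (*)\<rparr>"

definition opposite_algebra :: "('k, 'a, 'z) module_scheme \<Rightarrow> ('k, 'a, 'z) module_scheme"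
  where "opposite_algebra A = A\<lparr>monoid.mult := (\<lambda>a b. b \<otimes>\<^bsub>A\<^esub> a)\<rparr>"

definition algebra_hom ::
    "('k, 'a, 'y) module_scheme \<Rightarrow> ('k, 'b, 'z) module_scheme \<Rightarrow> ('a \<Rightarrow> 'b) set"
  where "algebra_hom A B =
    {h \<in> ring_hom A B. \<forall>c. \<forall>a\<in>carrier A. h (c \<odot>\<^bsub>A\<^esub> a) = c \<odot>\<^bsub>B\<^esub> h a}"

definition monoid_algebra :: "('m, 'z) monoid_scheme \<Rightarrow> ('k::field, 'm \<Rightarrow>\<^sub>0 'k) module"
  where "monoid_algebra M =
    \<lparr>carrier = {f. Poly_Mapping.keys f \<subseteq> carrier M},
     monoid.mult = (\<lambda>f g. \<Sum>p\<in>Poly_Mapping.keys f. \<Sum>q\<in>Poly_Mapping.keys g.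
       Poly_Mapping.single (p \<otimes>\<^bsub>M\<^esub> q) (Poly_Mapping.lookup f p * Poly_Mapping.lookup g q)),
     one = Poly_Mapping.single \<one>\<^bsub>M\<^esub> 1,
     zero = 0,
     add = (+),
     smult = (\<lambda>c. Poly_Mapping.map ((*) c))\<rparr>"

text \<open>The quotient of \<open>A\<close> by the two-sided ideal generated by \<open>S\<close>; its elements are cosets.\<close>

definition quotient_algebra :: "('k, 'a, 'z) module_scheme \<Rightarrow> 'a set \<Rightarrow> ('k, 'a set) module"
  where "quotient_algebra A S =
    ring.extend (A Quot (Idl\<^bsub>A\<^esub> S))
      (module.fields (\<lambda>c X. \<Union>a\<in>X. (Idl\<^bsub>A\<^esub> S) +>\<^bsub>A\<^esub> (c \<odot>\<^bsub>A\<^esub> a)))"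

definition linear_extension ::
    "('k::field, 'b, 'z) module_scheme \<Rightarrow> ('p \<Rightarrow> 'b) \<Rightarrow> ('p \<Rightarrow>\<^sub>0 'k) \<Rightarrow> 'b"
  where "linear_extension B g f = (\<Oplus>\<^bsub>B\<^esub>p\<in>Poly_Mapping.keys f. Poly_Mapping.lookup f p \<odot>\<^bsub>B\<^esub> g p)"

text \<open>
  The map induced on cosets by a map that is constant on each of them; as in HOL-Algebra,
  \<open>the_elem\<close> extracts the common value.
\<close>

definition induced_map :: "('b set, 'z) partial_object_scheme \<Rightarrow> ('b \<Rightarrow> 'c) \<Rightarrow> 'b set \<Rightarrow> 'c"
  where "induced_map Q h = (\<lambda>X\<in>carrier Q. the_elem (h ` X))"


section \<open>Presentations by generators and relations\<close>

definition free_monoid :: "'x set \<Rightarrow> 'x list monoid"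
  where "free_monoid G = \<lparr>carrier = lists G, monoid.mult = (@), one = []\<rparr>"

definition free_algebra :: "'x set \<Rightarrow> ('k::field, 'x list \<Rightarrow>\<^sub>0 'k) module"
  where "free_algebra G = monoid_algebra (free_monoid G)"

definition free_generator :: "'x \<Rightarrow> 'x list \<Rightarrow>\<^sub>0 'k::field"
  where "free_generator x = Poly_Mapping.single [x] 1"

definition word_value :: "('b, 'z) monoid_scheme \<Rightarrow> ('x \<Rightarrow> 'b) \<Rightarrow> 'x list \<Rightarrow> 'b"
  where "word_value B g w = foldr (\<lambda>x b. g x \<otimes>\<^bsub>B\<^esub> b) w \<one>\<^bsub>B\<^esub>"

definition presented_algebra ::
    "'x set \<Rightarrow> ('x list \<Rightarrow>\<^sub>0 'k::field) set \<Rightarrow> ('k, ('x list \<Rightarrow>\<^sub>0 'k) set) module"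
  where "presented_algebra G R = quotient_algebra (free_algebra G) R"

definition presented_generator ::
    "'x set \<Rightarrow> ('x list \<Rightarrow>\<^sub>0 'k::field) set \<Rightarrow> 'x \<Rightarrow> ('x list \<Rightarrow>\<^sub>0 'k) set"
  where "presented_generator G R x =
    (Idl\<^bsub>free_algebra G\<^esub> R) +>\<^bsub>free_algebra G\<^esub> free_generator x"

text \<open>
  The algebra homomorphism from the presented algebra to \<open>B\<close> that sends each generator \<open>x\<close> to
  \<open>g x\<close>; it exists if the elements \<open>g x\<close> satisfy the relations \<open>R\<close>.
\<close>

definition presented_hom ::
    "'x set \<Rightarrow> ('x list \<Rightarrow>\<^sub>0 'k::field) set \<Rightarrow> ('k, 'b, 'z) module_scheme \<Rightarrow> ('x \<Rightarrow> 'b)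
      \<Rightarrow> ('x list \<Rightarrow>\<^sub>0 'k) set \<Rightarrow> 'b"
  where "presented_hom G R B g =
    induced_map (presented_algebra G R) (linear_extension B (word_value B g))"


section \<open>Tensor products\<close>

text \<open>
  The vector space on the basis \<open>carrier A \<times> carrier B\<close> is the monoid algebra of the
  multiplicative monoid \<open>A \<times>\<times> B\<close>. The ideal generated by the bilinearity relators is just their
  linear span, since multiplication by a basis vector permutes the relators of each kind among
  themselves; so the quotient is the usual \<open>A \<otimes> B\<close> with \<open>(a \<otimes> b) (a' \<otimes> b') = aa' \<otimes> bb'\<close>.
\<close>

definition bilinearity_relators ::
    "('k::field, 'a, 'y) module_scheme \<Rightarrow> ('k, 'b, 'z) module_scheme \<Rightarrow> ('a \<times> 'b \<Rightarrow>\<^sub>0 'k) set"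
  where "bilinearity_relators A B =
    {Poly_Mapping.single (a \<oplus>\<^bsub>A\<^esub> a', b) 1 - Poly_Mapping.single (a, b) 1 - Poly_Mapping.single (a', b) 1
      | a a' b. a \<in> carrier A \<and> a' \<in> carrier A \<and> b \<in> carrier B} \<union>
    {Poly_Mapping.single (a, b \<oplus>\<^bsub>B\<^esub> b') 1 - Poly_Mapping.single (a, b) 1 - Poly_Mapping.single (a, b') 1
      | a b b'. a \<in> carrier A \<and> b \<in> carrier B \<and> b' \<in> carrier B} \<union>
    {Poly_Mapping.single (c \<odot>\<^bsub>A\<^esub> a, b) 1 - Poly_Mapping.single (a, b) c
      | c a b. a \<in> carrier A \<and> b \<in> carrier B} \<union>
    {Poly_Mapping.single (a, c \<odot>\<^bsub>B\<^esub> b) 1 - Poly_Mapping.single (a, b) c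
      | c a b. a \<in> carrier A \<and> b \<in> carrier B}"

definition tensor_algebra ::
    "('k::field, 'a, 'y) module_scheme \<Rightarrow> ('k, 'b, 'z) module_scheme
      \<Rightarrow> ('k, ('a \<times> 'b \<Rightarrow>\<^sub>0 'k) set) module"
  where "tensor_algebra A B =
    quotient_algebra (monoid_algebra (A \<times>\<times> B)) (bilinearity_relators A B)"

definition pure_tensor ::
    "('k::field, 'a, 'y) module_scheme \<Rightarrow> ('k, 'b, 'z) module_scheme
      \<Rightarrow> 'a \<Rightarrow> 'b \<Rightarrow> ('a \<times> 'b \<Rightarrow>\<^sub>0 'k) set"
  where "pure_tensor A B a b =
    (Idl\<^bsub>monoid_algebra (A \<times>\<times> B)\<^esub> (bilinearity_relators A B))
      +>\<^bsub>monoid_algebra (A \<times>\<times> B)\<^esub> Poly_Mapping.single (a, b) 1"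

text \<open>The map \<open>f \<otimes> g\<close> from \<open>A \<otimes> B\<close> to \<open>A' \<otimes> B'\<close>, for linear \<open>f\<close> and \<open>g\<close>.\<close>

definition tensor_map ::
    "('k::field, 'a, 'y) module_scheme \<Rightarrow> ('k, 'b, 'z) module_scheme
      \<Rightarrow> ('k, 'c, 'v) module_scheme \<Rightarrow> ('k, 'd, 'w) module_scheme
      \<Rightarrow> ('a \<Rightarrow> 'c) \<Rightarrow> ('b \<Rightarrow> 'd) \<Rightarrow> ('a \<times> 'b \<Rightarrow>\<^sub>0 'k) set \<Rightarrow> ('c \<times> 'd \<Rightarrow>\<^sub>0 'k) set"
  where "tensor_map A B A' B' f g =
    induced_map (tensor_algebra A B)
      (linear_extension (tensor_algebra A' B') (\<lambda>(a, b). pure_tensor A' B' (f a) (g b)))"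


section \<open>Hopf algebra automorphisms\<close>

record (overloaded) ('k, 'a) hopf_algebra = "('k::field, 'a) module" +
  comult :: "'a \<Rightarrow> ('a \<times> 'a \<Rightarrow>\<^sub>0 'k) set"
  counit :: "'a \<Rightarrow> 'k"
  antipode :: "'a \<Rightarrow> 'a"

text \<open>
  As in \<^const>\<open>auto\<close>, maps in \<^const>\<open>Bij\<close> are extensional, so an automorphism is determined by its
  values on the carrier.
\<close>

definition hopf_auto :: "('k::field, 'a, 'z) hopf_algebra_scheme \<Rightarrow> ('a \<Rightarrow> 'a) set"
  where "hopf_auto H =
    {\<phi> \<in> algebra_hom H H \<inter> Bij (carrier H).
      \<forall>a\<in>carrier H.
        comult H (\<phi> a) = tensor_map H H H H \<phi> \<phi> (comult H a) \<and>
        counit H (\<phi> a) = counit H a \<and>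
        antipode H (\<phi> a) = \<phi> (antipode H a)}"


section \<open>The Suzuki Hopf algebras\<close>

text \<open>
  \<open>alternating M x i j m\<close> is the product, in the monoid \<open>M\<close>, of the alternating word with \<open>m\<close>
  letters that starts with \<open>x i j\<close>; for \<open>i, j \<in> {1, 2}\<close> the letter after \<open>x i j\<close> is
  \<open>x (3 - i) (3 - j)\<close>, that is, 11 alternates with 22 and 12 with 21.
\<close>

primrec alternating ::
    "('a, 'z) monoid_scheme \<Rightarrow> (nat \<Rightarrow> nat \<Rightarrow> 'a) \<Rightarrow> nat \<Rightarrow> nat \<Rightarrow> nat \<Rightarrow> 'a"
  where
    "alternating M x i j 0 = \<one>\<^bsub>M\<^esub>"
  | "alternating M x i j (Suc m) = x i j \<otimes>\<^bsub>M\<^esub> alternating M x (3 - i) (3 - j) m"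

definition suzuki_generators :: "(nat \<times> nat) set"
  where "suzuki_generators = {1, 2} \<times> {1, 2}"

definition suzuki_relators ::
    "nat \<Rightarrow> nat \<Rightarrow> 'k::field \<Rightarrow> 'k \<Rightarrow> ((nat \<times> nat) list \<Rightarrow>\<^sub>0 'k) set"
  where "suzuki_relators N n mu lam =
    (let F = free_algebra suzuki_generators;
         x = (\<lambda>i j. free_generator (i, j));
         \<chi> = alternating F x
     in {x 1 1 [^]\<^bsub>F\<^esub> (2::nat) \<ominus>\<^bsub>F\<^esub> x 2 2 [^]\<^bsub>F\<^esub> (2::nat),
         x 1 2 [^]\<^bsub>F\<^esub> (2::nat) \<ominus>\<^bsub>F\<^esub> x 2 1 [^]\<^bsub>F\<^esub> (2::nat),
         \<chi> 2 1 n \<ominus>\<^bsub>F\<^esub> lam \<odot>\<^bsub>F\<^esub> \<chi> 1 2 n,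
         \<chi> 1 1 n \<ominus>\<^bsub>F\<^esub> \<chi> 2 2 n,
         (x 1 1 [^]\<^bsub>F\<^esub> (2 * N) \<oplus>\<^bsub>F\<^esub> mu \<odot>\<^bsub>F\<^esub> (x 1 2 [^]\<^bsub>F\<^esub> (2 * N))) \<ominus>\<^bsub>F\<^esub> \<one>\<^bsub>F\<^esub>} \<union>
        {x i j \<otimes>\<^bsub>F\<^esub> x k l | i j k l.
          i \<in> {1, 2} \<and> j \<in> {1, 2} \<and> k \<in> {1, 2} \<and> l \<in> {1, 2} \<and> odd (i + j + k + l)})"

definition suzuki_algebra ::
    "nat \<Rightarrow> nat \<Rightarrow> 'k::field \<Rightarrow> 'k \<Rightarrow> ('k, ((nat \<times> nat) list \<Rightarrow>\<^sub>0 'k) set) module"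
  where "suzuki_algebra N n mu lam =
    presented_algebra suzuki_generators (suzuki_relators N n mu lam)"

definition suzuki_x ::
    "nat \<Rightarrow> nat \<Rightarrow> 'k::field \<Rightarrow> 'k \<Rightarrow> nat \<Rightarrow> nat \<Rightarrow> ((nat \<times> nat) list \<Rightarrow>\<^sub>0 'k) set"
  where "suzuki_x N n mu lam i j =
    presented_generator suzuki_generators (suzuki_relators N n mu lam) (i, j)"

definition suzuki_hom ::
    "nat \<Rightarrow> nat \<Rightarrow> 'k::field \<Rightarrow> 'k \<Rightarrow> ('k, 'b, 'z) module_scheme \<Rightarrow> (nat \<Rightarrow> nat \<Rightarrow> 'b)
      \<Rightarrow> ((nat \<times> nat) list \<Rightarrow>\<^sub>0 'k) set \<Rightarrow> 'b"
  where "suzuki_hom N n mu lam B g =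
    presented_hom suzuki_generators (suzuki_relators N n mu lam) B (\<lambda>(i, j). g i j)"

text \<open>
  The comultiplication and the counit are algebra homomorphisms; the antipode is an algebra
  antihomomorphism, that is, an algebra homomorphism to the opposite algebra.
\<close>

definition suzuki ::
    "nat \<Rightarrow> nat \<Rightarrow> 'k::field \<Rightarrow> 'k \<Rightarrow> ('k, ((nat \<times> nat) list \<Rightarrow>\<^sub>0 'k) set) hopf_algebra"
  where "suzuki N n mu lam =
    (let A = suzuki_algebra N n mu lam;
         x = suzuki_x N n mu lam
     in module.extend A (hopf_algebra.fields
       (suzuki_hom N n mu lam (tensor_algebra A A)
         (\<lambda>i j. pure_tensor A A (x i 1) (x 1 j) \<oplus>\<^bsub>tensor_algebra A A\<^esub>
                pure_tensor A A (x i 2) (x 2 j)))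
       (suzuki_hom N n mu lam ground_algebra (\<lambda>i j. if i = j then 1 else 0))
       (suzuki_hom N n mu lam (opposite_algebra A) (\<lambda>i j. x j i [^]\<^bsub>A\<^esub> (4 * N - 1)))))"

definition suzuki_chi ::
    "nat \<Rightarrow> nat \<Rightarrow> 'k::field \<Rightarrow> 'k \<Rightarrow> nat \<Rightarrow> nat \<Rightarrow> nat \<Rightarrow> ((nat \<times> nat) list \<Rightarrow>\<^sub>0 'k) set"
  where "suzuki_chi N n mu lam = alternating (suzuki N n mu lam) (suzuki_x N n mu lam)"


section \<open>The automorphisms in the classification\<close>

definition is_Psi ::
    "nat \<Rightarrow> nat \<Rightarrow> 'k::field \<Rightarrow> 'k \<Rightarrow> nat \<Rightarrow> nat \<Rightarrow> 'k
      \<Rightarrow> (((nat \<times> nat) list \<Rightarrow>\<^sub>0 'k) set \<Rightarrow> ((nat \<times> nat) list \<Rightarrow>\<^sub>0 'k) set) \<Rightarrow> bool"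
  where "is_Psi N n mu lam s t d \<phi> \<longleftrightarrow>
    (let A = suzuki N n mu lam; x = suzuki_x N n mu lam; \<chi> = suzuki_chi N n mu lam
     in \<phi> \<in> hopf_auto A \<and>
        \<phi> (x 1 1) = x 1 1 [^]\<^bsub>A\<^esub> (2 * s) \<otimes>\<^bsub>A\<^esub> \<chi> 1 1 t \<and>
        \<phi> (x 2 2) = x 1 1 [^]\<^bsub>A\<^esub> (2 * s) \<otimes>\<^bsub>A\<^esub> \<chi> 2 2 t \<and>
        \<phi> (x 1 2) = d \<odot>\<^bsub>A\<^esub> (x 1 2 [^]\<^bsub>A\<^esub> (2 * s) \<otimes>\<^bsub>A\<^esub> \<chi> 1 2 t) \<and>
        \<phi> (x 2 1) = inverse d \<odot>\<^bsub>A\<^esub> (x 1 2 [^]\<^bsub>A\<^esub> (2 * s) \<otimes>\<^bsub>A\<^esub> \<chi> 2 1 t))"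

definition is_Phi ::
    "nat \<Rightarrow> nat \<Rightarrow> 'k::field \<Rightarrow> 'k \<Rightarrow> nat \<Rightarrow> nat \<Rightarrow> 'k
      \<Rightarrow> (((nat \<times> nat) list \<Rightarrow>\<^sub>0 'k) set \<Rightarrow> ((nat \<times> nat) list \<Rightarrow>\<^sub>0 'k) set) \<Rightarrow> bool"
  where "is_Phi N n mu lam s t d \<phi> \<longleftrightarrow>
    (let A = suzuki N n mu lam; x = suzuki_x N n mu lam; \<chi> = suzuki_chi N n mu lam
     in \<phi> \<in> hopf_auto A \<and>
        \<phi> (x 1 1) = x 1 1 [^]\<^bsub>A\<^esub> (2 * s) \<otimes>\<^bsub>A\<^esub> \<chi> 2 2 t \<and>
        \<phi> (x 2 2) = x 1 1 [^]\<^bsub>A\<^esub> (2 * s) \<otimes>\<^bsub>A\<^esub> \<chi> 1 1 t \<and>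
        \<phi> (x 1 2) = d \<odot>\<^bsub>A\<^esub> (x 1 2 [^]\<^bsub>A\<^esub> (2 * s) \<otimes>\<^bsub>A\<^esub> \<chi> 2 1 t) \<and>
        \<phi> (x 2 1) = inverse d \<odot>\<^bsub>A\<^esub> (x 1 2 [^]\<^bsub>A\<^esub> (2 * s) \<otimes>\<^bsub>A\<^esub> \<chi> 1 2 t))"

definition is_Gamma ::
    "nat \<Rightarrow> nat \<Rightarrow> 'k::field \<Rightarrow> 'k \<Rightarrow> nat \<Rightarrow> 'k \<Rightarrow> 'k
      \<Rightarrow> (((nat \<times> nat) list \<Rightarrow>\<^sub>0 'k) set \<Rightarrow> ((nat \<times> nat) list \<Rightarrow>\<^sub>0 'k) set) \<Rightarrow> bool"
  where "is_Gamma N n mu lam s \<zeta>1 \<zeta>2 \<phi> \<longleftrightarrow>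
    (let A = suzuki N n mu lam; x = suzuki_x N n mu lam;
         u = x 1 1 [^]\<^bsub>A\<^esub> (2 * s); v = x 1 2 [^]\<^bsub>A\<^esub> (2 * s);
         x11_plus_x22 = x 1 1 \<oplus>\<^bsub>A\<^esub> x 2 2;
         x11_minus_x22 = x 1 1 \<ominus>\<^bsub>A\<^esub> x 2 2;
         zx12_plus_zx21 = \<zeta>2 \<odot>\<^bsub>A\<^esub> x 1 2 \<oplus>\<^bsub>A\<^esub> inverse \<zeta>2 \<odot>\<^bsub>A\<^esub> x 2 1;
         zx12_minus_zx21 = \<zeta>2 \<odot>\<^bsub>A\<^esub> x 1 2 \<ominus>\<^bsub>A\<^esub> inverse \<zeta>2 \<odot>\<^bsub>A\<^esub> x 2 1
     in \<phi> \<in> hopf_auto A \<and>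
        \<phi> (x 1 1) = (1 / 2) \<odot>\<^bsub>A\<^esub> (u \<otimes>\<^bsub>A\<^esub> x11_plus_x22 \<oplus>\<^bsub>A\<^esub> v \<otimes>\<^bsub>A\<^esub> zx12_plus_zx21) \<and>
        \<phi> (x 2 2) = (1 / 2) \<odot>\<^bsub>A\<^esub> (u \<otimes>\<^bsub>A\<^esub> x11_plus_x22 \<ominus>\<^bsub>A\<^esub> v \<otimes>\<^bsub>A\<^esub> zx12_plus_zx21) \<and>
        \<phi> (x 1 2) = (\<zeta>1 / 2) \<odot>\<^bsub>A\<^esub> (u \<otimes>\<^bsub>A\<^esub> x11_minus_x22 \<ominus>\<^bsub>A\<^esub> v \<otimes>\<^bsub>A\<^esub> zx12_minus_zx21) \<and>
        \<phi> (x 2 1) = (inverse \<zeta>1 / 2) \<odot>\<^bsub>A\<^esub> (u \<otimes>\<^bsub>A\<^esub> x11_minus_x22 \<oplus>\<^bsub>A\<^esub> v \<otimes>\<^bsub>A\<^esub> zx12_minus_zx21))"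

text \<open>The condition \<open>t = n/2\<close> is stated as \<open>2 * t = n\<close>, since \<open>div\<close> would truncate.\<close>

definition Psi_Phi_condition :: "nat \<Rightarrow> nat \<Rightarrow> nat \<Rightarrow> nat \<Rightarrow> 'k::field \<Rightarrow> bool"
  where "Psi_Phi_condition N n s t d \<longleftrightarrow>
    (odd t \<and> 2 * t \<noteq> n \<and> gcd N (2 * s + t) = 1 \<and> gcd t n = 1 \<and>
      (if even n then d ^ (2 * N) = 1 \<and> d ^ 4 = 1 else d ^ 2 = 1)) \<or>
    (2 * t = n \<and> t = 1 \<and> d ^ (2 * N) = 1 \<and> d ^ 4 = 1 \<and> gcd (2 * s + 1) N = 1)"

definition Gamma_condition ::
    "nat \<Rightarrow> nat \<Rightarrow> 'k::field \<Rightarrow> 'k \<Rightarrow> nat \<Rightarrow> 'k \<Rightarrow> 'k \<Rightarrow> bool"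
  where "Gamma_condition N n mu lam s \<zeta>1 \<zeta>2 \<longleftrightarrow>
    lam = 1 \<and> n = 2 \<and> gcd (2 * s + 1) N = 1 \<and>
    (if even N then \<zeta>1 ^ 4 = 1 \<and> \<zeta>2 ^ 4 = 1 \<and> mu = 1 else \<zeta>1 ^ 2 = mu \<and> \<zeta>2 ^ 2 = mu)"

end

theory Submission
  imports Defs
begin

text \<open>
  The Suzuki algebra is the direct sum of two components, spanned by the words in \<open>x\<^sub>1\<^sub>1, x\<^sub>2\<^sub>2\<close> and by
  those in \<open>x\<^sub>1\<^sub>2, x\<^sub>2\<^sub>1\<close>. Both are group algebras, twisted by signs in the second case, of the
  quotient of the group \<open>\<langle>u, v | u u = v v\<rangle>\<close> by \<open>(u u)\<^sup>N\<close> and \<open>(u v\<^sup>-\<^sup>1)\<^sup>n\<close>. So linear functionals are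
  functions \<open>F g d\<close> on two copies of the infinite group that are periodic up to signs, and the product
  of functionals dual to the comultiplication is a convolution over the two copies that involves the
  automorphism swapping \<open>u\<close> and \<open>v\<close>. For an automorphism \<open>\<phi>\<close>, the comatrix \<open>\<phi> (x\<^sub>i\<^sub>j)\<close> turns
  functionals into \<open>2 \<times> 2\<close> matrices multiplicatively, and the functions concentrated at the points of
  the first copy become orthogonal idempotents. Surjectivity of \<open>\<phi>\<close> makes one of them nonzero at a
  point \<open>g\<close> that the swap moves; then the swapped point occurs too, so these two projections have rank
  one and add up to the identity, and everything is supported at the two points. If the projections
  are diagonal, \<open>\<phi>\<close> is \<open>\<Psi>\<close> or \<open>\<Phi>\<close>. Otherwise \<open>x\<^sub>1\<^sub>1 x\<^sub>1\<^sub>2 = 0 = x\<^sub>1\<^sub>1 x\<^sub>2\<^sub>1\<close> forces \<open>n = 2\<close> and diagonal entries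
  \<open>1/2\<close>, and the remaining relations leave only \<open>\<Gamma>\<close>. The conditions on \<open>s\<close> and \<open>t\<close> say that the two
  points generate the finite group, which also gives surjectivity in the converse direction.
\<close>

section \<open>Associative algebras\<close>

text \<open>In the second component \<open>z^N\<close> and \<open>r^n\<close> act as the scalars
  \<open>mu\<close> and \<open>lam\<close>, so over the finite group every product would carry a
  cocycle. Over the infinite group multiplication is plain addition of indices, and signs occur only
  in the two shift rules. The same choice turns functionals into functions obeying these rules;
  pairs of them separate the points of the tensor square, so an identity between tensors becomes one
  between scalars. The swap comes from the index pattern of the comultiplication:
  \<open>x i k\<close> on the left is followed by \<open>x k j\<close> on the right, so the leading
  index changes exactly when the left factor lies in the second component. The conditions on the
  scalar \<open>d\<close> of \<Psi> and \<Phi> have three sources: \<open>u u = v v\<close> forces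
  \<open>d ^ 4 = 1\<close>, the rule for \<open>z^N\<close> forces \<open>d ^ (2 * N) = 1\<close>,
  and the rule for \<open>r^n\<close> forces \<open>d ^ (2 * n) = 1\<close>. Given the first, the
  last says \<open>d ^ 2 = 1\<close> for odd \<open>n\<close> and nothing for even
  \<open>n\<close>.\<close>

locale assoc_algebra = ring A for A :: "('k::field, 'a, 'z) module_scheme" (structure) +
  assumes smult_closed [simp, intro]: "a \<in> carrier A \<Longrightarrow> c \<odot> a \<in> carrier A"
    and smult_add_right: "\<lbrakk>a \<in> carrier A; b \<in> carrier A\<rbrakk> \<Longrightarrow> c \<odot> (a \<oplus> b) = c \<odot> a \<oplus> c \<odot> b"
    and smult_add_left: "a \<in> carrier A \<Longrightarrow> (c + d) \<odot> a = c \<odot> a \<oplus> d \<odot> a"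
    and smult_smult: "a \<in> carrier A \<Longrightarrow> c \<odot> (d \<odot> a) = (c * d) \<odot> a"
    and smult_one [simp]: "a \<in> carrier A \<Longrightarrow> 1 \<odot> a = a"
    and smult_mult_left: "\<lbrakk>a \<in> carrier A; b \<in> carrier A\<rbrakk> \<Longrightarrow> (c \<odot> a) \<otimes> b = c \<odot> (a \<otimes> b)"
    and smult_mult_right: "\<lbrakk>a \<in> carrier A; b \<in> carrier A\<rbrakk> \<Longrightarrow> a \<otimes> (c \<odot> b) = c \<odot> (a \<otimes> b)"
begin

lemma smult_zero_left [simp]: "a \<in> carrier A \<Longrightarrow> 0 \<odot> a = \<zero>"
  using smult_add_left[of a 0 0] by (metis add.l_cancel_one' add_0 smult_closed)

lemma smult_zero_right [simp]: "c \<odot> \<zero> = \<zero>"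
  using smult_smult[of \<zero> c 0] by simp

lemma smult_minus_one: "a \<in> carrier A \<Longrightarrow> (-1) \<odot> a = \<ominus> a"
  using smult_add_left[of a "-1" 1] minus_equality[of "(-1) \<odot> a" a] by simp

lemma minus_eq_smult: "\<lbrakk>a \<in> carrier A; b \<in> carrier A\<rbrakk> \<Longrightarrow> a \<ominus> b = a \<oplus> (-1) \<odot> b"
  by (simp add: a_minus_def smult_minus_one)

lemma smult_finsum: "f \<in> I \<rightarrow> carrier A \<Longrightarrow> c \<odot> finsum A f I = (\<Oplus>i\<in>I. c \<odot> f i)"
  by (induct I rule: infinite_finite_induct) (auto simp: smult_add_right Pi_def)

lemma linear_extension_superset:
  assumes "finite K" "Poly_Mapping.keys f \<subseteq> K" "g \<in> K \<rightarrow> carrier A"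
  shows "linear_extension A g f = (\<Oplus>p\<in>K. Poly_Mapping.lookup f p \<odot> g p)"
  unfolding linear_extension_def
  using assms by (intro add.finprod_mono_neutral_cong_left) (auto simp: in_keys_iff Pi_iff)

lemma linear_extension_closed [simp]:
  "g \<in> Poly_Mapping.keys f \<rightarrow> carrier A \<Longrightarrow> linear_extension A g f \<in> carrier A"
  unfolding linear_extension_def by (auto intro!: finsum_closed)

lemma linear_extension_zero [simp]: "linear_extension A g 0 = \<zero>"
  by (simp add: linear_extension_def)

lemma linear_extension_single:
  "g p \<in> carrier A \<Longrightarrow> linear_extension A g (Poly_Mapping.single p c) = c \<odot> g p"
  by (subst linear_extension_superset[where K = "{p}"]) (auto simp: lookup_single)

lemma linear_extension_add:
  assumes "g \<in> C \<rightarrow> carrier A" "Poly_Mapping.keys f \<subseteq> C" "Poly_Mapping.keys h \<subseteq> C"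
  shows "linear_extension A g (f + h) = linear_extension A g f \<oplus> linear_extension A g h"
proof -
  let ?K = "Poly_Mapping.keys f \<union> Poly_Mapping.keys h"
  have g: "g \<in> ?K \<rightarrow> carrier A" using assms by auto
  have "linear_extension A g (f + h) =
      (\<Oplus>p\<in>?K. Poly_Mapping.lookup (f + h) p \<odot> g p)"
    using g Poly_Mapping.keys_add[of f h] by (intro linear_extension_superset) auto
  also have "\<dots> = (\<Oplus>p\<in>?K. Poly_Mapping.lookup f p \<odot> g p \<oplus> Poly_Mapping.lookup h p \<odot> g p)"
    using g by (intro finsum_cong') (auto simp: lookup_add smult_add_left Pi_def)
  also have "\<dots> = (\<Oplus>p\<in>?K. Poly_Mapping.lookup f p \<odot> g p) \<oplus> (\<Oplus>p\<in>?K. Poly_Mapping.lookup h p \<odot> g p)"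
    using g by (intro finsum_addf) (auto simp: Pi_def)
  finally show ?thesis
    using g by (simp add: linear_extension_superset[of ?K, OF _ _ g])
qed

end

lemma keys_map_times: "Poly_Mapping.keys (Poly_Mapping.map ((*) (c::'k::field)) f) \<subseteq> Poly_Mapping.keys f"
  by (auto simp: in_keys_iff Poly_Mapping.map.rep_eq when_def)

lemma lookup_map_times [simp]:
  "Poly_Mapping.lookup (Poly_Mapping.map ((*) (c::'k::field)) f) p = c * Poly_Mapping.lookup f p"
  by (simp add: Poly_Mapping.map.rep_eq when_def)

lemma (in assoc_algebra) linear_extension_smult:
  assumes "g \<in> Poly_Mapping.keys f \<rightarrow> carrier A"
  shows "linear_extension A g (Poly_Mapping.map ((*) c) f) = c \<odot> linear_extension A g f"
proof -
  have "linear_extension A g (Poly_Mapping.map ((*) c) f) =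
      (\<Oplus>p\<in>Poly_Mapping.keys f. (c * Poly_Mapping.lookup f p) \<odot> g p)"
    using assms by (subst linear_extension_superset[OF _ keys_map_times]) auto
  also have "\<dots> = (\<Oplus>p\<in>Poly_Mapping.keys f. c \<odot> (Poly_Mapping.lookup f p \<odot> g p))"
    using assms by (intro finsum_cong') (auto simp: smult_smult Pi_def)
  also have "\<dots> = c \<odot> linear_extension A g f"
    unfolding linear_extension_def using assms by (intro smult_finsum[symmetric]) (auto simp: Pi_def)
  finally show ?thesis .
qed

section \<open>Monoid algebras\<close>

context
  fixes M :: "('m, 'z) monoid_scheme" (structure)
begin

lemma carrier_monoid_algebra:
  "carrier (monoid_algebra M :: ('k::field, _) module) = {f. Poly_Mapping.keys f \<subseteq> carrier M}"
  and one_monoid_algebra: "\<one>\<^bsub>(monoid_algebra M :: ('k::field, _) module)\<^esub> = Poly_Mapping.single \<one> 1"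
  and zero_monoid_algebra: "\<zero>\<^bsub>(monoid_algebra M :: ('k::field, _) module)\<^esub> = 0"
  and add_monoid_algebra: "f \<oplus>\<^bsub>(monoid_algebra M :: ('k::field, _) module)\<^esub> g = f + g"
  and smult_monoid_algebra:
    "c \<odot>\<^bsub>(monoid_algebra M :: ('k::field, _) module)\<^esub> f = Poly_Mapping.map ((*) c) f"
  by (simp_all add: monoid_algebra_def)

text \<open>The support of a sum may be smaller than the union of the supports. Allowing larger
  index sets \<open>K\<close> and \<open>L\<close> makes bilinearity a termwise identity over a
  common index set.\<close>

lemma mult_monoid_algebra:
  fixes f g :: "'m \<Rightarrow>\<^sub>0 'k::field"
  assumes "finite K" "Poly_Mapping.keys f \<subseteq> K" "finite L" "Poly_Mapping.keys g \<subseteq> L"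
  shows "f \<otimes>\<^bsub>monoid_algebra M\<^esub> g = (\<Sum>p\<in>K. \<Sum>q\<in>L.
    Poly_Mapping.single (p \<otimes> q) (Poly_Mapping.lookup f p * Poly_Mapping.lookup g q))"
proof -
  have "f \<otimes>\<^bsub>monoid_algebra M\<^esub> g = (\<Sum>p\<in>Poly_Mapping.keys f. \<Sum>q\<in>Poly_Mapping.keys g.
    Poly_Mapping.single (p \<otimes> q) (Poly_Mapping.lookup f p * Poly_Mapping.lookup g q))"
    by (simp add: monoid_algebra_def)
  also have "\<dots> = (\<Sum>p\<in>Poly_Mapping.keys f. \<Sum>q\<in>L.
    Poly_Mapping.single (p \<otimes> q) (Poly_Mapping.lookup f p * Poly_Mapping.lookup g q))"
    using assms by (intro sum.cong sum.mono_neutral_left) (auto simp: in_keys_iff)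
  also have "\<dots> = (\<Sum>p\<in>K. \<Sum>q\<in>L.
    Poly_Mapping.single (p \<otimes> q) (Poly_Mapping.lookup f p * Poly_Mapping.lookup g q))"
    using assms by (intro sum.mono_neutral_left) (auto simp: in_keys_iff)
  finally show ?thesis .
qed

lemma monoid_algebra_mult_single:
  "Poly_Mapping.single p (c::'k::field) \<otimes>\<^bsub>monoid_algebra M\<^esub> Poly_Mapping.single q d =
    Poly_Mapping.single (p \<otimes> q) (c * d)"
  by (subst mult_monoid_algebra[where K = "{p}" and L = "{q}"]) (auto simp: lookup_single)

lemma monoid_algebra_add_mult:
  fixes f g h :: "'m \<Rightarrow>\<^sub>0 'k::field"
  shows "(f + g) \<otimes>\<^bsub>monoid_algebra M\<^esub> h =
    f \<otimes>\<^bsub>monoid_algebra M\<^esub> h + g \<otimes>\<^bsub>monoid_algebra M\<^esub> h"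
  using Poly_Mapping.keys_add[of f g]
  by (simp add: mult_monoid_algebra[where K = "Poly_Mapping.keys f \<union> Poly_Mapping.keys g"
        and L = "Poly_Mapping.keys h"]
      lookup_add distrib_right single_add sum.distrib)

lemma monoid_algebra_mult_add:
  fixes f g h :: "'m \<Rightarrow>\<^sub>0 'k::field"
  shows "h \<otimes>\<^bsub>monoid_algebra M\<^esub> (f + g) =
    h \<otimes>\<^bsub>monoid_algebra M\<^esub> f + h \<otimes>\<^bsub>monoid_algebra M\<^esub> g"
  using Poly_Mapping.keys_add[of f g]
  by (simp add: mult_monoid_algebra[where L = "Poly_Mapping.keys f \<union> Poly_Mapping.keys g"
        and K = "Poly_Mapping.keys h"]
      lookup_add distrib_left single_add sum.distrib)

lemma monoid_algebra_zero_mult: "0 \<otimes>\<^bsub>monoid_algebra M\<^esub> (h :: 'm \<Rightarrow>\<^sub>0 'k::field) = 0"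
  and monoid_algebra_mult_zero: "(h :: 'm \<Rightarrow>\<^sub>0 'k::field) \<otimes>\<^bsub>monoid_algebra M\<^esub> 0 = 0"
  by (simp_all add: monoid_algebra_def)

end

lemma poly_mapping_eq_sum_single:
  fixes f :: "'a \<Rightarrow>\<^sub>0 'b::comm_monoid_add"
  shows "f = (\<Sum>p\<in>Poly_Mapping.keys f. Poly_Mapping.single p (Poly_Mapping.lookup f p))"
  by (rule poly_mapping_eqI) (auto simp: lookup_sum lookup_single when_def in_keys_iff)

text \<open>The support stays inside \<open>C\<close> throughout, so membership in the carrier of a
  monoid algebra is available at each step. The step does not exclude that \<open>p\<close> already
  occurs in \<open>f\<close>, which suits additive statements.\<close>

lemma poly_mapping_keys_induct [consumes 1, case_names zero add]:
  fixes f :: "'a \<Rightarrow>\<^sub>0 'b::comm_monoid_add"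
  assumes "Poly_Mapping.keys f \<subseteq> C" "P 0"
    and "\<And>p c f. \<lbrakk>p \<in> C; Poly_Mapping.keys f \<subseteq> C; P f\<rbrakk> \<Longrightarrow> P (Poly_Mapping.single p c + f)"
  shows "P f"
proof -
  have "Poly_Mapping.keys (\<Sum>p\<in>K. Poly_Mapping.single p (Poly_Mapping.lookup f p)) \<subseteq> C \<and>
      P (\<Sum>p\<in>K. Poly_Mapping.single p (Poly_Mapping.lookup f p))"
    if "finite K" "K \<subseteq> C" for K
    using that
  proof (induct K)
    case (insert p K)
    let ?r = "\<Sum>p\<in>K. Poly_Mapping.single p (Poly_Mapping.lookup f p)"
    have "Poly_Mapping.keys (Poly_Mapping.single p (Poly_Mapping.lookup f p) + ?r) \<subseteq> C"
      using insert Poly_Mapping.keys_add[of "Poly_Mapping.single p (Poly_Mapping.lookup f p)" ?r]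
      by (auto split: if_splits)
    then show ?case using insert assms(3) by auto
  qed (simp add: assms)
  from this[OF finite_keys assms(1)] show ?thesis
    by (simp flip: poly_mapping_eq_sum_single)
qed

lemma (in monoid) monoid_algebra_closed:
  "\<lbrakk>f \<in> carrier (monoid_algebra G); g \<in> carrier (monoid_algebra G)\<rbrakk>
    \<Longrightarrow> f \<otimes>\<^bsub>monoid_algebra G\<^esub> g \<in> carrier (monoid_algebra G :: ('k::field, _) module)"
  unfolding carrier_monoid_algebra mem_Collect_eq
proof (induct f rule: poly_mapping_keys_induct)
  case zero
  then show ?case by (simp add: monoid_algebra_zero_mult)
next
  case (add p c f)
  have "Poly_Mapping.keys (Poly_Mapping.single p c \<otimes>\<^bsub>monoid_algebra G\<^esub> g) \<subseteq> carrier G"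
    using add.prems
  proof (induct g rule: poly_mapping_keys_induct)
    case zero
    then show ?case by (simp add: monoid_algebra_mult_zero)
  next
    case (add q d g)
    then show ?case
      using \<open>p \<in> carrier G\<close> Poly_Mapping.keys_add[of "Poly_Mapping.single (p \<otimes> q) (c * d)"
          "Poly_Mapping.single p c \<otimes>\<^bsub>monoid_algebra G\<^esub> g"]
      by (auto simp: monoid_algebra_mult_add monoid_algebra_mult_single split: if_splits)
  qed
  then show ?case
    using add Poly_Mapping.keys_add[of "Poly_Mapping.single p c \<otimes>\<^bsub>monoid_algebra G\<^esub> g"
        "f \<otimes>\<^bsub>monoid_algebra G\<^esub> g"]
    by (auto simp: monoid_algebra_add_mult)
qed

lemma (in monoid) monoid_algebra_assoc:
  assumes "f \<in> carrier (monoid_algebra G)" "g \<in> carrier (monoid_algebra G)"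
    "h \<in> carrier (monoid_algebra G :: ('k::field, _) module)"
  shows "(f \<otimes>\<^bsub>monoid_algebra G\<^esub> g) \<otimes>\<^bsub>monoid_algebra G\<^esub> h =
    f \<otimes>\<^bsub>monoid_algebra G\<^esub> (g \<otimes>\<^bsub>monoid_algebra G\<^esub> h)"
proof -
  have single2: "(Poly_Mapping.single p c \<otimes>\<^bsub>monoid_algebra G\<^esub> Poly_Mapping.single q d) \<otimes>\<^bsub>monoid_algebra G\<^esub> h =
     Poly_Mapping.single p c \<otimes>\<^bsub>monoid_algebra G\<^esub> (Poly_Mapping.single q d \<otimes>\<^bsub>monoid_algebra G\<^esub> h)"
    if "p \<in> carrier G" "q \<in> carrier G" for p q c d
    using assms(3) that unfolding carrier_monoid_algebra mem_Collect_eq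
    by (induct h rule: poly_mapping_keys_induct)
      (simp_all add: monoid_algebra_mult_zero monoid_algebra_mult_add monoid_algebra_mult_single
        m_assoc mult.assoc)
  have single1: "(Poly_Mapping.single p c \<otimes>\<^bsub>monoid_algebra G\<^esub> g) \<otimes>\<^bsub>monoid_algebra G\<^esub> h =
     Poly_Mapping.single p c \<otimes>\<^bsub>monoid_algebra G\<^esub> (g \<otimes>\<^bsub>monoid_algebra G\<^esub> h)"
    if "p \<in> carrier G" for p c
    using assms(2) that unfolding carrier_monoid_algebra mem_Collect_eq
    by (induct g rule: poly_mapping_keys_induct)
      (simp_all add: single2 monoid_algebra_mult_zero monoid_algebra_zero_mult
        monoid_algebra_mult_add monoid_algebra_add_mult)
  show ?thesis
    using assms(1) unfolding carrier_monoid_algebra mem_Collect_eq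
    by (induct f rule: poly_mapping_keys_induct)
      (simp_all add: single1 monoid_algebra_zero_mult monoid_algebra_add_mult)
qed

lemma map_times_add:
  "Poly_Mapping.map ((*) (c::'k::field)) (f + g) = Poly_Mapping.map ((*) c) f + Poly_Mapping.map ((*) c) g"
  by (rule poly_mapping_eqI) (simp add: lookup_add distrib_left)

lemma map_times_single:
  "Poly_Mapping.map ((*) (c::'k::field)) (Poly_Mapping.single p d) = Poly_Mapping.single p (c * d)"
  by (rule poly_mapping_eqI) (simp add: lookup_single when_def)

lemma map_times_zero: "Poly_Mapping.map ((*) (c::'k::field)) 0 = 0"
  by (rule poly_mapping_eqI) simp

lemma (in monoid) assoc_algebra_monoid_algebra:
  "assoc_algebra (monoid_algebra G :: ('k::field, 'a \<Rightarrow>\<^sub>0 'k) module)"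
proof -
  let ?A = "monoid_algebra G :: ('k::field, 'a \<Rightarrow>\<^sub>0 'k) module"
  have single_one: "Poly_Mapping.single \<one> 1 \<otimes>\<^bsub>?A\<^esub> f = f" "f \<otimes>\<^bsub>?A\<^esub> Poly_Mapping.single \<one> 1 = f"
    if "f \<in> carrier ?A" for f
    using that unfolding carrier_monoid_algebra mem_Collect_eq
    by (induct f rule: poly_mapping_keys_induct)
      (simp_all add: monoid_algebra_zero_mult monoid_algebra_mult_zero
        monoid_algebra_mult_add monoid_algebra_add_mult monoid_algebra_mult_single)
  have ag: "abelian_group ?A"
  proof (rule abelian_groupI)
    fix f assume "f \<in> carrier ?A"
    then show "\<exists>g\<in>carrier ?A. g \<oplus>\<^bsub>?A\<^esub> f = \<zero>\<^bsub>?A\<^esub>"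
      by (intro bexI[of _ "- f"]) (auto simp: carrier_monoid_algebra add_monoid_algebra zero_monoid_algebra)
  next
    fix f g assume "f \<in> carrier ?A" "g \<in> carrier ?A"
    then show "f \<oplus>\<^bsub>?A\<^esub> g \<in> carrier ?A"
      using Poly_Mapping.keys_add[of f g] by (auto simp: carrier_monoid_algebra add_monoid_algebra)
  qed (auto simp: carrier_monoid_algebra add_monoid_algebra zero_monoid_algebra algebra_simps)
  have mon: "Group.monoid ?A"
    by (rule monoidI)
      (simp_all add: monoid_algebra_closed monoid_algebra_assoc one_monoid_algebra single_one,
        simp add: carrier_monoid_algebra)
  have "ring ?A"
    by (rule ringI[OF ag mon])
      (simp_all add: add_monoid_algebra monoid_algebra_mult_add monoid_algebra_add_mult)
  moreover have smult_left:
    "Poly_Mapping.map ((*) c) f \<otimes>\<^bsub>?A\<^esub> g = Poly_Mapping.map ((*) c) (f \<otimes>\<^bsub>?A\<^esub> g)" for c f g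
  proof -
    have "Poly_Mapping.map ((*) c) (Poly_Mapping.single p d) \<otimes>\<^bsub>?A\<^esub> g =
        Poly_Mapping.map ((*) c) (Poly_Mapping.single p d \<otimes>\<^bsub>?A\<^esub> g)" for p d
      by (induct g rule: poly_mapping_keys_induct[OF subset_UNIV])
        (simp_all add: monoid_algebra_mult_zero map_times_zero map_times_single map_times_add
          monoid_algebra_mult_add monoid_algebra_mult_single mult.assoc)
    then show ?thesis
      by (induct f rule: poly_mapping_keys_induct[OF subset_UNIV])
        (simp_all add: monoid_algebra_zero_mult map_times_zero map_times_add monoid_algebra_add_mult)
  qed
  moreover have smult_right:
    "g \<otimes>\<^bsub>?A\<^esub> Poly_Mapping.map ((*) c) f = Poly_Mapping.map ((*) c) (g \<otimes>\<^bsub>?A\<^esub> f)" for c f g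
  proof -
    have "g \<otimes>\<^bsub>?A\<^esub> Poly_Mapping.map ((*) c) (Poly_Mapping.single p d) =
        Poly_Mapping.map ((*) c) (g \<otimes>\<^bsub>?A\<^esub> Poly_Mapping.single p d)" for p d
      by (induct g rule: poly_mapping_keys_induct[OF subset_UNIV])
        (simp_all add: monoid_algebra_zero_mult map_times_zero map_times_single map_times_add
          monoid_algebra_add_mult monoid_algebra_mult_single mult.left_commute)
    then show ?thesis
      by (induct f rule: poly_mapping_keys_induct[OF subset_UNIV])
        (simp_all add: monoid_algebra_mult_zero map_times_zero map_times_add monoid_algebra_mult_add)
  qed
  ultimately show ?thesis
    by (intro assoc_algebra.intro assoc_algebra_axioms.intro)
      (auto simp: smult_monoid_algebra add_monoid_algebra map_times_add carrier_monoid_algebra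
        lookup_add algebra_simps dest!: subsetD[OF keys_map_times] intro!: poly_mapping_eqI)
qed

text \<open>Both sides are bilinear, which reduces the claim to two basis elements, where it is the
  multiplicativity of \<open>g\<close>. This is the main half of the universal property of the
  monoid algebra.\<close>

lemma (in monoid) linear_extension_mult:
  fixes B :: "('k::field, 'c, 'y) module_scheme"
  assumes "assoc_algebra B" and g: "g \<in> hom G B"
    and f: "f \<in> carrier (monoid_algebra G)" and h: "h \<in> carrier (monoid_algebra G)"
  shows "linear_extension B g (f \<otimes>\<^bsub>monoid_algebra G\<^esub> h) =
    linear_extension B g f \<otimes>\<^bsub>B\<^esub> linear_extension B g h"
proof -
  interpret B: assoc_algebra B by fact
  note closed = monoid_algebra_closed[unfolded carrier_monoid_algebra mem_Collect_eq]
  have gc: "g \<in> carrier G \<rightarrow> carrier B" and gm: "\<And>p q. \<lbrakk>p \<in> carrier G; q \<in> carrier G\<rbrakk> \<Longrightarrow> g (p \<otimes> q) = g p \<otimes>\<^bsub>B\<^esub> g q"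
    using g by (auto simp: hom_def)
  have gcl: "\<And>p. p \<in> carrier G \<Longrightarrow> g p \<in> carrier B" using gc by auto
  have lc: "linear_extension B g x \<in> carrier B" if "Poly_Mapping.keys x \<subseteq> carrier G" for x
    using that gc by (intro B.linear_extension_closed) auto
  have ks: "Poly_Mapping.keys (Poly_Mapping.single p (c::'k)) \<subseteq> carrier G" if "p \<in> carrier G" for p c
    using that by auto
  have single: "linear_extension B g (Poly_Mapping.single p c \<otimes>\<^bsub>monoid_algebra G\<^esub> h) =
    linear_extension B g (Poly_Mapping.single p c) \<otimes>\<^bsub>B\<^esub> linear_extension B g h" if p: "p \<in> carrier G" for p c
    using h unfolding carrier_monoid_algebra mem_Collect_eq
  proof (induct h rule: poly_mapping_keys_induct)
    case zero
    show ?case using p gcl by (simp add: monoid_algebra_mult_zero B.linear_extension_single)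
  next
    case (add q d h)
    then show ?case using p
      by (simp add: monoid_algebra_mult_add monoid_algebra_mult_single ks closed gcl gm lc
          B.linear_extension_add[OF gc] B.linear_extension_single B.r_distr
          B.smult_mult_left B.smult_mult_right B.smult_smult mult.commute)
  qed
  show ?thesis
    using f unfolding carrier_monoid_algebra mem_Collect_eq
  proof (induct f rule: poly_mapping_keys_induct)
    case zero
    have "linear_extension B g h \<in> carrier B" using h lc by (simp add: carrier_monoid_algebra)
    then show ?case by (simp add: monoid_algebra_zero_mult)
  next
    case (add q d f)
    then show ?case using h
      by (simp add: carrier_monoid_algebra monoid_algebra_add_mult ks closed gcl lc single
          B.linear_extension_add[OF gc] B.l_distr)
  qed
qed

section \<open>Algebra homomorphisms and linear functionals\<close>

definition linear_functional :: "('k::field, 'a, 'z) module_scheme \<Rightarrow> ('a \<Rightarrow> 'k) \<Rightarrow> bool"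
  where "linear_functional A f \<longleftrightarrow>
    (\<forall>a\<in>carrier A. \<forall>b\<in>carrier A. f (a \<oplus>\<^bsub>A\<^esub> b) = f a + f b) \<and>
    (\<forall>c. \<forall>a\<in>carrier A. f (c \<odot>\<^bsub>A\<^esub> a) = c * f a)"

lemma ground_algebra_simps [simp]:
  "carrier (ground_algebra :: ('k::field, 'k) module) = UNIV"
  "a \<otimes>\<^bsub>(ground_algebra :: ('k::field, 'k) module)\<^esub> b = a * b"
  "\<one>\<^bsub>(ground_algebra :: ('k::field, 'k) module)\<^esub> = 1"
  "\<zero>\<^bsub>(ground_algebra :: ('k::field, 'k) module)\<^esub> = 0"
  "a \<oplus>\<^bsub>(ground_algebra :: ('k::field, 'k) module)\<^esub> b = a + b"
  "a \<odot>\<^bsub>(ground_algebra :: ('k::field, 'k) module)\<^esub> b = a * b"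
  by (simp_all add: ground_algebra_def)

lemma assoc_algebra_ground: "assoc_algebra (ground_algebra :: ('k::field, 'k) module)"
proof -
  have "ring (ground_algebra :: ('k, 'k) module)"
    by (intro ringI abelian_groupI monoidI) (auto simp: algebra_simps intro: exI[of _ "- _"])
  then show ?thesis
    by (intro assoc_algebra.intro assoc_algebra_axioms.intro) (auto simp: algebra_simps)
qed

lemma assoc_algebra_opposite:
  assumes "assoc_algebra A"
  shows "assoc_algebra (opposite_algebra A)"
proof -
  interpret assoc_algebra A by fact
  have "abelian_group (opposite_algebra A)"
    by (rule abelian_groupI)
      (auto simp: opposite_algebra_def a_ac intro: bexI[of _ "\<ominus>\<^bsub>A\<^esub> _"] l_neg)
  then have "ring (opposite_algebra A)"
    by (intro ringI monoidI) (auto simp: opposite_algebra_def m_assoc l_distr r_distr)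
  then show ?thesis
    by (intro assoc_algebra.intro assoc_algebra_axioms.intro)
      (auto simp: opposite_algebra_def smult_add_left smult_add_right smult_smult
        smult_mult_left smult_mult_right)
qed

locale algebra_map = A: assoc_algebra A + B: assoc_algebra B
  for A :: "('k::field, 'a, 'y) module_scheme" and B :: "('k, 'b, 'z) module_scheme" +
  fixes h :: "'a \<Rightarrow> 'b"
  assumes hom: "h \<in> algebra_hom A B"
begin

lemma closed [simp]: "a \<in> carrier A \<Longrightarrow> h a \<in> carrier B"
  and add: "\<lbrakk>a \<in> carrier A; b \<in> carrier A\<rbrakk> \<Longrightarrow> h (a \<oplus>\<^bsub>A\<^esub> b) = h a \<oplus>\<^bsub>B\<^esub> h b"
  and mult: "\<lbrakk>a \<in> carrier A; b \<in> carrier A\<rbrakk> \<Longrightarrow> h (a \<otimes>\<^bsub>A\<^esub> b) = h a \<otimes>\<^bsub>B\<^esub> h b"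
  and one [simp]: "h \<one>\<^bsub>A\<^esub> = \<one>\<^bsub>B\<^esub>"
  and smult: "a \<in> carrier A \<Longrightarrow> h (c \<odot>\<^bsub>A\<^esub> a) = c \<odot>\<^bsub>B\<^esub> h a"
  using hom by (auto simp: algebra_hom_def ring_hom_def)

lemma zero [simp]: "h \<zero>\<^bsub>A\<^esub> = \<zero>\<^bsub>B\<^esub>"
  using smult[of "\<zero>\<^bsub>A\<^esub>" 0] by simp

lemma minus: "\<lbrakk>a \<in> carrier A; b \<in> carrier A\<rbrakk> \<Longrightarrow> h (a \<ominus>\<^bsub>A\<^esub> b) = h a \<ominus>\<^bsub>B\<^esub> h b"
  by (simp add: A.minus_eq_smult B.minus_eq_smult add smult)

lemma nat_pow: "a \<in> carrier A \<Longrightarrow> h (a [^]\<^bsub>A\<^esub> (n::nat)) = h a [^]\<^bsub>B\<^esub> n"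
  by (induct n) (simp_all add: mult)

lemma alternating:
  assumes "\<And>i j. \<lbrakk>i \<in> {1, 2}; j \<in> {1, 2}\<rbrakk> \<Longrightarrow> x i j \<in> carrier A" "i \<in> {1, 2}" "j \<in> {1, 2}"
  shows "alternating A x i j m \<in> carrier A"
    and "h (alternating A x i j m) = alternating B (\<lambda>i j. h (x i j)) i j m"
proof -
  have flip: "3 - i \<in> {1, 2}" if "i \<in> {1, 2}" for i :: nat using that by auto
  have closed: "alternating A x i j m \<in> carrier A" if "i \<in> {1, 2}" "j \<in> {1, 2}" for i j m
    using that
  proof (induct m arbitrary: i j)
    case (Suc m)
    show ?case using Suc.hyps[OF flip flip] Suc.prems assms(1) by simp
  qed simp
  show "alternating A x i j m \<in> carrier A" using closed assms by simp
  show "h (alternating A x i j m) = alternating B (\<lambda>i j. h (x i j)) i j m"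
    using assms(2,3)
  proof (induct m arbitrary: i j)
    case (Suc m)
    show ?case
      using Suc.hyps[OF flip flip] Suc.prems assms(1) closed[OF flip flip] by (simp add: mult)
  qed simp
qed

lemma finsum: "f \<in> I \<rightarrow> carrier A \<Longrightarrow> h (finsum A f I) = (\<Oplus>\<^bsub>B\<^esub>i\<in>I. h (f i))"
  by (induct I rule: infinite_finite_induct) (auto simp: add Pi_iff)

lemma linear_extension:
  assumes "g \<in> Poly_Mapping.keys f \<rightarrow> carrier A"
  shows "h (linear_extension A g f) = linear_extension B (\<lambda>p. h (g p)) f"
proof -
  have "h (linear_extension A g f) =
      (\<Oplus>\<^bsub>B\<^esub>p\<in>Poly_Mapping.keys f. h (Poly_Mapping.lookup f p \<odot>\<^bsub>A\<^esub> g p))"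
    unfolding linear_extension_def using assms by (intro finsum) auto
  also have "\<dots> = linear_extension B (\<lambda>p. h (g p)) f"
    unfolding linear_extension_def using assms by (intro B.finsum_cong') (auto simp: smult Pi_iff)
  finally show ?thesis .
qed

end

lemma (in monoid) linear_extension_hom:
  fixes B :: "('k::field, 'c, 'y) module_scheme"
  assumes B: "assoc_algebra B" and g: "g \<in> hom G B" and one: "g \<one> = \<one>\<^bsub>B\<^esub>"
  shows "linear_extension B g \<in> algebra_hom (monoid_algebra G) B"
proof -
  interpret B: assoc_algebra B by fact
  have gc: "g \<in> carrier G \<rightarrow> carrier B" using g by (auto simp: hom_def)
  have gk: "g \<in> Poly_Mapping.keys f \<rightarrow> carrier B" if "Poly_Mapping.keys f \<subseteq> carrier G"
    for f :: "'a \<Rightarrow>\<^sub>0 'k" using gc that by auto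
  show ?thesis
    unfolding algebra_hom_def mem_Collect_eq
  proof (intro conjI ring_hom_memI ballI allI)
    fix x y assume "x \<in> carrier (monoid_algebra G :: ('k, _) module)"
      "y \<in> carrier (monoid_algebra G :: ('k, _) module)"
    then show "linear_extension B g (x \<otimes>\<^bsub>monoid_algebra G\<^esub> y) =
        linear_extension B g x \<otimes>\<^bsub>B\<^esub> linear_extension B g y"
      by (rule linear_extension_mult[OF B g])
  qed (use one gk in \<open>auto simp: carrier_monoid_algebra one_monoid_algebra add_monoid_algebra
        smult_monoid_algebra B.linear_extension_single B.linear_extension_smult
        intro: B.linear_extension_closed B.linear_extension_add[OF gc]\<close>)
qed

section \<open>Quotients\<close>

lemma ring_extend:
  assumes "ring R"
  shows "ring (ring.extend R m)"
proof -
  interpret ring R by fact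
  have "abelian_group (ring.extend R m)"
    by (rule abelian_groupI) (auto simp: ring.defs a_ac intro: bexI[of _ "\<ominus>\<^bsub>R\<^esub> _"] l_neg)
  then show ?thesis
    by (intro ringI monoidI) (auto simp: ring.defs m_assoc l_distr r_distr)
qed

text \<open>Additive inverses are obtained as multiples by \<open>\<ominus> \<one>\<close>, which
  turns the closure conditions into a subgroup.\<close>

lemma (in assoc_algebra) idealI_algebra:
  assumes "J \<subseteq> carrier A" "\<zero> \<in> J"
    and "\<And>a b. \<lbrakk>a \<in> J; b \<in> J\<rbrakk> \<Longrightarrow> a \<oplus> b \<in> J"
    and left: "\<And>a b. \<lbrakk>a \<in> J; b \<in> carrier A\<rbrakk> \<Longrightarrow> b \<otimes> a \<in> J"
    and "\<And>a b. \<lbrakk>a \<in> J; b \<in> carrier A\<rbrakk> \<Longrightarrow> a \<otimes> b \<in> J"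
  shows "ideal J A"
proof (rule idealI[OF ring_axioms])
  have "\<ominus> a \<in> J" if "a \<in> J" for a
    using left[OF that, of "\<ominus> \<one>"] that assms(1) by (auto simp: l_minus)
  then show "subgroup J (add_monoid A)"
    using assms(1-3) by (intro subgroup.intro) (auto simp flip: a_inv_def)
qed (use assms in auto)

locale algebra_quotient = assoc_algebra A for A :: "('k::field, 'a, 'z) module_scheme" (structure) +
  fixes S :: "'a set"
  assumes relators: "S \<subseteq> carrier A"
begin

abbreviation "Q \<equiv> quotient_algebra A S"
abbreviation "cls a \<equiv> (Idl S) +> a"

lemma ideal_Idl: "ideal (Idl S) A"
  using relators by (rule genideal_ideal)

lemma cls_eq_iff: "\<lbrakk>a \<in> carrier A; b \<in> carrier A\<rbrakk> \<Longrightarrow> cls a = cls b \<longleftrightarrow> a \<ominus> b \<in> Idl S"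
  using quotient_eq_iff_same_a_r_cos[OF ideal_Idl] by simp

lemma mem_cls_iff:
  assumes "a \<in> carrier A"
  shows "a' \<in> cls a \<longleftrightarrow> a' \<in> carrier A \<and> cls a' = cls a"
proof -
  interpret I: ideal "Idl S" A by (rule ideal_Idl)
  show ?thesis
    using a_repr_independence[OF _ _ I.is_additive_subgroup[THEN additive_subgroup.a_subgroup]]
      I.a_rcos_self a_r_coset_subset_G[OF I.a_subset] assms by blast
qed

lemma carrier_quotient: "carrier Q = cls ` carrier A"
  by (auto simp: quotient_algebra_def ring.defs FactRing_simps)

lemma cls_closed [simp]: "a \<in> carrier A \<Longrightarrow> cls a \<in> carrier Q"
  by (simp add: carrier_quotient)

lemma quotient_carrierE:
  assumes "X \<in> carrier Q" obtains a where "a \<in> carrier A" "X = cls a"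
  using assms by (auto simp: carrier_quotient)

lemma cls_add:
  assumes "a \<in> carrier A" "b \<in> carrier A"
  shows "cls a \<oplus>\<^bsub>Q\<^esub> cls b = cls (a \<oplus> b)"
proof -
  interpret I: ideal "Idl S" A by (rule ideal_Idl)
  show ?thesis
    by (simp add: quotient_algebra_def ring.defs FactRing_def I.a_rcos_sum assms)
qed

lemma cls_mult:
  assumes "a \<in> carrier A" "b \<in> carrier A"
  shows "cls a \<otimes>\<^bsub>Q\<^esub> cls b = cls (a \<otimes> b)"
proof -
  interpret I: ideal "Idl S" A by (rule ideal_Idl)
  show ?thesis
    by (simp add: quotient_algebra_def ring.defs FactRing_def I.rcoset_mult_add assms)
qed

lemma cls_one: "\<one>\<^bsub>Q\<^esub> = cls \<one>"
  by (simp add: quotient_algebra_def ring.defs FactRing_def)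

lemma cls_zero: "\<zero>\<^bsub>Q\<^esub> = cls \<zero>"
proof -
  interpret I: ideal "Idl S" A by (rule ideal_Idl)
  show ?thesis
    using a_coset_join2[OF zero_closed I.is_additive_subgroup[THEN additive_subgroup.a_subgroup]]
    by (simp add: quotient_algebra_def ring.defs FactRing_def)
qed

text \<open>A scalar multiple of a coset is defined as a union over all representatives. They yield
  the same coset because \<open>c \<odot> b\<close> and \<open>c \<odot> a\<close> differ by the
  product of \<open>c \<odot> \<one>\<close> with an element of the ideal.\<close>

lemma cls_smult: assumes "a \<in> carrier A" shows "c \<odot>\<^bsub>Q\<^esub> cls a = cls (c \<odot> a)"
proof -
  interpret I: ideal "Idl S" A by (rule ideal_Idl)
  have "cls (c \<odot> b) = cls (c \<odot> a)" if "b \<in> cls a" for b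
  proof -
    have b: "b \<in> carrier A" "b \<ominus> a \<in> Idl S"
      using that assms by (auto simp: mem_cls_iff cls_eq_iff)
    then have "(c \<odot> \<one>) \<otimes> (b \<ominus> a) \<in> Idl S" by (simp add: I.I_l_closed)
    also have "(c \<odot> \<one>) \<otimes> (b \<ominus> a) = c \<odot> b \<ominus> c \<odot> a"
      using b(1) assms by (simp add: minus_eq_smult smult_mult_left smult_add_right smult_smult mult.commute)
    finally show ?thesis using b(1) assms by (simp add: cls_eq_iff)
  qed
  then have "(\<Union>b\<in>cls a. cls (c \<odot> b)) = cls (c \<odot> a)"
    using I.a_rcos_self[OF assms] by blast
  then show ?thesis by (simp add: quotient_algebra_def ring.defs module.defs)
qed

lemma assoc_algebra_quotient: "assoc_algebra Q"
proof -
  have "ring Q"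
    unfolding quotient_algebra_def by (rule ring_extend[OF ideal.quotient_is_ring[OF ideal_Idl]])
  then show ?thesis
    by (intro assoc_algebra.intro assoc_algebra_axioms.intro)
      (auto elim!: quotient_carrierE simp: cls_smult cls_add cls_mult smult_add_left smult_add_right
        smult_smult smult_mult_left smult_mult_right)
qed

lemma cls_hom: "(+>) (Idl S) \<in> algebra_hom A Q"
  by (auto simp: algebra_hom_def cls_smult cls_add cls_mult cls_one intro!: ring_hom_memI)

lemma cls_relator: "s \<in> S \<Longrightarrow> cls s = \<zero>\<^bsub>Q\<^esub>"
  using genideal_self[OF relators] relators cls_eq_iff[of s \<zero>]
  by (force simp: cls_zero a_minus_def)

lemma induced_map_cls:
  assumes "a \<in> carrier A" "\<And>b. \<lbrakk>b \<in> carrier A; cls b = cls a\<rbrakk> \<Longrightarrow> h b = h a"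
  shows "induced_map Q h (cls a) = h a"
proof -
  have "h b = h a" if "b \<in> cls a" for b
    using that assms(2) mem_cls_iff[OF assms(1)] by blast
  moreover have "a \<in> cls a" using assms(1) by (simp add: mem_cls_iff)
  ultimately have "h ` cls a = {h a}" by blast
  then show ?thesis using assms(1) by (simp add: induced_map_def)
qed

text \<open>The kernel of \<open>h\<close> is an ideal containing \<open>S\<close>, hence contains
  the ideal generated by \<open>S\<close>; so \<open>h\<close> is constant on cosets and
  \<open>induced_map\<close> returns its value there.\<close>

lemma induced_hom:
  assumes B: "assoc_algebra B" and h: "h \<in> algebra_hom A B" and S: "\<And>s. s \<in> S \<Longrightarrow> h s = \<zero>\<^bsub>B\<^esub>"
  shows "induced_map Q h \<in> algebra_hom Q B"
    and "a \<in> carrier A \<Longrightarrow> induced_map Q h (cls a) = h a"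
proof -
  interpret h: algebra_map A B h
    using B h assoc_algebra_axioms by (intro algebra_map.intro algebra_map_axioms.intro) auto
  have "ideal {a \<in> carrier A. h a = \<zero>\<^bsub>B\<^esub>} A"
    by (rule idealI_algebra) (auto simp: h.add h.mult)
  then have I: "Idl S \<subseteq> {a \<in> carrier A. h a = \<zero>\<^bsub>B\<^esub>}"
    using S relators by (intro genideal_minimal) auto
  have "h b = h a" if "a \<in> carrier A" "b \<in> carrier A" "cls b = cls a" for a b
  proof -
    have "b \<ominus> a \<in> Idl S" using that cls_eq_iff by blast
    then have "h b \<ominus>\<^bsub>B\<^esub> h a = \<zero>\<^bsub>B\<^esub>" using I that h.minus by auto
    then show ?thesis
      using that h.B.minus_equality[of "h b" "\<ominus>\<^bsub>B\<^esub> h a"] by (simp add: a_minus_def)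
  qed
  then have *: "induced_map Q h (cls a) = h a" if "a \<in> carrier A" for a
    using that by (intro induced_map_cls) blast+
  then show "a \<in> carrier A \<Longrightarrow> induced_map Q h (cls a) = h a" .
  show "induced_map Q h \<in> algebra_hom Q B"
    unfolding algebra_hom_def mem_Collect_eq
  proof (intro conjI ring_hom_memI ballI allI)
    fix X Y assume "X \<in> carrier Q" "Y \<in> carrier Q"
    then obtain x y where "x \<in> carrier A" "y \<in> carrier A" "X = cls x" "Y = cls y"
      by (auto elim!: quotient_carrierE)
    then show "induced_map Q h (X \<otimes>\<^bsub>Q\<^esub> Y) = induced_map Q h X \<otimes>\<^bsub>B\<^esub> induced_map Q h Y"
      and "induced_map Q h (X \<oplus>\<^bsub>Q\<^esub> Y) = induced_map Q h X \<oplus>\<^bsub>B\<^esub> induced_map Q h Y"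
      by (simp_all add: cls_add cls_mult * h.add h.mult)
  next
    fix X c assume "X \<in> carrier Q"
    then obtain x where "x \<in> carrier A" "X = cls x" by (rule quotient_carrierE)
    then show "induced_map Q h X \<in> carrier B"
      and "induced_map Q h (c \<odot>\<^bsub>Q\<^esub> X) = c \<odot>\<^bsub>B\<^esub> induced_map Q h X"
      by (simp_all add: cls_smult * h.smult)
  qed (simp add: cls_one *)
qed

end

text \<open>
  A family of functionals that is stable under translation and vanishes on the relators vanishes
  on the ideal they generate; this is how linear independence in quotients is detected.
\<close>

locale monoid_algebra_quotient = monoid M for M :: "('m, 'z) monoid_scheme" (structure) +
  fixes S :: "('m \<Rightarrow>\<^sub>0 'k::field) set"
  assumes relators_closed: "S \<subseteq> carrier (monoid_algebra M)"
begin

sublocale algebra_quotient "monoid_algebra M" S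
  using relators_closed assoc_algebra_monoid_algebra
  by (intro algebra_quotient.intro algebra_quotient_axioms.intro)

lemma induced_functional:
  assumes f: "f \<in> F"
    and left: "\<And>f p. \<lbrakk>f \<in> F; p \<in> carrier M\<rbrakk> \<Longrightarrow> \<exists>f'\<in>F. \<forall>q\<in>carrier M. f (p \<otimes> q) = f' q"
    and right: "\<And>f p. \<lbrakk>f \<in> F; p \<in> carrier M\<rbrakk> \<Longrightarrow> \<exists>f'\<in>F. \<forall>q\<in>carrier M. f (q \<otimes> p) = f' q"
    and S: "\<And>f s. \<lbrakk>f \<in> F; s \<in> S\<rbrakk> \<Longrightarrow> linear_extension ground_algebra f s = 0"
  shows "linear_functional Q (induced_map Q (linear_extension ground_algebra f))"
    and "x \<in> carrier (monoid_algebra M) \<Longrightarrow>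
      induced_map Q (linear_extension ground_algebra f) (cls x) = linear_extension ground_algebra f x"
proof -
  interpret k: assoc_algebra "ground_algebra :: ('k, 'k) module" by (rule assoc_algebra_ground)
  define L where "L = (linear_extension ground_algebra :: ('m \<Rightarrow> 'k) \<Rightarrow> ('m \<Rightarrow>\<^sub>0 'k) \<Rightarrow> 'k)"
  have L_add: "L f (x + y) = L f x + L f y" for f x y
    unfolding L_def by (subst k.linear_extension_add[where C = UNIV]) auto
  have L_single: "L f (Poly_Mapping.single p c) = c * f p" for f p c
    unfolding L_def by (subst k.linear_extension_single) auto
  have L_smult: "L f (Poly_Mapping.map ((*) c) x) = c * L f x" for f x c
    unfolding L_def by (subst k.linear_extension_smult) auto
  have L_zero: "L f 0 = 0" for f unfolding L_def by simp
  have L_ring: "L f (x \<oplus>\<^bsub>monoid_algebra M\<^esub> y) = L f x + L f y" "L f \<zero>\<^bsub>monoid_algebra M\<^esub> = 0"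
    for f x y by (simp_all add: add_monoid_algebra zero_monoid_algebra L_add L_zero)
  \<comment> \<open>The kernel of a single functional need not be an ideal. The common kernel of the
    family is one, because multiplication by a basis element can be moved into the functional, where
    it yields another member of \<open>F\<close>.\<close>
  define J where "J = {x \<in> carrier (monoid_algebra M). \<forall>f\<in>F. L f x = 0}"
  have mult_left: "L f (y \<otimes>\<^bsub>monoid_algebra M\<^esub> x) = 0"
    if "x \<in> J" "y \<in> carrier (monoid_algebra M)" "f \<in> F" for x y f
  proof -
    have left_single: "L f (Poly_Mapping.single p c \<otimes>\<^bsub>monoid_algebra M\<^esub> x) = 0" if p: "p \<in> carrier M" for p c
    proof -
      obtain f' where f': "f' \<in> F" "\<forall>q\<in>carrier M. f (p \<otimes> q) = f' q" using left[OF \<open>f \<in> F\<close> p] by auto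
      have "Poly_Mapping.keys x \<subseteq> carrier M" using \<open>x \<in> J\<close> by (simp add: J_def carrier_monoid_algebra)
      then have "L f (Poly_Mapping.single p c \<otimes>\<^bsub>monoid_algebra M\<^esub> x) = c * L f' x"
        by (induct x rule: poly_mapping_keys_induct)
          (simp_all add: monoid_algebra_mult_zero monoid_algebra_mult_add monoid_algebra_mult_single
            L_add L_single L_zero f' distrib_left)
      then show ?thesis using \<open>x \<in> J\<close> f' by (simp add: J_def)
    qed
    show ?thesis
      using that(2) unfolding carrier_monoid_algebra mem_Collect_eq
      by (induct y rule: poly_mapping_keys_induct)
        (simp_all add: left_single monoid_algebra_zero_mult monoid_algebra_add_mult L_add L_zero)
  qed
  have mult_right: "L f (x \<otimes>\<^bsub>monoid_algebra M\<^esub> y) = 0"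
    if "x \<in> J" "y \<in> carrier (monoid_algebra M)" "f \<in> F" for x y f
  proof -
    have right_single: "L f (x \<otimes>\<^bsub>monoid_algebra M\<^esub> Poly_Mapping.single p c) = 0" if p: "p \<in> carrier M" for p c
    proof -
      obtain f' where f': "f' \<in> F" "\<forall>q\<in>carrier M. f (q \<otimes> p) = f' q" using right[OF \<open>f \<in> F\<close> p] by auto
      have "Poly_Mapping.keys x \<subseteq> carrier M" using \<open>x \<in> J\<close> by (simp add: J_def carrier_monoid_algebra)
      then have "L f (x \<otimes>\<^bsub>monoid_algebra M\<^esub> Poly_Mapping.single p c) = c * L f' x"
        by (induct x rule: poly_mapping_keys_induct)
          (simp_all add: monoid_algebra_zero_mult monoid_algebra_add_mult monoid_algebra_mult_single
            L_add L_single L_zero f' distrib_left)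
      then show ?thesis using \<open>x \<in> J\<close> f' by (simp add: J_def)
    qed
    show ?thesis
      using that(2) unfolding carrier_monoid_algebra mem_Collect_eq
      by (induct y rule: poly_mapping_keys_induct)
        (simp_all add: right_single monoid_algebra_mult_zero monoid_algebra_mult_add L_add L_zero)
  qed
  have "ideal J (monoid_algebra M)"
    using mult_left mult_right
    by (intro idealI_algebra)
      (auto simp: J_def L_ring)
  then have I: "Idl\<^bsub>monoid_algebra M\<^esub> S \<subseteq> J"
    using S relators_closed by (intro genideal_minimal) (auto simp: J_def L_def)
  have "L f b = L f a" if "a \<in> carrier (monoid_algebra M)" "b \<in> carrier (monoid_algebra M)"
    "cls b = cls a" for a b
  proof -
    have "b \<ominus>\<^bsub>monoid_algebra M\<^esub> a \<in> J" using I that cls_eq_iff by auto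
    then have "L f (b \<ominus>\<^bsub>monoid_algebra M\<^esub> a) = 0" using f by (simp add: J_def)
    then show ?thesis
      using that by (simp add: minus_eq_smult add_monoid_algebra smult_monoid_algebra L_add L_smult)
  qed
  then have *: "induced_map Q (L f) (cls a) = L f a" if "a \<in> carrier (monoid_algebra M)" for a
    using that by (intro induced_map_cls) blast+
  then show "x \<in> carrier (monoid_algebra M) \<Longrightarrow>
      induced_map Q (linear_extension ground_algebra f) (cls x) = linear_extension ground_algebra f x"
    by (simp add: L_def)
  show "linear_functional Q (induced_map Q (linear_extension ground_algebra f))"
    unfolding linear_functional_def L_def[symmetric]
  proof (intro conjI ballI allI)
    fix X Y assume "X \<in> carrier Q" "Y \<in> carrier Q"
    then obtain x y where xy: "x \<in> carrier (monoid_algebra M)" "y \<in> carrier (monoid_algebra M)"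
      "X = cls x" "Y = cls y"
      by (auto elim!: quotient_carrierE)
    then have "X \<oplus>\<^bsub>Q\<^esub> Y = cls (x \<oplus>\<^bsub>monoid_algebra M\<^esub> y)" by (simp add: cls_add)
    then show "induced_map Q (L f) (X \<oplus>\<^bsub>Q\<^esub> Y) = induced_map Q (L f) X + induced_map Q (L f) Y"
      using xy by (simp only: * add.m_closed a_closed) (simp add: add_monoid_algebra L_add)
  next
    fix X c assume "X \<in> carrier Q"
    then obtain x where x: "x \<in> carrier (monoid_algebra M)" "X = cls x" by (rule quotient_carrierE)
    then have "c \<odot>\<^bsub>Q\<^esub> X = cls (c \<odot>\<^bsub>monoid_algebra M\<^esub> x)" by (simp add: cls_smult)
    then show "induced_map Q (L f) (c \<odot>\<^bsub>Q\<^esub> X) = c * induced_map Q (L f) X"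
      using x by (simp only: * smult_closed) (simp add: smult_monoid_algebra L_smult)
  qed
qed

end

lemma (in assoc_algebra) linear_extension_diff:
  assumes "g \<in> C \<rightarrow> carrier A" "Poly_Mapping.keys f \<subseteq> C" "Poly_Mapping.keys h \<subseteq> C"
  shows "linear_extension A g (f - h) = linear_extension A g f \<ominus> linear_extension A g h"
proof -
  have fh: "f - h = f + Poly_Mapping.map ((*) (-1)) h"
    by (rule poly_mapping_eqI) (simp add: lookup_add lookup_minus)
  have "g \<in> Poly_Mapping.keys f \<rightarrow> carrier A" "g \<in> Poly_Mapping.keys h \<rightarrow> carrier A"
    using assms by auto
  moreover have "Poly_Mapping.keys (Poly_Mapping.map ((*) (-1)) h) \<subseteq> C"
    using assms(3) keys_map_times[of "-1" h] by auto
  ultimately show ?thesis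
    unfolding fh using assms
    by (simp add: linear_extension_add[OF assms(1)] linear_extension_smult minus_eq_smult)
qed

lemma (in assoc_algebra) minus_self: "a \<in> carrier A \<Longrightarrow> a \<ominus> a = \<zero>"
  by (simp add: a_minus_def r_neg)

lemma (in assoc_algebra) add_minus_minus:
  assumes "a \<in> carrier A" "b \<in> carrier A"
  shows "a \<oplus> b \<ominus> a \<ominus> b = \<zero>"
  using assms by algebra

lemma linear_extension_ground:
  "linear_extension ground_algebra f (x + y) =
    linear_extension ground_algebra f x + linear_extension ground_algebra f y"
  "linear_extension ground_algebra f (x - y) =
    linear_extension ground_algebra f x - linear_extension ground_algebra f y"
  "linear_extension ground_algebra f (Poly_Mapping.single p c) = c * f p"
  for f :: "'p \<Rightarrow> 'k::field"
proof -
  interpret k: assoc_algebra "ground_algebra :: ('k, 'k) module" by (rule assoc_algebra_ground)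
  show "linear_extension ground_algebra f (x + y) =
    linear_extension ground_algebra f x + linear_extension ground_algebra f y"
    by (subst k.linear_extension_add[where C = UNIV]) auto
  show "linear_extension ground_algebra f (x - y) =
    linear_extension ground_algebra f x - linear_extension ground_algebra f y"
    by (subst k.linear_extension_diff[where C = UNIV]) (auto simp: k.minus_eq_smult)
  show "linear_extension ground_algebra f (Poly_Mapping.single p c) = c * f p"
    by (subst k.linear_extension_single) auto
qed

section \<open>Tensor products of algebras\<close>

lemma (in monoid) monoid_algebra_minus:
  assumes "f \<in> carrier (monoid_algebra G)" "g \<in> carrier (monoid_algebra G :: ('k::field, _) module)"
  shows "f \<ominus>\<^bsub>monoid_algebra G\<^esub> g = f - g"
proof -
  interpret M: assoc_algebra "monoid_algebra G :: ('k, _) module" by (rule assoc_algebra_monoid_algebra)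
  show ?thesis
    using assms by (simp add: M.minus_eq_smult add_monoid_algebra smult_monoid_algebra)
      (rule poly_mapping_eqI, simp add: lookup_add lookup_minus)
qed

locale algebra_pair = A: assoc_algebra A + B: assoc_algebra B
  for A :: "('k::field, 'a, 'y) module_scheme" and B :: "('k, 'b, 'z) module_scheme"
begin

abbreviation "T \<equiv> tensor_algebra A B"
abbreviation tensor (infixr "\<oslash>" 75) where "a \<oslash> b \<equiv> pure_tensor A B a b"

lemma monoid_pair: "Group.monoid (A \<times>\<times> B)"
  by (rule DirProd_monoid) (rule A.monoid_axioms, rule B.monoid_axioms)

lemma monoid_algebra_quotient: "monoid_algebra_quotient (A \<times>\<times> B) (bilinearity_relators A B)"
proof (intro monoid_algebra_quotient.intro monoid_algebra_quotient_axioms.intro)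
  show "Group.monoid (A \<times>\<times> B)"
    by (rule monoid_pair)
  have *: "Poly_Mapping.keys (x - y) \<subseteq> C" if "Poly_Mapping.keys x \<subseteq> C" "Poly_Mapping.keys y \<subseteq> C"
    for x y :: "'a \<times> 'b \<Rightarrow>\<^sub>0 'k" and C
    using that keys_diff[of x y] by blast
  show "bilinearity_relators A B \<subseteq> carrier (monoid_algebra (A \<times>\<times> B))"
    by (auto simp: bilinearity_relators_def carrier_monoid_algebra DirProd_def
        dest!: subsetD[OF keys_diff] split: if_splits)
qed

sublocale Q: monoid_algebra_quotient "A \<times>\<times> B" "bilinearity_relators A B"
  rewrites "quotient_algebra (monoid_algebra (A \<times>\<times> B)) (bilinearity_relators A B) = T"
  by (rule monoid_algebra_quotient) (simp add: tensor_algebra_def)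

lemma assoc_algebra_tensor: "assoc_algebra T"
  using Q.assoc_algebra_quotient by simp

lemma single_closed: "\<lbrakk>a \<in> carrier A; b \<in> carrier B\<rbrakk> \<Longrightarrow>
    Poly_Mapping.single (a, b) c \<in> carrier (monoid_algebra (A \<times>\<times> B) :: ('k, _) module)"
  by (auto simp: carrier_monoid_algebra)

lemma tensor_closed [simp]: "\<lbrakk>a \<in> carrier A; b \<in> carrier B\<rbrakk> \<Longrightarrow> a \<oslash> b \<in> carrier T"
  by (simp add: pure_tensor_def single_closed Q.cls_closed)

lemma relator_zero:
  assumes "x - y \<in> bilinearity_relators A B" "x \<in> carrier (monoid_algebra (A \<times>\<times> B))"
    "y \<in> carrier (monoid_algebra (A \<times>\<times> B))"
  shows "Q.cls x = Q.cls y"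
  using assms Q.genideal_self[OF Q.relators] by (auto simp: Q.cls_eq_iff monoid.monoid_algebra_minus[OF monoid_pair])

lemma tensor_add_left:
  assumes "a \<in> carrier A" "a' \<in> carrier A" "b \<in> carrier B"
  shows "(a \<oplus>\<^bsub>A\<^esub> a') \<oslash> b = a \<oslash> b \<oplus>\<^bsub>T\<^esub> a' \<oslash> b"
proof -
  have "Q.cls (Poly_Mapping.single (a \<oplus>\<^bsub>A\<^esub> a', b) 1) =
      Q.cls (Poly_Mapping.single (a, b) 1 \<oplus>\<^bsub>monoid_algebra (A \<times>\<times> B)\<^esub> Poly_Mapping.single (a', b) 1)"
    using assms
    by (intro relator_zero Q.a_closed single_closed)
      (auto simp: bilinearity_relators_def add_monoid_algebra diff_diff_add)
  then show ?thesis using assms by (simp add: pure_tensor_def Q.cls_add single_closed)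
qed

lemma tensor_add_right:
  assumes "a \<in> carrier A" "b \<in> carrier B" "b' \<in> carrier B"
  shows "a \<oslash> (b \<oplus>\<^bsub>B\<^esub> b') = a \<oslash> b \<oplus>\<^bsub>T\<^esub> a \<oslash> b'"
proof -
  have "Q.cls (Poly_Mapping.single (a, b \<oplus>\<^bsub>B\<^esub> b') 1) =
      Q.cls (Poly_Mapping.single (a, b) 1 \<oplus>\<^bsub>monoid_algebra (A \<times>\<times> B)\<^esub> Poly_Mapping.single (a, b') 1)"
    using assms
    by (intro relator_zero Q.a_closed single_closed)
      (auto simp: bilinearity_relators_def add_monoid_algebra diff_diff_add)
  then show ?thesis using assms by (simp add: pure_tensor_def Q.cls_add single_closed)
qed

lemma tensor_smult_left:
  assumes "a \<in> carrier A" "b \<in> carrier B"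
  shows "(c \<odot>\<^bsub>A\<^esub> a) \<oslash> b = c \<odot>\<^bsub>T\<^esub> (a \<oslash> b)"
proof -
  have "Q.cls (Poly_Mapping.single (c \<odot>\<^bsub>A\<^esub> a, b) 1) = Q.cls (Poly_Mapping.single (a, b) c)"
    using assms by (intro relator_zero single_closed) (auto simp: bilinearity_relators_def)
  then show ?thesis
    using assms by (simp add: pure_tensor_def Q.cls_smult single_closed smult_monoid_algebra map_times_single)
qed

lemma tensor_smult_right:
  assumes "a \<in> carrier A" "b \<in> carrier B"
  shows "a \<oslash> (c \<odot>\<^bsub>B\<^esub> b) = c \<odot>\<^bsub>T\<^esub> (a \<oslash> b)"
proof -
  have "Q.cls (Poly_Mapping.single (a, c \<odot>\<^bsub>B\<^esub> b) 1) = Q.cls (Poly_Mapping.single (a, b) c)"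
    using assms by (intro relator_zero single_closed) (auto simp: bilinearity_relators_def)
  then show ?thesis
    using assms by (simp add: pure_tensor_def Q.cls_smult single_closed smult_monoid_algebra map_times_single)
qed

lemma tensor_mult:
  assumes "a \<in> carrier A" "a' \<in> carrier A" "b \<in> carrier B" "b' \<in> carrier B"
  shows "(a \<oslash> b) \<otimes>\<^bsub>T\<^esub> (a' \<oslash> b') = (a \<otimes>\<^bsub>A\<^esub> a') \<oslash> (b \<otimes>\<^bsub>B\<^esub> b')"
  using assms by (simp add: pure_tensor_def Q.cls_mult single_closed monoid_algebra_mult_single)

lemma tensor_one: "\<one>\<^bsub>T\<^esub> = \<one>\<^bsub>A\<^esub> \<oslash> \<one>\<^bsub>B\<^esub>"
  by (simp add: pure_tensor_def Q.cls_one one_monoid_algebra)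

lemma tensor_zero_left: "b \<in> carrier B \<Longrightarrow> \<zero>\<^bsub>A\<^esub> \<oslash> b = \<zero>\<^bsub>T\<^esub>"
  using tensor_smult_left[of "\<zero>\<^bsub>A\<^esub>" b 0] assoc_algebra.smult_zero_left[OF assoc_algebra_tensor] by simp

lemma tensor_zero_right: "a \<in> carrier A \<Longrightarrow> a \<oslash> \<zero>\<^bsub>B\<^esub> = \<zero>\<^bsub>T\<^esub>"
  using tensor_smult_right[of a "\<zero>\<^bsub>B\<^esub>" 0] assoc_algebra.smult_zero_left[OF assoc_algebra_tensor] by simp

lemma tensor_functional_exists:
  assumes f: "linear_functional A f" and g: "linear_functional B g"
  obtains L where "linear_functional T L"
    "\<And>a b. \<lbrakk>a \<in> carrier A; b \<in> carrier B\<rbrakk> \<Longrightarrow> L (a \<oslash> b) = f a * g b"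
proof -
  \<comment> \<open>Multiplication by a basis vector \<open>(a, b)\<close> replaces \<open>f\<close>
    and \<open>g\<close> by translates, so only the family of all such products of functionals is
    stable under translation.\<close>
  define F where "F = {(\<lambda>(a, b). f a * g b) | f g. linear_functional A f \<and> linear_functional B g}"
  have left: "\<exists>h'\<in>F. \<forall>q\<in>carrier (A \<times>\<times> B). h (p \<otimes>\<^bsub>A \<times>\<times> B\<^esub> q) = h' q"
    if h: "h \<in> F" and p: "p \<in> carrier (A \<times>\<times> B)" for h p
  proof -
    obtain f g where "linear_functional A f" "linear_functional B g" "h = (\<lambda>(a, b). f a * g b)"
      using h by (auto simp: F_def)
    moreover obtain a b where "p = (a, b)" "a \<in> carrier A" "b \<in> carrier B" using p by auto
    ultimately show ?thesis
      unfolding F_def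
      by (intro bexI[of _ "\<lambda>(x, y). f (a \<otimes>\<^bsub>A\<^esub> x) * g (b \<otimes>\<^bsub>B\<^esub> y)"] CollectI exI)
        (auto simp: linear_functional_def A.r_distr B.r_distr A.smult_mult_right B.smult_mult_right)
  qed
  have right: "\<exists>h'\<in>F. \<forall>q\<in>carrier (A \<times>\<times> B). h (q \<otimes>\<^bsub>A \<times>\<times> B\<^esub> p) = h' q"
    if h: "h \<in> F" and p: "p \<in> carrier (A \<times>\<times> B)" for h p
  proof -
    obtain f g where "linear_functional A f" "linear_functional B g" "h = (\<lambda>(a, b). f a * g b)"
      using h by (auto simp: F_def)
    moreover obtain a b where "p = (a, b)" "a \<in> carrier A" "b \<in> carrier B" using p by auto
    ultimately show ?thesis
      unfolding F_def
      by (intro bexI[of _ "\<lambda>(x, y). f (x \<otimes>\<^bsub>A\<^esub> a) * g (y \<otimes>\<^bsub>B\<^esub> b)"] CollectI exI)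
        (auto simp: linear_functional_def A.l_distr B.l_distr A.smult_mult_left B.smult_mult_left)
  qed
  have S: "linear_extension ground_algebra h s = 0" if "h \<in> F" "s \<in> bilinearity_relators A B" for h s
    using that
    by (auto simp: F_def bilinearity_relators_def linear_extension_ground linear_functional_def
        distrib_left distrib_right mult.assoc mult.left_commute)
  have F: "(\<lambda>(a, b). f a * g b) \<in> F" using f g by (auto simp: F_def)
  show thesis
  proof (rule that)
    show "linear_functional T (induced_map T (linear_extension ground_algebra (\<lambda>(a, b). f a * g b)))"
      by (rule Q.induced_functional(1)[of _ F]) (fact F | erule (1) left | erule (1) right | erule (1) S)+
    fix a b assume ab: "a \<in> carrier A" "b \<in> carrier B"
    have "induced_map T (linear_extension ground_algebra (\<lambda>(a, b). f a * g b))
        (Q.cls (Poly_Mapping.single (a, b) 1)) =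
      linear_extension ground_algebra (\<lambda>(a, b). f a * g b) (Poly_Mapping.single (a, b) 1)"
      by (rule Q.induced_functional(2)[of _ F])
        (fact F | erule (1) left | erule (1) right | erule (1) S | rule single_closed[OF ab])+
    then show "induced_map T (linear_extension ground_algebra (\<lambda>(a, b). f a * g b)) (a \<oslash> b) = f a * g b"
      by (simp add: pure_tensor_def linear_extension_ground)
  qed
qed

end

text \<open>On pairs the map is multiplicative and respects the bilinearity relators, so its linear
  extension descends to the quotient. Multiplicativity of the result is what later reduces
  compatibility with the comultiplication to the generators.\<close>

lemma tensor_map_hom:
  fixes A :: "('k::field, 'a, 'y) module_scheme" and B :: "('k, 'b, 'z) module_scheme"
    and A' :: "('k, 'c, 'v) module_scheme" and B' :: "('k, 'd, 'w) module_scheme"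
  assumes "algebra_map A A' h" "algebra_map B B' h'"
  shows "tensor_map A B A' B' h h' \<in> algebra_hom (tensor_algebra A B) (tensor_algebra A' B')"
    and "\<lbrakk>a \<in> carrier A; b \<in> carrier B\<rbrakk> \<Longrightarrow>
      tensor_map A B A' B' h h' (pure_tensor A B a b) = pure_tensor A' B' (h a) (h' b)"
proof -
  interpret h: algebra_map A A' h by fact
  interpret h': algebra_map B B' h' by fact
  interpret S: algebra_pair A B by unfold_locales
  interpret S': algebra_pair A' B' by unfold_locales
  interpret T: assoc_algebra "tensor_algebra A' B'" by (rule S'.assoc_algebra_tensor)
  define g where "g = (\<lambda>(a, b). pure_tensor A' B' (h a) (h' b))"
  have g_apply [simp]: "g (a, b) = pure_tensor A' B' (h a) (h' b)" for a b by (simp add: g_def)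
  have g: "g \<in> hom (A \<times>\<times> B) (tensor_algebra A' B')"
    by (auto simp: hom_def S'.tensor_mult h.mult h'.mult)
  have g1: "g \<one>\<^bsub>A \<times>\<times> B\<^esub> = \<one>\<^bsub>tensor_algebra A' B'\<^esub>"
    by (simp add: S'.tensor_one)
  have LE: "linear_extension (tensor_algebra A' B') g \<in> algebra_hom (monoid_algebra (A \<times>\<times> B)) (tensor_algebra A' B')"
    by (rule monoid.linear_extension_hom[OF S.monoid_pair S'.assoc_algebra_tensor]) (fact g, fact g1)
  have gc: "g \<in> carrier (A \<times>\<times> B) \<rightarrow> carrier (tensor_algebra A' B')"
    by auto
  have keys: "Poly_Mapping.keys (Poly_Mapping.single (a, b) c) \<subseteq> carrier (A \<times>\<times> B)"
    if "a \<in> carrier A" "b \<in> carrier B" for a b and c :: 'k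
    using that by auto
  have keys_diff: "Poly_Mapping.keys (x - y) \<subseteq> C" if "Poly_Mapping.keys x \<subseteq> C" "Poly_Mapping.keys y \<subseteq> C"
    for x y :: "'a \<times> 'b \<Rightarrow>\<^sub>0 'k" and C
    using that keys_diff[of x y] by blast
  have "linear_extension (tensor_algebra A' B') g s = \<zero>\<^bsub>tensor_algebra A' B'\<^esub>"
    if "s \<in> bilinearity_relators A B" for s
    using that
    by (auto simp: bilinearity_relators_def T.linear_extension_diff[OF gc] keys keys_diff
        T.linear_extension_single h.add h'.add h.smult h'.smult S'.tensor_add_left S'.tensor_add_right
        S'.tensor_smult_left S'.tensor_smult_right T.minus_self T.add_minus_minus)
  from S.Q.induced_hom[OF S'.assoc_algebra_tensor LE this]
  have H: "tensor_map A B A' B' h h' \<in> algebra_hom (tensor_algebra A B) (tensor_algebra A' B')"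
    "x \<in> carrier (monoid_algebra (A \<times>\<times> B)) \<Longrightarrow>
      tensor_map A B A' B' h h' (S.Q.cls x) = linear_extension (tensor_algebra A' B') g x" for x
    by (auto simp: tensor_map_def g_def)
  then show "tensor_map A B A' B' h h' \<in> algebra_hom (tensor_algebra A B) (tensor_algebra A' B')" by simp
  show "\<lbrakk>a \<in> carrier A; b \<in> carrier B\<rbrakk> \<Longrightarrow>
      tensor_map A B A' B' h h' (pure_tensor A B a b) = pure_tensor A' B' (h a) (h' b)"
    by (simp add: pure_tensor_def[of A B] H S.single_closed T.linear_extension_single)
qed

section \<open>The group generated by u and v with u u = v v\<close>

text \<open>
  \<open>Dih i j e\<close> stands for \<open>z\<^sup>i r\<^sup>j u\<^sup>e\<close>, where \<open>z = u u = v v\<close> is central, \<open>r = u v\<^sup>-\<^sup>1\<close> and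
  \<open>u r = r\<^sup>-\<^sup>1 u\<close>. The group is written additively.
\<close>

datatype dih = Dih int int bool

text \<open>The carry in the first coordinate is \<open>u u = z\<close> and the sign in the second
  is \<open>u r^j = r^-j u\<close>. Since \<open>u^-1 = z^-1 u\<close>, the inverse of
  \<open>z^i r^j u\<close> is \<open>z^(-i-1) r^j u\<close>.\<close>

instantiation dih :: group_add
begin

definition zero_dih :: dih where "0 = Dih 0 0 False"

fun plus_dih :: "dih \<Rightarrow> dih \<Rightarrow> dih" where
  "Dih i j e + Dih i' j' e' =
    Dih (i + i' + (if e \<and> e' then 1 else 0)) (if e then j - j' else j + j') (e \<noteq> e')"

fun uminus_dih :: "dih \<Rightarrow> dih" where
  "- Dih i j e = (if e then Dih (- i - 1) j True else Dih (- i) (- j) False)"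

definition minus_dih :: "dih \<Rightarrow> dih \<Rightarrow> dih" where "g - h = g + - (h :: dih)"

instance
proof
  fix a b c :: dih
  show "a + b + c = a + (b + c)" by (cases a; cases b; cases c) auto
  show "0 + a = a" "a + 0 = a" "- a + a = 0" "a + - b = a - b"
    by (cases a, auto simp: zero_dih_def minus_dih_def)+
qed

end

definition dih_u :: dih where "dih_u = Dih 0 0 True"
text \<open>From \<open>r = u v^-1\<close> one gets \<open>v = r^-1 u\<close>.\<close>

definition dih_v :: dih where "dih_v = Dih 0 (- 1) True"

lemmas dih_defs = dih_u_def dih_v_def zero_dih_def minus_dih_def

text \<open>The letters generate the group: \<open>u u\<close> and its inverse move the first
  coordinate, \<open>u v^-1\<close> and \<open>v u^-1\<close> move the second, and a final
  \<open>u\<close> sets the flag.\<close>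

lemma dih_induct [case_names zero step]:
  assumes "P 0" "\<And>g. P g \<Longrightarrow> P (g + dih_u) \<and> P (g + dih_v) \<and> P (g - dih_u) \<and> P (g - dih_v)"
  shows "P g"
proof -
  note * = assms(2)[THEN conjunct1] assms(2)[THEN conjunct2, THEN conjunct1]
    assms(2)[THEN conjunct2, THEN conjunct2, THEN conjunct1]
    assms(2)[THEN conjunct2, THEN conjunct2, THEN conjunct2]
  obtain i j e where g: "g = Dih i j e" by (cases g)
  have 1: "P (Dih i 0 False)"
  proof (induct i rule: int_induct[where k = 0])
    case base
    then show ?case using assms(1) by (simp add: zero_dih_def)
  next
    case (step1 i)
    then show ?case using *(1)[OF *(1)[of "Dih i 0 False"]] by (simp add: dih_defs add.commute)
  next
    case (step2 i)
    then show ?case using *(3)[OF *(3)[of "Dih i 0 False"]] by (simp add: dih_defs)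
  qed
  have 2: "P (Dih i j False)"
  proof (induct j rule: int_induct[where k = 0])
    case base
    then show ?case by (rule 1)
  next
    case (step1 j)
    then show ?case using *(4)[OF *(1)[of "Dih i j False"]] by (simp add: dih_defs add.commute)
  next
    case (step2 j)
    then show ?case using *(3)[OF *(2)[of "Dih i j False"]] by (simp add: dih_defs)
  qed
  show ?thesis using 2 *(1)[of "Dih i j False"] by (cases e) (simp_all add: g dih_defs)
qed

text \<open>The alternating word with \<open>m\<close> letters that starts with \<open>v\<close> if
  \<open>b\<close> holds and with \<open>u\<close> otherwise. The formula comes from
  \<open>u v = z r\<close> and \<open>v u = z r^-1\<close>; an odd word starting with
  \<open>v\<close> ends in one more \<open>v = r^-1 u\<close>, whence the rounding up.\<close>

definition dih_alt :: "bool \<Rightarrow> nat \<Rightarrow> dih" where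
  "dih_alt b m = Dih (int (m div 2)) (if b then - int ((m + 1) div 2) else int (m div 2)) (odd m)"

lemma dih_alt_Suc: "dih_alt b (Suc m) = (if b then dih_v else dih_u) + dih_alt (\<not> b) m"
  by (cases "even m") (auto simp: dih_alt_def dih_defs elim!: evenE oddE)

lemma dih_alt_0: "dih_alt b 0 = 0"
  by (simp add: dih_alt_def zero_dih_def)

text \<open>The automorphism exchanging \<open>u\<close> and \<open>v\<close>. It fixes
  \<open>z\<close> and inverts \<open>r\<close>, and the offset for odd elements arises because
  \<open>u\<close> itself goes to \<open>v = r^-1 u\<close>.\<close>

fun dih_swap :: "dih \<Rightarrow> dih" where
  "dih_swap (Dih i j e) = Dih i (- j - (if e then 1 else 0)) e"

lemma dih_swap_add: "dih_swap (g + h) = dih_swap g + dih_swap h"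
  by (cases g; cases h) auto

lemma dih_swap_simps [simp]:
  "dih_swap 0 = 0" "dih_swap dih_u = dih_v" "dih_swap dih_v = dih_u" "dih_swap (dih_swap g) = g"
  by (auto simp: dih_defs intro: dih.exhaust[of g])

lemma dih_swap_uminus: "dih_swap (- g) = - dih_swap g"
  by (cases g) auto

text \<open>Needed for the antipode, which sends \<open>x i j\<close> to a power of
  \<open>x j i\<close> and therefore exchanges \<open>u\<close> and \<open>v\<close> in the second
  component only.\<close>

definition dih_twist :: "bool \<Rightarrow> dih \<Rightarrow> dih" where
  "dih_twist d g = (if d then dih_swap g else g)"

text \<open>Universal property of the group with generators \<open>u\<close>, \<open>v\<close> and
  the relation \<open>u u = v v\<close>: the normal form \<open>z^i r^j u^e\<close> is mapped to the
  same expression in \<open>G\<close>, where \<open>z\<close> commutes with everything in sight and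
  \<open>u\<close> inverts \<open>r\<close>.\<close>

lemma (in group) dih_hom_exists:
  assumes u: "u \<in> carrier G" and v: "v \<in> carrier G" and uv: "u \<otimes> u = v \<otimes> v"
  obtains \<gamma> where "\<And>g. \<gamma> g \<in> carrier G" "\<And>g h. \<gamma> (g + h) = \<gamma> g \<otimes> \<gamma> h"
    "\<gamma> dih_u = u" "\<gamma> dih_v = v" "\<gamma> 0 = \<one>"
proof -
  define r where "r = u \<otimes> inv v"
  define z where "z = u \<otimes> u"
  have r: "r \<in> carrier G" and z: "z \<in> carrier G" using u v by (auto simp: r_def z_def)
  have zu: "u \<otimes> z = z \<otimes> u" using u by (simp add: z_def m_assoc)
  have zv: "v \<otimes> z = z \<otimes> v" using v by (simp add: z_def uv m_assoc)
  have zr: "r \<otimes> z = z \<otimes> r"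
  proof -
    have "inv v \<otimes> z = z \<otimes> inv v"
      using v z zv by (metis inv_closed inv_solve_left inv_solve_right' m_closed m_assoc)
    then show ?thesis using u v z zu by (metis r_def inv_closed m_assoc)
  qed
  have ur: "u \<otimes> r = v"
    using u v by (simp add: r_def uv m_assoc flip: m_assoc[of u u])
  have ru: "inv r \<otimes> u = v"
    using u v by (simp add: r_def inv_mult_group m_assoc)
  have comm_pow: "x \<otimes> y [^] (i::int) = y [^] i \<otimes> x"
    if "x \<in> carrier G" "y \<in> carrier G" "x \<otimes> y = y \<otimes> x" for x y i
  proof -
    have "x \<otimes> inv y = inv y \<otimes> x"
      using that by (metis inv_closed inv_solve_left inv_solve_right' m_closed m_assoc)
    then have "x \<otimes> inv y [^] k = inv y [^] k \<otimes> x" "x \<otimes> y [^] k = y [^] k \<otimes> x" for k :: nat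
      using that by (metis group_commutes_pow inv_closed)+
    then show ?thesis
      using that by (cases i rule: int_cases2) (auto simp: int_pow_int int_pow_neg nat_pow_inv)
  qed
  have zrpow: "r [^] (j::int) \<otimes> z = z \<otimes> r [^] j" for j
    using comm_pow[of z r j] r z zr by simp
  \<comment> \<open>Both signs of \<open>j\<close> rest on \<open>u r = v = r^-1 u\<close>, which is
    the relation \<open>u u = v v\<close> in another form.\<close>
  have urpow: "u \<otimes> r [^] (j::int) = r [^] (- j) \<otimes> u" for j
  proof (induct j rule: int_induct[where k = 0])
    case base
    show ?case using u by simp
  next
    case (step1 j)
    have "u \<otimes> r [^] (j + 1) = (u \<otimes> r [^] j) \<otimes> r" using u r by (simp add: int_pow_mult m_assoc)
    also have "\<dots> = r [^] (- j) \<otimes> (u \<otimes> r)" using u r step1 by (simp add: m_assoc)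
    also have "u \<otimes> r = r [^] (- 1 :: int) \<otimes> u" using ur ru r by (simp add: int_pow_neg)
    also have "r [^] (- j) \<otimes> (r [^] (- 1 :: int) \<otimes> u) = r [^] (- j + - 1) \<otimes> u"
      using int_pow_mult[OF r, of "- j" "- 1"] u r by (simp add: m_assoc)
    finally show ?case by (simp add: algebra_simps)
  next
    case (step2 j)
    have uri: "u \<otimes> inv r = r \<otimes> u"
      using ur ru u v r by (metis inv_closed inv_solve_left inv_solve_right' m_closed m_assoc)
    have "u \<otimes> r [^] (j - 1) = (u \<otimes> r [^] j) \<otimes> r [^] (- 1 :: int)"
      using int_pow_mult[OF r, of j "- 1"] u r by (simp add: m_assoc)
    also have "\<dots> = r [^] (- j) \<otimes> (u \<otimes> inv r)" using u r step2 by (simp add: m_assoc int_pow_neg)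
    also have "\<dots> = r [^] (- j + 1) \<otimes> u"
      using int_pow_mult[OF r, of "- j" 1] u r by (simp add: uri m_assoc)
    finally show ?case by (simp add: algebra_simps)
  qed
  define \<gamma> where "\<gamma> g = (case g of Dih i j e \<Rightarrow> z [^] i \<otimes> (r [^] j \<otimes> (if e then u else \<one>)))" for g
  show thesis
  proof (rule that[of \<gamma>])
    show "\<gamma> g \<in> carrier G" for g using u r z by (auto simp: \<gamma>_def split: dih.splits)
    show "\<gamma> dih_u = u" "\<gamma> 0 = \<one>" using u r z by (auto simp: \<gamma>_def dih_defs)
    show "\<gamma> dih_v = v" using u r z ru by (auto simp: \<gamma>_def dih_defs int_pow_neg)
    show "\<gamma> (g + h) = \<gamma> g \<otimes> \<gamma> h" for g h
    proof -
      obtain i j e where g: "g = Dih i j e" by (cases g)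
      obtain i' j' e' where h: "h = Dih i' j' e'" by (cases h)
      let ?e = "if e then u else \<one>" and ?e' = "if e' then u else \<one>"
      let ?j = "if e then - j' else j'"
      have e: "?e \<in> carrier G" "?e' \<in> carrier G" using u by auto
      have zp: "x \<otimes> (z [^] i' \<otimes> y) = z [^] i' \<otimes> (x \<otimes> y)"
        if "x \<in> carrier G" "y \<in> carrier G" "x \<otimes> z = z \<otimes> x" for x y
        using comm_pow[OF that(1) z that(3), of i'] that z by (metis int_pow_closed m_assoc)
      have "\<gamma> g \<otimes> \<gamma> h = z [^] i \<otimes> (r [^] j \<otimes> (?e \<otimes> (z [^] i' \<otimes> (r [^] j' \<otimes> ?e'))))"
        using e r z by (simp add: \<gamma>_def g h m_assoc)
      also have "?e \<otimes> (z [^] i' \<otimes> (r [^] j' \<otimes> ?e')) = z [^] i' \<otimes> (?e \<otimes> (r [^] j' \<otimes> ?e'))"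
        using e r z zu by (intro zp) auto
      also have "?e \<otimes> (r [^] j' \<otimes> ?e') = r [^] ?j \<otimes> (?e \<otimes> ?e')"
        using e r urpow[of j'] by (auto simp flip: m_assoc)
      also have "r [^] j \<otimes> (z [^] i' \<otimes> (r [^] ?j \<otimes> (?e \<otimes> ?e'))) =
          z [^] i' \<otimes> (r [^] j \<otimes> (r [^] ?j \<otimes> (?e \<otimes> ?e')))"
        using e r z zrpow by (intro zp) auto
      also have "\<dots> = z [^] i' \<otimes> (r [^] (j + ?j) \<otimes> (?e \<otimes> ?e'))"
        using e r by (simp add: int_pow_mult m_assoc)
      also have "\<dots> = z [^] i' \<otimes> (z [^] (if e \<and> e' then 1 else 0 :: int) \<otimes>
          (r [^] (j + ?j) \<otimes> (if e \<noteq> e' then u else \<one>)))"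
      proof (cases "e \<and> e'")
        case True
        then show ?thesis using r z u zrpow[of "j + ?j"] by (simp add: m_assoc flip: z_def)
      qed (use e r z u in auto)
      also have "z [^] i \<otimes> \<dots> = \<gamma> (g + h)"
        using r z u int_pow_mult[OF r, of j "- j'"] by (auto simp: \<gamma>_def g h int_pow_mult m_assoc)
      finally show ?thesis ..
    qed
  qed
qed

section \<open>Presentation of the Suzuki algebras\<close>

text \<open>The relations as equations in an arbitrary algebra. They are needed in the Suzuki
  algebra itself, its opposite, its tensor square and the ground field, where relators of the free
  algebra would have to be evaluated each time.\<close>

definition suzuki_relations ::
  "nat \<Rightarrow> nat \<Rightarrow> 'k::field \<Rightarrow> 'k \<Rightarrow> ('k, 'b, 'z) module_scheme \<Rightarrow> (nat \<Rightarrow> nat \<Rightarrow> 'b) \<Rightarrow> bool" where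
  "suzuki_relations N n mu lam B y \<longleftrightarrow>
    (\<forall>i\<in>{1,2}. \<forall>j\<in>{1,2}. y i j \<in> carrier B) \<and>
    y 1 1 [^]\<^bsub>B\<^esub> (2::nat) = y 2 2 [^]\<^bsub>B\<^esub> (2::nat) \<and>
    y 1 2 [^]\<^bsub>B\<^esub> (2::nat) = y 2 1 [^]\<^bsub>B\<^esub> (2::nat) \<and>
    alternating B y 2 1 n = lam \<odot>\<^bsub>B\<^esub> alternating B y 1 2 n \<and>
    alternating B y 1 1 n = alternating B y 2 2 n \<and>
    y 1 1 [^]\<^bsub>B\<^esub> (2 * N) \<oplus>\<^bsub>B\<^esub> mu \<odot>\<^bsub>B\<^esub> (y 1 2 [^]\<^bsub>B\<^esub> (2 * N)) = \<one>\<^bsub>B\<^esub> \<and>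
    (\<forall>i\<in>{1,2}. \<forall>j\<in>{1,2}. \<forall>k\<in>{1,2}. \<forall>l\<in>{1,2}.
      odd (i + j + k + l) \<longrightarrow> y i j \<otimes>\<^bsub>B\<^esub> y k l = \<zero>\<^bsub>B\<^esub>)"

lemma (in assoc_algebra) minus_eq_zero_iff:
  "\<lbrakk>a \<in> carrier A; b \<in> carrier A\<rbrakk> \<Longrightarrow> a \<ominus> b = \<zero> \<longleftrightarrow> a = b"
  using minus_equality[of a "\<ominus> b"] by (auto simp: minus_self, simp add: a_minus_def)

lemma monoid_free_monoid: "Group.monoid (free_monoid G)"
  by (rule monoidI) (auto simp: free_monoid_def)

lemma free_monoid_simps:
  "carrier (free_monoid G) = lists G" "p \<otimes>\<^bsub>free_monoid G\<^esub> q = p @ q" "\<one>\<^bsub>free_monoid G\<^esub> = []"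
  by (simp_all add: free_monoid_def)

lemma assoc_algebra_free: "assoc_algebra (free_algebra G :: ('k::field, _) module)"
  unfolding free_algebra_def by (rule monoid.assoc_algebra_monoid_algebra[OF monoid_free_monoid])

lemma free_generator_closed:
  "x \<in> G \<Longrightarrow> free_generator x \<in> carrier (free_algebra G :: ('k::field, _) module)"
  by (simp add: free_algebra_def free_generator_def carrier_monoid_algebra free_monoid_simps)

lemma suzuki_generators_mem: "(i, j) \<in> suzuki_generators \<longleftrightarrow> i \<in> {1, 2} \<and> j \<in> {1, 2}"
  by (auto simp: suzuki_generators_def)

lemma suzuki_relators_closed:
  "suzuki_relators N n mu lam \<subseteq> carrier (free_algebra suzuki_generators :: ('k::field, _) module)"
proof -
  interpret F: assoc_algebra "free_algebra suzuki_generators :: ('k, _) module"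
    by (rule assoc_algebra_free)
  have x: "free_generator (i, j) \<in> carrier (free_algebra suzuki_generators :: ('k, _) module)"
    if "i \<in> {1, 2}" "j \<in> {1, 2}" for i j :: nat
    by (rule free_generator_closed) (use that in \<open>auto simp: suzuki_generators_mem\<close>)
  interpret I: algebra_map "free_algebra suzuki_generators :: ('k, _) module"
    "free_algebra suzuki_generators :: ('k, _) module" "\<lambda>x. x"
    by unfold_locales (auto simp: algebra_hom_def ring_hom_def)
  note closed = x I.alternating(1)[where x = "\<lambda>i j. free_generator (i, j)"]
  have "free_generator (i, j) \<otimes>\<^bsub>free_algebra suzuki_generators\<^esub> free_generator (k, l) \<in>
      carrier (free_algebra suzuki_generators :: ('k, _) module)"
    if "i \<in> {1, 2}" "j \<in> {1, 2}" "k \<in> {1, 2}" "l \<in> {1, 2}" for i j k l :: nat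
    using x that by blast
  then have products: "{free_generator (i, j) \<otimes>\<^bsub>free_algebra suzuki_generators\<^esub> free_generator (k, l) | i j k l.
      i \<in> {1, 2} \<and> j \<in> {1, 2} \<and> k \<in> {1, 2} \<and> l \<in> {1, 2} \<and> odd (i + j + k + l)} \<subseteq>
      carrier (free_algebra suzuki_generators :: ('k, _) module)"
    by blast
  have 12: "1 \<in> {1, 2::nat}" "2 \<in> {1, 2::nat}" by simp_all
  show ?thesis
    unfolding suzuki_relators_def Let_def
    by (intro Un_least products insert_subsetI empty_subsetI F.minus_closed F.nat_pow_closed F.smult_closed
        F.a_closed F.one_closed closed 12)
qed

text \<open>Used in both directions: for the quotient map it shows that the generators satisfy the
  relations, for an evaluation map it supplies the vanishing on relators that the universal property
  asks for.\<close>

lemma suzuki_relators_relations: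
  assumes "algebra_map (free_algebra suzuki_generators) B h"
  shows "(\<forall>s\<in>suzuki_relators N n mu lam. h s = \<zero>\<^bsub>B\<^esub>) \<longleftrightarrow>
    suzuki_relations N n mu lam B (\<lambda>i j. h (free_generator (i, j)))"
proof -
  interpret algebra_map "free_algebra suzuki_generators" B h by fact
  have x: "free_generator (i, j) \<in> carrier (free_algebra suzuki_generators :: ('a, _) module)"
    if "i \<in> {1, 2}" "j \<in> {1, 2}" for i j :: nat
    by (rule free_generator_closed) (use that in \<open>auto simp: suzuki_generators_mem\<close>)
  have alt: "alternating (free_algebra suzuki_generators) (\<lambda>i j. free_generator (i, j)) i j m \<in>
      carrier (free_algebra suzuki_generators :: ('a, _) module)"
    "h (alternating (free_algebra suzuki_generators) (\<lambda>i j. free_generator (i, j)) i j m) =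
      alternating B (\<lambda>i j. h (free_generator (i, j))) i j m" if "i \<in> {1, 2}" "j \<in> {1, 2}" for i j m
    using alternating[where x = "\<lambda>i j. free_generator (i, j)", OF _ that] x by blast+
  have 12: "1 \<in> {1, 2::nat}" "2 \<in> {1, 2::nat}" by simp_all
  note gen = x[OF 12(1) 12(1)] x[OF 12(1) 12(2)] x[OF 12(2) 12(1)] x[OF 12(2) 12(2)]
  note alts = alt[OF 12(1) 12(1)] alt[OF 12(1) 12(2)] alt[OF 12(2) 12(1)] alt[OF 12(2) 12(2)]
  note hyps = gen alts closed[OF gen(1)] closed[OF gen(2)] closed[OF gen(3)] closed[OF gen(4)]
    closed[OF alts(1)] closed[OF alts(3)] closed[OF alts(5)] closed[OF alts(7)]
  have products: "(\<forall>s\<in>{free_generator (i, j) \<otimes>\<^bsub>free_algebra suzuki_generators\<^esub> free_generator (k, l) | i j k l.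
      i \<in> {1, 2} \<and> j \<in> {1, 2} \<and> k \<in> {1, 2} \<and> l \<in> {1, 2} \<and> odd (i + j + k + l)}. h s = \<zero>\<^bsub>B\<^esub>) \<longleftrightarrow>
    (\<forall>i\<in>{1,2}. \<forall>j\<in>{1,2}. \<forall>k\<in>{1,2}. \<forall>l\<in>{1,2}. odd (i + j + k + l) \<longrightarrow>
      h (free_generator (i, j)) \<otimes>\<^bsub>B\<^esub> h (free_generator (k, l)) = \<zero>\<^bsub>B\<^esub>)" (is "?L \<longleftrightarrow> ?R")
  proof
    assume L: ?L
    show ?R
    proof (intro ballI impI)
      fix i j k l :: nat
      assume *: "i \<in> {1, 2}" "j \<in> {1, 2}" "k \<in> {1, 2}" "l \<in> {1, 2}" "odd (i + j + k + l)"
      then have "h (free_generator (i, j) \<otimes>\<^bsub>free_algebra suzuki_generators\<^esub> free_generator (k, l)) = \<zero>\<^bsub>B\<^esub>"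
        using L by blast
      then show "h (free_generator (i, j)) \<otimes>\<^bsub>B\<^esub> h (free_generator (k, l)) = \<zero>\<^bsub>B\<^esub>"
        using x[OF *(1,2)] x[OF *(3,4)] by (simp only: mult)
    qed
  next
    assume R: ?R
    show ?L
    proof
      fix s :: "(nat \<times> nat) list \<Rightarrow>\<^sub>0 'a"
      assume "s \<in> {free_generator (i, j) \<otimes>\<^bsub>free_algebra suzuki_generators\<^esub> free_generator (k, l) | i j k l.
        i \<in> {1, 2} \<and> j \<in> {1, 2} \<and> k \<in> {1, 2} \<and> l \<in> {1, 2} \<and> odd (i + j + k + l)}"
      then obtain i j k l where
        s: "s = free_generator (i, j) \<otimes>\<^bsub>free_algebra suzuki_generators\<^esub> free_generator (k, l)"
        and *: "i \<in> {1, 2}" "j \<in> {1, 2}" "k \<in> {1, 2}" "l \<in> {1, 2}" "odd (i + j + k + l)" by blast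
      have "h s = h (free_generator (i, j)) \<otimes>\<^bsub>B\<^esub> h (free_generator (k, l))"
        unfolding s using x[OF *(1,2)] x[OF *(3,4)] by (rule mult)
      also have "\<dots> = \<zero>\<^bsub>B\<^esub>" using R * by blast
      finally show "h s = \<zero>\<^bsub>B\<^esub>" .
    qed
  qed
  have gens: "(\<forall>i\<in>{1,2}. \<forall>j\<in>{1,2}. h (free_generator (i, j)) \<in> carrier B) \<longleftrightarrow> True"
    using x closed by blast
  show ?thesis
    unfolding suzuki_relators_def suzuki_relations_def Let_def ball_Un products gens using hyps
    by (simp del: One_nat_def add: minus nat_pow add smult mult B.minus_eq_zero_iff)
qed

lemma suzuki_hom:
  assumes B: "assoc_algebra B" and rel: "suzuki_relations N n mu lam B y"
  shows "suzuki_hom N n mu lam B y \<in> algebra_hom (suzuki_algebra N n mu lam) B"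
    and "\<lbrakk>i \<in> {1, 2}; j \<in> {1, 2}\<rbrakk> \<Longrightarrow> suzuki_hom N n mu lam B y (suzuki_x N n mu lam i j) = y i j"
proof -
  interpret B: assoc_algebra B by fact
  define g where "g = word_value B (\<lambda>(i, j). y i j)"
  have y: "y i j \<in> carrier B" if "(i, j) \<in> suzuki_generators" for i j
    using rel that by (auto simp: suzuki_relations_def suzuki_generators_mem)
  have g_closed: "g w \<in> carrier B" if "w \<in> lists suzuki_generators" for w
    using that y by (induct w) (auto simp: g_def word_value_def)
  have g_append: "g (w @ w') = g w \<otimes>\<^bsub>B\<^esub> g w'"
    if "w \<in> lists suzuki_generators" "w' \<in> lists suzuki_generators" for w w'
    using that
  proof (induct w)
    case Nil
    then show ?case using g_closed[of w'] by (simp add: g_def word_value_def)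
  next
    case (Cons x w)
    then have "g w \<in> carrier B" "g w' \<in> carrier B" using g_closed by auto
    then show ?case using Cons y by (cases x) (simp add: g_def word_value_def B.m_assoc)
  qed
  have "linear_extension B g \<in> algebra_hom (free_algebra suzuki_generators) B"
    unfolding free_algebra_def
    by (rule monoid.linear_extension_hom[OF monoid_free_monoid B])
      (auto simp: hom_def free_monoid_simps g_closed g_append, simp add: g_def word_value_def)
  then interpret L: algebra_map "free_algebra suzuki_generators" B "linear_extension B g"
    using assoc_algebra_free B by (intro algebra_map.intro algebra_map_axioms.intro)
  have Lx: "linear_extension B g (free_generator (i, j)) = y i j" if "i \<in> {1, 2}" "j \<in> {1, 2}" for i j
    unfolding free_generator_def using y[of i j] that
    by (subst B.linear_extension_single) (auto simp: g_def word_value_def suzuki_generators_mem)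
  have "suzuki_relations N n mu lam B (\<lambda>i j. linear_extension B g (free_generator (i, j)))"
  proof -
    have alt: "alternating B (\<lambda>i j. linear_extension B g (free_generator (i, j))) i j m = alternating B y i j m"
      if "i \<in> {1, 2}" "j \<in> {1, 2}" for i j m
      using that
    proof (induct m arbitrary: i j)
      case (Suc m)
      have "3 - i \<in> {1, 2}" "3 - j \<in> {1, 2}" using Suc.prems by auto
      then show ?case using Suc Lx[of i j] by simp
    qed simp
    show ?thesis using rel Lx[of 1 1] Lx[of 1 2] Lx[of 2 1] Lx[of 2 2]
      by (auto simp: suzuki_relations_def alt)
  qed
  then have S: "\<And>s. s \<in> suzuki_relators N n mu lam \<Longrightarrow> linear_extension B g s = \<zero>\<^bsub>B\<^esub>"
    using suzuki_relators_relations[OF L.algebra_map_axioms] by blast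
  interpret Q: algebra_quotient "free_algebra suzuki_generators" "suzuki_relators N n mu lam"
    using assoc_algebra_free suzuki_relators_closed
    by (intro algebra_quotient.intro algebra_quotient_axioms.intro)
  note H = Q.induced_hom[OF B L.hom S]
  show "suzuki_hom N n mu lam B y \<in> algebra_hom (suzuki_algebra N n mu lam) B"
    using H(1) by (simp add: suzuki_hom_def presented_hom_def presented_algebra_def suzuki_algebra_def g_def)
  show "suzuki_hom N n mu lam B y (suzuki_x N n mu lam i j) = y i j" if "i \<in> {1, 2}" "j \<in> {1, 2}"
  proof -
    have "(i, j) \<in> suzuki_generators" using that by (simp add: suzuki_generators_mem)
    then show ?thesis
      using H(2)[OF _ free_generator_closed] Lx[OF that]
      by (simp add: suzuki_hom_def presented_hom_def presented_algebra_def suzuki_algebra_def g_def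
          suzuki_x_def presented_generator_def)
  qed
qed

lemma assoc_algebra_suzuki_algebra: "assoc_algebra (suzuki_algebra N n mu lam)"
  unfolding suzuki_algebra_def presented_algebra_def
  by (intro algebra_quotient.assoc_algebra_quotient algebra_quotient.intro algebra_quotient_axioms.intro
      assoc_algebra_free suzuki_relators_closed)

lemma suzuki_x_relations:
  "suzuki_relations N n mu lam (suzuki_algebra N n mu lam) (suzuki_x N n (mu::'k::field) lam)"
proof -
  interpret Q: algebra_quotient "free_algebra suzuki_generators" "suzuki_relators N n mu lam"
    using assoc_algebra_free suzuki_relators_closed
    by (intro algebra_quotient.intro algebra_quotient_axioms.intro)
  have "algebra_map (free_algebra suzuki_generators) (suzuki_algebra N n mu lam)
      ((+>\<^bsub>free_algebra suzuki_generators\<^esub>) (Idl\<^bsub>free_algebra suzuki_generators\<^esub> suzuki_relators N n mu lam))"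
    using Q.cls_hom assoc_algebra_free assoc_algebra_suzuki_algebra
    by (intro algebra_map.intro algebra_map_axioms.intro) (auto simp: suzuki_algebra_def presented_algebra_def)
  from suzuki_relators_relations[OF this, of N n mu lam] show ?thesis
    using Q.cls_relator[folded presented_algebra_def, folded suzuki_algebra_def]
    unfolding suzuki_x_def[abs_def] presented_generator_def by blast
qed

lemma suzuki_word_induct [consumes 1, case_names add smult word]:
  assumes a: "a \<in> carrier (suzuki_algebra N n mu (lam::'k::field))"
    and add: "\<And>a b. \<lbrakk>a \<in> carrier (suzuki_algebra N n mu lam); b \<in> carrier (suzuki_algebra N n mu lam); P a; P b\<rbrakk>
      \<Longrightarrow> P (a \<oplus>\<^bsub>suzuki_algebra N n mu lam\<^esub> b)"
    and smult: "\<And>c a. \<lbrakk>a \<in> carrier (suzuki_algebra N n mu lam); P a\<rbrakk>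
      \<Longrightarrow> P (c \<odot>\<^bsub>suzuki_algebra N n mu lam\<^esub> a)"
    and word: "\<And>w. w \<in> lists suzuki_generators \<Longrightarrow>
      P ((Idl\<^bsub>free_algebra suzuki_generators\<^esub> suzuki_relators N n mu lam) +>\<^bsub>free_algebra suzuki_generators\<^esub>
        Poly_Mapping.single w 1)"
  shows "P a"
proof -
  let ?F = "free_algebra suzuki_generators :: ('k, _) module"
  interpret Q: algebra_quotient ?F "suzuki_relators N n mu lam"
    using assoc_algebra_free suzuki_relators_closed
    by (intro algebra_quotient.intro algebra_quotient_axioms.intro)
  interpret C: algebra_map ?F "suzuki_algebra N n mu lam" Q.cls
    using Q.cls_hom assoc_algebra_free assoc_algebra_suzuki_algebra
    by (intro algebra_map.intro algebra_map_axioms.intro) (auto simp: suzuki_algebra_def presented_algebra_def)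
  have single: "Poly_Mapping.single w 1 \<in> carrier ?F" if "w \<in> lists suzuki_generators" for w
    using that by (simp add: free_algebra_def carrier_monoid_algebra free_monoid_simps)
  obtain f where f: "f \<in> carrier ?F" "a = Q.cls f"
    using a Q.carrier_quotient by (auto simp: suzuki_algebra_def presented_algebra_def)
  from f(1) have "Poly_Mapping.keys f \<subseteq> lists suzuki_generators"
    by (simp add: free_algebra_def carrier_monoid_algebra free_monoid_simps)
  then have "P (Q.cls f)"
  proof (induct f rule: poly_mapping_keys_induct)
    case zero
    have "P (0 \<odot>\<^bsub>suzuki_algebra N n mu lam\<^esub> Q.cls (Poly_Mapping.single [] 1))"
      using word[of "[]"] single[of "[]"] by (intro smult) auto
    moreover have "\<zero>\<^bsub>?F\<^esub> = 0" by (simp add: free_algebra_def zero_monoid_algebra)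
    ultimately show ?case using C.zero single[of "[]"] by simp
  next
    case (add p c f)
    have cf: "f \<in> carrier ?F" using add by (simp add: free_algebra_def carrier_monoid_algebra free_monoid_simps)
    have "Poly_Mapping.single p c + f = c \<odot>\<^bsub>?F\<^esub> Poly_Mapping.single p 1 \<oplus>\<^bsub>?F\<^esub> f"
      by (simp add: free_algebra_def add_monoid_algebra smult_monoid_algebra map_times_single)
    then have "Q.cls (Poly_Mapping.single p c + f) =
      c \<odot>\<^bsub>suzuki_algebra N n mu lam\<^esub> Q.cls (Poly_Mapping.single p 1) \<oplus>\<^bsub>suzuki_algebra N n mu lam\<^esub> Q.cls f"
      using single[OF add(1)] cf by (simp add: C.add C.smult)
    then show ?case
      using single[OF add(1)] cf word[OF add(1)] add(3) assms(2,3) by simp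
  qed
  then show ?thesis by (simp add: f)
qed

lemma suzuki_word_Cons:
  assumes "(i, j) \<in> suzuki_generators" "w \<in> lists suzuki_generators"
  shows "(Idl\<^bsub>free_algebra suzuki_generators\<^esub> suzuki_relators N n mu lam) +>\<^bsub>free_algebra suzuki_generators\<^esub>
      Poly_Mapping.single ((i, j) # w) 1 =
    suzuki_x N n mu (lam::'k::field) i j \<otimes>\<^bsub>suzuki_algebra N n mu lam\<^esub>
      ((Idl\<^bsub>free_algebra suzuki_generators\<^esub> suzuki_relators N n mu lam) +>\<^bsub>free_algebra suzuki_generators\<^esub>
        Poly_Mapping.single w 1)"
proof -
  let ?F = "free_algebra suzuki_generators :: ('k, _) module"
  interpret Q: algebra_quotient ?F "suzuki_relators N n mu lam"
    using assoc_algebra_free suzuki_relators_closed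
    by (intro algebra_quotient.intro algebra_quotient_axioms.intro)
  have "Poly_Mapping.single w 1 \<in> carrier ?F"
    using assms(2) by (simp add: free_algebra_def carrier_monoid_algebra free_monoid_simps)
  note mult = Q.cls_mult[OF free_generator_closed[OF assms(1)] this]
  have "Poly_Mapping.single ((i, j) # w) 1 = free_generator (i, j) \<otimes>\<^bsub>?F\<^esub> Poly_Mapping.single w 1"
    by (simp add: free_algebra_def free_generator_def monoid_algebra_mult_single free_monoid_simps)
  then show ?thesis
    by (simp add: suzuki_x_def presented_generator_def suzuki_algebra_def presented_algebra_def mult)
qed

lemma suzuki_word_Nil:
  "(Idl\<^bsub>free_algebra suzuki_generators\<^esub> suzuki_relators N n mu lam) +>\<^bsub>free_algebra suzuki_generators\<^esub>
      Poly_Mapping.single [] 1 = \<one>\<^bsub>suzuki_algebra N n mu (lam::'k::field)\<^esub>"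
proof -
  interpret Q: algebra_quotient "free_algebra suzuki_generators :: ('k, _) module" "suzuki_relators N n mu lam"
    using assoc_algebra_free suzuki_relators_closed
    by (intro algebra_quotient.intro algebra_quotient_axioms.intro)
  have "\<one>\<^bsub>free_algebra suzuki_generators :: ('k, _) module\<^esub> = Poly_Mapping.single [] 1"
    by (simp add: free_algebra_def one_monoid_algebra free_monoid_simps)
  then show ?thesis
    using Q.cls_one by (simp add: suzuki_algebra_def presented_algebra_def)
qed

lemma suzuki_algebra_induct [consumes 1, case_names add smult one mult]:
  assumes a: "a \<in> carrier (suzuki_algebra N n mu (lam::'k::field))"
    and add: "\<And>a b. \<lbrakk>a \<in> carrier (suzuki_algebra N n mu lam); b \<in> carrier (suzuki_algebra N n mu lam); P a; P b\<rbrakk>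
      \<Longrightarrow> P (a \<oplus>\<^bsub>suzuki_algebra N n mu lam\<^esub> b)"
    and smult: "\<And>c a. \<lbrakk>a \<in> carrier (suzuki_algebra N n mu lam); P a\<rbrakk>
      \<Longrightarrow> P (c \<odot>\<^bsub>suzuki_algebra N n mu lam\<^esub> a)"
    and one: "P \<one>\<^bsub>suzuki_algebra N n mu lam\<^esub>"
    and mult: "\<And>i j a. \<lbrakk>i \<in> {1, 2}; j \<in> {1, 2}; a \<in> carrier (suzuki_algebra N n mu lam); P a\<rbrakk>
      \<Longrightarrow> P (suzuki_x N n mu lam i j \<otimes>\<^bsub>suzuki_algebra N n mu lam\<^esub> a)"
  shows "P a"
proof -
  interpret A: assoc_algebra "suzuki_algebra N n mu lam" by (rule assoc_algebra_suzuki_algebra)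
  let ?c = "\<lambda>w. (Idl\<^bsub>free_algebra suzuki_generators\<^esub> suzuki_relators N n mu lam) +>\<^bsub>free_algebra suzuki_generators\<^esub>
    Poly_Mapping.single w 1"
  have word: "?c w \<in> carrier (suzuki_algebra N n mu lam) \<and> P (?c w)" if "w \<in> lists suzuki_generators" for w
    using that
  proof (induct w)
    case Nil
    then show ?case using one by (simp add: suzuki_word_Nil)
  next
    case (Cons p w)
    obtain i j where p: "p = (i, j)" by (cases p)
    have ij: "i \<in> {1, 2}" "j \<in> {1, 2}" using Cons by (auto simp: p suzuki_generators_mem)
    then have "suzuki_x N n mu lam i j \<in> carrier (suzuki_algebra N n mu lam)"
      using suzuki_x_relations[of N n mu lam] unfolding suzuki_relations_def by blast
    then show ?case
      using Cons.hyps suzuki_word_Cons[of i j w N n mu lam] mult[OF ij] by (simp add: p)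
  qed
  show ?thesis using a by (induct a rule: suzuki_word_induct) (use word add smult in auto)
qed

section \<open>Families of elements indexed by the group\<close>

text \<open>
  A homomorphism from the Suzuki algebra to \<open>B\<close> amounts to a family \<open>\<beta> g d\<close>, where \<open>d\<close> tells apart the
  component generated by \<open>x\<^sub>1\<^sub>1, x\<^sub>2\<^sub>2\<close> from the one generated by \<open>x\<^sub>1\<^sub>2, x\<^sub>2\<^sub>1\<close>: the letters \<open>u\<close> and \<open>v\<close>
  are \<open>x\<^sub>1\<^sub>1\<close> and \<open>x\<^sub>2\<^sub>2\<close> in the first component, \<open>x\<^sub>1\<^sub>2\<close> and \<open>x\<^sub>2\<^sub>1\<close> in the second one.
\<close>

definition component_sign :: "'k::field \<Rightarrow> bool \<Rightarrow> 'k" where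
  "component_sign m d = (if d then m else 1)"

text \<open>\<open>\<beta> 0 False\<close> and \<open>\<beta> 0 True\<close> are complementary
  orthogonal idempotents, the images of \<open>x 1 1\<close> to the power \<open>2 * N\<close> and
  of \<open>mu\<close> times the same power of \<open>x 1 2\<close>. Within each component \<beta>
  is a representation of the infinite group by units of that component, with \<open>z^N\<close> and
  \<open>r^n\<close> acting as signs.\<close>

definition suzuki_family ::
  "nat \<Rightarrow> nat \<Rightarrow> 'k::field \<Rightarrow> 'k \<Rightarrow> ('k, 'b, 'z) module_scheme \<Rightarrow> (dih \<Rightarrow> bool \<Rightarrow> 'b) \<Rightarrow> bool" where
  "suzuki_family N n mu lam B \<beta> \<longleftrightarrow>
    (\<forall>g d. \<beta> g d \<in> carrier B) \<and>
    (\<forall>g h d. \<beta> g d \<otimes>\<^bsub>B\<^esub> \<beta> h d = \<beta> (g + h) d) \<and>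
    (\<forall>g h d. \<beta> g d \<otimes>\<^bsub>B\<^esub> \<beta> h (\<not> d) = \<zero>\<^bsub>B\<^esub>) \<and>
    \<beta> 0 False \<oplus>\<^bsub>B\<^esub> \<beta> 0 True = \<one>\<^bsub>B\<^esub> \<and>
    (\<forall>i j e d. \<beta> (Dih (i + int N) j e) d = component_sign mu d \<odot>\<^bsub>B\<^esub> \<beta> (Dih i j e) d) \<and>
    (\<forall>i j e d. \<beta> (Dih i (j + int n) e) d = component_sign lam d \<odot>\<^bsub>B\<^esub> \<beta> (Dih i j e) d)"

definition family_generators :: "(dih \<Rightarrow> bool \<Rightarrow> 'b) \<Rightarrow> nat \<Rightarrow> nat \<Rightarrow> 'b" where
  "family_generators \<beta> i j = \<beta> (if i = 1 then dih_u else dih_v) (i \<noteq> j)"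

text \<open>The empty word is excluded because its value is the unit of \<open>B\<close>, while
  \<open>\<beta> 0 d\<close> is only the unit of one component.\<close>

lemma alternating_family:
  assumes "\<And>g h d. \<beta> g d \<otimes>\<^bsub>B\<^esub> \<beta> h d = \<beta> (g + h) d" "\<And>g d. \<beta> g d \<in> carrier B"
    "\<And>i j. \<lbrakk>i \<in> {1, 2}; j \<in> {1, 2}\<rbrakk> \<Longrightarrow> y i j = family_generators \<beta> i j" "Group.monoid B"
    "i \<in> {1, 2}" "j \<in> {1, 2}"
  shows "alternating B y i j (Suc m) = \<beta> (dih_alt (i = 2) (Suc m)) (i \<noteq> j)"
  using assms(5,6)
proof (induct m arbitrary: i j)
  case 0
  then show ?case
    using monoid.r_one[OF assms(4,2)] assms(3)[OF 0]
    by (auto simp: dih_alt_Suc dih_alt_0 family_generators_def)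
next
  case (Suc m)
  have "3 - i \<in> {1, 2}" "3 - j \<in> {1, 2}" using Suc.prems by auto
  note IH = Suc.hyps[OF this]
  have "alternating B y i j (Suc (Suc m)) = y i j \<otimes>\<^bsub>B\<^esub> alternating B y (3 - i) (3 - j) (Suc m)" by simp
  also have "\<dots> = \<beta> (if i = 1 then dih_u else dih_v) (i \<noteq> j) \<otimes>\<^bsub>B\<^esub> \<beta> (dih_alt (3 - i = 2) (Suc m)) (i \<noteq> j)"
    unfolding IH assms(3)[OF Suc.prems] using Suc.prems by (auto simp: family_generators_def)
  also have "\<dots> = \<beta> (dih_alt (i = 2) (Suc (Suc m))) (i \<noteq> j)"
    unfolding assms(1) dih_alt_Suc[of _ "Suc m"] using Suc.prems by auto
  finally show ?case .
qed

locale suzuki_parameters =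
  fixes N n :: nat and mu lam :: "'k::field"
  assumes N: "N \<ge> 1" and n: "n \<ge> 2" and mu: "mu \<in> {1, -1}" and lam: "lam \<in> {1, -1}"
begin

lemma mu_mu [simp]: "mu * mu = 1" and lam_lam [simp]: "lam * lam = 1"
  using mu lam by auto

lemma component_sign_square [simp]:
  "component_sign mu d * component_sign mu d = 1" "component_sign lam d * component_sign lam d = 1"
  by (auto simp: component_sign_def)

end

locale family = suzuki_parameters N n mu lam + assoc_algebra B
  for N n and mu lam :: "'k::field" and B :: "('k, 'b, 'z) module_scheme" (structure) +
  fixes \<beta> :: "dih \<Rightarrow> bool \<Rightarrow> 'b"
  assumes family: "suzuki_family N n mu lam B \<beta>"
begin

lemma closed [simp]: "\<beta> g d \<in> carrier B"
  and mult [simp]: "\<beta> g d \<otimes> \<beta> h d = \<beta> (g + h) d"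
  and mult_zero: "\<beta> g d \<otimes> \<beta> h (\<not> d) = \<zero>"
  and sum_one: "\<beta> 0 False \<oplus> \<beta> 0 True = \<one>"
  and shift_N: "\<beta> (Dih (i + int N) j e) d = component_sign mu d \<odot> \<beta> (Dih i j e) d"
  and shift_n: "\<beta> (Dih i (j + int n) e) d = component_sign lam d \<odot> \<beta> (Dih i j e) d"
  using family by (auto simp: suzuki_family_def)

lemma mult_zero' [simp]: "d \<noteq> d' \<Longrightarrow> \<beta> g d \<otimes> \<beta> h d' = \<zero>"
  using mult_zero[of g d h] by (cases d; cases d') auto

text \<open>The two alternating words of length \<open>n\<close> differ by the factor
  \<open>r^n\<close>. In this way the relation with \<open>lam\<close> and the relation without it
  become one shift rule, read in the two components.\<close>

lemma dih_alt_n: "\<beta> (dih_alt False n) d = component_sign lam d \<odot> \<beta> (dih_alt True n) d"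
proof -
  have "dih_alt False n = Dih (int (n div 2)) (- int ((n + 1) div 2) + int n) (odd n)"
    by (cases "even n") (auto simp: dih_alt_def elim!: evenE oddE)
  then show ?thesis by (simp only: shift_n) (simp add: dih_alt_def)
qed

text \<open>For \<open>g\<close> equal to \<open>u\<close> or \<open>v\<close> this computes even
  powers of the generators. The exponent starts at 2, since the power 0 is the unit of
  \<open>B\<close> and not that of the component.\<close>

lemma double: "g + g = Dih 1 0 False \<Longrightarrow> \<beta> g d [^] (2 * Suc k) = \<beta> (Dih (int (Suc k)) 0 False) d"
proof (induct k)
  case 0
  then show ?case by (simp add: numeral_2_eq_2)
next
  case (Suc k)
  have "\<beta> g d [^] (2 * Suc (Suc k)) = \<beta> g d [^] (2 * Suc k) \<otimes> (\<beta> g d \<otimes> \<beta> g d)"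
    by (simp add: m_assoc add.assoc)
  also have "\<dots> = \<beta> (Dih (int (Suc k)) 0 False + Dih 1 0 False) d"
    using Suc by (simp only: mult)
  finally show ?case by (simp add: add.commute)
qed

lemma double_N: "g + g = Dih 1 0 False \<Longrightarrow> \<beta> g d [^] (2 * N) = component_sign mu d \<odot> \<beta> 0 d"
  using double[of g d "N - 1"] N shift_N[of 0 0 False d] by (simp add: zero_dih_def)

lemma relations: "suzuki_relations N n mu lam B (family_generators \<beta>)"
proof -
  obtain n' where n': "n = Suc n'" using n by (cases n) auto
  note alt = alternating_family[where \<beta> = \<beta> and y = "family_generators \<beta>", OF mult closed refl monoid_axioms,
      of _ _ n', folded n']
  have uu: "dih_u + dih_u = Dih 1 0 False" "dih_v + dih_v = Dih 1 0 False" by (simp_all add: dih_defs)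
  show ?thesis
    unfolding suzuki_relations_def
  proof (intro conjI ballI impI)
    show "alternating B (family_generators \<beta>) 2 1 n = lam \<odot> alternating B (family_generators \<beta>) 1 2 n"
      by (simp add: alt dih_alt_n smult_smult component_sign_def)
    show "alternating B (family_generators \<beta>) 1 1 n = alternating B (family_generators \<beta>) 2 2 n"
      by (simp add: alt dih_alt_n component_sign_def)
    show "family_generators \<beta> 1 1 [^] (2 * N) \<oplus> mu \<odot> (family_generators \<beta> 1 2 [^] (2 * N)) = \<one>"
      using sum_one
      by (simp add: family_generators_def double_N[OF uu(1)] component_sign_def smult_smult)
  next
    fix i j k l :: nat
    assume *: "i \<in> {1, 2}" "j \<in> {1, 2}" "k \<in> {1, 2}" "l \<in> {1, 2}" "odd (i + j + k + l)"
    then have "(i \<noteq> j) \<noteq> (k \<noteq> l)" by auto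
    then show "family_generators \<beta> i j \<otimes> family_generators \<beta> k l = \<zero>"
      unfolding family_generators_def by (rule mult_zero')
  next
    show "family_generators \<beta> 1 1 [^] (2::nat) = family_generators \<beta> 2 2 [^] (2::nat)"
      "family_generators \<beta> 1 2 [^] (2::nat) = family_generators \<beta> 2 1 [^] (2::nat)"
      using uu by (simp_all add: family_generators_def numeral_2_eq_2)
  qed (simp_all add: family_generators_def)
qed

text \<open>The values on inverses are forced, since \<open>-u = (N - 1) z + u\<close> up to a shift by \<open>N\<close>.\<close>

lemma ext:
  assumes "suzuki_family N n mu lam B \<beta>'"
    and "\<And>d. \<beta>' dih_u d = \<beta> dih_u d" "\<And>d. \<beta>' dih_v d = \<beta> dih_v d"
  shows "\<beta>' = \<beta>"
proof -
  interpret b': family N n mu lam B \<beta>'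
    using assms(1) by unfold_locales
  have uu: "dih_u + dih_u = Dih 1 0 False" "dih_v + dih_v = Dih 1 0 False" by (simp_all add: dih_defs)
  have zero: "\<beta>' 0 d = \<beta> 0 d" for d
    using double_N[OF uu(1), of d] b'.double_N[OF uu(1), of d] assms(2)
    by (metis b'.closed closed component_sign_square(1) smult_one smult_smult)
  have z: "\<beta>' (Dih (int k) 0 False) d = \<beta> (Dih (int k) 0 False) d" for k d
    using double[OF uu(1), of d "k - 1"] b'.double[OF uu(1), of d "k - 1"] assms(2) zero
    by (cases k) (auto simp: zero_dih_def)
  have neg: "\<beta>' (- g) d = \<beta> (- g) d" if "\<beta>' g d = \<beta> g d" "g + g = Dih 1 0 False" for g d
  proof -
    have g: "Dih (int (N - 1)) 0 False + g = Dih (int N) 0 False + - g"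
    proof -
      have "Dih (int N) 0 False = Dih (int (N - 1)) 0 False + (g + g)" using N by (simp add: that(2))
      then show ?thesis by (metis add.assoc add.right_inverse add.right_neutral)
    qed
    obtain i j e where mg: "- g = Dih i j e" by (cases "- g")
    have N': "Dih (int N) 0 False + - g = Dih (i + int N) j e" by (simp add: mg)
    have "component_sign mu d \<odot> \<beta>' (- g) d = \<beta>' (Dih (int (N - 1)) 0 False + g) d"
      unfolding g N' b'.shift_N by (simp add: mg)
    also have "\<dots> = \<beta> (Dih (int (N - 1)) 0 False + g) d"
      using z[of "N - 1" d] that(1) by (metis mult b'.mult)
    also have "\<dots> = component_sign mu d \<odot> \<beta> (- g) d"
      unfolding g N' shift_N by (simp add: mg)
    finally have "component_sign mu d \<odot> (component_sign mu d \<odot> \<beta>' (- g) d) =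
      component_sign mu d \<odot> (component_sign mu d \<odot> \<beta> (- g) d)" by simp
    then show ?thesis by (simp add: smult_smult)
  qed
  have "\<beta>' g d = \<beta> g d" for g d
  proof (induct g rule: dih_induct)
    case zero
    show ?case by (rule \<open>\<beta>' 0 d = \<beta> 0 d\<close>)
  next
    case (step g)
    have add: "\<beta>' (g + h) d = \<beta> (g + h) d" if "\<beta>' h d = \<beta> h d" for h
      using step that by (metis mult b'.mult)
    show ?case
      using add assms(2,3) neg[of dih_u d] neg[of dih_v d] uu
      by (metis add_uminus_conv_diff)
  qed
  then show ?thesis by blast
qed

end

text \<open>The relation with \<open>mu\<close> splits the unit into two idempotents, which are
  orthogonal because mixed products vanish. Adding generators across the components yields two units
  with equal squares, hence a homomorphism from the infinite group; \<beta> is its product with the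
  two idempotents.\<close>

lemma (in suzuki_parameters) family_exists:
  fixes B :: "('k, 'b, 'z) module_scheme" (structure)
  assumes B: "assoc_algebra B" and rel: "suzuki_relations N n mu lam B y"
  obtains \<beta> where "suzuki_family N n mu lam B \<beta>"
    "\<And>i j. \<lbrakk>i \<in> {1, 2}; j \<in> {1, 2}\<rbrakk> \<Longrightarrow> family_generators \<beta> i j = y i j"
proof -
  interpret assoc_algebra B by (rule B)
  define a b c d where "a = y 1 1" and "b = y 2 2" and "c = y 1 2" and "d = y 2 1"
  note defs = a_def b_def c_def d_def
  have closed [simp]: "a \<in> carrier B" "b \<in> carrier B" "c \<in> carrier B" "d \<in> carrier B"
    using rel by (auto simp: suzuki_relations_def defs)
  have zeros: "a \<otimes> c = \<zero>" "a \<otimes> d = \<zero>" "b \<otimes> c = \<zero>" "b \<otimes> d = \<zero>"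
    "c \<otimes> a = \<zero>" "d \<otimes> a = \<zero>" "c \<otimes> b = \<zero>" "d \<otimes> b = \<zero>"
    using rel by (auto simp: suzuki_relations_def defs)
  have aabb: "a \<otimes> a = b \<otimes> b" and ccdd: "c \<otimes> c = d \<otimes> d"
    and alt_1: "alternating B y 2 1 n = lam \<odot> alternating B y 1 2 n"
    and alt_0: "alternating B y 1 1 n = alternating B y 2 2 n"
    and unit: "a [^] (2 * N) \<oplus> mu \<odot> (c [^] (2 * N)) = \<one>"
    using rel closed unfolding suzuki_relations_def defs[symmetric]
    by (simp_all add: numeral_2_eq_2)
  define e0 e1 where "e0 = a [^] (2 * N)" and "e1 = mu \<odot> (c [^] (2 * N))"
  have e_closed [simp]: "e0 \<in> carrier B" "e1 \<in> carrier B" by (simp_all add: e0_def e1_def)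
  obtain M where M: "2 * N = Suc M" using N by (cases "2 * N") auto
  have e0_left: "e0 = a \<otimes> a [^] M" and e1_left: "c [^] (2 * N) = c \<otimes> c [^] M"
    unfolding e0_def M using nat_pow_Suc2 by auto
  have e0_right: "e0 = a [^] M \<otimes> a" and e1_right: "c [^] (2 * N) = c [^] M \<otimes> c"
    unfolding e0_def M by auto
  have left_zero: "x \<otimes> e0 = \<zero>" if "x \<otimes> a = \<zero>" "x \<in> carrier B" for x
    using that by (simp add: e0_left flip: m_assoc)
  have right_zero: "e0 \<otimes> x = \<zero>" if "a \<otimes> x = \<zero>" "x \<in> carrier B" for x
    using that by (simp add: e0_right m_assoc)
  have left_zero1: "x \<otimes> e1 = \<zero>" if "x \<otimes> c = \<zero>" "x \<in> carrier B" for x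
    using that by (simp add: e1_def e1_left smult_mult_right flip: m_assoc)
  have right_zero1: "e1 \<otimes> x = \<zero>" if "c \<otimes> x = \<zero>" "x \<in> carrier B" for x
    using that by (simp add: e1_def e1_right smult_mult_left m_assoc)
  have ez: "a \<otimes> e1 = \<zero>" "b \<otimes> e1 = \<zero>" "e1 \<otimes> a = \<zero>" "e1 \<otimes> b = \<zero>"
    "c \<otimes> e0 = \<zero>" "d \<otimes> e0 = \<zero>" "e0 \<otimes> c = \<zero>" "e0 \<otimes> d = \<zero>"
    using left_zero right_zero left_zero1 right_zero1 zeros by auto
  have sum: "e0 \<oplus> e1 = \<one>" using unit by (simp add: e0_def e1_def)
  have e01: "e0 \<otimes> e1 = \<zero>" "e1 \<otimes> e0 = \<zero>"
    using right_zero[of e1] left_zero[of e1] ez by auto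
  have split: "x = e0 \<otimes> x \<oplus> e1 \<otimes> x" "x = x \<otimes> e0 \<oplus> x \<otimes> e1" if "x \<in> carrier B" for x
    using that sum l_distr[of e0 e1 x] r_distr[of e0 e1 x] by auto
  have id: "e0 \<otimes> a = a" "e0 \<otimes> b = b" "a \<otimes> e0 = a" "b \<otimes> e0 = b"
    "e1 \<otimes> c = c" "e1 \<otimes> d = d" "c \<otimes> e1 = c" "d \<otimes> e1 = d"
    using split[of a] split[of b] split[of c] split[of d] ez by auto
  have idem: "e0 \<otimes> e0 = e0" "e1 \<otimes> e1 = e1"
    using split[of e0] split[of e1] e01 by auto
  \<comment> \<open>A single generator is annihilated by the idempotent of the other component and
    so need not be invertible in \<open>B\<close>. The sums are invertible, and multiplying by
    \<open>e0\<close> or \<open>e1\<close> recovers their summands.\<close>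
  define U V where "U = a \<oplus> c" and "V = b \<oplus> d"
  have UV_closed [simp]: "U \<in> carrier B" "V \<in> carrier B" by (simp_all add: U_def V_def)
  have UU: "U \<otimes> U = a \<otimes> a \<oplus> c \<otimes> c" by (simp add: U_def l_distr r_distr zeros)
  have VV: "V \<otimes> V = b \<otimes> b \<oplus> d \<otimes> d" by (simp add: V_def l_distr r_distr zeros)
  have UUVV: "U \<otimes> U = V \<otimes> V" by (simp add: UU VV aabb ccdd)
  have eU: "e0 \<otimes> U = a" "U \<otimes> e0 = a" "e1 \<otimes> U = c" "U \<otimes> e1 = c"
    "e0 \<otimes> V = b" "V \<otimes> e0 = b" "e1 \<otimes> V = d" "V \<otimes> e1 = d"
    by (simp_all add: U_def V_def r_distr l_distr id ez)
  have Upow: "U [^] Suc k = a [^] Suc k \<oplus> c [^] Suc k" for k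
  proof (induct k)
    case (Suc k)
    have "a [^] Suc k \<otimes> c = \<zero>" "c [^] Suc k \<otimes> a = \<zero>" by (simp_all add: m_assoc zeros)
    then have "(a [^] Suc k \<oplus> c [^] Suc k) \<otimes> (a \<oplus> c) = a [^] Suc k \<otimes> a \<oplus> c [^] Suc k \<otimes> c"
      by (simp add: l_distr r_distr del: nat_pow_Suc)
    then show ?case using Suc unfolding nat_pow_Suc[of _ "Suc k"] by (simp add: U_def del: nat_pow_Suc)
  qed (simp add: U_def)
  define \<sigma> where "\<sigma> m = e0 \<oplus> m \<odot> e1" for m
  have c2N: "c [^] (2 * N) = mu \<odot> e1" by (simp add: e1_def smult_smult)
  have U2N: "U [^] (2 * N) = \<sigma> mu" using Upow[of M] by (simp add: \<sigma>_def M[symmetric] e0_def c2N del: nat_pow_Suc)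
  \<comment> \<open>The power \<open>2 * N\<close> of \<open>U\<close> is 1 on the first component
    and \<open>mu\<close> on the second, so its square is the unit.\<close>
  have "\<sigma> mu \<otimes> \<sigma> mu = \<one>"
    using sum by (simp add: \<sigma>_def l_distr r_distr smult_mult_left smult_mult_right e01 idem smult_smult)
  then have U4N: "U [^] (2 * N + 2 * N) = \<one>" by (simp only: nat_pow_mult[symmetric] UV_closed U2N)
  have "V [^] (2 * N + 2 * N) = (V [^] (2::nat)) [^] (2 * N)" by (simp add: nat_pow_pow mult.commute)
  also have "V [^] (2::nat) = U [^] (2::nat)" by (simp add: numeral_2_eq_2 UUVV)
  also have "(U [^] (2::nat)) [^] (2 * N) = \<one>"
    using U4N by (simp add: nat_pow_pow mult_2)
  finally have V4N: "V [^] (2 * N + 2 * N) = \<one>" .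
  have Units: "x \<in> Units B" if "x [^] (2 * N + 2 * N) = \<one>" "x \<in> carrier B" for x
  proof -
    obtain k where k: "2 * N + 2 * N = Suc k" using N by (cases "2 * N + 2 * N") auto
    have "x [^] k \<otimes> x = \<one>" "x \<otimes> x [^] k = \<one>"
      using that nat_pow_Suc2[OF that(2), of k] by (simp_all add: k)
    then show ?thesis using that(2) by (auto simp: Units_def)
  qed
  interpret G: group "units_of B" by (rule units_group)
  obtain \<gamma> where "\<And>g. \<gamma> g \<in> carrier (units_of B)" "\<And>g h. \<gamma> (g + h) = \<gamma> g \<otimes>\<^bsub>units_of B\<^esub> \<gamma> h"
    "\<gamma> dih_u = U" "\<gamma> dih_v = V" "\<gamma> 0 = \<one>\<^bsub>units_of B\<^esub>"
    by (rule G.dih_hom_exists[of U V]) (use Units U4N V4N UUVV in \<open>auto simp: units_of_def\<close>)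
  then have \<gamma>U: "\<And>g. \<gamma> g \<in> Units B" and \<gamma>_add: "\<And>g h. \<gamma> (g + h) = \<gamma> g \<otimes> \<gamma> h"
    and \<gamma>_u: "\<gamma> dih_u = U" and \<gamma>_v: "\<gamma> dih_v = V" and \<gamma>_0: "\<gamma> 0 = \<one>"
    by (auto simp: units_of_def)
  have \<gamma> [simp]: "\<gamma> g \<in> carrier B" for g using \<gamma>U Units_closed by blast
  define e where "e x = (if x then e1 else e0)" for x
  have e [simp]: "e x \<in> carrier B" and ee: "e x \<otimes> e x = e x" for x by (auto simp: e_def idem)
  have e_\<gamma>: "e x \<otimes> \<gamma> g = \<gamma> g \<otimes> e x" for x g
  proof (induct g rule: dih_induct)
    case zero
    show ?case by (simp add: \<gamma>_0)
  next
    case (step g)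
    have neg: "e x \<otimes> \<gamma> (- h) = \<gamma> (- h) \<otimes> e x" if "e x \<otimes> \<gamma> h = \<gamma> h \<otimes> e x" for h
    proof -
      have inv: "\<gamma> h \<otimes> \<gamma> (- h) = \<one>" "\<gamma> (- h) \<otimes> \<gamma> h = \<one>" by (simp_all add: \<gamma>_0 flip: \<gamma>_add)
      have "e x \<otimes> \<gamma> (- h) = (\<gamma> (- h) \<otimes> \<gamma> h) \<otimes> (e x \<otimes> \<gamma> (- h))" by (simp add: inv)
      also have "\<dots> = \<gamma> (- h) \<otimes> ((\<gamma> h \<otimes> e x) \<otimes> \<gamma> (- h))" by (simp add: m_assoc)
      also have "\<dots> = \<gamma> (- h) \<otimes> (e x \<otimes> (\<gamma> h \<otimes> \<gamma> (- h)))" by (simp add: that[symmetric] m_assoc)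
      finally show ?thesis by (simp add: inv)
    qed
    have add: "e x \<otimes> \<gamma> (g + h) = \<gamma> (g + h) \<otimes> e x" if "e x \<otimes> \<gamma> h = \<gamma> h \<otimes> e x" for h
    proof -
      have "e x \<otimes> \<gamma> (g + h) = (\<gamma> g \<otimes> e x) \<otimes> \<gamma> h" by (simp add: \<gamma>_add step flip: m_assoc)
      also have "\<dots> = \<gamma> (g + h) \<otimes> e x" by (simp add: \<gamma>_add that m_assoc)
      finally show ?thesis .
    qed
    have uv: "e x \<otimes> \<gamma> dih_u = \<gamma> dih_u \<otimes> e x" "e x \<otimes> \<gamma> dih_v = \<gamma> dih_v \<otimes> e x"
      by (auto simp: \<gamma>_u \<gamma>_v e_def eU)
    show ?case
      using add[OF uv(1)] add[OF uv(2)] add[OF neg[OF uv(1)]] add[OF neg[OF uv(2)]] by simp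
  qed
  define \<beta> where "\<beta> g x = e x \<otimes> \<gamma> g" for g x
  have \<beta> [simp]: "\<beta> g x \<in> carrier B" for g x by (simp add: \<beta>_def)
  have mult: "\<beta> g x \<otimes> \<beta> h x = \<beta> (g + h) x" for g h x
  proof -
    have "\<beta> g x \<otimes> \<beta> h x = e x \<otimes> ((\<gamma> g \<otimes> e x) \<otimes> \<gamma> h)" by (simp add: \<beta>_def m_assoc)
    also have "\<dots> = (e x \<otimes> e x) \<otimes> (\<gamma> g \<otimes> \<gamma> h)" by (simp add: e_\<gamma>[symmetric] m_assoc)
    finally show ?thesis by (simp add: ee \<beta>_def \<gamma>_add)
  qed
  have mult0: "\<beta> g x \<otimes> \<beta> h (\<not> x) = \<zero>" for g h x
  proof -
    have "\<beta> g x \<otimes> \<beta> h (\<not> x) = e x \<otimes> ((\<gamma> g \<otimes> e (\<not> x)) \<otimes> \<gamma> h)" by (simp add: \<beta>_def m_assoc)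
    also have "\<dots> = (e x \<otimes> e (\<not> x)) \<otimes> (\<gamma> g \<otimes> \<gamma> h)" by (simp add: e_\<gamma>[symmetric] m_assoc)
    also have "e x \<otimes> e (\<not> x) = \<zero>" by (auto simp: e_def e01)
    finally show ?thesis by simp
  qed
  have gens: "family_generators \<beta> i j = y i j" if "i \<in> {1, 2}" "j \<in> {1, 2}" for i j
    using that by (auto simp: family_generators_def \<beta>_def e_def \<gamma>_u \<gamma>_v eU defs)
  have \<gamma>_z: "\<gamma> (Dih (int k) 0 False) = U [^] (2 * k)" for k
  proof (induct k)
    case 0
    show ?case using \<gamma>_0 by (simp add: zero_dih_def)
  next
    case (Suc k)
    have "Dih (int (Suc k)) 0 False = Dih (int k) 0 False + dih_u + dih_u" by (simp add: dih_defs add.commute)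
    then show ?case using Suc by (simp add: \<gamma>_add \<gamma>_u m_assoc)
  qed
  have shift_N: "\<beta> (Dih (i + int N) j f) x = component_sign mu x \<odot> \<beta> (Dih i j f) x" for i j f x
  proof -
    have "Dih (i + int N) j f = Dih (int N) 0 False + Dih i j f" by simp
    then have "\<beta> (Dih (i + int N) j f) x = (e x \<otimes> \<sigma> mu) \<otimes> \<gamma> (Dih i j f)"
      unfolding \<beta>_def by (simp only: \<gamma>_add \<gamma>_z U2N) (simp add: \<sigma>_def m_assoc)
    also have "e x \<otimes> \<sigma> mu = component_sign mu x \<odot> e x"
      by (auto simp: \<sigma>_def e_def component_sign_def r_distr smult_mult_right e01 idem)
    finally show ?thesis by (simp add: \<beta>_def smult_mult_left)
  qed
  obtain n' where n': "n = Suc n'" using n by (cases n) auto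
  have alt: "alternating B y i j n = \<beta> (dih_alt (i = 2) n) (i \<noteq> j)" if "i \<in> {1, 2}" "j \<in> {1, 2}" for i j
    unfolding n' by (rule alternating_family) (use mult gens that monoid_axioms in auto)
  have alt_n: "\<beta> (dih_alt False n) x = component_sign lam x \<odot> \<beta> (dih_alt True n) x" for x
    using alt_0 alt_1 alt by (cases x) (auto simp: component_sign_def smult_smult)
  \<comment> \<open>\<open>r^n\<close> is the quotient of the two alternating words of length
    \<open>n\<close>, so the relations between these words are the shift rule at the neutral
    element; multiplying by an arbitrary element gives the general case.\<close>
  have "\<beta> (Dih 0 (int n) False) x = component_sign lam x \<odot> \<beta> 0 x" for x
  proof -
    have "Dih 0 (int n) False + dih_alt True n = dih_alt False n"
      by (cases "even n") (auto simp: dih_alt_def elim!: evenE oddE)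
    then have "Dih 0 (int n) False = dih_alt False n + - dih_alt True n"
      by (metis add.right_inverse add.right_neutral add.assoc)
    then have "\<beta> (Dih 0 (int n) False) x = \<beta> (dih_alt False n) x \<otimes> \<beta> (- dih_alt True n) x"
      by (simp only: mult)
    then show ?thesis by (simp only: alt_n smult_mult_left \<beta> mult add.right_inverse)
  qed
  then have shift_n: "\<beta> (Dih i (j + int n) f) x = component_sign lam x \<odot> \<beta> (Dih i j f) x" for i j f x
  proof -
    have "Dih i (j + int n) f = Dih 0 (int n) False + Dih i j f" by simp
    then have "\<beta> (Dih i (j + int n) f) x = \<beta> (Dih 0 (int n) False) x \<otimes> \<beta> (Dih i j f) x"
      by (simp only: mult)
    then show ?thesis
      using \<open>\<beta> (Dih 0 (int n) False) x = component_sign lam x \<odot> \<beta> 0 x\<close>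
      by (simp only: smult_mult_left \<beta> mult add_0_left)
  qed
  have "suzuki_family N n mu lam B \<beta>"
    unfolding suzuki_family_def using mult mult0 shift_N shift_n sum
    by (auto simp: \<beta>_def[of 0] \<gamma>_0 e_def)
  then show thesis using gens by (rule that)
qed

section \<open>A basis of the Suzuki algebra and its dual\<close>

lemma dih_induct_left [case_names zero step]:
  assumes "P 0" "\<And>g. P g \<Longrightarrow> P (dih_u + g) \<and> P (dih_v + g) \<and> P (- dih_u + g) \<and> P (- dih_v + g)"
  shows "P g"
proof -
  have "P (- h)" for h
  proof (induct h rule: dih_induct)
    case zero
    show ?case using assms(1) by simp
  next
    case (step h)
    show ?case using assms(2)[OF step] by (simp add: minus_add diff_conv_add_uminus del: add_uminus_conv_diff)
  qed
  from this[of "- g"] show ?thesis by simp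
qed

lemma algebra_map_family:
  assumes "algebra_map A B h" "suzuki_family N n mu lam A \<beta>"
  shows "suzuki_family N n mu lam B (\<lambda>g d. h (\<beta> g d))"
proof -
  interpret algebra_map A B h by fact
  show ?thesis
    using assms(2) unfolding suzuki_family_def
    by (auto simp flip: mult add smult one zero)
qed

section \<open>The spanning family of the Suzuki algebra\<close>

context suzuki_parameters
begin

abbreviation "A \<equiv> suzuki_algebra N n mu lam"
abbreviation "gen \<equiv> suzuki_x N n mu lam"

text \<open>The choice is harmless: by \<open>ext\<close> a family is determined by its values at
  \<open>dih_u\<close> and \<open>dih_v\<close>, which here are the generators.\<close>

definition elt :: "dih \<Rightarrow> bool \<Rightarrow> ((nat \<times> nat) list \<Rightarrow>\<^sub>0 'k) set" where
  "elt = (SOME \<beta>. suzuki_family N n mu lam A \<beta> \<and>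
    (\<forall>i\<in>{1,2}. \<forall>j\<in>{1,2}. family_generators \<beta> i j = gen i j))"

lemma elt_spec: "suzuki_family N n mu lam A elt \<and> (\<forall>i\<in>{1,2}. \<forall>j\<in>{1,2}. family_generators elt i j = gen i j)"
proof -
  obtain \<beta> where "suzuki_family N n mu lam A \<beta>"
    "\<And>i j. \<lbrakk>i \<in> {1, 2}; j \<in> {1, 2}\<rbrakk> \<Longrightarrow> family_generators \<beta> i j = gen i j"
    using family_exists[OF assoc_algebra_suzuki_algebra suzuki_x_relations] by metis
  then have "\<exists>\<beta>. suzuki_family N n mu lam A \<beta> \<and>
      (\<forall>i\<in>{1,2}. \<forall>j\<in>{1,2}. family_generators \<beta> i j = gen i j)"
    by (intro exI[of _ \<beta>] conjI ballI)
  then show ?thesis unfolding elt_def by (rule someI_ex)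
qed

sublocale A: family N n mu lam A elt
  using elt_spec assoc_algebra_suzuki_algebra
  by (intro family.intro family_axioms.intro suzuki_parameters_axioms) auto

lemma gen_eq: "\<lbrakk>i \<in> {1, 2}; j \<in> {1, 2}\<rbrakk> \<Longrightarrow> gen i j = elt (if i = 1 then dih_u else dih_v) (i \<noteq> j)"
  using elt_spec by (metis family_generators_def)

lemma gen_simps: "gen (Suc 0) (Suc 0) = elt dih_u False" "gen (Suc 0) 2 = elt dih_u True"
  "gen 2 (Suc 0) = elt dih_v True" "gen 2 2 = elt dih_v False"
  using gen_eq by auto

lemma span_induct [consumes 1, case_names add smult elt]:
  assumes a: "a \<in> carrier A"
    and add: "\<And>a a'. \<lbrakk>a \<in> carrier A; a' \<in> carrier A; P a; P a'\<rbrakk> \<Longrightarrow> P (a \<oplus>\<^bsub>A\<^esub> a')"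
    and smult: "\<And>c a. \<lbrakk>a \<in> carrier A; P a\<rbrakk> \<Longrightarrow> P (c \<odot>\<^bsub>A\<^esub> a)"
    and elt: "\<And>g d. P (elt g d)"
  shows "P a"
proof -
  have zero: "P \<zero>\<^bsub>A\<^esub>" using smult[OF A.closed elt, of 0 0 False] by simp
  \<comment> \<open>The induction multiplies by generators from the left, so the claim for all
    products \<open>elt h d\<close> times \<open>a\<close> has to be carried along: a generator
    merges with \<open>elt h d\<close> into another member of the family or gives zero.\<close>
  have "P a \<and> (\<forall>h d. P (elt h d \<otimes>\<^bsub>A\<^esub> a))"
    using a
  proof (induct a rule: suzuki_algebra_induct)
    case (add a a')
    then show ?case using assms(2) by (simp add: A.r_distr)
  next
    case (smult c a)
    then show ?case using assms(3) by (simp add: A.smult_mult_right)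
  next
    case one
    have "P \<one>\<^bsub>A\<^esub>" using assms(2)[OF A.closed A.closed elt elt, of 0 False 0 True] by (simp add: A.sum_one)
    then show ?case using elt by simp
  next
    case (mult i j a)
    have "P (elt h d \<otimes>\<^bsub>A\<^esub> (gen i j \<otimes>\<^bsub>A\<^esub> a))" for h d
    proof -
      let ?u = "if i = 1 then dih_u else dih_v"
      have "elt h d \<otimes>\<^bsub>A\<^esub> (gen i j \<otimes>\<^bsub>A\<^esub> a) = (elt h d \<otimes>\<^bsub>A\<^esub> elt ?u (i \<noteq> j)) \<otimes>\<^bsub>A\<^esub> a"
        using mult by (simp add: gen_eq A.m_assoc)
      then show ?thesis
        using mult zero by (cases "d = (i \<noteq> j)") auto
    qed
    then show ?case using mult by (auto simp: gen_eq)
  qed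
  then show ?thesis by simp
qed

section \<open>Functionals as functions that are periodic up to signs\<close>

definition quasi_periodic :: "(dih \<Rightarrow> bool \<Rightarrow> 'k) \<Rightarrow> bool" where
  "quasi_periodic F \<longleftrightarrow> (\<forall>g d. F (Dih (int N) 0 False + g) d = component_sign mu d * F g d \<and>
    F (Dih 0 (int n) False + g) d = component_sign lam d * F g d)"

lemma dih_shift_commute:
  "h + (Dih i 0 False + g) = Dih i 0 False + (h + g)"
  "h + (Dih 0 j False + g) = Dih 0 (case h of Dih _ _ e \<Rightarrow> if e then - j else j) False + (h + g)"
  by (cases h; cases g; auto)+

text \<open>The signs are their own inverses, so shifts in the opposite direction produce the same
  sign. This is needed because \<open>r^n\<close> is inverted when it is moved past
  \<open>u\<close>.\<close>

lemma quasi_periodic_minus: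
  assumes "quasi_periodic F"
  shows "F (Dih (- int N) 0 False + g) d = component_sign mu d * F g d"
    "F (Dih 0 (- int n) False + g) d = component_sign lam d * F g d"
proof -
  have "F g d = component_sign mu d * F (Dih (- int N) 0 False + g) d"
    "F g d = component_sign lam d * F (Dih 0 (- int n) False + g) d"
    using assms[unfolded quasi_periodic_def, rule_format, of "Dih (- int N) 0 False + g" d]
      assms[unfolded quasi_periodic_def, rule_format, of "Dih 0 (- int n) False + g" d]
    by (auto simp: zero_dih_def[symmetric] simp flip: add.assoc)
  then show "F (Dih (- int N) 0 False + g) d = component_sign mu d * F g d"
    "F (Dih 0 (- int n) False + g) d = component_sign lam d * F g d"
    by (metis component_sign_square mult.assoc mult_1)+
qed

text \<open>The predicate \<open>Q\<close> records the components in which a word survives: the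
  empty word keeps both, a word in letters of one component keeps that one, and a mixed word keeps
  none.\<close>

lemma quasi_periodic_translate:
  assumes "quasi_periodic F"
  shows "quasi_periodic (\<lambda>g d. if Q d then F (h + g) d else 0)"
    and "quasi_periodic (\<lambda>g d. if Q d then F (g + h) d else 0)"
  using assms quasi_periodic_minus[OF assms] unfolding quasi_periodic_def
  by (auto simp: dih_shift_commute add.assoc split: dih.splits)

text \<open>The converse is \<open>coord_elt\<close>; together they identify functionals with
  quasi-periodic functions without any choice of representatives.\<close>

lemma quasi_periodic_functional:
  assumes "linear_functional A f"
  shows "quasi_periodic (\<lambda>g d. f (elt g d))"
proof -
  have "f (elt (Dih (int N) 0 False + g) d) = component_sign mu d * f (elt g d)"
    "f (elt (Dih 0 (int n) False + g) d) = component_sign lam d * f (elt g d)" for g d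
    using A.shift_N[of "case g of Dih i j e \<Rightarrow> i" "case g of Dih i j e \<Rightarrow> j" "case g of Dih i j e \<Rightarrow> e" d]
      A.shift_n[of "case g of Dih i j e \<Rightarrow> i" "case g of Dih i j e \<Rightarrow> j" "case g of Dih i j e \<Rightarrow> e" d]
      assms A.closed
    by (cases g, simp add: linear_functional_def add.commute)+
  then show ?thesis by (simp add: quasi_periodic_def)
qed

definition word_dih :: "(nat \<times> nat) list \<Rightarrow> dih" where
  "word_dih w = foldr (\<lambda>p g. (if fst p = 1 then dih_u else dih_v) + g) w 0"

text \<open>A sum of two cases and not a case distinction, because the empty word lies in both
  components: the unit is \<open>elt 0 False\<close> plus \<open>elt 0 True\<close>. Mixed words get
  the value 0.\<close>

definition word_functional :: "(dih \<Rightarrow> bool \<Rightarrow> 'k) \<Rightarrow> (nat \<times> nat) list \<Rightarrow> 'k" where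
  "word_functional F w =
    (if \<forall>p\<in>set w. fst p = snd p then F (word_dih w) False else 0) +
    (if \<forall>p\<in>set w. fst p \<noteq> snd p then F (word_dih w) True else 0)"

lemma word_dih_append: "word_dih (w @ w') = word_dih w + word_dih w'"
  by (induct w) (simp_all add: word_dih_def add.assoc)

lemma word_functional_append:
  "word_functional F (w @ w') =
    word_functional (\<lambda>g d. if \<forall>p\<in>set w. (fst p \<noteq> snd p) = d then F (word_dih w + g) d else 0) w'"
  "word_functional F (w @ w') =
    word_functional (\<lambda>g d. if \<forall>p\<in>set w'. (fst p \<noteq> snd p) = d then F (g + word_dih w') d else 0) w"
  by (simp_all add: word_functional_def word_dih_append ball_Un)

lemma free_generator_pow:
  assumes "p \<in> G"
  shows "free_generator p [^]\<^bsub>(free_algebra G :: ('k, _) module)\<^esub> k = Poly_Mapping.single (replicate k p) 1"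
proof (induct k)
  case 0
  then show ?case by (simp add: free_algebra_def one_monoid_algebra free_monoid_simps)
next
  case (Suc k)
  then show ?case
    by (simp add: free_algebra_def free_generator_def monoid_algebra_mult_single free_monoid_simps
        replicate_append_same)
qed

lemma free_alternating:
  assumes "i \<in> {1, 2}" "j \<in> {1, 2}"
  obtains w where
    "alternating (free_algebra suzuki_generators :: ('k, _) module) (\<lambda>i j. free_generator (i, j)) i j (Suc m) =
      Poly_Mapping.single w 1" "w \<in> lists suzuki_generators" "w \<noteq> []"
    "\<forall>p\<in>set w. (fst p \<noteq> snd p) = (i \<noteq> j)" "word_dih w = dih_alt (i = 2) (Suc m)"
  using assms
proof (induct m arbitrary: i j thesis)
  case 0
  show ?case
    by (rule 0(1)[of "[(i, j)]"])
      (use 0(2,3) in \<open>auto simp: free_algebra_def free_generator_def monoid_algebra_mult_single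
        free_monoid_simps one_monoid_algebra word_dih_def dih_alt_Suc dih_alt_0 suzuki_generators_mem\<close>)
next
  case (Suc m)
  have flip: "3 - i \<in> {1, 2}" "3 - j \<in> {1, 2}" using Suc.prems by auto
  obtain w where w:
    "alternating (free_algebra suzuki_generators :: ('k, _) module) (\<lambda>i j. free_generator (i, j)) (3 - i) (3 - j) (Suc m) =
      Poly_Mapping.single w 1" "w \<in> lists suzuki_generators" "w \<noteq> []"
    "\<forall>p\<in>set w. (fst p \<noteq> snd p) = (3 - i \<noteq> 3 - j)" "word_dih w = dih_alt (3 - i = 2) (Suc m)"
    by (rule Suc.hyps[OF _ flip])
  have types: "(3 - i \<noteq> 3 - j) = (i \<noteq> j)" "(3 - i = 2) = (i \<noteq> 2)" using Suc.prems(2,3) by auto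
  show ?case
  proof (rule Suc.prems(1)[of "(i, j) # w"])
    show "alternating (free_algebra suzuki_generators :: ('k, _) module) (\<lambda>i j. free_generator (i, j)) i j (Suc (Suc m)) =
      Poly_Mapping.single ((i, j) # w) 1"
      unfolding alternating.simps(2)[of _ _ _ _ "Suc m"] w(1)
      by (simp add: free_algebra_def free_generator_def monoid_algebra_mult_single free_monoid_simps)
    show "word_dih ((i, j) # w) = dih_alt (i = 2) (Suc (Suc m))"
      using w(5) Suc.prems(2) unfolding dih_alt_Suc[of _ "Suc m"] types by (auto simp: word_dih_def)
  qed (use w types Suc.prems(2,3) in \<open>auto simp: suzuki_generators_mem\<close>)
qed

text \<open>Squares agree because \<open>u u = v v\<close>, the relations of length \<open>n\<close>
  are the shift by \<open>r^n\<close>, and the last relation uses the shift by \<open>z^N\<close>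
  with \<open>mu * mu = 1\<close>. A mixed product is a word that lies in neither component.\<close>

lemma word_functional_relator:
  assumes F: "quasi_periodic F" and s: "s \<in> suzuki_relators N n mu lam"
  shows "linear_extension ground_algebra (word_functional F) s = 0"
proof -
  let ?F = "free_algebra suzuki_generators :: ('k, _) module"
  interpret F: assoc_algebra ?F by (rule assoc_algebra_free)
  have minus: "f \<ominus>\<^bsub>?F\<^esub> g = f - g" if "f \<in> carrier ?F" "g \<in> carrier ?F" for f g
    using monoid.monoid_algebra_minus[OF monoid_free_monoid] that by (simp add: free_algebra_def)
  have single [simp]: "Poly_Mapping.single w c \<in> carrier ?F" if "w \<in> lists suzuki_generators" for w c
    using that by (simp add: free_algebra_def carrier_monoid_algebra free_monoid_simps)
  have ops: "f \<oplus>\<^bsub>?F\<^esub> g = f + g" "c \<odot>\<^bsub>?F\<^esub> Poly_Mapping.single w 1 = Poly_Mapping.single w c"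
    "\<one>\<^bsub>?F\<^esub> = Poly_Mapping.single [] 1"
    "Poly_Mapping.single w 1 \<otimes>\<^bsub>?F\<^esub> Poly_Mapping.single w' 1 = Poly_Mapping.single (w @ w') 1" for f g c w w'
    by (simp_all add: free_algebra_def add_monoid_algebra smult_monoid_algebra map_times_single
        one_monoid_algebra free_monoid_simps monoid_algebra_mult_single)
  have gens: "(1, 1) \<in> suzuki_generators" "(1, 2) \<in> suzuki_generators" "(2, 1) \<in> suzuki_generators"
    "(2, 2) \<in> suzuki_generators" by (simp_all add: suzuki_generators_mem)
  note pow = gens[THEN free_generator_pow]
  have rep: "replicate k p \<in> lists suzuki_generators" if "p \<in> suzuki_generators" for k p
    using that by (induct k) auto
  have wd: "word_dih (replicate (2 * k) p) = Dih (int k) 0 False" for k p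
    by (induct k) (simp_all add: word_dih_def dih_defs)
  have wf: "word_functional F (replicate (2 * Suc k) p) = F (Dih (int (Suc k)) 0 False) (fst p \<noteq> snd p)" for k p
    unfolding word_functional_def wd by simp
  have wf2: "word_functional F (replicate 2 p) = F (Dih 1 0 False) (fst p \<noteq> snd p)" for p
    using wf[of 0 p] by simp
  have wfN: "word_functional F (replicate (2 * N) p) = component_sign mu (fst p \<noteq> snd p) * F 0 (fst p \<noteq> snd p)" for p
    using wf[of "N - 1" p] N F[unfolded quasi_periodic_def, rule_format, of 0] by simp
  obtain n' where n': "n = Suc n'" using n by (cases n) auto
  have 12: "1 \<in> {1, 2::nat}" "2 \<in> {1, 2::nat}" by simp_all
  have alt: "\<exists>w. alternating ?F (\<lambda>i j. free_generator (i, j)) i j n = Poly_Mapping.single w 1 \<and>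
      w \<in> lists suzuki_generators \<and> word_functional F w = F (dih_alt (i = 2) n) (i \<noteq> j)"
    if ij: "i \<in> {1, 2}" "j \<in> {1, 2}" for i j :: nat
  proof -
    obtain w where w: "alternating ?F (\<lambda>i j. free_generator (i, j)) i j n = Poly_Mapping.single w 1"
      "w \<in> lists suzuki_generators" "w \<noteq> []" "\<forall>p\<in>set w. (fst p \<noteq> snd p) = (i \<noteq> j)"
      "word_dih w = dih_alt (i = 2) n"
      unfolding n' by (rule free_alternating[OF ij])
    obtain p where "p \<in> set w" using w(3) by (cases w) auto
    then have "(\<forall>p\<in>set w. fst p = snd p) = (i = j)" "(\<forall>p\<in>set w. fst p \<noteq> snd p) = (i \<noteq> j)"
      using w(4) by blast+
    then have "word_functional F w = F (dih_alt (i = 2) n) (i \<noteq> j)"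
      unfolding word_functional_def w(5) by simp
    then show ?thesis using w by blast
  qed
  obtain w11 w12 w21 w22 where w:
    "alternating ?F (\<lambda>i j. free_generator (i, j)) 1 1 n = Poly_Mapping.single w11 1"
    "w11 \<in> lists suzuki_generators" "word_functional F w11 = F (dih_alt False n) False"
    "alternating ?F (\<lambda>i j. free_generator (i, j)) 1 2 n = Poly_Mapping.single w12 1"
    "w12 \<in> lists suzuki_generators" "word_functional F w12 = F (dih_alt False n) True"
    "alternating ?F (\<lambda>i j. free_generator (i, j)) 2 1 n = Poly_Mapping.single w21 1"
    "w21 \<in> lists suzuki_generators" "word_functional F w21 = F (dih_alt True n) True"
    "alternating ?F (\<lambda>i j. free_generator (i, j)) 2 2 n = Poly_Mapping.single w22 1"
    "w22 \<in> lists suzuki_generators" "word_functional F w22 = F (dih_alt True n) False"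
    using alt[OF 12(1) 12(1)] alt[OF 12(1) 12(2)] alt[OF 12(2) 12(1)] alt[OF 12(2) 12(2)] by auto
  have alt_n: "F (dih_alt False n) d = component_sign lam d * F (dih_alt True n) d" for d
  proof -
    have "Dih 0 (int n) False + dih_alt True n = dih_alt False n"
      by (cases "even n") (auto simp: dih_alt_def elim!: evenE oddE)
    then show ?thesis using F[unfolded quasi_periodic_def] by metis
  qed
  from s consider
      "s = free_generator (1, 1) [^]\<^bsub>?F\<^esub> (2::nat) \<ominus>\<^bsub>?F\<^esub> free_generator (2, 2) [^]\<^bsub>?F\<^esub> (2::nat)"
    | "s = free_generator (1, 2) [^]\<^bsub>?F\<^esub> (2::nat) \<ominus>\<^bsub>?F\<^esub> free_generator (2, 1) [^]\<^bsub>?F\<^esub> (2::nat)"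
    | "s = alternating ?F (\<lambda>i j. free_generator (i, j)) 2 1 n \<ominus>\<^bsub>?F\<^esub>
        lam \<odot>\<^bsub>?F\<^esub> alternating ?F (\<lambda>i j. free_generator (i, j)) 1 2 n"
    | "s = alternating ?F (\<lambda>i j. free_generator (i, j)) 1 1 n \<ominus>\<^bsub>?F\<^esub>
        alternating ?F (\<lambda>i j. free_generator (i, j)) 2 2 n"
    | "s = (free_generator (1, 1) [^]\<^bsub>?F\<^esub> (2 * N) \<oplus>\<^bsub>?F\<^esub>
        mu \<odot>\<^bsub>?F\<^esub> (free_generator (1, 2) [^]\<^bsub>?F\<^esub> (2 * N))) \<ominus>\<^bsub>?F\<^esub> \<one>\<^bsub>?F\<^esub>"
    | i j k l where "s = free_generator (i, j) \<otimes>\<^bsub>?F\<^esub> free_generator (k, l)"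
        "i \<in> {1, 2}" "j \<in> {1, 2}" "k \<in> {1, 2}" "l \<in> {1, 2}" "odd (i + j + k + l)"
    unfolding suzuki_relators_def Let_def by blast
  then show ?thesis
  proof cases
    case 6
    have "s = Poly_Mapping.single [(i, j), (k, l)] 1"
      unfolding 6(1) using ops(4)[of "[(i, j)]" "[(k, l)]"] by (simp add: free_generator_def)
    moreover have "(i \<noteq> j) \<noteq> (k \<noteq> l)" using 6(2-) by auto
    ultimately show ?thesis by (auto simp: linear_extension_ground word_functional_def)
  qed (simp_all del: One_nat_def add: pow w ops minus rep gens linear_extension_ground wf2 wfN alt_n
      F.a_closed[unfolded ops] component_sign_def, auto simp: word_functional_def word_dih_def)
qed

text \<open>The functional with prescribed values \<open>F\<close> on the family. Its existence for
  every quasi-periodic \<open>F\<close> is what makes the spanning family linearly independent up to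
  the shift rules.\<close>

definition coord :: "(dih \<Rightarrow> bool \<Rightarrow> 'k) \<Rightarrow> ((nat \<times> nat) list \<Rightarrow>\<^sub>0 'k) set \<Rightarrow> 'k" where
  "coord F = induced_map A (linear_extension ground_algebra (word_functional F))"

lemma monoid_algebra_quotient_A:
  "monoid_algebra_quotient (free_monoid suzuki_generators) (suzuki_relators N n mu lam)"
  using suzuki_relators_closed[of N n mu lam] monoid_free_monoid
  by (intro monoid_algebra_quotient.intro monoid_algebra_quotient_axioms.intro) (auto simp: free_algebra_def)

lemma coord:
  assumes F: "quasi_periodic F"
  shows linear_functional_coord: "linear_functional A (coord F)"
    and coord_cls: "w \<in> lists suzuki_generators \<Longrightarrow>
      coord F ((Idl\<^bsub>free_algebra suzuki_generators\<^esub> suzuki_relators N n mu lam) +>\<^bsub>free_algebra suzuki_generators\<^esub>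
        Poly_Mapping.single w 1) = word_functional F w"
proof -
  interpret Q: monoid_algebra_quotient "free_monoid suzuki_generators" "suzuki_relators N n mu lam"
    by (rule monoid_algebra_quotient_A)
  define \<F> where "\<F> = word_functional ` {F. quasi_periodic F}"
  have mem: "word_functional F \<in> \<F>" using F by (auto simp: \<F>_def)
  have left: "\<exists>f'\<in>\<F>. \<forall>q\<in>carrier (free_monoid suzuki_generators). f (p \<otimes>\<^bsub>free_monoid suzuki_generators\<^esub> q) = f' q"
    if f: "f \<in> \<F>" for f p
  proof -
    obtain F where "quasi_periodic F" "f = word_functional F" using f by (auto simp: \<F>_def)
    note F = this
    define F' where "F' = (\<lambda>g d. if \<forall>r\<in>set p. (fst r \<noteq> snd r) = d then F (word_dih p + g) d else 0)"
    have "quasi_periodic F'"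
      unfolding F'_def by (rule quasi_periodic_translate(1)[OF F(1)])
    moreover have "f (p @ q) = word_functional F' q" for q
      unfolding F F'_def by (rule word_functional_append(1))
    ultimately show ?thesis unfolding \<F>_def free_monoid_simps by blast
  qed
  have right: "\<exists>f'\<in>\<F>. \<forall>q\<in>carrier (free_monoid suzuki_generators). f (q \<otimes>\<^bsub>free_monoid suzuki_generators\<^esub> p) = f' q"
    if f: "f \<in> \<F>" for f p
  proof -
    obtain F where "quasi_periodic F" "f = word_functional F" using f by (auto simp: \<F>_def)
    note F = this
    define F' where "F' = (\<lambda>g d. if \<forall>r\<in>set p. (fst r \<noteq> snd r) = d then F (g + word_dih p) d else 0)"
    have "quasi_periodic F'"
      unfolding F'_def by (rule quasi_periodic_translate(2)[OF F(1)])
    moreover have "f (q @ p) = word_functional F' q" for q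
      unfolding F F'_def by (rule word_functional_append(2))
    ultimately show ?thesis unfolding \<F>_def free_monoid_simps by blast
  qed
  have rel: "linear_extension ground_algebra f s = 0" if "f \<in> \<F>" "s \<in> suzuki_relators N n mu lam" for f s
    using that word_functional_relator by (auto simp: \<F>_def)
  have A: "quotient_algebra (monoid_algebra (free_monoid suzuki_generators)) (suzuki_relators N n mu lam) = A"
    by (simp add: suzuki_algebra_def presented_algebra_def free_algebra_def)
  show "linear_functional A (coord F)"
    unfolding coord_def A[symmetric]
    by (rule Q.induced_functional(1)[of _ \<F>]) (fact mem | erule left | erule right | erule (1) rel)+
  show "coord F ((Idl\<^bsub>free_algebra suzuki_generators\<^esub> suzuki_relators N n mu lam) +>\<^bsub>free_algebra suzuki_generators\<^esub>
        Poly_Mapping.single w 1) = word_functional F w" if w: "w \<in> lists suzuki_generators"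
  proof -
    have "Poly_Mapping.single w 1 \<in> carrier (monoid_algebra (free_monoid suzuki_generators) :: ('k, _) module)"
      using w by (simp add: carrier_monoid_algebra free_monoid_simps)
    then have "coord F (Q.cls (Poly_Mapping.single w 1)) =
        linear_extension ground_algebra (word_functional F) (Poly_Mapping.single w 1)"
      unfolding coord_def A[symmetric]
      by (rule Q.induced_functional(2)[of _ \<F>, rotated -1]) (fact mem | erule left | erule right | erule (1) rel)+
    then show ?thesis by (simp add: free_algebra_def linear_extension_ground)
  qed
qed

lemma coord_add: "\<lbrakk>quasi_periodic F; a \<in> carrier A; a' \<in> carrier A\<rbrakk> \<Longrightarrow> coord F (a \<oplus>\<^bsub>A\<^esub> a') = coord F a + coord F a'"
  and coord_smult: "\<lbrakk>quasi_periodic F; a \<in> carrier A\<rbrakk> \<Longrightarrow> coord F (c \<odot>\<^bsub>A\<^esub> a) = c * coord F a"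
  using linear_functional_coord by (auto simp: linear_functional_def)

lemma gen_closed [simp]: "\<lbrakk>i \<in> {1, 2}; j \<in> {1, 2}\<rbrakk> \<Longrightarrow> gen i j \<in> carrier A"
  by (simp add: gen_eq)

lemma coord_gen_mult:
  assumes F: "quasi_periodic F" and a: "a \<in> carrier A" and ij: "i \<in> {1, 2}" "j \<in> {1, 2}"
  shows "coord F (gen i j \<otimes>\<^bsub>A\<^esub> a) =
    coord (\<lambda>g d. if (i \<noteq> j) = d then F ((if i = 1 then dih_u else dih_v) + g) d else 0) a"
proof -
  define F' where "F' = (\<lambda>g d. if (i \<noteq> j) = d then F ((if i = 1 then dih_u else dih_v) + g) d else 0)"
  have F': "quasi_periodic F'" unfolding F'_def by (rule quasi_periodic_translate(1)[OF F])
  have x: "gen i j \<in> carrier A" using ij by simp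
  have "coord F (gen i j \<otimes>\<^bsub>A\<^esub> a) = coord F' a"
    using a
  proof (induct a rule: suzuki_word_induct)
    case (add a a')
    then show ?case using x F F' by (simp add: A.r_distr coord_add)
  next
    case (smult c a)
    then show ?case using x F F' by (simp add: A.smult_mult_right coord_smult)
  next
    case (word w)
    have p: "(i, j) \<in> suzuki_generators" using ij by (simp add: suzuki_generators_mem)
    have "word_functional F ([(i, j)] @ w) = word_functional F' w"
    proof -
      have "word_dih [(i, j)] = (if i = 1 then dih_u else dih_v)" by (simp add: word_dih_def)
      then show ?thesis unfolding word_functional_append(1) F'_def by (simp only:) simp
    qed
    then show ?case
      using coord_cls[OF F, of "(i, j) # w"] coord_cls[OF F' word] p word by (simp add: suzuki_word_Cons)
  qed
  then show ?thesis by (simp add: F'_def)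
qed

lemma coord_one: "quasi_periodic F \<Longrightarrow> coord F \<one>\<^bsub>A\<^esub> = F 0 False + F 0 True"
  using coord_cls[of F "[]"] by (simp add: suzuki_word_Nil word_functional_def word_dih_def)

lemma elt_shift:
  "elt (Dih (int N) 0 False + g) d = component_sign mu d \<odot>\<^bsub>A\<^esub> elt g d"
  "elt (Dih 0 (int n) False + g) d = component_sign lam d \<odot>\<^bsub>A\<^esub> elt g d"
  using A.shift_N A.shift_n by (cases g, simp add: add.commute)+

text \<open>The functional is defined on words, which only reach products of \<open>u\<close> and
  \<open>v\<close>. Inverses are obtained from \<open>h^-1 = z^-N z^(N-1) h\<close> for
  \<open>h\<close> equal to \<open>u\<close> or \<open>v\<close>, where \<open>h h = z\<close> and
  the shift by \<open>N\<close> is already understood.\<close>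

lemma coord_elt [simp]:
  assumes "quasi_periodic F"
  shows "coord F (elt g d) = F g d"
proof -
  let ?P = "\<lambda>g. \<forall>F. quasi_periodic F \<longrightarrow> coord F (elt g d) = F g d"
  have letter: "\<exists>i\<in>{1, 2}. \<exists>j\<in>{1, 2}. gen i j = elt h d \<and> (i \<noteq> j) = d \<and> (if i = 1 then dih_u else dih_v) = h"
    if "h \<in> {dih_u, dih_v}" for h
    using that by (cases d) (auto simp: gen_simps)
  have mult: "coord F (elt h d \<otimes>\<^bsub>A\<^esub> a) = coord (\<lambda>g d'. if d = d' then F (h + g) d' else 0) a"
    if h: "h \<in> {dih_u, dih_v}" and "quasi_periodic F" "a \<in> carrier A" for h F a
  proof -
    obtain i j where ij: "i \<in> {1, 2}" "j \<in> {1, 2}" "gen i j = elt h d" "(i \<noteq> j) = d"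
      "(if i = 1 then dih_u else dih_v) = h" using letter[OF h] by blast
    show ?thesis using coord_gen_mult[OF that(2,3) ij(1,2)] unfolding ij(3-5) .
  qed
  have add: "?P (h + g)" if P: "?P g" and h: "h \<in> {dih_u, dih_v}" for h g
  proof (intro allI impI)
    fix F assume F: "quasi_periodic F"
    show "coord F (elt (h + g) d) = F (h + g) d"
      using mult[OF h F A.closed[of g d]] P quasi_periodic_translate(1)[OF F, of "\<lambda>d'. d = d'" h] by simp
  qed
  have z: "?P (Dih (int k) 0 False + g)" if "?P g" for g k
  proof (induct k)
    case 0
    then show ?case using that by (simp flip: zero_dih_def)
  next
    case (Suc k)
    have "Dih (int (Suc k)) 0 False + g = dih_u + (dih_u + (Dih (int k) 0 False + g))"
      by (cases g) (simp add: dih_defs)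
    then show ?case using add[OF add[OF Suc]] by simp
  qed
  have cancel: "?P g" if "?P (Dih (int N) 0 False + g)" for g
  proof (intro allI impI)
    fix F assume F: "quasi_periodic F"
    have "component_sign mu d * coord F (elt g d) = component_sign mu d * F g d"
      using that F F[unfolded quasi_periodic_def, rule_format, of g d]
      by (metis A.closed coord_smult elt_shift(1))
    then show "coord F (elt g d) = F g d"
      by (metis component_sign_square(1) mult.assoc mult_1)
  qed
  have neg: "?P (- h + g)" if "?P g" "h \<in> {dih_u, dih_v}" for h g
  proof (rule cancel)
    have "Dih (int N) 0 False + (- h + g) = Dih (int (N - 1)) 0 False + (h + g)"
      using N that(2) by (cases g) (auto simp: dih_defs)
    then show "?P (Dih (int N) 0 False + (- h + g))" using z[OF add[OF that]] by simp
  qed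
  \<comment> \<open>The induction cannot start at the neutral element, since the unit of the algebra
    mixes both components. Multiplying the unit by a letter isolates one component, and the neutral
    element is then reached as \<open>- u + u\<close>.\<close>
  have u: "?P dih_u"
  proof (intro allI impI)
    fix F assume F: "quasi_periodic F"
    show "coord F (elt dih_u d) = F dih_u d"
      using mult[of dih_u F "\<one>\<^bsub>A\<^esub>"] F coord_one[OF quasi_periodic_translate(1)[OF F, of "\<lambda>d'. d = d'" dih_u]]
      by (cases d) auto
  qed
  have "?P g"
  proof (induct g rule: dih_induct_left)
    case zero
    show ?case using neg[OF u, of dih_u] by simp
  next
    case (step g)
    show ?case using add[OF step] neg[OF step] by blast
  qed
  then show ?thesis using assms by simp
qed

text \<open>Every functional is determined by its values on the family; composites such as a tensor
  functional after the comultiplication are identified in this way.\<close>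

lemma functional_eq_coord:
  assumes f: "linear_functional A f" and a: "a \<in> carrier A"
  shows "f a = coord (\<lambda>g d. f (elt g d)) a"
  using a
proof (induct a rule: span_induct)
  case (add a a')
  then show ?case using f by (simp add: coord_add[OF quasi_periodic_functional[OF f]] linear_functional_def)
next
  case (smult c a)
  then show ?case using f by (simp add: coord_smult[OF quasi_periodic_functional[OF f]] linear_functional_def)
next
  case (elt g d)
  show ?case by (simp add: quasi_periodic_functional[OF f])
qed

text \<open>The functional dual to \<open>elt g d\<close>.\<close>

definition sign_power :: "'k \<Rightarrow> bool \<Rightarrow> int \<Rightarrow> 'k" where
  "sign_power m d k = (if even k then 1 else component_sign m d)"

definition delta :: "dih \<Rightarrow> bool \<Rightarrow> dih \<Rightarrow> bool \<Rightarrow> 'k" where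
  "delta g d h d' = (case (g, h) of (Dih i j e, Dih i' j' e') \<Rightarrow>
    if d = d' \<and> e = e' \<and> int N dvd i' - i \<and> int n dvd j' - j
    then sign_power mu d ((i' - i) div int N) * sign_power lam d ((j' - j) div int n) else 0)"

lemma quasi_periodic_delta: "quasi_periodic (delta g d)"
proof -
  have eq: "i' + m - i = (i' - i) + m" for i' i m :: int by simp
  have sign: "sign_power mu d (k + 1) = component_sign mu d * sign_power mu d k"
    "sign_power lam d (k + 1) = component_sign lam d * sign_power lam d k" for k d
    by (auto simp: sign_power_def)
  have "delta g d (Dih (int N) 0 False + h) d' = component_sign mu d' * delta g d h d' \<and>
    delta g d (Dih 0 (int n) False + h) d' = component_sign lam d' * delta g d h d'" for h d'
    using N n by (cases g; cases h) (simp add: delta_def add.commute[of "int _"] eq sign)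
  then show ?thesis by (simp add: quasi_periodic_def)
qed

lemma delta_self [simp]: "delta g d g d = 1"
  by (cases g) (simp add: delta_def sign_power_def)

lemma delta_other [simp]: "d \<noteq> d' \<Longrightarrow> delta g d h d' = 0"
  by (cases g; cases h) (simp add: delta_def)

text \<open>There are \<open>2 * N * n\<close> representatives, hence \<open>4 * N * n\<close> pairs
  with a component, which is the dimension.\<close>

definition reps :: "dih set" where
  "reps = (\<lambda>(i, j, e). Dih i j e) ` ({0..<int N} \<times> {0..<int n} \<times> UNIV)"

definition rep :: "dih \<Rightarrow> dih" where
  "rep g = (case g of Dih i j e \<Rightarrow> Dih (i mod int N) (j mod int n) e)"

lemma finite_reps [simp]: "finite reps"
  by (simp add: reps_def)

lemma rep_reps: "rep g \<in> reps"
proof (cases g)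
  case (Dih i j e)
  then show ?thesis
    using N n by (auto simp: rep_def reps_def intro!: rev_image_eqI[of "(i mod int N, j mod int n, e)"])
qed

lemma delta_reps: "h \<in> reps \<Longrightarrow> delta h d g d = 0 \<or> h = rep g"
  using N n
  by (auto simp: delta_def reps_def rep_def mod_eq_dvd_iff[symmetric] split: dih.splits)

text \<open>If one shift acts by an operation that is its own inverse, the effect of an integer
  multiple depends only on its parity. Both the shift by \<open>z^N\<close> and the one by
  \<open>r^n\<close> are instances.\<close>

lemma involution_shift:
  assumes shift: "\<And>g. f (Dih p q False + g) = s (f g)" and s: "\<And>g. s (s (f g)) = f g"
  shows "f (Dih (k * p) (k * q) False + h) = (if even k then f h else s (f h))"
proof (induct k rule: int_induct[where k = 0])
  case base
  show ?case by (simp flip: zero_dih_def)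
next
  case (step1 k)
  have "Dih ((k + 1) * p) ((k + 1) * q) False + h = Dih p q False + (Dih (k * p) (k * q) False + h)"
    by (cases h) (simp add: algebra_simps)
  then show ?case using step1 by (simp add: shift s)
next
  case (step2 k)
  have "Dih (k * p) (k * q) False + h = Dih p q False + (Dih ((k - 1) * p) ((k - 1) * q) False + h)"
    by (cases h) (simp add: algebra_simps)
  then have "s (f (Dih (k * p) (k * q) False + h)) = f (Dih ((k - 1) * p) ((k - 1) * q) False + h)"
    by (simp add: shift s)
  then show ?case using step2 by (auto simp: s)
qed

lemma rep_eq: "g = Dih ((case g of Dih i j e \<Rightarrow> i div int N) * int N) 0 False +
    (Dih 0 ((case g of Dih i j e \<Rightarrow> j div int n) * int n) False + rep g)"
  by (cases g) (simp add: rep_def)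

lemma delta_rep: "delta (rep g) d g d =
  sign_power mu d (case g of Dih i j e \<Rightarrow> i div int N) * sign_power lam d (case g of Dih i j e \<Rightarrow> j div int n)"
proof -
  have "(i - i mod m) div m = i div m" if "m > 0" for i m :: int
    using that by (simp add: minus_mod_eq_mult_div)
  then show ?thesis using N n by (cases g) (simp add: delta_def rep_def)
qed

lemma elt_rep: "elt g d = delta (rep g) d g d \<odot>\<^bsub>A\<^esub> elt (rep g) d"
proof -
  have "elt (Dih (k * int N) 0 False + h) d = sign_power mu d k \<odot>\<^bsub>A\<^esub> elt h d"
    "elt (Dih 0 (k * int n) False + h) d = sign_power lam d k \<odot>\<^bsub>A\<^esub> elt h d" for k h
    using involution_shift[of "\<lambda>g. elt g d" "int N" 0 "\<lambda>y. component_sign mu d \<odot>\<^bsub>A\<^esub> y" k h]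
      involution_shift[of "\<lambda>g. elt g d" 0 "int n" "\<lambda>y. component_sign lam d \<odot>\<^bsub>A\<^esub> y" k h]
    by (auto simp: elt_shift sign_power_def A.smult_smult)
  then show ?thesis
    by (subst rep_eq) (simp add: delta_rep A.smult_smult)
qed

lemma expansion:
  assumes "a \<in> carrier A"
  shows "a = (\<Oplus>\<^bsub>A\<^esub>p\<in>reps \<times> UNIV. coord (delta (fst p) (snd p)) a \<odot>\<^bsub>A\<^esub> elt (fst p) (snd p))"
  using assms
proof (induct a rule: span_induct)
  case (add a a')
  have "(\<Oplus>\<^bsub>A\<^esub>p\<in>reps \<times> UNIV. coord (delta (fst p) (snd p)) (a \<oplus>\<^bsub>A\<^esub> a') \<odot>\<^bsub>A\<^esub> elt (fst p) (snd p)) =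
    (\<Oplus>\<^bsub>A\<^esub>p\<in>reps \<times> UNIV. coord (delta (fst p) (snd p)) a \<odot>\<^bsub>A\<^esub> elt (fst p) (snd p) \<oplus>\<^bsub>A\<^esub>
      coord (delta (fst p) (snd p)) a' \<odot>\<^bsub>A\<^esub> elt (fst p) (snd p))"
    using add by (intro A.finsum_cong') (auto simp: coord_add quasi_periodic_delta A.smult_add_left)
  also have "\<dots> = (\<Oplus>\<^bsub>A\<^esub>p\<in>reps \<times> UNIV. coord (delta (fst p) (snd p)) a \<odot>\<^bsub>A\<^esub> elt (fst p) (snd p)) \<oplus>\<^bsub>A\<^esub>
    (\<Oplus>\<^bsub>A\<^esub>p\<in>reps \<times> UNIV. coord (delta (fst p) (snd p)) a' \<odot>\<^bsub>A\<^esub> elt (fst p) (snd p))"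
    by (intro A.finsum_addf) auto
  finally show ?case using add by simp
next
  case (smult c a)
  have "(\<Oplus>\<^bsub>A\<^esub>p\<in>reps \<times> UNIV. coord (delta (fst p) (snd p)) (c \<odot>\<^bsub>A\<^esub> a) \<odot>\<^bsub>A\<^esub> elt (fst p) (snd p)) =
    (\<Oplus>\<^bsub>A\<^esub>p\<in>reps \<times> UNIV. c \<odot>\<^bsub>A\<^esub> (coord (delta (fst p) (snd p)) a \<odot>\<^bsub>A\<^esub> elt (fst p) (snd p)))"
    using smult by (intro A.finsum_cong') (auto simp: coord_smult quasi_periodic_delta A.smult_smult)
  also have "\<dots> = c \<odot>\<^bsub>A\<^esub> (\<Oplus>\<^bsub>A\<^esub>p\<in>reps \<times> UNIV. coord (delta (fst p) (snd p)) a \<odot>\<^bsub>A\<^esub> elt (fst p) (snd p))"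
    by (intro A.smult_finsum[symmetric]) auto
  finally show ?case using smult by simp
next
  case (elt g d)
  have "(\<Oplus>\<^bsub>A\<^esub>p\<in>reps \<times> UNIV. delta (fst p) (snd p) g d \<odot>\<^bsub>A\<^esub> elt (fst p) (snd p)) =
    (\<Oplus>\<^bsub>A\<^esub>p\<in>{(rep g, d)}. delta (fst p) (snd p) g d \<odot>\<^bsub>A\<^esub> elt (fst p) (snd p))"
  proof (rule A.add.finprod_mono_neutral_cong_right)
    fix p assume p: "p \<in> reps \<times> UNIV - {(rep g, d)}"
    then have "delta (fst p) (snd p) g d = 0"
      using delta_reps[of "fst p" d g] by (cases "snd p = d") (auto simp: prod_eq_iff)
    then show "delta (fst p) (snd p) g d \<odot>\<^bsub>A\<^esub> elt (fst p) (snd p) = \<zero>\<^bsub>A\<^esub>" by simp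
  next
  qed (use rep_reps in auto)
  also have "\<dots> = elt g d" using elt_rep[of g d] by simp
  finally show ?case by (simp add: quasi_periodic_delta)
qed

text \<open>Only the coefficients with respect to the dual functionals enter the expansion, so
  functionals separate points.\<close>

lemma coord_ext:
  assumes "a \<in> carrier A" "a' \<in> carrier A" "\<And>F. quasi_periodic F \<Longrightarrow> coord F a = coord F a'"
  shows "a = a'"
  using expansion[OF assms(1)] expansion[OF assms(2)] assms(3) by (simp add: quasi_periodic_delta)

end

section \<open>The structure maps of the Suzuki algebra\<close>

lemma suzuki_relations_cong:
  assumes rel: "suzuki_relations N n mu lam B y'"
    and y: "\<And>i j. \<lbrakk>i \<in> {1, 2}; j \<in> {1, 2}\<rbrakk> \<Longrightarrow> y i j = y' i j"
  shows "suzuki_relations N n mu lam B y"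
proof -
  have alt: "alternating B y i j m = alternating B y' i j m" if "i \<in> {1, 2}" "j \<in> {1, 2}" for i j m
    using that
  proof (induct m arbitrary: i j)
    case (Suc m)
    have "3 - i \<in> {1, 2}" "3 - j \<in> {1, 2}" using Suc.prems by auto
    then show ?case using Suc y[of i j] by simp
  qed simp
  have 12: "1 \<in> {1, 2::nat}" "2 \<in> {1, 2::nat}" by simp_all
  note y12 = y[OF 12(1) 12(1)] y[OF 12(1) 12(2)] y[OF 12(2) 12(1)] y[OF 12(2) 12(2)]
  note alt12 = alt[OF 12(1) 12(1)] alt[OF 12(1) 12(2)] alt[OF 12(2) 12(1)] alt[OF 12(2) 12(2)]
  have "y i j \<otimes>\<^bsub>B\<^esub> y k l = \<zero>\<^bsub>B\<^esub>"
    if "i \<in> {1, 2}" "j \<in> {1, 2}" "k \<in> {1, 2}" "l \<in> {1, 2}" "odd (i + j + k + l)" for i j k l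
    unfolding y[OF that(1,2)] y[OF that(3,4)] using rel that unfolding suzuki_relations_def by blast
  moreover have "y i j \<in> carrier B" if "i \<in> {1, 2}" "j \<in> {1, 2}" for i j
    unfolding y[OF that] using rel that unfolding suzuki_relations_def by blast
  moreover note rel[unfolded suzuki_relations_def, THEN conjunct2]
  ultimately show ?thesis
    unfolding suzuki_relations_def y12 alt12 by (intro conjI ballI impI) (elim conjE, assumption | blast)+
qed

context suzuki_parameters
begin

abbreviation "H \<equiv> suzuki N n mu lam"
abbreviation "T \<equiv> tensor_algebra A A"

lemma suzuki_simps:
  "carrier H = carrier A" "a \<otimes>\<^bsub>H\<^esub> a' = a \<otimes>\<^bsub>A\<^esub> a'" "\<one>\<^bsub>H\<^esub> = \<one>\<^bsub>A\<^esub>" "\<zero>\<^bsub>H\<^esub> = \<zero>\<^bsub>A\<^esub>"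
  "a \<oplus>\<^bsub>H\<^esub> a' = a \<oplus>\<^bsub>A\<^esub> a'" "c \<odot>\<^bsub>H\<^esub> a = c \<odot>\<^bsub>A\<^esub> a"
  by (simp_all add: suzuki_def Let_def module.defs)

lemma suzuki_pow: "a [^]\<^bsub>H\<^esub> (k::nat) = a [^]\<^bsub>A\<^esub> k"
  by (simp add: nat_pow_def suzuki_simps)

lemma suzuki_minus: "a \<ominus>\<^bsub>H\<^esub> a' = a \<ominus>\<^bsub>A\<^esub> a'"
  by (simp add: a_minus_def a_inv_def m_inv_def suzuki_simps)

lemma suzuki_alternating: "alternating H y i j m = alternating A y i j m"
  by (induct m arbitrary: i j) (simp_all add: suzuki_simps)

lemma tensor_suzuki: "tensor_algebra H H = T"
proof -
  have "monoid_algebra (H \<times>\<times> H) = (monoid_algebra (A \<times>\<times> A) :: ('k, _) module)"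
    by (simp add: DirProd_def suzuki_simps)
  moreover have "bilinearity_relators H H = bilinearity_relators A A"
    by (simp add: bilinearity_relators_def suzuki_simps)
  ultimately show ?thesis by (simp add: tensor_algebra_def)
qed

lemma pure_tensor_suzuki: "pure_tensor H H = pure_tensor A A"
proof -
  have "monoid_algebra (H \<times>\<times> H) = (monoid_algebra (A \<times>\<times> A) :: ('k, _) module)"
    by (simp add: DirProd_def suzuki_simps)
  moreover have "bilinearity_relators H H = bilinearity_relators A A"
    by (simp add: bilinearity_relators_def suzuki_simps)
  ultimately show ?thesis by (simp add: pure_tensor_def fun_eq_iff)
qed

lemma tensor_map_suzuki: "tensor_map H H H H f g = tensor_map A A A A f g"
  by (simp add: tensor_map_def tensor_suzuki pure_tensor_suzuki)

lemma algebra_hom_suzuki: "algebra_hom H H = algebra_hom A A"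
  by (simp add: algebra_hom_def ring_hom_def suzuki_simps)

text \<open>Given a family, the homomorphism is known on every \<open>elt g d\<close> and not only
  on generators. This produces closed formulas for the comultiplication, the counit and the
  antipode.\<close>

lemma hom_of_family:
  assumes B: "assoc_algebra B" and \<beta>: "suzuki_family N n mu lam B \<beta>"
    and y: "\<And>i j. \<lbrakk>i \<in> {1, 2}; j \<in> {1, 2}\<rbrakk> \<Longrightarrow> y i j = family_generators \<beta> i j"
  shows "suzuki_hom N n mu lam B y \<in> algebra_hom A B"
    and "suzuki_hom N n mu lam B y (elt g d) = \<beta> g d"
proof -
  interpret B: family N n mu lam B \<beta>
    using B \<beta> by (intro family.intro family_axioms.intro suzuki_parameters_axioms)
  have rel: "suzuki_relations N n mu lam B y"
    by (rule suzuki_relations_cong[OF B.relations]) (rule y)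
  show hom: "suzuki_hom N n mu lam B y \<in> algebra_hom A B"
    by (rule suzuki_hom(1)[OF B rel])
  let ?\<Phi> = "suzuki_hom N n mu lam B y"
  have "(\<lambda>g d. ?\<Phi> (elt g d)) = \<beta>"
  proof (rule B.ext)
    show "suzuki_family N n mu lam B (\<lambda>g d. ?\<Phi> (elt g d))"
      by (rule algebra_map_family[OF algebra_map.intro[OF assoc_algebra_suzuki_algebra B algebra_map_axioms.intro[OF hom]] A.family])
    have "?\<Phi> (elt (if i = 1 then dih_u else dih_v) (i \<noteq> j)) = \<beta> (if i = 1 then dih_u else dih_v) (i \<noteq> j)"
      if "i \<in> {1, 2}" "j \<in> {1, 2}" for i j :: nat
      using suzuki_hom(2)[OF B rel that] y[OF that] that by (simp add: gen_eq family_generators_def)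
    from this[of 1 1] this[of 1 2] this[of 2 1] this[of 2 2]
    show "?\<Phi> (elt dih_u d) = \<beta> dih_u d" "?\<Phi> (elt dih_v d) = \<beta> dih_v d" for d
      by (cases d; simp)+
  qed
  then show "?\<Phi> (elt g d) = \<beta> g d" by metis
qed

sublocale T: algebra_pair A A
  by unfold_locales

lemma assoc_algebra_T: "assoc_algebra T"
  by (rule T.assoc_algebra_tensor)

text \<open>In a term whose left factor stays in the first component, the right factor keeps its
  leading letter. If the left factor lies in the second component, the index changes in between, so
  the right factor is swapped and its component is the opposite one.\<close>

definition comult_family :: "dih \<Rightarrow> bool \<Rightarrow> (((nat \<times> nat) list \<Rightarrow>\<^sub>0 'k) set \<times> ((nat \<times> nat) list \<Rightarrow>\<^sub>0 'k) set \<Rightarrow>\<^sub>0 'k) set"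
  where "comult_family g d = pure_tensor A A (elt g False) (elt g d) \<oplus>\<^bsub>T\<^esub>
    pure_tensor A A (elt g True) (elt (dih_swap g) (\<not> d))"

lemma dih_swap_shift:
  "dih_swap (Dih i 0 False + g) = Dih i 0 False + dih_swap g"
  "dih_swap (Dih 0 j False + g) = Dih 0 (- j) False + dih_swap g"
  by (cases g; simp)+

lemma elt_shift_minus:
  "elt (Dih (- int N) 0 False + g) d = component_sign mu d \<odot>\<^bsub>A\<^esub> elt g d"
  "elt (Dih 0 (- int n) False + g) d = component_sign lam d \<odot>\<^bsub>A\<^esub> elt g d"
proof -
  have "Dih (int N) 0 False + (Dih (- int N) 0 False + g) = g" "Dih 0 (int n) False + (Dih 0 (- int n) False + g) = g"
    by (cases g; simp)+
  then have "elt g d = component_sign mu d \<odot>\<^bsub>A\<^esub> elt (Dih (- int N) 0 False + g) d"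
    "elt g d = component_sign lam d \<odot>\<^bsub>A\<^esub> elt (Dih 0 (- int n) False + g) d"
    using elt_shift by metis+
  then show "elt (Dih (- int N) 0 False + g) d = component_sign mu d \<odot>\<^bsub>A\<^esub> elt g d"
    "elt (Dih 0 (- int n) False + g) d = component_sign lam d \<odot>\<^bsub>A\<^esub> elt g d"
    by (metis A.smult_smult A.smult_one component_sign_square A.closed)+
qed

lemma suzuki_familyI:
  assumes "assoc_algebra B" "\<And>g d. \<beta> g d \<in> carrier B" "\<And>g h d. \<beta> g d \<otimes>\<^bsub>B\<^esub> \<beta> h d = \<beta> (g + h) d"
    "\<And>g h d. \<beta> g d \<otimes>\<^bsub>B\<^esub> \<beta> h (\<not> d) = \<zero>\<^bsub>B\<^esub>" "\<beta> 0 False \<oplus>\<^bsub>B\<^esub> \<beta> 0 True = \<one>\<^bsub>B\<^esub>"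
    "\<And>g d. \<beta> (Dih (int N) 0 False + g) d = component_sign mu d \<odot>\<^bsub>B\<^esub> \<beta> g d"
    "\<And>g d. \<beta> (Dih 0 (int n) False + g) d = component_sign lam d \<odot>\<^bsub>B\<^esub> \<beta> g d"
  shows "suzuki_family N n mu lam B \<beta>"
proof -
  have "\<beta> (Dih (i + int N) j e) d = component_sign mu d \<odot>\<^bsub>B\<^esub> \<beta> (Dih i j e) d"
    "\<beta> (Dih i (j + int n) e) d = component_sign lam d \<odot>\<^bsub>B\<^esub> \<beta> (Dih i j e) d" for i j e d
    using assms(6)[of "Dih i j e" d] assms(7)[of "Dih i j e" d] by (simp_all add: add.commute)
  then show ?thesis using assms by (simp add: suzuki_family_def)
qed

lemma comult_family: "suzuki_family N n mu lam T comult_family"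
proof (rule suzuki_familyI[OF assoc_algebra_T])
  interpret T': assoc_algebra T by (rule assoc_algebra_T)
  note bilinear = T.tensor_mult T.tensor_smult_left T.tensor_smult_right T'.smult_smult T'.smult_add_right
    T.tensor_zero_left T.tensor_zero_right
  show "comult_family g d \<in> carrier T" for g d by (simp add: comult_family_def)
  show "comult_family g d \<otimes>\<^bsub>T\<^esub> comult_family h d = comult_family (g + h) d" for g h d
    by (simp add: comult_family_def T'.l_distr T'.r_distr bilinear dih_swap_add)
  show "comult_family g d \<otimes>\<^bsub>T\<^esub> comult_family h (\<not> d) = \<zero>\<^bsub>T\<^esub>" for g h d
    by (simp add: comult_family_def T'.l_distr T'.r_distr bilinear)
  show "comult_family (Dih (int N) 0 False + g) d = component_sign mu d \<odot>\<^bsub>T\<^esub> comult_family g d" for g d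
    by (cases d) (simp_all add: comult_family_def elt_shift dih_swap_shift bilinear component_sign_def)
  show "comult_family (Dih 0 (int n) False + g) d = component_sign lam d \<odot>\<^bsub>T\<^esub> comult_family g d" for g d
    by (cases d)
      (simp_all add: comult_family_def elt_shift elt_shift_minus dih_swap_shift bilinear component_sign_def)
  let ?e = "\<lambda>d. elt 0 d"
  have "\<one>\<^bsub>T\<^esub> = pure_tensor A A (?e False \<oplus>\<^bsub>A\<^esub> ?e True) (?e False \<oplus>\<^bsub>A\<^esub> ?e True)"
    by (simp add: T.tensor_one A.sum_one)
  also have "\<dots> = comult_family 0 False \<oplus>\<^bsub>T\<^esub> comult_family 0 True"
    by (simp add: comult_family_def T.tensor_add_left T.tensor_add_right T'.a_ac)
  finally show "comult_family 0 False \<oplus>\<^bsub>T\<^esub> comult_family 0 True = \<one>\<^bsub>T\<^esub>" ..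
qed

lemma comult_hom: "comult H \<in> algebra_hom A T"
  and comult_elt: "comult H (elt g d) = comult_family g d"
proof -
  interpret T': assoc_algebra T by (rule assoc_algebra_T)
  have y: "pure_tensor A A (gen i 1) (gen 1 j) \<oplus>\<^bsub>T\<^esub> pure_tensor A A (gen i 2) (gen 2 j) =
      family_generators comult_family i j" if "i \<in> {1, 2}" "j \<in> {1, 2}" for i j
    using that by (auto simp: family_generators_def comult_family_def gen_simps T'.a_comm)
  have c: "comult H = suzuki_hom N n mu lam T
      (\<lambda>i j. pure_tensor A A (gen i 1) (gen 1 j) \<oplus>\<^bsub>T\<^esub> pure_tensor A A (gen i 2) (gen 2 j))"
    by (simp add: suzuki_def Let_def module.defs hopf_algebra.defs)
  show "comult H \<in> algebra_hom A T" "comult H (elt g d) = comult_family g d"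
    unfolding c by (rule hom_of_family[OF assoc_algebra_T comult_family y], assumption+)+
qed

lemma counit_hom: "counit H \<in> algebra_hom A ground_algebra"
  and counit_elt: "counit H (elt g d) = (if d then 0 else 1)"
proof -
  have fam: "suzuki_family N n mu lam ground_algebra (\<lambda>g d. if d then 0 else (1::'k))"
    by (rule suzuki_familyI[OF assoc_algebra_ground]) (auto simp: component_sign_def)
  have c: "counit H = suzuki_hom N n mu lam ground_algebra (\<lambda>i j. if i = j then 1 else 0)"
    by (simp add: suzuki_def Let_def module.defs hopf_algebra.defs)
  show "counit H \<in> algebra_hom A ground_algebra" "counit H (elt g d) = (if d then 0 else 1)"
    unfolding c
    by (rule hom_of_family[OF assoc_algebra_ground fam], simp add: family_generators_def)+
qed

lemma antipode_family:
  "suzuki_family N n mu lam (opposite_algebra A) (\<lambda>g d. elt (dih_twist d (- g)) d)"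
proof (rule suzuki_familyI[OF assoc_algebra_opposite[OF assoc_algebra_suzuki_algebra]])
  have shift: "- (Dih i 0 False + g) = Dih (- i) 0 False + - g"
    "- (Dih 0 j False + g) = Dih 0 (case g of Dih _ _ e \<Rightarrow> if e then j else - j) False + - g" for i j g
    by (cases g; simp)+
  have opp: "c \<odot>\<^bsub>opposite_algebra A\<^esub> a = c \<odot>\<^bsub>A\<^esub> a" for c a by (simp add: opposite_algebra_def)
  show "elt (dih_twist d (- (Dih (int N) 0 False + g))) d =
      component_sign mu d \<odot>\<^bsub>opposite_algebra A\<^esub> elt (dih_twist d (- g)) d" for g d
    unfolding shift opp dih_twist_def
    by (cases d) (simp_all only: if_True if_False dih_swap_shift elt_shift_minus)
  show "elt (dih_twist d (- (Dih 0 (int n) False + g))) d =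
      component_sign lam d \<odot>\<^bsub>opposite_algebra A\<^esub> elt (dih_twist d (- g)) d" for g d
    unfolding shift opp dih_twist_def
    by (cases d; cases g; cases "case g of Dih _ _ e \<Rightarrow> e")
      (simp_all only: if_True if_False dih_swap_shift elt_shift elt_shift_minus dih.case minus_minus)
qed (auto simp: opposite_algebra_def dih_twist_def minus_add A.sum_one simp flip: dih_swap_add)

text \<open>Within its component a generator has the inverse given by the power
  \<open>4 * N - 1\<close>: that exponent is \<open>2 * k + 1\<close> with
  \<open>k = 2 * N - 1\<close>, and the two shifts by \<open>N\<close> that relate it to the inverse
  contribute \<open>mu * mu = 1\<close>.\<close>

lemma antipode_hom: "antipode H \<in> algebra_hom A (opposite_algebra A)"
  and antipode_elt: "antipode H (elt g d) = elt (dih_twist d (- g)) d"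
proof -
  have pow: "elt g d [^]\<^bsub>A\<^esub> (4 * N - 1) = elt (- g) d" if "g + g = Dih 1 0 False" for g d
  proof -
    obtain k where k: "4 * N - 1 = Suc (2 * k)" "int k + 1 = 2 * int N" using N by (intro that[of "2 * N - 1"]) auto
    have "elt g d [^]\<^bsub>A\<^esub> (2 * k) = elt (Dih (int k) 0 False) d"
      using A.double[OF that, of d "k - 1"] k N by (cases k) auto
    then have "elt g d [^]\<^bsub>A\<^esub> (4 * N - 1) = elt (Dih (int k) 0 False + g) d"
      unfolding k(1) by simp
    also have "Dih (int k) 0 False + g = Dih (int k) 0 False + ((g + g) + - g)"
      by (simp add: add.assoc)
    also have "\<dots> = Dih (int N) 0 False + (Dih (int N) 0 False + - g)"
      unfolding that using k(2) by (cases "- g") simp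
    finally show ?thesis unfolding elt_shift by (simp add: A.smult_smult)
  qed
  have y: "gen j i [^]\<^bsub>A\<^esub> (4 * N - 1) = family_generators (\<lambda>g d. elt (dih_twist d (- g)) d) i j"
    if "i \<in> {1, 2}" "j \<in> {1, 2}" for i j
  proof -
    have "dih_u + dih_u = Dih 1 0 False" "dih_v + dih_v = Dih 1 0 False" by (simp_all add: dih_defs)
    then show ?thesis
      using that by (auto simp: family_generators_def gen_simps pow[unfolded One_nat_def] dih_twist_def dih_swap_uminus)
  qed
  have c: "antipode H = suzuki_hom N n mu lam (opposite_algebra A) (\<lambda>i j. gen j i [^]\<^bsub>A\<^esub> (4 * N - 1))"
    by (simp add: suzuki_def Let_def module.defs hopf_algebra.defs)
  show "antipode H \<in> algebra_hom A (opposite_algebra A)" "antipode H (elt g d) = elt (dih_twist d (- g)) d"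
    unfolding c
    by (rule hom_of_family[OF assoc_algebra_opposite[OF assoc_algebra_suzuki_algebra] antipode_family y], assumption+)+
qed

end

section \<open>A criterion for Hopf algebra automorphisms\<close>

text \<open>The hypothesis says that the rows of \<open>M'\<close> span the unit vectors. There are
  no more rows than unit vectors, so the rows are independent, and the entries of
  \<open>M' M - 1\<close> are the coefficients of a linear relation between them.\<close>

lemma left_inverse_matrix:
  fixes M M' :: "'i \<Rightarrow> 'i \<Rightarrow> 'a::field"
  assumes I: "finite I" and inv: "\<And>i k. \<lbrakk>i \<in> I; k \<in> I\<rbrakk> \<Longrightarrow> (\<Sum>j\<in>I. M i j * M' j k) = (if i = k then 1 else 0)"
    and ik: "i \<in> I" "k \<in> I"
  shows "(\<Sum>j\<in>I. M' i j * M j k) = (if i = k then 1 else 0)"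
proof -
  interpret V: vector_space "\<lambda>c::'a. Poly_Mapping.map ((*) c) :: ('i \<Rightarrow>\<^sub>0 'a) \<Rightarrow> _"
    by unfold_locales (auto intro!: poly_mapping_eqI simp: lookup_add algebra_simps)
  define e where "e i = Poly_Mapping.single i (1::'a)" for i :: 'i
  define r where "r j = (\<Sum>k\<in>I. Poly_Mapping.single k (M' j k))" for j
  have lookup_e: "Poly_Mapping.lookup (e i) k = (if i = k then 1 else 0)" for i k
    by (simp add: e_def lookup_single when_def)
  have lookup_r: "Poly_Mapping.lookup (r j) k = (if k \<in> I then M' j k else 0)" for j k
    using I by (simp add: r_def lookup_sum lookup_single when_def)
  have e_r: "e i = (\<Sum>j\<in>I. Poly_Mapping.map ((*) (M i j)) (r j))" if "i \<in> I" for i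
  proof (rule poly_mapping_eqI)
    fix k show "Poly_Mapping.lookup (e i) k = Poly_Mapping.lookup (\<Sum>j\<in>I. Poly_Mapping.map ((*) (M i j)) (r j)) k"
      using inv[OF that, of k] that by (cases "k \<in> I") (auto simp: lookup_e lookup_sum lookup_r)
  qed
  have inj: "inj_on e I" by (rule inj_onI) (metis e_def lookup_e zero_neq_one)
  have indep: "\<not> V.dependent (e ` I)"
  proof
    assume "V.dependent (e ` I)"
    then obtain S u v where S: "finite S" "S \<subseteq> e ` I" "(\<Sum>v\<in>S. Poly_Mapping.map ((*) (u v)) v) = 0"
      and v: "v \<in> S" "u v \<noteq> 0"
      unfolding V.dependent_explicit by blast
    from v S(2) obtain i where i: "v = e i" "i \<in> I" by blast
    have "Poly_Mapping.lookup (\<Sum>v\<in>S. Poly_Mapping.map ((*) (u v)) v) i = (\<Sum>w\<in>S. if w = v then u v else 0)"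
      unfolding lookup_sum
    proof (intro sum.cong refl)
      fix w assume "w \<in> S"
      then obtain j where "w = e j" "j \<in> I" using S(2) by blast
      then show "Poly_Mapping.lookup (Poly_Mapping.map ((*) (u w)) w) i = (if w = v then u v else 0)"
        using i inj_onD[OF inj, of i j] by (auto simp: lookup_e)
    qed
    then show False using S v by simp
  qed
  \<comment> \<open>A nonzero coefficient would put one row into the span of the others, and fewer
    vectors than \<open>card I\<close> would span the independent unit vectors.\<close>
  have zero: "c k = 0" if c: "(\<Sum>j\<in>I. Poly_Mapping.map ((*) (c j)) (r j)) = 0" and k: "k \<in> I" for c k
  proof (rule ccontr)
    assume ck: "c k \<noteq> 0"
    let ?R = "r ` (I - {k})"
    have "Poly_Mapping.map ((*) (c k)) (r k) + (\<Sum>j\<in>I - {k}. Poly_Mapping.map ((*) (c j)) (r j)) = 0"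
      using c I k by (simp add: sum.remove)
    then have "Poly_Mapping.map ((*) (c k)) (r k) = - (\<Sum>j\<in>I - {k}. Poly_Mapping.map ((*) (c j)) (r j))"
      by (simp add: eq_neg_iff_add_eq_0)
    also have "\<dots> \<in> V.span ?R"
      by (intro V.span_neg V.span_sum V.span_scale V.span_base) auto
    finally have "Poly_Mapping.map ((*) (inverse (c k))) (Poly_Mapping.map ((*) (c k)) (r k)) \<in> V.span ?R"
      by (rule V.span_scale)
    then have rk: "r k \<in> V.span ?R" using ck by simp
    have "r j \<in> V.span ?R" if "j \<in> I" for j
      by (cases "j = k") (use rk that in \<open>simp_all add: V.span_base\<close>)
    then have "e ` I \<subseteq> V.span ?R"
      by (auto simp: e_r intro!: V.span_sum V.span_scale)
    then have "card (e ` I) \<le> card ?R"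
      using V.independent_span_bound[OF finite_imageI[OF finite_Diff[OF I]] indep] by (simp only:)
    also have "\<dots> \<le> card (I - {k})" using I by (intro card_image_le) simp
    also have "\<dots> < card I" using I k by (intro psubset_card_mono) auto
    finally show False using card_image[OF inj] by simp
  qed
  \<comment> \<open>This is a row of \<open>M' M M' - M'\<close>, which vanishes since
    \<open>M M' = 1\<close>.\<close>
  have "(\<Sum>j\<in>I. Poly_Mapping.map ((*) ((\<Sum>l\<in>I. M' i l * M l j) - (if i = j then 1 else 0))) (r j)) = 0"
  proof (rule poly_mapping_eqI)
    fix k
    have "(\<Sum>j\<in>I. (\<Sum>l\<in>I. M' i l * M l j) * M' j k) = (\<Sum>l\<in>I. M' i l * (\<Sum>j\<in>I. M l j * M' j k))"
      unfolding sum_distrib_left sum_distrib_right by (subst sum.swap) (simp only: mult.assoc)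
    also have "\<dots> = M' i k" if "k \<in> I" using that I inv by (simp add: if_distrib[of "(*) _"] cong: if_cong)
    finally show "Poly_Mapping.lookup (\<Sum>j\<in>I. Poly_Mapping.map ((*) ((\<Sum>l\<in>I. M' i l * M l j) - (if i = j then 1 else 0))) (r j)) k =
        Poly_Mapping.lookup 0 k"
      using I ik(1) by (auto simp: lookup_sum lookup_r left_diff_distrib sum_subtractf if_distrib[of "\<lambda>x. x * _"] cong: if_cong)
  qed
  from zero[OF this ik(2)] show ?thesis by simp
qed

section \<open>Separating the tensor square by pairs of functionals\<close>

context suzuki_parameters
begin

lemma T_span_induct [consumes 1, case_names add smult tensor]:
  assumes t: "t \<in> carrier T"
    and add: "\<And>t t'. \<lbrakk>t \<in> carrier T; t' \<in> carrier T; P t; P t'\<rbrakk> \<Longrightarrow> P (t \<oplus>\<^bsub>T\<^esub> t')"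
    and smult: "\<And>c t. \<lbrakk>t \<in> carrier T; P t\<rbrakk> \<Longrightarrow> P (c \<odot>\<^bsub>T\<^esub> t)"
    and tensor: "\<And>g d h d'. P (pure_tensor A A (elt g d) (elt h d'))"
  shows "P t"
proof -
  have left: "P (pure_tensor A A (elt g d) a')" if "a' \<in> carrier A" for g d a'
    using that
    by (induct a' rule: span_induct) (simp_all add: add smult tensor T.tensor_add_right T.tensor_smult_right)
  have pure: "P (pure_tensor A A a a')" if "a \<in> carrier A" "a' \<in> carrier A" for a a'
    using that
    by (induct a rule: span_induct) (simp_all add: left add smult T.tensor_add_left T.tensor_smult_left)
  interpret T': assoc_algebra T by (rule assoc_algebra_T)
  obtain f where f: "f \<in> carrier (monoid_algebra (A \<times>\<times> A))" "t = T.Q.cls f"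
    using t by (rule T.Q.quotient_carrierE)
  have "f \<in> carrier (monoid_algebra (A \<times>\<times> A)) \<and> P (T.Q.cls f)"
    using f(1) unfolding carrier_monoid_algebra mem_Collect_eq
  proof (induct f rule: poly_mapping_keys_induct)
    case zero
    have "P (0 \<odot>\<^bsub>T\<^esub> pure_tensor A A \<zero>\<^bsub>A\<^esub> \<zero>\<^bsub>A\<^esub>)" using pure by (intro smult) auto
    moreover have "T.Q.cls 0 = \<zero>\<^bsub>T\<^esub>" using T.Q.cls_zero by (simp add: zero_monoid_algebra)
    ultimately show ?case by simp
  next
    case (add p c f)
    obtain a a' where p: "p = (a, a')" "a \<in> carrier A" "a' \<in> carrier A" using add(1) by auto
    have f: "f \<in> carrier (monoid_algebra (A \<times>\<times> A))" using add(2) by (simp add: carrier_monoid_algebra)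
    have "Poly_Mapping.single p c + f =
        c \<odot>\<^bsub>monoid_algebra (A \<times>\<times> A)\<^esub> Poly_Mapping.single (a, a') 1 \<oplus>\<^bsub>monoid_algebra (A \<times>\<times> A)\<^esub> f"
      by (simp add: p smult_monoid_algebra add_monoid_algebra map_times_single)
    moreover have "T.Q.cls (c \<odot>\<^bsub>monoid_algebra (A \<times>\<times> A)\<^esub> Poly_Mapping.single (a, a') 1 \<oplus>\<^bsub>monoid_algebra (A \<times>\<times> A)\<^esub> f) =
        c \<odot>\<^bsub>T\<^esub> pure_tensor A A a a' \<oplus>\<^bsub>T\<^esub> T.Q.cls f"
      using p T.single_closed[OF p(2,3), of 1] f
      by (simp add: T.Q.cls_add T.Q.cls_smult pure_tensor_def del: T.Q.carrier_quotient)
    moreover have "P (c \<odot>\<^bsub>T\<^esub> pure_tensor A A a a' \<oplus>\<^bsub>T\<^esub> T.Q.cls f)"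
      using pure[OF p(2,3)] add(3) f p by (intro assms(2,3)) auto
    moreover have "Poly_Mapping.keys (Poly_Mapping.single p c + f) \<subseteq> carrier (A \<times>\<times> A)"
      using add(1,2) Poly_Mapping.keys_add[of "Poly_Mapping.single p c" f] by (auto split: if_splits)
    ultimately show ?case by simp
  qed
  then show ?thesis using f(2) by simp
qed

definition tensor_coord where
  "tensor_coord F G = (SOME L. linear_functional T L \<and>
    (\<forall>a\<in>carrier A. \<forall>a'\<in>carrier A. L (pure_tensor A A a a') = coord F a * coord G a'))"

lemma tensor_coord:
  assumes "quasi_periodic F" "quasi_periodic G"
  shows "linear_functional T (tensor_coord F G)"
    and "\<lbrakk>a \<in> carrier A; a' \<in> carrier A\<rbrakk> \<Longrightarrow> tensor_coord F G (pure_tensor A A a a') = coord F a * coord G a'"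
proof -
  obtain L where "linear_functional T L"
    "\<And>a a'. \<lbrakk>a \<in> carrier A; a' \<in> carrier A\<rbrakk> \<Longrightarrow> L (pure_tensor A A a a') = coord F a * coord G a'"
    using T.tensor_functional_exists[OF linear_functional_coord[OF assms(1)] linear_functional_coord[OF assms(2)]]
    by blast
  then have "\<exists>L. linear_functional T L \<and>
    (\<forall>a\<in>carrier A. \<forall>a'\<in>carrier A. L (pure_tensor A A a a') = coord F a * coord G a')" by blast
  note * = someI_ex[OF this, folded tensor_coord_def]
  show "linear_functional T (tensor_coord F G)"
    and "\<lbrakk>a \<in> carrier A; a' \<in> carrier A\<rbrakk> \<Longrightarrow> tensor_coord F G (pure_tensor A A a a') = coord F a * coord G a'"
    using * by blast+
qed

lemma tensor_coord_linear:
  assumes "quasi_periodic F" "quasi_periodic G"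
  shows "\<lbrakk>t \<in> carrier T; t' \<in> carrier T\<rbrakk> \<Longrightarrow> tensor_coord F G (t \<oplus>\<^bsub>T\<^esub> t') = tensor_coord F G t + tensor_coord F G t'"
    and "t \<in> carrier T \<Longrightarrow> tensor_coord F G (c \<odot>\<^bsub>T\<^esub> t) = c * tensor_coord F G t"
  using tensor_coord(1)[OF assms] by (auto simp: linear_functional_def)

abbreviation "tensor_index \<equiv> (reps \<times> (UNIV :: bool set)) \<times> (reps \<times> (UNIV :: bool set))"
abbreviation "delta' p \<equiv> delta (fst p) (snd p)"
abbreviation "elt' p \<equiv> elt (fst p) (snd p)"

lemma T_expansion:
  assumes "t \<in> carrier T"
  shows "t = (\<Oplus>\<^bsub>T\<^esub>p\<in>tensor_index. tensor_coord (delta' (fst p)) (delta' (snd p)) t \<odot>\<^bsub>T\<^esub>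
    pure_tensor A A (elt' (fst p)) (elt' (snd p)))"
proof -
  interpret T': assoc_algebra T by (rule assoc_algebra_T)
  note lin = tensor_coord_linear[OF quasi_periodic_delta quasi_periodic_delta]
  show ?thesis
    using assms
  proof (induct t rule: T_span_induct)
    case (add t t')
    have "(\<Oplus>\<^bsub>T\<^esub>p\<in>tensor_index. tensor_coord (delta' (fst p)) (delta' (snd p)) (t \<oplus>\<^bsub>T\<^esub> t') \<odot>\<^bsub>T\<^esub>
        pure_tensor A A (elt' (fst p)) (elt' (snd p))) =
      (\<Oplus>\<^bsub>T\<^esub>p\<in>tensor_index. tensor_coord (delta' (fst p)) (delta' (snd p)) t \<odot>\<^bsub>T\<^esub>
        pure_tensor A A (elt' (fst p)) (elt' (snd p)) \<oplus>\<^bsub>T\<^esub>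
        tensor_coord (delta' (fst p)) (delta' (snd p)) t' \<odot>\<^bsub>T\<^esub>
        pure_tensor A A (elt' (fst p)) (elt' (snd p)))"
      using add by (intro T'.finsum_cong') (auto simp: lin T'.smult_add_left)
    also have "\<dots> = (\<Oplus>\<^bsub>T\<^esub>p\<in>tensor_index. tensor_coord (delta' (fst p)) (delta' (snd p)) t \<odot>\<^bsub>T\<^esub>
        pure_tensor A A (elt' (fst p)) (elt' (snd p))) \<oplus>\<^bsub>T\<^esub>
      (\<Oplus>\<^bsub>T\<^esub>p\<in>tensor_index. tensor_coord (delta' (fst p)) (delta' (snd p)) t' \<odot>\<^bsub>T\<^esub>
        pure_tensor A A (elt' (fst p)) (elt' (snd p)))"
      by (intro T'.finsum_addf) auto
    finally show ?case using add by simp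
  next
    case (smult c t)
    have "(\<Oplus>\<^bsub>T\<^esub>p\<in>tensor_index. tensor_coord (delta' (fst p)) (delta' (snd p)) (c \<odot>\<^bsub>T\<^esub> t) \<odot>\<^bsub>T\<^esub>
        pure_tensor A A (elt' (fst p)) (elt' (snd p))) =
      (\<Oplus>\<^bsub>T\<^esub>p\<in>tensor_index. c \<odot>\<^bsub>T\<^esub> (tensor_coord (delta' (fst p)) (delta' (snd p)) t \<odot>\<^bsub>T\<^esub>
        pure_tensor A A (elt' (fst p)) (elt' (snd p))))"
      using smult by (intro T'.finsum_cong') (auto simp: lin T'.smult_smult)
    also have "\<dots> = c \<odot>\<^bsub>T\<^esub> (\<Oplus>\<^bsub>T\<^esub>p\<in>tensor_index. tensor_coord (delta' (fst p)) (delta' (snd p)) t \<odot>\<^bsub>T\<^esub>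
        pure_tensor A A (elt' (fst p)) (elt' (snd p)))"
      by (intro T'.smult_finsum[symmetric]) auto
    finally show ?case using smult by simp
  next
    case (tensor g d h d')
    let ?q = "((rep g, d), (rep h, d'))"
    let ?t = "pure_tensor A A (elt g d) (elt h d')"
    have val: "tensor_coord (delta' (fst p)) (delta' (snd p)) ?t =
        delta' (fst p) g d * delta' (snd p) h d'" for p
      by (simp add: tensor_coord quasi_periodic_delta)
    have "(\<Oplus>\<^bsub>T\<^esub>p\<in>tensor_index. tensor_coord (delta' (fst p)) (delta' (snd p)) ?t \<odot>\<^bsub>T\<^esub>
        pure_tensor A A (elt' (fst p)) (elt' (snd p))) =
      (\<Oplus>\<^bsub>T\<^esub>p\<in>{?q}. (delta' (fst p) g d * delta' (snd p) h d') \<odot>\<^bsub>T\<^esub>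
        pure_tensor A A (elt' (fst p)) (elt' (snd p)))"
      unfolding val
    proof (rule T'.add.finprod_mono_neutral_cong_right)
      fix p assume p: "p \<in> tensor_index - {?q}"
      have "delta' (fst p) g d = 0 \<or> delta' (snd p) h d' = 0"
      proof (rule ccontr)
        assume *: "\<not> ?thesis"
        then have "snd (fst p) = d" "snd (snd p) = d'" using delta_other by metis+
        moreover have "fst (fst p) = rep g" "fst (snd p) = rep h"
          using * p calculation delta_reps[of "fst (fst p)" d g] delta_reps[of "fst (snd p)" d' h] by auto
        ultimately show False using p by (auto simp: prod_eq_iff)
      qed
      then show "(delta' (fst p) g d * delta' (snd p) h d') \<odot>\<^bsub>T\<^esub>
        pure_tensor A A (elt' (fst p)) (elt' (snd p)) = \<zero>\<^bsub>T\<^esub>" by auto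
    qed (use rep_reps in auto)
    also have "\<dots> = pure_tensor A A (delta (rep g) d g d \<odot>\<^bsub>A\<^esub> elt (rep g) d) (delta (rep h) d' h d' \<odot>\<^bsub>A\<^esub> elt (rep h) d')"
      by (simp add: T.tensor_smult_left T.tensor_smult_right T'.smult_smult mult.commute)
    also have "\<dots> = ?t" using elt_rep[of g d] elt_rep[of h d'] by simp
    finally show ?case ..
  qed
qed

text \<open>Tensors of family members over the representatives span, and products of dual
  functionals read off the coefficients; so equations between tensors can be tested by
  scalars.\<close>

lemma T_ext:
  assumes "t \<in> carrier T" "t' \<in> carrier T"
    "\<And>F G. \<lbrakk>quasi_periodic F; quasi_periodic G\<rbrakk> \<Longrightarrow> tensor_coord F G t = tensor_coord F G t'"
  shows "t = t'"
  using T_expansion[OF assms(1)] T_expansion[OF assms(2)] assms(3) by (simp add: quasi_periodic_delta)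

lemma algebra_map_A:
  assumes "assoc_algebra B" "h \<in> algebra_hom A B"
  shows "algebra_map A B h"
  using assms assoc_algebra_suzuki_algebra by (intro algebra_map.intro algebra_map_axioms.intro)

lemma hom_ext:
  assumes B: "assoc_algebra B" and h: "h \<in> algebra_hom A B" "h' \<in> algebra_hom A B"
    and gens: "\<And>i j. \<lbrakk>i \<in> {1, 2}; j \<in> {1, 2}\<rbrakk> \<Longrightarrow> h (gen i j) = h' (gen i j)"
    and a: "a \<in> carrier A"
  shows "h a = h' a"
proof -
  interpret h: algebra_map A B h by (rule algebra_map_A[OF B h(1)])
  interpret h': algebra_map A B h' by (rule algebra_map_A[OF B h(2)])
  show ?thesis
    using a
  proof (induct a rule: suzuki_algebra_induct)
    case (mult i j a)
    then show ?case using gens gen_closed by (simp only: h.mult h'.mult)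
  qed (simp_all add: h.add h'.add h.smult h'.smult)
qed

text \<open>The transpose of \<open>comult_family\<close>: the value at \<open>g\<close> of the
  product of two functionals is their joint value on the two tensors that make up the
  comultiplication.\<close>

definition conv :: "(dih \<Rightarrow> bool \<Rightarrow> 'k) \<Rightarrow> (dih \<Rightarrow> bool \<Rightarrow> 'k) \<Rightarrow> dih \<Rightarrow> bool \<Rightarrow> 'k" where
  "conv F G g d = F g False * G g d + F g True * G (dih_swap g) (\<not> d)"

lemma tensor_coord_comult:
  assumes F: "quasi_periodic F" and G: "quasi_periodic G"
  shows "quasi_periodic (conv F G)"
    and "a \<in> carrier A \<Longrightarrow> tensor_coord F G (comult H a) = coord (conv F G) a"
proof -
  interpret T': assoc_algebra T by (rule assoc_algebra_T)
  interpret c: algebra_map A T "comult H" by (rule algebra_map_A[OF assoc_algebra_T comult_hom])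
  have lin: "linear_functional A (\<lambda>a. tensor_coord F G (comult H a))"
    by (auto simp: linear_functional_def c.add c.smult tensor_coord_linear[OF F G])
  have val: "(\<lambda>g d. tensor_coord F G (comult H (elt g d))) = conv F G"
    by (intro ext) (simp add: comult_elt comult_family_def tensor_coord_linear[OF F G] tensor_coord(2)[OF F G] F G conv_def)
  show "quasi_periodic (conv F G)" using quasi_periodic_functional[OF lin] by (simp add: val)
  show "a \<in> carrier A \<Longrightarrow> tensor_coord F G (comult H a) = coord (conv F G) a"
    using functional_eq_coord[OF lin, of a] by (simp add: val)
qed

lemma comult_gen:
  assumes "i \<in> {1, 2}" "j \<in> {1, 2}"
  shows "comult H (gen i j) = pure_tensor A A (gen i 1) (gen 1 j) \<oplus>\<^bsub>T\<^esub> pure_tensor A A (gen i 2) (gen 2 j)"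
proof -
  interpret T': assoc_algebra T by (rule assoc_algebra_T)
  show ?thesis using assms by (auto simp: gen_simps comult_elt comult_family_def T'.a_comm)
qed

text \<open>Both sides are algebra homomorphisms, so generators suffice, and tensors are separated
  by pairs of functionals. What remains says that sending \<open>F\<close> to the matrix of the
  \<open>coord F (\<phi> (gen i j))\<close> turns \<open>conv\<close> into the matrix
  product.\<close>

lemma comult_commute_iff:
  assumes \<phi>: "\<phi> \<in> algebra_hom A A"
  shows "(\<forall>a\<in>carrier A. comult H (\<phi> a) = tensor_map A A A A \<phi> \<phi> (comult H a)) \<longleftrightarrow>
    (\<forall>i\<in>{1,2}. \<forall>j\<in>{1,2}. \<forall>F G. quasi_periodic F \<and> quasi_periodic G \<longrightarrow>
      coord (conv F G) (\<phi> (gen i j)) =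
        coord F (\<phi> (gen i 1)) * coord G (\<phi> (gen 1 j)) + coord F (\<phi> (gen i 2)) * coord G (\<phi> (gen 2 j)))"
proof -
  interpret T': assoc_algebra T by (rule assoc_algebra_T)
  interpret \<phi>: algebra_map A A \<phi> by (rule algebra_map_A[OF assoc_algebra_suzuki_algebra \<phi>])
  interpret c: algebra_map A T "comult H" by (rule algebra_map_A[OF assoc_algebra_T comult_hom])
  note tm = tensor_map_hom[OF \<phi>.algebra_map_axioms \<phi>.algebra_map_axioms]
  interpret tm: algebra_map T T "tensor_map A A A A \<phi> \<phi>"
    using tm(1) assoc_algebra_T by (intro algebra_map.intro algebra_map_axioms.intro)
  have hom1: "(\<lambda>a. comult H (\<phi> a)) \<in> algebra_hom A T"
    by (auto simp: algebra_hom_def \<phi>.add \<phi>.mult \<phi>.smult c.add c.mult c.smult intro!: ring_hom_memI)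
  have hom2: "(\<lambda>a. tensor_map A A A A \<phi> \<phi> (comult H a)) \<in> algebra_hom A T"
    by (auto simp: algebra_hom_def tm.add tm.mult tm.smult c.add c.mult c.smult intro!: ring_hom_memI)
  have 12: "1 \<in> {1, 2::nat}" "2 \<in> {1, 2::nat}" by simp_all
  have closed: "\<phi> (gen i j) \<in> carrier A" if "i \<in> {1, 2}" "j \<in> {1, 2}" for i j
    using gen_closed[OF that] by simp
  have tm_gen: "tensor_map A A A A \<phi> \<phi> (comult H (gen i j)) =
      pure_tensor A A (\<phi> (gen i 1)) (\<phi> (gen 1 j)) \<oplus>\<^bsub>T\<^esub> pure_tensor A A (\<phi> (gen i 2)) (\<phi> (gen 2 j))"
    if ij: "i \<in> {1, 2}" "j \<in> {1, 2}" for i j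
    using gen_closed[OF ij(1) 12(1)] gen_closed[OF ij(1) 12(2)] gen_closed[OF 12(1) ij(2)] gen_closed[OF 12(2) ij(2)]
    by (simp add: comult_gen[OF ij] tm.add tm(2) del: One_nat_def)
  have val: "tensor_coord F G (tensor_map A A A A \<phi> \<phi> (comult H (gen i j))) =
      coord F (\<phi> (gen i 1)) * coord G (\<phi> (gen 1 j)) + coord F (\<phi> (gen i 2)) * coord G (\<phi> (gen 2 j))"
    if ij: "i \<in> {1, 2}" "j \<in> {1, 2}" and F: "quasi_periodic F" "quasi_periodic G" for i j F G
    using closed[OF ij(1) 12(1)] closed[OF ij(1) 12(2)] closed[OF 12(1) ij(2)] closed[OF 12(2) ij(2)]
    by (simp add: tm_gen[OF ij] tensor_coord_linear[OF F] tensor_coord(2)[OF F] del: One_nat_def)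
  have step: "comult H (\<phi> (gen i j)) = tensor_map A A A A \<phi> \<phi> (comult H (gen i j)) \<longleftrightarrow>
    (\<forall>F G. quasi_periodic F \<and> quasi_periodic G \<longrightarrow> coord (conv F G) (\<phi> (gen i j)) =
        coord F (\<phi> (gen i 1)) * coord G (\<phi> (gen 1 j)) + coord F (\<phi> (gen i 2)) * coord G (\<phi> (gen 2 j)))"
    (is "?L = ?R") if ij: "i \<in> {1, 2}" "j \<in> {1, 2}" for i j
  proof
    assume ?L
    then show ?R using val[OF ij] tensor_coord_comult(2)[OF _ _ closed[OF ij]] by metis
  next
    assume R: ?R
    show ?L
    proof (rule T_ext)
      show "comult H (\<phi> (gen i j)) \<in> carrier T" using closed[OF ij] by simp
      show "tensor_map A A A A \<phi> \<phi> (comult H (gen i j)) \<in> carrier T" using gen_closed[OF ij] by simp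
      show "tensor_coord F G (comult H (\<phi> (gen i j))) = tensor_coord F G (tensor_map A A A A \<phi> \<phi> (comult H (gen i j)))"
        if "quasi_periodic F" "quasi_periodic G" for F G
        using R that val[OF ij that] tensor_coord_comult(2)[OF that closed[OF ij]] by simp
    qed
  qed
  have "(\<forall>a\<in>carrier A. comult H (\<phi> a) = tensor_map A A A A \<phi> \<phi> (comult H a)) \<longleftrightarrow>
    (\<forall>i\<in>{1,2}. \<forall>j\<in>{1,2}. comult H (\<phi> (gen i j)) = tensor_map A A A A \<phi> \<phi> (comult H (gen i j)))"
  proof
    assume "\<forall>a\<in>carrier A. comult H (\<phi> a) = tensor_map A A A A \<phi> \<phi> (comult H a)"
    then show "\<forall>i\<in>{1,2}. \<forall>j\<in>{1,2}. comult H (\<phi> (gen i j)) = tensor_map A A A A \<phi> \<phi> (comult H (gen i j))"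
      using gen_closed by blast
  next
    assume gens: "\<forall>i\<in>{1,2}. \<forall>j\<in>{1,2}. comult H (\<phi> (gen i j)) = tensor_map A A A A \<phi> \<phi> (comult H (gen i j))"
    show "\<forall>a\<in>carrier A. comult H (\<phi> a) = tensor_map A A A A \<phi> \<phi> (comult H a)"
    proof
      fix a assume "a \<in> carrier A"
      then show "comult H (\<phi> a) = tensor_map A A A A \<phi> \<phi> (comult H a)"
        by (rule hom_ext[OF assoc_algebra_T hom1 hom2, rotated]) (rule gens[rule_format])
    qed
  qed
  also have "\<dots> \<longleftrightarrow> (\<forall>i\<in>{1,2}. \<forall>j\<in>{1,2}. \<forall>F G. quasi_periodic F \<and> quasi_periodic G \<longrightarrow>
      coord (conv F G) (\<phi> (gen i j)) =
        coord F (\<phi> (gen i 1)) * coord G (\<phi> (gen 1 j)) + coord F (\<phi> (gen i 2)) * coord G (\<phi> (gen 2 j)))"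
    by (intro ball_cong refl step)
  finally show ?thesis .
qed

definition counit_function :: "dih \<Rightarrow> bool \<Rightarrow> 'k" where
  "counit_function g d = (if d then 0 else 1)"

lemma quasi_periodic_counit: "quasi_periodic counit_function"
  by (auto simp: quasi_periodic_def counit_function_def component_sign_def)

lemma counit_coord: "a \<in> carrier A \<Longrightarrow> counit H a = coord counit_function a"
proof -
  interpret c: algebra_map A ground_algebra "counit H"
    by (rule algebra_map_A[OF assoc_algebra_ground counit_hom])
  have "linear_functional A (counit H)" using c.add c.smult by (auto simp: linear_functional_def)
  moreover have "(\<lambda>g d. counit H (elt g d)) = counit_function"
    by (intro ext) (simp add: counit_elt counit_function_def)
  ultimately show "a \<in> carrier A \<Longrightarrow> counit H a = coord counit_function a"
    using functional_eq_coord[of "counit H" a] by simp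
qed

lemma antipode_closed [simp]: "a \<in> carrier A \<Longrightarrow> antipode H a \<in> carrier A"
  using antipode_hom by (auto simp: algebra_hom_def ring_hom_def opposite_algebra_def)

lemma antipode_add: "\<lbrakk>a \<in> carrier A; a' \<in> carrier A\<rbrakk> \<Longrightarrow> antipode H (a \<oplus>\<^bsub>A\<^esub> a') = antipode H a \<oplus>\<^bsub>A\<^esub> antipode H a'"
  and antipode_mult: "\<lbrakk>a \<in> carrier A; a' \<in> carrier A\<rbrakk> \<Longrightarrow> antipode H (a \<otimes>\<^bsub>A\<^esub> a') = antipode H a' \<otimes>\<^bsub>A\<^esub> antipode H a"
  and antipode_smult: "a \<in> carrier A \<Longrightarrow> antipode H (c \<odot>\<^bsub>A\<^esub> a) = c \<odot>\<^bsub>A\<^esub> antipode H a"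
  and antipode_one: "antipode H \<one>\<^bsub>A\<^esub> = \<one>\<^bsub>A\<^esub>"
  using antipode_hom by (auto simp: algebra_hom_def ring_hom_def opposite_algebra_def)

lemma antipode_gen_mult:
  assumes "i \<in> {1, 2}" "j \<in> {1, 2}"
  shows "antipode H (gen i 1) \<otimes>\<^bsub>A\<^esub> gen 1 j \<oplus>\<^bsub>A\<^esub> antipode H (gen i 2) \<otimes>\<^bsub>A\<^esub> gen 2 j = (if i = j then \<one>\<^bsub>A\<^esub> else \<zero>\<^bsub>A\<^esub>)"
  using assms
  by (auto simp: gen_simps antipode_elt dih_twist_def dih_swap_uminus A.sum_one A.a_comm[of "elt 0 True"])

text \<open>The two matrices compared here are a left and a right inverse of the matrix of the \<open>\<phi> (x i j)\<close>.\<close>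

lemma antipode_commute:
  assumes \<phi>: "\<phi> \<in> algebra_hom A A"
    and right: "\<And>i j. \<lbrakk>i \<in> {1, 2}; j \<in> {1, 2}\<rbrakk> \<Longrightarrow>
      \<phi> (gen i 1) \<otimes>\<^bsub>A\<^esub> antipode H (\<phi> (gen 1 j)) \<oplus>\<^bsub>A\<^esub> \<phi> (gen i 2) \<otimes>\<^bsub>A\<^esub> antipode H (\<phi> (gen 2 j)) =
        (if i = j then \<one>\<^bsub>A\<^esub> else \<zero>\<^bsub>A\<^esub>)"
    and a: "a \<in> carrier A"
  shows "antipode H (\<phi> a) = \<phi> (antipode H a)"
proof -
  interpret \<phi>: algebra_map A A \<phi> by (rule algebra_map_A[OF assoc_algebra_suzuki_algebra \<phi>])
  define V W where "V i j = \<phi> (antipode H (gen i j))" and "W i j = antipode H (\<phi> (gen i j))" for i j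
  have closed: "V i j \<in> carrier A" "W i j \<in> carrier A" "\<phi> (gen i j) \<in> carrier A"
    if "i \<in> {1, 2}" "j \<in> {1, 2}" for i j
    using gen_closed[OF that] by (simp_all add: V_def W_def)
  have 12: "1 \<in> {1, 2::nat}" "2 \<in> {1, 2::nat}" by simp_all
  have left: "V i 1 \<otimes>\<^bsub>A\<^esub> \<phi> (gen 1 j) \<oplus>\<^bsub>A\<^esub> V i 2 \<otimes>\<^bsub>A\<^esub> \<phi> (gen 2 j) = (if i = j then \<one>\<^bsub>A\<^esub> else \<zero>\<^bsub>A\<^esub>)"
    if ij: "i \<in> {1, 2}" "j \<in> {1, 2}" for i j
    using arg_cong[OF antipode_gen_mult[OF ij], of \<phi>]
      gen_closed[OF ij(1) 12(1)] gen_closed[OF ij(1) 12(2)] gen_closed[OF 12(1) ij(2)] gen_closed[OF 12(2) ij(2)]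
    by (simp add: \<phi>.add \<phi>.mult V_def if_distrib del: One_nat_def cong: if_cong)
  have "V i j = W i j" if ij: "i \<in> {1, 2}" "j \<in> {1, 2}" for i j
  proof -
    note c = closed[OF ij(1) 12(1)] closed[OF ij(1) 12(2)] closed[OF 12(1) ij(2)] closed[OF 12(2) ij(2)]
      closed[OF 12(1) 12(1)] closed[OF 12(1) 12(2)] closed[OF 12(2) 12(1)] closed[OF 12(2) 12(2)]
    have "V i 1 \<otimes>\<^bsub>A\<^esub> (\<phi> (gen 1 1) \<otimes>\<^bsub>A\<^esub> W 1 j \<oplus>\<^bsub>A\<^esub> \<phi> (gen 1 2) \<otimes>\<^bsub>A\<^esub> W 2 j) \<oplus>\<^bsub>A\<^esub>
        V i 2 \<otimes>\<^bsub>A\<^esub> (\<phi> (gen 2 1) \<otimes>\<^bsub>A\<^esub> W 1 j \<oplus>\<^bsub>A\<^esub> \<phi> (gen 2 2) \<otimes>\<^bsub>A\<^esub> W 2 j) =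
      (V i 1 \<otimes>\<^bsub>A\<^esub> \<phi> (gen 1 1) \<oplus>\<^bsub>A\<^esub> V i 2 \<otimes>\<^bsub>A\<^esub> \<phi> (gen 2 1)) \<otimes>\<^bsub>A\<^esub> W 1 j \<oplus>\<^bsub>A\<^esub>
      (V i 1 \<otimes>\<^bsub>A\<^esub> \<phi> (gen 1 2) \<oplus>\<^bsub>A\<^esub> V i 2 \<otimes>\<^bsub>A\<^esub> \<phi> (gen 2 2)) \<otimes>\<^bsub>A\<^esub> W 2 j"
      using c by (simp add: A.l_distr A.r_distr A.m_assoc A.a_ac del: One_nat_def)
    then have "V i 1 \<otimes>\<^bsub>A\<^esub> (if 1 = j then \<one>\<^bsub>A\<^esub> else \<zero>\<^bsub>A\<^esub>) \<oplus>\<^bsub>A\<^esub> V i 2 \<otimes>\<^bsub>A\<^esub> (if 2 = j then \<one>\<^bsub>A\<^esub> else \<zero>\<^bsub>A\<^esub>) =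
      (if i = 1 then \<one>\<^bsub>A\<^esub> else \<zero>\<^bsub>A\<^esub>) \<otimes>\<^bsub>A\<^esub> W 1 j \<oplus>\<^bsub>A\<^esub> (if i = 2 then \<one>\<^bsub>A\<^esub> else \<zero>\<^bsub>A\<^esub>) \<otimes>\<^bsub>A\<^esub> W 2 j"
      unfolding W_def right[OF 12(1) ij(2)] right[OF 12(2) ij(2)] left[OF ij(1) 12(1)] left[OF ij(1) 12(2)] .
    then show ?thesis using ij c by (auto simp del: One_nat_def)
  qed
  then have gens: "antipode H (\<phi> (gen i j)) = \<phi> (antipode H (gen i j))" if "i \<in> {1, 2}" "j \<in> {1, 2}" for i j
    using that unfolding V_def W_def by metis
  have "(\<lambda>a. antipode H (\<phi> a)) \<in> algebra_hom A (opposite_algebra A)"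
    "(\<lambda>a. \<phi> (antipode H a)) \<in> algebra_hom A (opposite_algebra A)"
    by (auto simp: algebra_hom_def opposite_algebra_def antipode_add antipode_mult antipode_smult antipode_one
        \<phi>.add \<phi>.mult \<phi>.smult intro!: ring_hom_memI)
  then show ?thesis
    by (rule hom_ext[OF assoc_algebra_opposite[OF assoc_algebra_suzuki_algebra]]) (fact gens, fact a)
qed

section \<open>Bijectivity from surjectivity by finite dimension\<close>

lemma functional_expansion:
  assumes f: "linear_functional A f" and a: "a \<in> carrier A"
  shows "f a = (\<Sum>p\<in>reps \<times> UNIV. coord (delta' p) a * f (elt' p))"
  using a
proof (induct a rule: span_induct)
  case (add a a')
  then show ?case
    using f by (simp add: linear_functional_def coord_add quasi_periodic_delta distrib_right sum.distrib)
next
  case (smult c a)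
  then show ?case
    using f by (simp add: linear_functional_def coord_smult quasi_periodic_delta sum_distrib_left mult.assoc)
next
  case (elt g d)
  have "(\<Sum>p\<in>reps \<times> UNIV. delta' p g d * f (elt' p)) = (\<Sum>p\<in>{(rep g, d)}. delta' p g d * f (elt' p))"
  proof (rule sum.mono_neutral_right)
    show "\<forall>p\<in>reps \<times> UNIV - {(rep g, d)}. delta' p g d * f (elt' p) = 0"
    proof
      fix p assume p: "p \<in> reps \<times> UNIV - {(rep g, d)}"
      then have "delta' p g d = 0"
        using delta_reps[of "fst p" d g] by (cases "snd p = d") (auto simp: prod_eq_iff)
      then show "delta' p g d * f (elt' p) = 0" by simp
    qed
  qed (use rep_reps in auto)
  also have "\<dots> = f (elt g d)"
    using f elt_rep[of g d] by (metis (no_types, lifting) A.closed fst_conv snd_conv linear_functional_def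
        sum.empty sum.insert finite.emptyI empty_iff add.right_neutral)
  finally show ?case by (simp add: quasi_periodic_delta)
qed

lemma coord_delta_reps:
  assumes "p \<in> reps \<times> UNIV" "q \<in> reps \<times> UNIV"
  shows "delta' p (fst q) (snd q) = (if p = q then 1 else 0)"
proof -
  have "rep (fst q) = fst q" using assms(2) by (auto simp: reps_def rep_def)
  then show ?thesis
    using delta_reps[of "fst p" "snd p" "fst q"] assms(1) by (cases "snd p = snd q") (auto simp: prod_eq_iff)
qed

text \<open>Preimages of the basis elements provide a right inverse of the matrix of \<phi>. It is
  also a left inverse, so the coordinates of an element can be recovered from those of its
  image.\<close>

lemma surj_imp_inj:
  assumes \<phi>: "\<phi> \<in> algebra_hom A A" and surj: "\<phi> ` carrier A = carrier A"
  shows "inj_on \<phi> (carrier A)"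
proof -
  interpret \<phi>: algebra_map A A \<phi> by (rule algebra_map_A[OF assoc_algebra_suzuki_algebra \<phi>])
  let ?I = "reps \<times> (UNIV :: bool set)"
  have "\<exists>a\<in>carrier A. \<phi> a = elt' p" for p
  proof -
    have "elt' p \<in> \<phi> ` carrier A" using surj by simp
    then show ?thesis by (metis imageE)
  qed
  then obtain s where s: "\<And>p. s p \<in> carrier A" "\<And>p. \<phi> (s p) = elt' p" by metis
  have lin: "linear_functional A (\<lambda>a. coord (delta' p) (\<phi> a))" for p
    by (auto simp: linear_functional_def \<phi>.add \<phi>.smult coord_add coord_smult quasi_periodic_delta)
  have inv: "(\<Sum>q\<in>?I. coord (delta' q) (s r) * coord (delta' p) (\<phi> (elt' q))) = (if p = r then 1 else 0)"
    if "p \<in> ?I" "r \<in> ?I" for p r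
    using functional_expansion[OF lin s(1)[of r], of p] s(2)[of r] coord_delta_reps[OF that]
    by (simp add: quasi_periodic_delta)
  have inv': "(\<Sum>q\<in>?I. coord (delta' p) (s q) * coord (delta' q) (\<phi> (elt' r))) = (if p = r then 1 else 0)"
    if "p \<in> ?I" "r \<in> ?I" for p r
    using left_inverse_matrix[where I = ?I and M = "\<lambda>p q. coord (delta' p) (\<phi> (elt' q))"
        and M' = "\<lambda>q r. coord (delta' q) (s r)", OF _ _ that] inv
    by (simp add: mult.commute)
  have recover: "coord (delta' p) a = (\<Sum>q\<in>?I. coord (delta' p) (s q) * coord (delta' q) (\<phi> a))"
    if p: "p \<in> ?I" and a: "a \<in> carrier A" for p a
  proof -
    have "(\<Sum>q\<in>?I. coord (delta' p) (s q) * coord (delta' q) (\<phi> a)) =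
      (\<Sum>q\<in>?I. \<Sum>r\<in>?I. coord (delta' r) a * (coord (delta' p) (s q) * coord (delta' q) (\<phi> (elt' r))))"
      by (intro sum.cong refl) (simp add: functional_expansion[OF lin a] sum_distrib_left mult.left_commute)
    also have "\<dots> = (\<Sum>r\<in>?I. coord (delta' r) a * (\<Sum>q\<in>?I. coord (delta' p) (s q) * coord (delta' q) (\<phi> (elt' r))))"
      by (subst sum.swap) (simp add: sum_distrib_left)
    also have "\<dots> = (\<Sum>r\<in>?I. if p = r then coord (delta' r) a else 0)"
      using inv'[OF p] by (intro sum.cong) auto
    also have "\<dots> = coord (delta' p) a" using p by simp
    finally show ?thesis ..
  qed
  show ?thesis
  proof (rule inj_onI)
    fix a a' assume *: "a \<in> carrier A" "a' \<in> carrier A" "\<phi> a = \<phi> a'"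
    have "coord (delta' p) a = coord (delta' p) a'" if "p \<in> ?I" for p
      using recover[OF that] * by simp
    then have "(\<Oplus>\<^bsub>A\<^esub>p\<in>?I. coord (delta' p) a \<odot>\<^bsub>A\<^esub> elt' p) = (\<Oplus>\<^bsub>A\<^esub>p\<in>?I. coord (delta' p) a' \<odot>\<^bsub>A\<^esub> elt' p)"
      by (intro A.finsum_cong') auto
    then show "a = a'" using expansion[OF *(1)] expansion[OF *(2)] by simp
  qed
qed

lemma hopf_auto_iff:
  "\<phi> \<in> hopf_auto H \<longleftrightarrow> \<phi> \<in> algebra_hom A A \<and> \<phi> \<in> Bij (carrier A) \<and>
    (\<forall>a\<in>carrier A. comult H (\<phi> a) = tensor_map A A A A \<phi> \<phi> (comult H a) \<and>
      counit H (\<phi> a) = counit H a \<and> antipode H (\<phi> a) = \<phi> (antipode H a))"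
  by (simp add: hopf_auto_def algebra_hom_suzuki suzuki_simps tensor_map_suzuki)

lemma hopf_auto_ext:
  assumes "\<phi> \<in> hopf_auto H" "\<psi> \<in> hopf_auto H"
    "\<And>i j. \<lbrakk>i \<in> {1, 2}; j \<in> {1, 2}\<rbrakk> \<Longrightarrow> \<phi> (gen i j) = \<psi> (gen i j)"
  shows "\<phi> = \<psi>"
proof (rule extensionalityI)
  show "\<phi> \<in> extensional (carrier A)" "\<psi> \<in> extensional (carrier A)"
    using assms(1,2) Bij_imp_extensional by (auto simp: hopf_auto_iff)
  show "\<phi> a = \<psi> a" if "a \<in> carrier A" for a
    using assms(1,2) hom_ext[where h = \<phi> and h' = \<psi>, OF assoc_algebra_suzuki_algebra _ _ assms(3) that]
    unfolding hopf_auto_iff by blast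
qed

text \<open>Everything is checked on the images \<open>y\<close> of the generators. The condition on
  the antipode says that its values form a right inverse of the matrix \<open>y\<close>, as
  \<open>antipode_commute\<close> requires. Surjectivity is stated for all suitable \<phi> because
  the homomorphism is only constructed inside the proof.\<close>

lemma hopf_auto_exists:
  assumes rel: "suzuki_relations N n mu lam A y"
    and comult: "\<And>i j F G. \<lbrakk>i \<in> {1, 2}; j \<in> {1, 2}; quasi_periodic F; quasi_periodic G\<rbrakk> \<Longrightarrow>
      coord (conv F G) (y i j) = coord F (y i 1) * coord G (y 1 j) + coord F (y i 2) * coord G (y 2 j)"
    and counit: "\<And>i j. \<lbrakk>i \<in> {1, 2}; j \<in> {1, 2}\<rbrakk> \<Longrightarrow> coord counit_function (y i j) = (if i = j then 1 else 0)"
    and antipode: "\<And>i j. \<lbrakk>i \<in> {1, 2}; j \<in> {1, 2}\<rbrakk> \<Longrightarrow>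
      y i 1 \<otimes>\<^bsub>A\<^esub> antipode H (y 1 j) \<oplus>\<^bsub>A\<^esub> y i 2 \<otimes>\<^bsub>A\<^esub> antipode H (y 2 j) = (if i = j then \<one>\<^bsub>A\<^esub> else \<zero>\<^bsub>A\<^esub>)"
    and surj: "\<And>\<phi> i j. \<lbrakk>\<phi> \<in> algebra_hom A A; \<And>i j. \<lbrakk>i \<in> {1, 2}; j \<in> {1, 2}\<rbrakk> \<Longrightarrow> \<phi> (gen i j) = y i j;
      i \<in> {1, 2}; j \<in> {1, 2}\<rbrakk> \<Longrightarrow> gen i j \<in> \<phi> ` carrier A"
  shows "\<exists>!\<phi>. \<phi> \<in> hopf_auto H \<and> (\<forall>i\<in>{1,2}. \<forall>j\<in>{1,2}. \<phi> (gen i j) = y i j)"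
proof -
  define \<phi> where "\<phi> = suzuki_hom N n mu lam A y"
  have \<phi>: "\<phi> \<in> algebra_hom A A" and gens: "\<phi> (gen i j) = y i j" if "i \<in> {1, 2}" "j \<in> {1, 2}" for i j
    unfolding \<phi>_def using suzuki_hom[OF assoc_algebra_suzuki_algebra rel] that by auto
  have \<phi>: "\<phi> \<in> algebra_hom A A"
    unfolding \<phi>_def using suzuki_hom[OF assoc_algebra_suzuki_algebra rel] by auto
  have 12: "1 \<in> {1, 2::nat}" "2 \<in> {1, 2::nat}" by simp_all
  interpret \<phi>: algebra_map A A \<phi> by (rule algebra_map_A[OF assoc_algebra_suzuki_algebra \<phi>])
  have image: "a \<in> \<phi> ` carrier A" if "a \<in> carrier A" for a
    using that
  proof (induct a rule: suzuki_algebra_induct)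
    case (add a a')
    then show ?case by (auto simp flip: \<phi>.add)
  next
    case (smult c a)
    then show ?case by (auto simp flip: \<phi>.smult)
  next
    case one
    show ?case using \<phi>.one by (metis A.one_closed imageI)
  next
    case (mult i j a)
    have "gen i j \<in> \<phi> ` carrier A" by (rule surj[OF \<phi> gens mult(1,2)])
    then show ?case using mult(4) by (auto simp flip: \<phi>.mult)
  qed
  have surj': "\<phi> ` carrier A = carrier A" using image by auto
  have "\<phi> \<in> extensional (carrier A)"
    by (simp add: \<phi>_def suzuki_hom_def presented_hom_def induced_map_def suzuki_algebra_def)
  then have bij: "\<phi> \<in> Bij (carrier A)"
    using surj' surj_imp_inj[OF \<phi> surj'] by (simp add: Bij_def bij_betw_def)
  have comult': "\<forall>a\<in>carrier A. comult H (\<phi> a) = tensor_map A A A A \<phi> \<phi> (comult H a)"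
    unfolding comult_commute_iff[OF \<phi>]
  proof (intro ballI allI impI)
    fix i j :: nat and F G assume ij: "i \<in> {1, 2}" "j \<in> {1, 2}" and "quasi_periodic F \<and> quasi_periodic G"
    then show "coord (conv F G) (\<phi> (gen i j)) =
        coord F (\<phi> (gen i 1)) * coord G (\<phi> (gen 1 j)) + coord F (\<phi> (gen i 2)) * coord G (\<phi> (gen 2 j))"
      using comult[OF ij, of F G] gens[OF ij] gens[OF ij(1) 12(1)] gens[OF ij(1) 12(2)] gens[OF 12(1) ij(2)]
        gens[OF 12(2) ij(2)] by (simp del: One_nat_def)
  qed
  have counit': "counit H (\<phi> a) = counit H a" if a: "a \<in> carrier A" for a
  proof -
    interpret c: algebra_map A ground_algebra "counit H"
      by (rule algebra_map_A[OF assoc_algebra_ground counit_hom])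
    have hom: "(\<lambda>a. counit H (\<phi> a)) \<in> algebra_hom A ground_algebra"
      using c.add c.mult c.smult c.one
      by (auto simp: algebra_hom_def \<phi>.add \<phi>.mult \<phi>.smult intro!: ring_hom_memI)
    have "counit H (\<phi> (gen i j)) = counit H (gen i j)" if ij: "i \<in> {1, 2}" "j \<in> {1, 2}" for i j
      using counit[OF ij] gens[OF ij] counit_coord[of "y i j"] \<phi>.closed[OF gen_closed[OF ij]] ij
      by (simp add: gen_eq[OF ij] counit_elt)
    then show ?thesis
      by (rule hom_ext[OF assoc_algebra_ground hom counit_hom _ a])
  qed
  have antipode': "antipode H (\<phi> a) = \<phi> (antipode H a)" if "a \<in> carrier A" for a
  proof (rule antipode_commute[OF \<phi> _ that])
    fix i j :: nat assume ij: "i \<in> {1, 2}" "j \<in> {1, 2}"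
    show "\<phi> (gen i 1) \<otimes>\<^bsub>A\<^esub> antipode H (\<phi> (gen 1 j)) \<oplus>\<^bsub>A\<^esub> \<phi> (gen i 2) \<otimes>\<^bsub>A\<^esub> antipode H (\<phi> (gen 2 j)) =
        (if i = j then \<one>\<^bsub>A\<^esub> else \<zero>\<^bsub>A\<^esub>)"
      using antipode[OF ij] gens[OF ij(1) 12(1)] gens[OF ij(1) 12(2)] gens[OF 12(1) ij(2)] gens[OF 12(2) ij(2)]
      by (simp del: One_nat_def)
  qed
  have "\<phi> \<in> hopf_auto H"
    using \<phi> bij comult' counit' antipode' by (simp add: hopf_auto_iff)
  then show ?thesis
  proof (intro ex1I[of _ \<phi>] conjI ballI)
    show "\<phi> (gen i j) = y i j" if "i \<in> {1, 2}" "j \<in> {1, 2}" for i j using that by (rule gens)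
  next
    fix \<psi> assume \<psi>: "\<psi> \<in> hopf_auto H \<and> (\<forall>i\<in>{1, 2}. \<forall>j\<in>{1, 2}. \<psi> (gen i j) = y i j)"
    show "\<psi> = \<phi>"
    proof (rule hopf_auto_ext)
      fix i j :: nat assume ij: "i \<in> {1, 2}" "j \<in> {1, 2}"
      then have "\<psi> (gen i j) = y i j" using \<psi> by blast
      then show "\<psi> (gen i j) = \<phi> (gen i j)" by (simp only: gens[OF ij])
    qed (use \<psi> \<open>\<phi> \<in> hopf_auto H\<close> in auto)
  qed
qed

end

section \<open>Existence of the automorphisms\<close>

context suzuki_parameters
begin

lemma sign_nonzero: "component_sign mu d \<noteq> 0" "component_sign lam d \<noteq> 0"
  using component_sign_square by (metis mult_zero_left zero_neq_one)+

lemma elt_shift_multiple: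
  "elt (Dih (k * int N) 0 False + h) d = sign_power mu d k \<odot>\<^bsub>A\<^esub> elt h d"
  "elt (Dih 0 (k * int n) False + h) d = sign_power lam d k \<odot>\<^bsub>A\<^esub> elt h d"
  using involution_shift[of "\<lambda>g. elt g d" "int N" 0 "\<lambda>y. component_sign mu d \<odot>\<^bsub>A\<^esub> y" k h]
    involution_shift[of "\<lambda>g. elt g d" 0 "int n" "\<lambda>y. component_sign lam d \<odot>\<^bsub>A\<^esub> y" k h]
  by (auto simp: elt_shift sign_power_def A.smult_smult)

lemma elt_congruent:
  assumes "i' = i + k * int N" "j' = j + l * int n"
  shows "elt (Dih i' j' e) d = (sign_power mu d k * sign_power lam d l) \<odot>\<^bsub>A\<^esub> elt (Dih i j e) d"
proof -
  have "Dih i' j' e = Dih (k * int N) 0 False + (Dih 0 (l * int n) False + Dih i j e)"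
    using assms by simp
  then show ?thesis by (simp only: elt_shift_multiple) (simp add: A.smult_smult)
qed

text \<open>For \<open>s = 0\<close> the powers would be the unit of the whole algebra instead of
  the unit of a component; this is why \<open>s\<close> ranges over \<open>1, ..., N\<close> in the
  classification.\<close>

lemma gen_even_power:
  assumes "s \<ge> 1"
  shows "gen 1 1 [^]\<^bsub>A\<^esub> (2 * s) = elt (Dih (int s) 0 False) False"
    and "gen 1 2 [^]\<^bsub>A\<^esub> (2 * s) = elt (Dih (int s) 0 False) True"
  using A.double[of dih_u _ "s - 1"] assms by (simp_all add: gen_simps) (simp_all add: dih_defs)

lemma chi_eq:
  assumes "t \<ge> 1" "i \<in> {1, 2}" "j \<in> {1, 2}"
  shows "suzuki_chi N n mu lam i j t = elt (dih_alt (i = 2) t) (i \<noteq> j)"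
proof -
  obtain t' where t: "t = Suc t'" using assms(1) by (cases t) auto
  show ?thesis
    unfolding suzuki_chi_def suzuki_alternating t
    by (rule alternating_family) (use assms(2,3) A.monoid_axioms elt_spec in auto)
qed

text \<open>The common form of \<Psi> and \<Phi>. They differ in the base point: \<open>z^s\<close>
  times the alternating word with \<open>t\<close> letters that starts with \<open>u\<close> for
  \<Psi> and with \<open>v\<close> for \<Phi>.\<close>

definition monomial_auto where
  "monomial_auto g d \<phi> \<longleftrightarrow> \<phi> \<in> hopf_auto H \<and>
    \<phi> (gen 1 1) = elt g False \<and> \<phi> (gen 2 2) = elt (dih_swap g) False \<and>
    \<phi> (gen 1 2) = d \<odot>\<^bsub>A\<^esub> elt g True \<and> \<phi> (gen 2 1) = inverse d \<odot>\<^bsub>A\<^esub> elt (dih_swap g) True"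

definition word_point :: "nat \<Rightarrow> nat \<Rightarrow> bool \<Rightarrow> dih" where
  "word_point s t b = Dih (int s) 0 False + dih_alt b t"

lemma dih_swap_word_point: "dih_swap (word_point s t b) = word_point s t (\<not> b)"
  by (cases "even t") (auto simp: word_point_def dih_alt_def elim!: evenE oddE)

lemma is_Psi_iff:
  assumes "s \<ge> 1" "t \<ge> 1"
  shows "is_Psi N n mu lam s t d \<phi> \<longleftrightarrow> monomial_auto (word_point s t False) d \<phi>"
proof -
  have 12: "1 \<in> {1, 2::nat}" "2 \<in> {1, 2::nat}" by simp_all
  note chi = chi_eq[OF assms(2) 12(1) 12(1)] chi_eq[OF assms(2) 12(1) 12(2)]
    chi_eq[OF assms(2) 12(2) 12(1)] chi_eq[OF assms(2) 12(2) 12(2)]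
  show ?thesis
    unfolding is_Psi_def Let_def monomial_auto_def suzuki_simps suzuki_pow gen_even_power[OF assms(1)] chi
    by (simp add: dih_swap_word_point) (simp add: word_point_def)
qed

lemma is_Phi_iff:
  assumes "s \<ge> 1" "t \<ge> 1"
  shows "is_Phi N n mu lam s t d \<phi> \<longleftrightarrow> monomial_auto (word_point s t True) d \<phi>"
proof -
  have 12: "1 \<in> {1, 2::nat}" "2 \<in> {1, 2::nat}" by simp_all
  note chi = chi_eq[OF assms(2) 12(1) 12(1)] chi_eq[OF assms(2) 12(1) 12(2)]
    chi_eq[OF assms(2) 12(2) 12(1)] chi_eq[OF assms(2) 12(2) 12(2)]
  show ?thesis
    unfolding is_Phi_def Let_def monomial_auto_def suzuki_simps suzuki_pow gen_even_power[OF assms(1)] chi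
    by (simp add: dih_swap_word_point) (simp add: word_point_def)
qed

lemma coprime_solve:
  fixes p m c :: int
  assumes "coprime p m"
  obtains i k where "i * p = c + k * m"
proof -
  obtain u v where "u * p + v * m = 1"
    using bezout_int[of p m] assms by (auto simp: coprime_iff_gcd_eq_1)
  then have "(c * u) * p = c + (- c * v) * m" by (simp add: algebra_simps) (metis distrib_left mult.commute mult_1 add.commute)
  then show thesis by (rule that)
qed

text \<open>Sending \<open>u\<close> to \<open>g\<close> and \<open>v\<close> to its swap extends to
  an endomorphism of the infinite group, twisted in the second component by a character with the
  values \<open>d\<close> and \<open>inverse d\<close>. The conditions on \<open>d\<close> make the
  character well defined and trivial on \<open>z^N\<close> and \<open>r^n\<close>; the coprimality
  conditions make the endomorphism surjective modulo these two elements.\<close>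

lemma monomial_auto_exists:
  assumes g: "g = Dih i j True" and N_coprime: "coprime (2 * i + 1) (int N)"
    and n_coprime: "coprime (2 * j + 1) (int n)"
    and d4: "d ^ 4 = 1" and d2N: "d ^ (2 * N) = 1" and d2n: "d ^ (2 * n) = 1"
  shows "\<exists>!\<phi>. monomial_auto g d \<phi>"
proof -
  have d0: "d \<noteq> 0" using d4 by auto
  define c where "c k = d powi k" for k
  have c_add: "c (k + l) = c k * c l" for k l using d0 by (simp add: c_def power_int_add)
  have c4: "c (4 * k) = 1" for k
    using d4 by (simp add: c_def power_int_mult)
  have c_minus: "c (k - 4 * l) = c k" for k l
    using c_add[of "k - 4 * l" "4 * l"] c4[of l] by simp
  \<comment> \<open>Forced by the images of the letters: \<open>z\<close> goes to its power
    \<open>2 * i + 1\<close>, \<open>r\<close> to its power \<open>2 * j + 1\<close>, and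
    \<open>u\<close> to \<open>g\<close>.\<close>
  define \<eta> where "\<eta> h = (case h of Dih i' j' e \<Rightarrow>
    Dih (i' * (2 * i + 1) + (if e then i else 0)) ((2 * j + 1) * j' + (if e then j else 0)) e)" for h
  \<comment> \<open>Both \<open>z = u u\<close> and \<open>r = u v^-1\<close> have weight
    \<open>d ^ 2\<close>. Since \<open>u\<close> inverts \<open>r\<close>, the exponent is additive
    only modulo 4, which is where \<open>d ^ 4 = 1\<close> enters.\<close>
  define \<chi> where "\<chi> h = (case h of Dih i' j' e \<Rightarrow> c (2 * i' + 2 * j' + (if e then 1 else 0)))" for h
  have \<eta>_add: "\<eta> (h + h') = \<eta> h + \<eta> h'" for h h'
    by (cases h; cases h') (auto simp: \<eta>_def algebra_simps)
  have \<chi>_add: "\<chi> (h + h') = \<chi> h * \<chi> h'" for h h'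
  proof -
    obtain p q e where h: "h = Dih p q e" by (cases h)
    obtain p' q' e' where h': "h' = Dih p' q' e'" by (cases h')
    have eq: "2 * (p + p' + (if e \<and> e' then 1 else 0)) + 2 * (if e then q - q' else q + q') + (if e \<noteq> e' then 1 else 0) =
        (2 * p + 2 * q + (if e then 1 else 0)) + (2 * p' + 2 * q' + (if e' then 1 else 0)) - 4 * (if e then q' else 0)"
      by auto
    show ?thesis
      unfolding h h' \<chi>_def plus_dih.simps dih.case eq c_minus by (rule c_add)
  qed
  have \<eta>_u: "\<eta> dih_u = g" "\<eta> dih_v = dih_swap g" by (simp_all add: \<eta>_def dih_defs g)
  have \<chi>_u: "\<chi> dih_u = d" "\<chi> dih_v = inverse d" by (simp_all add: \<chi>_def dih_defs c_def)
  have \<chi>_N: "\<chi> (Dih (int N) 0 False) = 1" "\<chi> (Dih 0 (int n) False) = 1"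
    using d2N d2n unfolding \<chi>_def c_def by (simp_all flip: power_int_of_nat)
  define \<beta> where "\<beta> h x = (if x then \<chi> h else 1) \<odot>\<^bsub>A\<^esub> elt (\<eta> h) x" for h x
  have odd: "odd (2 * i + 1)" "odd (2 * j + 1)" by simp_all
  have \<eta>_N: "\<eta> (Dih (int N) 0 False) = Dih ((2 * i + 1) * int N) 0 False"
    "\<eta> (Dih 0 (int n) False) = Dih 0 ((2 * j + 1) * int n) False" by (simp_all add: \<eta>_def mult.commute)
  have \<beta>: "suzuki_family N n mu lam A \<beta>"
  proof (rule suzuki_familyI[OF assoc_algebra_suzuki_algebra])
    show "\<beta> (Dih (int N) 0 False + h) x = component_sign mu x \<odot>\<^bsub>A\<^esub> \<beta> h x" for h x
      unfolding \<beta>_def \<eta>_add \<chi>_add \<eta>_N \<chi>_N elt_shift_multiple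
      by (simp add: A.smult_smult sign_power_def mult.commute)
    show "\<beta> (Dih 0 (int n) False + h) x = component_sign lam x \<odot>\<^bsub>A\<^esub> \<beta> h x" for h x
      unfolding \<beta>_def \<eta>_add \<chi>_add \<eta>_N \<chi>_N elt_shift_multiple
      by (simp add: A.smult_smult sign_power_def mult.commute)
    have "\<eta> 0 = 0" "\<chi> 0 = 1" by (simp_all add: \<eta>_def \<chi>_def zero_dih_def c_def)
    then show "\<beta> 0 False \<oplus>\<^bsub>A\<^esub> \<beta> 0 True = \<one>\<^bsub>A\<^esub>" by (simp add: \<beta>_def A.sum_one)
  qed (auto simp: \<beta>_def A.smult_mult_left A.smult_mult_right A.smult_smult \<eta>_add \<chi>_add mult.commute)
  interpret b: family N n mu lam A \<beta>
    using \<beta> by unfold_locales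
  have y: "family_generators \<beta> i j = (if i \<noteq> j then (if i = 1 then d else inverse d) else 1) \<odot>\<^bsub>A\<^esub>
      elt (if i = 1 then g else dih_swap g) (i \<noteq> j)" for i j
    by (auto simp: family_generators_def \<beta>_def \<eta>_u \<chi>_u)
  have 12: "1 \<in> {1, 2::nat}" "2 \<in> {1, 2::nat}" by simp_all
  have "\<exists>!\<phi>. \<phi> \<in> hopf_auto H \<and> (\<forall>i\<in>{1,2}. \<forall>j\<in>{1,2}. \<phi> (gen i j) = family_generators \<beta> i j)"
  proof (rule hopf_auto_exists[OF b.relations])
    fix i j :: nat and F G assume ij: "i \<in> {1, 2}" "j \<in> {1, 2}" and FG: "quasi_periodic F" "quasi_periodic G"
    then show "coord (conv F G) (family_generators \<beta> i j) =
        coord F (family_generators \<beta> i 1) * coord G (family_generators \<beta> 1 j) +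
        coord F (family_generators \<beta> i 2) * coord G (family_generators \<beta> 2 j)"
      using d0 tensor_coord_comult(1)[OF FG]
      by (auto simp: y coord_smult conv_def algebra_simps)
  next
    fix i j :: nat assume ij: "i \<in> {1, 2}" "j \<in> {1, 2}"
    then show "coord counit_function (family_generators \<beta> i j) = (if i = j then 1 else 0)"
      by (auto simp: y coord_smult quasi_periodic_counit counit_function_def)
    show "family_generators \<beta> i 1 \<otimes>\<^bsub>A\<^esub> antipode H (family_generators \<beta> 1 j) \<oplus>\<^bsub>A\<^esub>
        family_generators \<beta> i 2 \<otimes>\<^bsub>A\<^esub> antipode H (family_generators \<beta> 2 j) = (if i = j then \<one>\<^bsub>A\<^esub> else \<zero>\<^bsub>A\<^esub>)"
      using ij d0
      by (auto simp: y antipode_smult antipode_elt dih_twist_def dih_swap_uminus A.smult_mult_left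
          A.smult_mult_right A.smult_smult A.sum_one A.a_comm[of "elt 0 True"])
  next
    fix \<phi> and i' j' :: nat assume \<phi>: "\<phi> \<in> algebra_hom A A"
      and gens: "\<And>i j. \<lbrakk>i \<in> {1, 2}; j \<in> {1, 2}\<rbrakk> \<Longrightarrow> \<phi> (gen i j) = family_generators \<beta> i j"
      and ij: "i' \<in> {1, 2}" "j' \<in> {1, 2}"
    interpret \<phi>: algebra_map A A \<phi> by (rule algebra_map_A[OF assoc_algebra_suzuki_algebra \<phi>])
    have "(\<lambda>g x. \<phi> (elt g x)) = \<beta>"
    proof (rule b.ext)
      show "suzuki_family N n mu lam A (\<lambda>g x. \<phi> (elt g x))"
        by (rule algebra_map_family[OF \<phi>.algebra_map_axioms A.family])
      show "\<phi> (elt dih_u x) = \<beta> dih_u x" "\<phi> (elt dih_v x) = \<beta> dih_v x" for x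
        using gens[OF 12(1) 12(1)] gens[OF 12(1) 12(2)] gens[OF 12(2) 12(1)] gens[OF 12(2) 12(2)]
        by (cases x; simp add: gen_simps family_generators_def)+
    qed
    then have val: "\<phi> (elt h x) = \<beta> h x" for h x by metis
    obtain p q x where x: "gen i' j' = elt (Dih p q True) x"
    proof -
      have "(if i' = 1 then dih_u else dih_v) = Dih 0 (if i' = 1 then 0 else - 1) True"
        by (simp add: dih_defs)
      then show thesis using that gen_eq[OF ij] by metis
    qed
    \<comment> \<open>Together with the next line this solves for a point that the endomorphism maps
      to the generator up to multiples of \<open>N\<close> and \<open>n\<close>, hence up to the
      nonzero scalar \<open>s\<close> below.\<close>
    obtain p' k where p': "p' * (2 * i + 1) = (p - i) + k * int N" by (rule coprime_solve[OF N_coprime])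
    obtain q' l where q': "q' * (2 * j + 1) = (q - j) + l * int n" by (rule coprime_solve[OF n_coprime])
    have eta: "\<eta> (Dih p' q' True) = Dih (p + k * int N) (q + l * int n) True"
      using p' q' by (simp add: \<eta>_def mult.commute)
    define s where "s = (if x then \<chi> (Dih p' q' True) else 1) * (sign_power mu x k * sign_power lam x l)"
    have "s \<noteq> 0" using d0 sign_nonzero by (auto simp: s_def \<chi>_def c_def sign_power_def)
    have "\<phi> (elt (Dih p' q' True) x) = s \<odot>\<^bsub>A\<^esub> gen i' j'"
      unfolding val \<beta>_def eta x
      by (subst elt_congruent[where i = p and j = q]) (auto simp: A.smult_smult s_def)
    then have "\<phi> (inverse s \<odot>\<^bsub>A\<^esub> elt (Dih p' q' True) x) = gen i' j'"
      using \<open>s \<noteq> 0\<close> gen_closed[OF ij] by (simp add: \<phi>.smult A.smult_smult)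
    then show "gen i' j' \<in> \<phi> ` carrier A" by (metis A.closed A.smult_closed imageI)
  qed
  moreover have "(\<phi> \<in> hopf_auto H \<and> (\<forall>i\<in>{1,2}. \<forall>j\<in>{1,2}. \<phi> (gen i j) = family_generators \<beta> i j)) \<longleftrightarrow>
      monomial_auto g d \<phi>" for \<phi>
    unfolding monomial_auto_def y by auto
  ultimately show ?thesis by simp
qed

text \<open>Alternative (b) has \<open>t = 1\<close> and \<open>n = 2\<close> and satisfies the same
  coprimality conditions as (a), so both are treated at once. The two conditions modulo
  \<open>n\<close> are for the base points of \<Psi> and \<Phi>, whose second coordinates are
  \<open>k\<close> and \<open>- (k + 1)\<close>.\<close>

lemma Psi_Phi_coprime:
  assumes "Psi_Phi_condition N n s t d" "t \<ge> 1"
  obtains k where "t = 2 * k + 1" "coprime (2 * int (s + k) + 1) (int N)" "coprime (2 * int k + 1) (int n)"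
    "coprime (2 * (- int (k + 1)) + 1) (int n)" "d ^ 4 = 1" "d ^ (2 * N) = 1" "d ^ (2 * n) = 1"
proof -
  have t: "odd t" "gcd N (2 * s + t) = 1" "gcd t n = 1"
    and d: "if even n then d ^ (2 * N) = 1 \<and> d ^ 4 = 1 else d ^ 2 = 1"
    using assms by (auto simp: Psi_Phi_condition_def gcd.commute)
  obtain k where k: "t = 2 * k + 1" using t(1) by (auto elim: oddE)
  have N: "2 * int (s + k) + 1 = int (2 * s + t)" and tn: "2 * int k + 1 = int t" "2 * (- int (k + 1)) + 1 = - int t"
    by (simp_all add: k)
  have "coprime (2 * int (s + k) + 1) (int N)" "coprime (2 * int k + 1) (int n)"
    "coprime (2 * (- int (k + 1)) + 1) (int n)"
    unfolding N tn coprime_minus_left_iff coprime_int_iff using t(2,3)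
    by (simp_all add: coprime_iff_gcd_eq_1 gcd.commute)
  moreover have "d ^ 4 = 1 \<and> d ^ (2 * N) = 1 \<and> d ^ (2 * n) = 1"
  proof (cases "even n")
    case True
    then obtain m where "n = 2 * m" by auto
    then have "d ^ (2 * n) = (d ^ 4) ^ m" by (simp flip: power_mult)
    then show ?thesis using d True by simp
  next
    case False
    then have d2: "d ^ 2 = 1" using d by simp
    have "d ^ 4 = (d ^ 2) ^ 2" by (simp flip: power_mult)
    then show ?thesis using d2 by (simp add: power_mult)
  qed
  ultimately show thesis using that k by blast
qed

lemma Psi_exists:
  assumes "s \<ge> 1" "t \<ge> 1" "Psi_Phi_condition N n s t d"
  shows "\<exists>!\<phi>. is_Psi N n mu lam s t d \<phi>"
proof -
  obtain k where k: "t = 2 * k + 1" "coprime (2 * int (s + k) + 1) (int N)" "coprime (2 * int k + 1) (int n)"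
    "d ^ 4 = 1" "d ^ (2 * N) = 1" "d ^ (2 * n) = 1"
    using Psi_Phi_coprime[OF assms(3,2)] by metis
  have "word_point s t False = Dih (int (s + k)) (int k) True"
    by (simp add: word_point_def dih_alt_def k)
  from monomial_auto_exists[OF this k(2-)] show ?thesis by (simp add: is_Psi_iff[OF assms(1,2)])
qed

lemma Phi_exists:
  assumes "s \<ge> 1" "t \<ge> 1" "Psi_Phi_condition N n s t d"
  shows "\<exists>!\<phi>. is_Phi N n mu lam s t d \<phi>"
proof -
  obtain k where k: "t = 2 * k + 1" "coprime (2 * int (s + k) + 1) (int N)" "coprime (2 * (- int (k + 1)) + 1) (int n)"
    "d ^ 4 = 1" "d ^ (2 * N) = 1" "d ^ (2 * n) = 1"
    using Psi_Phi_coprime[OF assms(3,2)] by metis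
  have "word_point s t True = Dih (int (s + k)) (- int (k + 1)) True"
    by (simp add: word_point_def dih_alt_def k)
  from monomial_auto_exists[OF this k(2-)] show ?thesis by (simp add: is_Phi_iff[OF assms(1,2)])
qed

text \<open>
  For \<open>n = 2\<close> and \<open>lam = 1\<close> the group acting is commutative, and these combinations multiply like
  elements of two copies of the group algebra of a group of order two.
\<close>

definition cmb :: "int \<Rightarrow> bool \<Rightarrow> 'k \<Rightarrow> 'k \<Rightarrow> 'k \<Rightarrow> 'k \<Rightarrow> ((nat \<times> nat) list \<Rightarrow>\<^sub>0 'k) set" where
  "cmb i e p q r s = (p \<odot>\<^bsub>A\<^esub> elt (Dih i 0 e) False \<oplus>\<^bsub>A\<^esub> q \<odot>\<^bsub>A\<^esub> elt (Dih i 1 e) False) \<oplus>\<^bsub>A\<^esub>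
    (r \<odot>\<^bsub>A\<^esub> elt (Dih i 0 e) True \<oplus>\<^bsub>A\<^esub> s \<odot>\<^bsub>A\<^esub> elt (Dih i 1 e) True)"

lemma cmb_closed [simp]: "cmb i e p q r s \<in> carrier A"
  by (simp add: cmb_def)

lemma coord_cmb [simp]:
  assumes "quasi_periodic F"
  shows "coord F (cmb i e p q r s) = p * F (Dih i 0 e) False + q * F (Dih i 1 e) False +
    (r * F (Dih i 0 e) True + s * F (Dih i 1 e) True)"
  using assms by (simp add: cmb_def coord_add coord_smult)

lemma cmb_add: "cmb i e p q r s \<oplus>\<^bsub>A\<^esub> cmb i e p' q' r' s' = cmb i e (p + p') (q + q') (r + r') (s + s')"
  by (rule coord_ext) (simp_all add: coord_add algebra_simps)

lemma cmb_smult: "c \<odot>\<^bsub>A\<^esub> cmb i e p q r s = cmb i e (c * p) (c * q) (c * r) (c * s)"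
  by (rule coord_ext) (simp_all add: coord_smult algebra_simps)

lemma cmb_minus: "cmb i e p q r s \<ominus>\<^bsub>A\<^esub> cmb i e p' q' r' s' = cmb i e (p - p') (q - q') (r - r') (s - s')"
  by (simp add: A.minus_eq_smult cmb_smult cmb_add)

lemma cmb_one: "cmb 0 False 1 0 1 0 = \<one>\<^bsub>A\<^esub>"
  by (simp add: cmb_def A.sum_one flip: zero_dih_def)

lemma cmb_zero: "cmb i e 0 0 0 0 = \<zero>\<^bsub>A\<^esub>"
  by (simp add: cmb_def)

lemma cmb_shift:
  assumes "odd k"
  shows "cmb (k * int N) e p q r s = cmb 0 e p q (mu * r) (mu * s)"
proof -
  have "elt (Dih (k * int N) j e) d = component_sign mu d \<odot>\<^bsub>A\<^esub> elt (Dih 0 j e) d" for j d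
    using elt_congruent[of "k * int N" 0 k j j 0 e d] assms by (simp add: sign_power_def)
  then show ?thesis by (simp add: cmb_def component_sign_def A.smult_smult mult.commute)
qed

end

section \<open>The case \<open>n = 2\<close>, \<open>lam = 1\<close>: existence of \<Gamma>\<close>

locale suzuki_two = suzuki_parameters N n mu lam for N n and mu lam :: "'k::field_char_0" +
  assumes n2: "n = 2" and lam1: "lam = 1"
begin

lemma elt_two: "elt (Dih i (j + 2 * k) e) d = elt (Dih i j e) d"
proof -
  have j: "j + 2 * k = j + k * int n" and i: "i = i + 0 * int N" by (simp_all add: n2)
  have "sign_power mu d 0 * sign_power lam d k = 1" by (simp add: sign_power_def component_sign_def lam1)
  then show ?thesis using elt_congruent[OF i j, of e d] by simp
qed

lemma elt_parity: "elt (Dih i j e) d = elt (Dih i (j mod 2) e) d"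
  using elt_two[of i "j mod 2" "j div 2" e d] by simp

lemma quasi_periodic_parity:
  "quasi_periodic F \<Longrightarrow> F (Dih i j e) d = F (Dih i (j mod 2) e) d"
  using elt_parity[of i j e d] by (metis coord_elt)

lemma cmb_mult:
  "cmb i e p q r s \<otimes>\<^bsub>A\<^esub> cmb i' e' p' q' r' s' = cmb (i + i' + (if e \<and> e' then 1 else 0)) (e \<noteq> e')
    (p * p' + q * q') (p * q' + q * p') (r * r' + s * s') (r * s' + s * r')"
proof -
  have parity: "F (Dih i (- 1) e) d = F (Dih i 1 e) d" "F (Dih i 2 e) d = F (Dih i 0 e) d"
    if "quasi_periodic F" for F i e d
    using quasi_periodic_parity[OF that, of i "- 1"] quasi_periodic_parity[OF that, of i 2] by simp_all
  show ?thesis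
    by (rule coord_ext)
      (auto simp: cmb_def A.l_distr A.r_distr A.smult_mult_left A.smult_mult_right A.smult_smult parity
        coord_add coord_smult algebra_simps)
qed

text \<open>Inversion keeps the second coordinate of an odd element, and the twist in the second
  component sends 0 to -1 and 1 to -2, that is, it exchanges the two parities.\<close>

lemma cmb_antipode: "antipode H (cmb i True p q r s) = cmb (- i - 1) True p q s r"
proof -
  have parity: "elt (Dih i (- 1) e) d = elt (Dih i 1 e) d" "elt (Dih i (- 2) e) d = elt (Dih i 0 e) d" for i e d
    by (simp_all add: elt_parity[of i "- 1"] elt_parity[of i "- 2"])
  show ?thesis
    by (simp add: cmb_def antipode_add antipode_smult antipode_elt dih_twist_def parity A.a_comm)
qed

lemma cmb_elt: "elt (Dih i 0 e) False = cmb i e 1 0 0 0" "elt (Dih i (- 1) e) False = cmb i e 0 1 0 0"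
  "elt (Dih i 0 e) True = cmb i e 0 0 1 0" "elt (Dih i (- 1) e) True = cmb i e 0 0 0 1"
  by (simp_all add: cmb_def elt_parity[of i "- 1"])

text \<open>\<open>a\<close> and \<open>c\<close> are the parameters \<open>\<zeta>1\<close> and
  \<open>\<zeta>2\<close>. Since \<open>v = r^-1 u\<close> agrees with \<open>r u\<close> here, the
  four coefficients belong to \<open>x 1 1\<close>, \<open>x 2 2\<close>, \<open>x 1 2\<close> and
  \<open>x 2 1\<close>, each shifted by \<open>z^s\<close>.\<close>

definition Gamma_gen :: "nat \<Rightarrow> 'k \<Rightarrow> 'k \<Rightarrow> nat \<Rightarrow> nat \<Rightarrow> ((nat \<times> nat) list \<Rightarrow>\<^sub>0 'k) set" where
  "Gamma_gen s a c i j =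
    (if i = j then (let \<epsilon> = (if i = 1 then 1 else - 1) in
       cmb (int s) True (1 / 2) (1 / 2) (\<epsilon> * c / 2) (\<epsilon> * inverse c / 2))
     else if i = 1 then cmb (int s) True (a / 2) (- a / 2) (- a * c / 2) (a * inverse c / 2)
     else cmb (int s) True (inverse a / 2) (- inverse a / 2) (inverse a * c / 2) (- inverse a * inverse c / 2))"

lemma is_Gamma_iff:
  assumes "s \<ge> 1"
  shows "is_Gamma N n mu lam s a c \<phi> \<longleftrightarrow>
    \<phi> \<in> hopf_auto H \<and> (\<forall>i\<in>{1,2}. \<forall>j\<in>{1,2}. \<phi> (gen i j) = Gamma_gen s a c i j)"
proof -
  have u: "dih_u = Dih 0 0 True" "dih_v = Dih 0 (- 1) True" by (simp_all add: dih_defs)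
  note g = gen_simps[unfolded u cmb_elt]
  show ?thesis
    unfolding is_Gamma_def Let_def suzuki_simps suzuki_pow suzuki_minus gen_even_power[OF assms] cmb_elt
    by (simp add: g cmb_add cmb_smult cmb_minus cmb_mult Gamma_gen_def Let_def)
      (auto simp: field_simps)
qed

lemma cmb_cong: "\<lbrakk>i = i'; p = p'; q = q'; r = r'; s = s'\<rbrakk> \<Longrightarrow> cmb i e p q r s = cmb i' e p' q' r' s'"
  by simp

text \<open>With \<open>\<sigma> * \<sigma> = 1\<close> the element
  \<open>(1 + \<sigma> r) / 2\<close> is idempotent, and in the second component
  \<open>(\<epsilon> + \<sigma> r) / 2\<close> is \<epsilon> times such an idempotent. So powers
  only affect the scalars and the exponent of \<open>z\<close>.\<close>

lemma cmb_power:
  assumes "\<sigma> * \<sigma> = 1" "\<epsilon> * \<epsilon> = 1"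
  shows "cmb i False (m / 2) (m * \<sigma> / 2) (m * \<epsilon> / 2) (m * \<sigma> / 2) [^]\<^bsub>A\<^esub> Suc k =
    cmb (int (Suc k) * i) False (m ^ Suc k / 2) (m ^ Suc k * \<sigma> / 2) (m ^ Suc k * \<epsilon> ^ Suc k / 2)
      (m ^ Suc k * \<sigma> * \<epsilon> ^ k / 2)"
proof (induct k)
  case (Suc k)
  have *: "\<sigma> * (\<sigma> * x) = x" "\<epsilon> * (\<epsilon> * x) = x" for x
    using assms by (simp_all flip: mult.assoc)
  show ?case
    unfolding A.nat_pow_Suc[of _ "Suc k"] Suc cmb_mult
    by (simp, rule cmb_cong; (simp add: field_simps; fail | simp add: field_simps, use assms in algebra)?)
qed simp

lemma inverse_cube: "(x::'k) ^ 4 = 1 \<Longrightarrow> inverse x = x ^ 3"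
  by (intro inverse_unique) (simp flip: power_Suc)

lemma fourth_root_powers:
  assumes "(x::'k) ^ 4 = 1"
  shows "x ^ 6 = x * x" "x * x ^ 3 = 1" "x ^ 3 * x = 1" "x ^ 3 * x ^ 3 = x * x"
proof -
  show 6: "x ^ 6 = x * x" using power_add[of x 4 2] assms by (simp add: power2_eq_square)
  show "x * x ^ 3 = 1" "x ^ 3 * x = 1" using assms by (simp_all flip: power_Suc power_Suc2)
  show "x ^ 3 * x ^ 3 = x * x" using 6 by (simp flip: power_add)
qed

text \<open>The result is left with \<open>a\<close> free because it serves twice: to verify the
  last relation for admissible parameters, and to read off the conditions on the parameters from a
  given automorphism.\<close>

lemma Gamma_last_relation:
  assumes c: "c ^ 4 = 1"
  shows "Gamma_gen s a c 1 1 [^]\<^bsub>A\<^esub> (2 * N) \<oplus>\<^bsub>A\<^esub> mu \<odot>\<^bsub>A\<^esub> (Gamma_gen s a c 1 2 [^]\<^bsub>A\<^esub> (2 * N)) =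
    cmb 0 False ((1 + mu * a ^ (2 * N)) / 2) ((1 - mu * a ^ (2 * N)) / 2)
      (mu * c ^ (2 * N) * (1 + mu * a ^ (2 * N)) / 2) (mu * c ^ (2 * (N - 1)) * (1 - mu * a ^ (2 * N)) / 2)"
proof -
  obtain k where k: "N = Suc k" using N by (cases N) auto
  have ic: "inverse c = c ^ 3" by (rule inverse_cube[OF c])
  have two: "(2::nat) = Suc (Suc 0)" by simp
  have m1: "- 1 * - 1 = (1::'k)" by simp
  have 11: "Gamma_gen s a c 1 1 [^]\<^bsub>A\<^esub> (2::nat) = cmb (2 * int s + 1) False (1 / 2) (1 * 1 / 2) (1 * c\<^sup>2 / 2) (1 * 1 / 2)"
    unfolding two
    by (simp add: Gamma_gen_def cmb_mult ic) (rule cmb_cong; (simp add: field_simps fourth_root_powers[OF c]))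
  have 12: "Gamma_gen s a c 1 2 [^]\<^bsub>A\<^esub> (2::nat) =
      cmb (2 * int s + 1) False (a\<^sup>2 / 2) (a\<^sup>2 * (- 1) / 2) (a\<^sup>2 * c\<^sup>2 / 2) (a\<^sup>2 * (- 1) / 2)"
    unfolding two
    by (simp add: Gamma_gen_def cmb_mult ic) (rule cmb_cong; (simp add: field_simps fourth_root_powers[OF c]))
  have cc: "c\<^sup>2 * c\<^sup>2 = 1" using c by (simp flip: power_add)
  have closed: "Gamma_gen s a c i j \<in> carrier A" for i j by (simp add: Gamma_gen_def Let_def)
  have pow: "x [^]\<^bsub>A\<^esub> (2 * N) = (x [^]\<^bsub>A\<^esub> (2::nat)) [^]\<^bsub>A\<^esub> Suc k" if "x \<in> carrier A" for x
  proof -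
    have "x [^]\<^bsub>A\<^esub> (2 * N) = (x [^]\<^bsub>A\<^esub> (2::nat)) [^]\<^bsub>A\<^esub> N"
      by (simp only: A.nat_pow_pow that)
    also have "\<dots> = (x [^]\<^bsub>A\<^esub> (2::nat)) [^]\<^bsub>A\<^esub> Suc k" by (rule arg_cong[OF k])
    finally show ?thesis .
  qed
  have idx: "int (Suc k) * (2 * int s + 1) = (2 * int s + 1) * int N" by (simp add: k)
  have odd: "odd (2 * int s + 1)" by simp
  show ?thesis
    unfolding pow[OF closed] 11 12
      cmb_power[where \<sigma> = 1 and \<epsilon> = "c\<^sup>2" and m = 1 and i = "2 * int s + 1" and k = k, OF mult_1 cc]
      cmb_power[where \<sigma> = "- 1" and \<epsilon> = "c\<^sup>2" and m = "a\<^sup>2" and i = "2 * int s + 1" and k = k,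
        OF m1 cc]
      idx cmb_shift[OF odd] cmb_smult cmb_add
    by (rule cmb_cong) (simp_all add: k power_mult field_simps power2_eq_square)
qed

lemma Gamma_relations:
  assumes a: "a ^ 4 = 1" and c: "c ^ 4 = 1" and mu_a: "mu * a ^ (2 * N) = 1" and mu_c: "mu * c ^ (2 * N) = 1"
  shows "suzuki_relations N n mu lam A (Gamma_gen s a c)"
proof -
  have ia: "inverse a = a ^ 3" by (rule inverse_cube[OF a])
  have ic: "inverse c = c ^ 3" by (rule inverse_cube[OF c])
  have two: "(2::nat) = Suc (Suc 0)" by simp
  note eqs = field_simps fourth_root_powers[OF a] fourth_root_powers[OF c]
  note defs = Gamma_gen_def Let_def ia ic cmb_mult
  have pow2: "y [^]\<^bsub>A\<^esub> (2::nat) = y \<otimes>\<^bsub>A\<^esub> y" if "y \<in> carrier A" for y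
    using that by (simp add: two)
  have closed: "Gamma_gen s a c i j \<in> carrier A" for i j by (simp add: Gamma_gen_def Let_def)
  have alt: "alternating A (Gamma_gen s a c) i j n = Gamma_gen s a c i j \<otimes>\<^bsub>A\<^esub> Gamma_gen s a c (3 - i) (3 - j)"
    for i j
  proof -
    have "n = Suc (Suc 0)" using n2 by simp
    then have "alternating A (Gamma_gen s a c) i j n = alternating A (Gamma_gen s a c) i j (Suc (Suc 0))"
      by (rule arg_cong)
    also have "\<dots> = Gamma_gen s a c i j \<otimes>\<^bsub>A\<^esub> Gamma_gen s a c (3 - i) (3 - j)"
      using closed by simp
    finally show ?thesis .
  qed
  have y: "Gamma_gen s a c (Suc 0) (Suc 0) = cmb (int s) True (1 / 2) (1 / 2) (c / 2) (c ^ 3 / 2)"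
    "Gamma_gen s a c 2 2 = cmb (int s) True (1 / 2) (1 / 2) (- c / 2) (- (c ^ 3) / 2)"
    "Gamma_gen s a c (Suc 0) 2 = cmb (int s) True (a / 2) (- a / 2) (- a * c / 2) (a * c ^ 3 / 2)"
    "Gamma_gen s a c 2 (Suc 0) = cmb (int s) True (a ^ 3 / 2) (- (a ^ 3) / 2) (a ^ 3 * c / 2) (- (a ^ 3) * c ^ 3 / 2)"
    by (simp_all add: Gamma_gen_def Let_def ia ic)
  have products: "Gamma_gen s a c (Suc 0) (Suc 0) \<otimes>\<^bsub>A\<^esub> Gamma_gen s a c (Suc 0) 2 = \<zero>\<^bsub>A\<^esub>"
    "Gamma_gen s a c (Suc 0) (Suc 0) \<otimes>\<^bsub>A\<^esub> Gamma_gen s a c 2 (Suc 0) = \<zero>\<^bsub>A\<^esub>"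
    "Gamma_gen s a c 2 2 \<otimes>\<^bsub>A\<^esub> Gamma_gen s a c (Suc 0) 2 = \<zero>\<^bsub>A\<^esub>"
    "Gamma_gen s a c 2 2 \<otimes>\<^bsub>A\<^esub> Gamma_gen s a c 2 (Suc 0) = \<zero>\<^bsub>A\<^esub>"
    "Gamma_gen s a c (Suc 0) 2 \<otimes>\<^bsub>A\<^esub> Gamma_gen s a c (Suc 0) (Suc 0) = \<zero>\<^bsub>A\<^esub>"
    "Gamma_gen s a c 2 (Suc 0) \<otimes>\<^bsub>A\<^esub> Gamma_gen s a c (Suc 0) (Suc 0) = \<zero>\<^bsub>A\<^esub>"
    "Gamma_gen s a c (Suc 0) 2 \<otimes>\<^bsub>A\<^esub> Gamma_gen s a c 2 2 = \<zero>\<^bsub>A\<^esub>"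
    "Gamma_gen s a c 2 (Suc 0) \<otimes>\<^bsub>A\<^esub> Gamma_gen s a c 2 2 = \<zero>\<^bsub>A\<^esub>"
    unfolding y cmb_mult cmb_zero[of "int s + int s + 1" False, symmetric]
    by (simp, rule cmb_cong; simp add: eqs)+
  show ?thesis
    unfolding suzuki_relations_def pow2[OF closed] alt
  proof (intro conjI ballI impI)
    fix i j k l :: nat
    assume *: "i \<in> {1, 2}" "j \<in> {1, 2}" "k \<in> {1, 2}" "l \<in> {1, 2}" "odd (i + j + k + l)"
    have "(i = j) \<noteq> (k = l)" using * by auto
    then show "Gamma_gen s a c i j \<otimes>\<^bsub>A\<^esub> Gamma_gen s a c k l = \<zero>\<^bsub>A\<^esub>"
      using * products by auto
  next
    show "Gamma_gen s a c 1 1 [^]\<^bsub>A\<^esub> (2 * N) \<oplus>\<^bsub>A\<^esub> mu \<odot>\<^bsub>A\<^esub> (Gamma_gen s a c 1 2 [^]\<^bsub>A\<^esub> (2 * N)) = \<one>\<^bsub>A\<^esub>"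
      unfolding Gamma_last_relation[OF c] mu_a mu_c cmb_one[symmetric] by (rule cmb_cong) simp_all
  next
    show "Gamma_gen s a c 2 1 \<otimes>\<^bsub>A\<^esub> Gamma_gen s a c (3 - 2) (3 - 1) =
      lam \<odot>\<^bsub>A\<^esub> (Gamma_gen s a c 1 2 \<otimes>\<^bsub>A\<^esub> Gamma_gen s a c (3 - 1) (3 - 2))"
    proof -
      have "lam \<odot>\<^bsub>A\<^esub> y = y" if "y \<in> carrier A" for y
        using arg_cong[OF lam1, of "\<lambda>l. l \<odot>\<^bsub>A\<^esub> y"] that by simp
      then show ?thesis by (simp add: defs) (rule cmb_cong; simp add: eqs)
    qed
  qed (simp_all add: closed, (simp add: defs, (rule cmb_cong; simp add: eqs)?)+)
qed

text \<open>Coprimality enters through surjectivity: the images of the generators lie at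
  \<open>z^s u\<close>, and products must bring them back to \<open>u\<close> modulo
  \<open>z^N\<close>.\<close>

lemma Gamma_exists:
  assumes s: "s \<ge> 1" and a: "a ^ 4 = 1" and c: "c ^ 4 = 1"
    and mu_a: "mu * a ^ (2 * N) = 1" and mu_c: "mu * c ^ (2 * N) = 1"
    and coprime: "coprime (2 * int s + 1) (int N)"
  shows "\<exists>!\<phi>. is_Gamma N n mu lam s a c \<phi>"
proof -
  have a0: "a \<noteq> 0" and c0: "c \<noteq> 0" using a c by auto
  have 12: "1 \<in> {1, 2::nat}" "2 \<in> {1, 2::nat}" by simp_all
  have "\<exists>!\<phi>. \<phi> \<in> hopf_auto H \<and> (\<forall>i\<in>{1,2}. \<forall>j\<in>{1,2}. \<phi> (gen i j) = Gamma_gen s a c i j)"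
  proof (rule hopf_auto_exists[OF Gamma_relations[OF a c mu_a mu_c]])
    fix i j :: nat and F G assume ij: "i \<in> {1, 2}" "j \<in> {1, 2}" and FG: "quasi_periodic F" "quasi_periodic G"
    have parity: "F (Dih i (- 1) e) d = F (Dih i 1 e) d" "F (Dih i (- 2) e) d = F (Dih i 0 e) d"
      if "quasi_periodic F" for F i e d
      using quasi_periodic_parity[OF that, of i "- 1"] quasi_periodic_parity[OF that, of i "- 2"] by simp_all
    note FG = FG tensor_coord_comult(1)[OF FG]
    define f00 f10 f01 f11 g00 g10 g01 g11 where "f00 = F (Dih (int s) 0 True) False"
      and "f10 = F (Dih (int s) 1 True) False" and "f01 = F (Dih (int s) 0 True) True"
      and "f11 = F (Dih (int s) 1 True) True" and "g00 = G (Dih (int s) 0 True) False"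
      and "g10 = G (Dih (int s) 1 True) False" and "g01 = G (Dih (int s) 0 True) True"
      and "g11 = G (Dih (int s) 1 True) True"
    note abbrev = f00_def[symmetric] f10_def[symmetric] f01_def[symmetric] f11_def[symmetric]
      g00_def[symmetric] g10_def[symmetric] g01_def[symmetric] g11_def[symmetric]
    have conv_values: "conv F G (Dih (int s) 0 True) False = f00 * g00 + f01 * g11"
      "conv F G (Dih (int s) 1 True) False = f10 * g10 + f11 * g01"
      "conv F G (Dih (int s) 0 True) True = f00 * g01 + f01 * g10"
      "conv F G (Dih (int s) 1 True) True = f10 * g11 + f11 * g00"
      by (simp_all add: conv_def abbrev parity FG)
    define c' a' where "c' = inverse c" and "a' = inverse a"
    have ic: "inverse c = c'" "inverse a = a'" by (simp_all add: c'_def a'_def)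
    have cancel: "c * (c' * z) = z" "a * (a' * z) = z" "a * w * (a' * z) = w * z" "a' * w * (a * z) = w * z" for w z
      using a0 c0 by (simp_all add: c'_def a'_def field_simps)
    have coords: "coord G' (Gamma_gen s a c 1 1) = (G' (Dih (int s) 0 True) False + G' (Dih (int s) 1 True) False +
          c * G' (Dih (int s) 0 True) True + c' * G' (Dih (int s) 1 True) True) / 2"
      "coord G' (Gamma_gen s a c 2 2) = (G' (Dih (int s) 0 True) False + G' (Dih (int s) 1 True) False -
          c * G' (Dih (int s) 0 True) True - c' * G' (Dih (int s) 1 True) True) / 2"
      "coord G' (Gamma_gen s a c 1 2) = a * (G' (Dih (int s) 0 True) False - G' (Dih (int s) 1 True) False -
          c * G' (Dih (int s) 0 True) True + c' * G' (Dih (int s) 1 True) True) / 2"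
      "coord G' (Gamma_gen s a c 2 1) = a' * (G' (Dih (int s) 0 True) False - G' (Dih (int s) 1 True) False +
          c * G' (Dih (int s) 0 True) True - c' * G' (Dih (int s) 1 True) True) / 2"
      if "quasi_periodic G'" for G'
      using that by (simp_all add: Gamma_gen_def Let_def ic algebra_simps add_divide_distrib diff_divide_distrib)
    note vals = coords[OF FG(1), unfolded abbrev] coords[OF FG(2), unfolded abbrev] coords[OF FG(3), unfolded conv_values]
    have half: "h / 2 = x / 2 * (y / 2) + z / 2 * (w / 2)"
      if "2 * h = x * y + z * w" for h x y z w :: 'k
      using that by (simp add: field_simps)
    consider "i = 1" "j = 1" | "i = 1" "j = 2" | "i = 2" "j = 1" | "i = 2" "j = 2" using ij by auto
    then show "coord (conv F G) (Gamma_gen s a c i j) =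
        coord F (Gamma_gen s a c i 1) * coord G (Gamma_gen s a c 1 j) +
        coord F (Gamma_gen s a c i 2) * coord G (Gamma_gen s a c 2 j)"
    proof cases
      case 1
      show ?thesis unfolding 1 vals
        by (rule half) (simp add: cancel algebra_simps)
    next
      case 2
      show ?thesis unfolding 2 vals
        by (rule half) (simp add: cancel algebra_simps)
    next
      case 3
      show ?thesis unfolding 3 vals
        by (rule half) (simp add: cancel algebra_simps)
    next
      case 4
      show ?thesis unfolding 4 vals
        by (rule half) (simp add: cancel algebra_simps)
    qed
  next
    fix i j :: nat assume ij: "i \<in> {1, 2}" "j \<in> {1, 2}"
    then show "coord counit_function (Gamma_gen s a c i j) = (if i = j then 1 else 0)"
      by (auto simp: Gamma_gen_def quasi_periodic_counit counit_function_def)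
    show "Gamma_gen s a c i 1 \<otimes>\<^bsub>A\<^esub> antipode H (Gamma_gen s a c 1 j) \<oplus>\<^bsub>A\<^esub>
        Gamma_gen s a c i 2 \<otimes>\<^bsub>A\<^esub> antipode H (Gamma_gen s a c 2 j) = (if i = j then \<one>\<^bsub>A\<^esub> else \<zero>\<^bsub>A\<^esub>)"
      unfolding cmb_one[symmetric] cmb_zero[of 0 False, symmetric] using ij a0 c0
      by (auto simp: Gamma_gen_def cmb_antipode cmb_mult cmb_add field_simps intro!: cmb_cong)
  next
    fix \<phi> and i' j' :: nat assume \<phi>: "\<phi> \<in> algebra_hom A A"
      and gens: "\<And>i j. \<lbrakk>i \<in> {1, 2}; j \<in> {1, 2}\<rbrakk> \<Longrightarrow> \<phi> (gen i j) = Gamma_gen s a c i j"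
      and ij: "i' \<in> {1, 2}" "j' \<in> {1, 2}"
    interpret \<phi>: algebra_map A A \<phi> by (rule algebra_map_A[OF assoc_algebra_suzuki_algebra \<phi>])
    let ?I = "\<phi> ` carrier A"
    have I_mult: "y \<otimes>\<^bsub>A\<^esub> z \<in> ?I" and I_add: "y \<oplus>\<^bsub>A\<^esub> z \<in> ?I" if "y \<in> ?I" "z \<in> ?I" for y z
      using that by (auto simp flip: \<phi>.mult \<phi>.add)
    have I_smult: "k \<odot>\<^bsub>A\<^esub> y \<in> ?I" if "y \<in> ?I" for y k
      using that by (auto simp flip: \<phi>.smult)
    have I_gen: "Gamma_gen s a c i j \<in> ?I" if "i \<in> {1, 2}" "j \<in> {1, 2}" for i j
      using gens[OF that] gen_closed[OF that] by (metis imageI)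
    note y = I_gen[OF 12(1) 12(1)] I_gen[OF 12(1) 12(2)] I_gen[OF 12(2) 12(1)] I_gen[OF 12(2) 12(2)]
    \<comment> \<open>For fixed exponent \<open>s\<close> the four images are a basis of the span of
      the four family members there; the scalars invert this change of basis.\<close>
    have cmb_I: "cmb (int s) True p q r t \<in> ?I" for p q r t
    proof -
      have "cmb (int s) True p q r t =
          (((p + q) / 2) \<odot>\<^bsub>A\<^esub> (Gamma_gen s a c 1 1 \<oplus>\<^bsub>A\<^esub> Gamma_gen s a c 2 2) \<oplus>\<^bsub>A\<^esub>
            ((r * inverse c + t * c) / 2) \<odot>\<^bsub>A\<^esub> (Gamma_gen s a c 1 1 \<oplus>\<^bsub>A\<^esub> (- 1) \<odot>\<^bsub>A\<^esub> Gamma_gen s a c 2 2)) \<oplus>\<^bsub>A\<^esub>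
          (((p - q) / 2) \<odot>\<^bsub>A\<^esub> (inverse a \<odot>\<^bsub>A\<^esub> Gamma_gen s a c 1 2 \<oplus>\<^bsub>A\<^esub> a \<odot>\<^bsub>A\<^esub> Gamma_gen s a c 2 1) \<oplus>\<^bsub>A\<^esub>
            ((r * inverse c - t * c) / 2) \<odot>\<^bsub>A\<^esub> (a \<odot>\<^bsub>A\<^esub> Gamma_gen s a c 2 1 \<oplus>\<^bsub>A\<^esub> (- inverse a) \<odot>\<^bsub>A\<^esub> Gamma_gen s a c 1 2))"
        using a0 c0 by (simp add: Gamma_gen_def cmb_add cmb_smult) (rule cmb_cong; simp add: field_simps)
      also have "\<dots> \<in> ?I" by (intro I_add I_smult y)
      finally show ?thesis .
    qed
    \<comment> \<open>Two factors with exponent \<open>s\<close> multiply to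
      \<open>z^(2s+1)\<close>, so all exponents \<open>m * (2 * s + 1) + s\<close> are
      reached.\<close>
    have power_I: "cmb (int m * (2 * int s + 1) + int s) True p q r t \<in> ?I" for m p q r t
    proof (induct m)
      case (Suc m)
      have "(cmb (int s) True 1 0 1 0 \<otimes>\<^bsub>A\<^esub> cmb (int s) True 1 0 1 0) \<otimes>\<^bsub>A\<^esub>
          cmb (int m * (2 * int s + 1) + int s) True p q r t \<in> ?I"
        by (intro I_mult cmb_I Suc)
      also have "(cmb (int s) True 1 0 1 0 \<otimes>\<^bsub>A\<^esub> cmb (int s) True 1 0 1 0) \<otimes>\<^bsub>A\<^esub>
          cmb (int m * (2 * int s + 1) + int s) True p q r t = cmb (int (Suc m) * (2 * int s + 1) + int s) True p q r t"
        by (simp add: cmb_mult) (rule cmb_cong; simp add: algebra_simps)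
      finally show ?case .
    qed (simp add: cmb_I)
    \<comment> \<open>Solves for an exponent of the form above that is divisible by
      \<open>N\<close>; since \<open>m\<close> counts factors, a nonnegative representative of
      \<open>p\<close> modulo \<open>N\<close> is taken next.\<close>
    obtain p k where pk: "p * (2 * int s + 1) = - int s + k * int N" by (rule coprime_solve[OF coprime])
    define m where "m = nat (p mod int N)"
    have m: "int m = p - (p div int N) * int N" using N by (simp add: m_def minus_div_mult_eq_mod)
    define l where "l = k - (p div int N) * (2 * int s + 1)"
    have ml: "int m * (2 * int s + 1) + int s = l * int N"
      using pk by (simp add: m l_def algebra_simps)
    have "\<exists>p q r t. gen i' j' = cmb 0 True p q r t"
      using ij by (auto simp: gen_simps dih_defs cmb_elt; blast)
    then obtain p q r t where g: "gen i' j' = cmb 0 True p q r t" by blast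
    \<comment> \<open>The sign picked up in the second component when the exponent
      \<open>l * N\<close> is reduced to 0.\<close>
    define \<sigma> where "\<sigma> = (if even l then 1 else mu)"
    have "elt (Dih (l * int N) j e) d = sign_power mu d l \<odot>\<^bsub>A\<^esub> elt (Dih 0 j e) d" for j e d
      using elt_congruent[of "l * int N" 0 l j j 0 e d] by (simp add: sign_power_def)
    then have "cmb (l * int N) True p q (\<sigma> * r) (\<sigma> * t) = cmb 0 True p q r t"
    proof -
      have mm: "mu * (mu * z) = z" for z by (simp flip: mult.assoc)
      then show ?thesis
        using \<open>\<And>j e d. elt (Dih (l * int N) j e) d = sign_power mu d l \<odot>\<^bsub>A\<^esub> elt (Dih 0 j e) d\<close>
        by (simp add: cmb_def A.smult_smult sign_power_def component_sign_def \<sigma>_def mult.commute mult.left_commute mm)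
    qed
    then show "gen i' j' \<in> ?I" using power_I[of m p q "\<sigma> * r" "\<sigma> * t"] unfolding ml g by simp
  qed
  then show ?thesis by (simp only: is_Gamma_iff[OF s])
qed

end

section \<open>Classification\<close>

text \<open>An idempotent matrix is the identity if its determinant is nonzero, and has trace 1 if
  it is singular and nonzero. Nonzero orthogonal idempotents cannot be the identity, so both have
  trace 1. Their sum is an idempotent of trace 2, hence the identity.\<close>

lemma orthogonal_idempotents_two:
  fixes p q :: "nat \<Rightarrow> nat \<Rightarrow> 'a::field_char_0"
  assumes p: "\<And>i j. \<lbrakk>i \<in> {1, 2}; j \<in> {1, 2}\<rbrakk> \<Longrightarrow> p i 1 * p 1 j + p i 2 * p 2 j = p i j"
    and q: "\<And>i j. \<lbrakk>i \<in> {1, 2}; j \<in> {1, 2}\<rbrakk> \<Longrightarrow> q i 1 * q 1 j + q i 2 * q 2 j = q i j"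
    and pq: "\<And>i j. \<lbrakk>i \<in> {1, 2}; j \<in> {1, 2}\<rbrakk> \<Longrightarrow> p i 1 * q 1 j + p i 2 * q 2 j = 0"
    and qp: "\<And>i j. \<lbrakk>i \<in> {1, 2}; j \<in> {1, 2}\<rbrakk> \<Longrightarrow> q i 1 * p 1 j + q i 2 * p 2 j = 0"
    and p0: "\<exists>i\<in>{1, 2}. \<exists>j\<in>{1, 2}. p i j \<noteq> 0" and q0: "\<exists>i\<in>{1, 2}. \<exists>j\<in>{1, 2}. q i j \<noteq> 0"
  shows "p 1 1 + p 2 2 = 1" "p 1 1 * p 2 2 = p 1 2 * p 2 1"
    "q 1 1 = p 2 2" "q 2 2 = p 1 1" "q 1 2 = - p 1 2" "q 2 1 = - p 2 1"
proof -
  have inv: "a = 1 \<and> b = 0 \<and> c = 0 \<and> d = 1"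
    if "a * a + b * c = a" "a * b + b * d = b" "c * a + d * c = c" "c * b + d * d = d" "a * d - b * c \<noteq> 0"
    for a b c d :: 'a
  proof -
    \<comment> \<open>The equation \<open>M M - M = 0\<close> multiplied by the adjugate of
      \<open>M\<close>.\<close>
    have "(a * d - b * c) * (a - 1) = d * (a * a + b * c - a) - b * (c * a + d * c - c)"
      "(a * d - b * c) * b = d * (a * b + b * d - b) - b * (c * b + d * d - d)"
      "(a * d - b * c) * c = a * (c * a + d * c - c) - c * (a * a + b * c - a)"
      "(a * d - b * c) * (d - 1) = a * (c * b + d * d - d) - c * (a * b + b * d - b)"
      by (simp_all add: algebra_simps)
    then have "(a * d - b * c) * (a - 1) = 0" "(a * d - b * c) * b = 0" "(a * d - b * c) * c = 0"
      "(a * d - b * c) * (d - 1) = 0"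
      by (simp_all only: that(1-4) diff_self mult_zero_right)
    then show ?thesis using that(5) by auto
  qed
  have trace: "a + d = 1"
    if "a * a + b * c = a" "a * b + b * d = b" "c * a + d * c = c" "c * b + d * d = d" "a * d = b * c"
      "a \<noteq> 0 \<or> b \<noteq> 0 \<or> c \<noteq> 0 \<or> d \<noteq> 0" for a b c d :: 'a
  proof -
    \<comment> \<open>The Cayley-Hamilton identity, which writes (trace - 1) times \<open>M\<close>
      as \<open>M M - M\<close> plus the determinant.\<close>
    have "(a + d - 1) * a = (a * a + b * c - a) + (a * d - b * c)" "(a + d - 1) * b = a * b + b * d - b"
      "(a + d - 1) * c = c * a + d * c - c" "(a + d - 1) * d = (c * b + d * d - d) + (a * d - b * c)"
      by (simp_all add: algebra_simps)
    then have "(a + d - 1) * a = 0" "(a + d - 1) * b = 0" "(a + d - 1) * c = 0" "(a + d - 1) * d = 0"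
      by (simp_all only: that(1-5) diff_self add_0)
    then show ?thesis using that(6) by auto
  qed
  have 12: "1 \<in> {1, 2::nat}" "2 \<in> {1, 2::nat}" by simp_all
  note ps = p[OF 12(1) 12(1)] p[OF 12(1) 12(2)] p[OF 12(2) 12(1)] p[OF 12(2) 12(2)]
  note qs = q[OF 12(1) 12(1)] q[OF 12(1) 12(2)] q[OF 12(2) 12(1)] q[OF 12(2) 12(2)]
  note pqs = pq[OF 12(1) 12(1)] pq[OF 12(1) 12(2)] pq[OF 12(2) 12(1)] pq[OF 12(2) 12(2)]
  note qps = qp[OF 12(1) 12(1)] qp[OF 12(1) 12(2)] qp[OF 12(2) 12(1)] qp[OF 12(2) 12(2)]
  have p_nz: "p 1 1 \<noteq> 0 \<or> p 1 2 \<noteq> 0 \<or> p 2 1 \<noteq> 0 \<or> p 2 2 \<noteq> 0"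
    and q_nz: "q 1 1 \<noteq> 0 \<or> q 1 2 \<noteq> 0 \<or> q 2 1 \<noteq> 0 \<or> q 2 2 \<noteq> 0" using p0 q0 by auto
  show det_p: "p 1 1 * p 2 2 = p 1 2 * p 2 1"
  proof (rule ccontr)
    assume "\<not> ?thesis"
    then have "p 1 1 = 1 \<and> p 1 2 = 0 \<and> p 2 1 = 0 \<and> p 2 2 = 1" using inv[OF ps] by simp
    then show False using q_nz pqs by simp
  qed
  have det_q: "q 1 1 * q 2 2 = q 1 2 * q 2 1"
  proof (rule ccontr)
    assume "\<not> ?thesis"
    then have "q 1 1 = 1 \<and> q 1 2 = 0 \<and> q 2 1 = 0 \<and> q 2 2 = 1" using inv[OF qs] by simp
    then show False using p_nz qps by simp
  qed
  show tr_p: "p 1 1 + p 2 2 = 1" by (rule trace[OF ps det_p p_nz])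
  have tr_q: "q 1 1 + q 2 2 = 1" by (rule trace[OF qs det_q q_nz])
  let ?s = "\<lambda>i j. p i j + q i j"
  have ss: "?s i 1 * ?s 1 j + ?s i 2 * ?s 2 j = ?s i j" if "i \<in> {1, 2}" "j \<in> {1, 2}" for i j
  proof -
    have "?s i 1 * ?s 1 j + ?s i 2 * ?s 2 j = (p i 1 * p 1 j + p i 2 * p 2 j) + (q i 1 * q 1 j + q i 2 * q 2 j) +
      (p i 1 * q 1 j + p i 2 * q 2 j) + (q i 1 * p 1 j + q i 2 * p 2 j)"
      by (simp add: algebra_simps)
    then show ?thesis by (simp only: p[OF that] q[OF that] pq[OF that] qp[OF that] add_0_right)
  qed
  note sums = ss[OF 12(1) 12(1)] ss[OF 12(1) 12(2)] ss[OF 12(2) 12(1)] ss[OF 12(2) 12(2)]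
  have "?s 1 1 * ?s 2 2 - ?s 1 2 * ?s 2 1 \<noteq> 0"
  proof
    assume 0: "?s 1 1 * ?s 2 2 - ?s 1 2 * ?s 2 1 = 0"
    have "?s 1 1 + ?s 2 2 = 2" using tr_p tr_q by (simp add: algebra_simps)
    have "?s 1 1 \<noteq> 0 \<or> ?s 1 2 \<noteq> 0 \<or> ?s 2 1 \<noteq> 0 \<or> ?s 2 2 \<noteq> 0"
      using \<open>?s 1 1 + ?s 2 2 = 2\<close> by auto
    then have "?s 1 1 + ?s 2 2 = 1" using trace[OF sums] 0 by simp
    then show False using \<open>?s 1 1 + ?s 2 2 = 2\<close> by simp
  qed
  then have "?s 1 1 = 1 \<and> ?s 1 2 = 0 \<and> ?s 2 1 = 0 \<and> ?s 2 2 = 1" by (rule inv[OF sums])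
  moreover have "p 1 1 = 1 - p 2 2" using tr_p by (simp add: eq_diff_eq)
  ultimately show "q 1 1 = p 2 2" "q 2 2 = p 1 1" "q 1 2 = - p 1 2" "q 2 1 = - p 2 1"
    by (simp_all add: eq_neg_iff_add_eq_0 add.commute) (simp_all add: eq_diff_eq diff_eq_eq add.commute)
qed

section \<open>Point functionals and their multiplication table\<close>

context suzuki_parameters
begin

text \<open>Equality in the quotient of the infinite group by \<open>z^N\<close> and
  \<open>r^n\<close>.\<close>

definition dih_cong :: "dih \<Rightarrow> dih \<Rightarrow> bool" where
  "dih_cong g h = (case (g, h) of (Dih i j e, Dih i' j' e') \<Rightarrow> e = e' \<and> int N dvd i' - i \<and> int n dvd j' - j)"

lemma delta_False: "delta g False h False = (if dih_cong g h then 1 else 0)"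
  by (auto simp: delta_def dih_cong_def sign_power_def component_sign_def split: dih.splits)

lemma delta_square: "delta g d h d * delta g d h d = (if dih_cong g h then 1 else 0)"
proof -
  have "sign_power mu d k * sign_power mu d k = 1" "sign_power lam d k * sign_power lam d k = 1" for k
    by (simp_all add: sign_power_def)
  then show ?thesis
    by (auto simp: delta_def dih_cong_def mult.commute mult.left_commute split: dih.splits)
qed

lemma delta_not_cong: "\<not> dih_cong g h \<Longrightarrow> delta g d h d' = 0"
  by (auto simp: delta_def dih_cong_def split: dih.splits)

lemma dih_cong_refl [simp]: "dih_cong g g"
  by (auto simp: dih_cong_def split: dih.splits)

lemma dih_cong_sym: "dih_cong g h \<Longrightarrow> dih_cong h g"
  by (auto simp: dih_cong_def dvd_diff_commute split: dih.splits)

lemma dih_cong_trans: "\<lbrakk>dih_cong g h; dih_cong h k\<rbrakk> \<Longrightarrow> dih_cong g k"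
proof -
  have "m dvd a - c" if "m dvd a - b" "m dvd b - c" for m a b c :: int
    using dvd_add[OF that] by simp
  then show "\<lbrakk>dih_cong g h; dih_cong h k\<rbrakk> \<Longrightarrow> dih_cong g k"
    by (auto simp: dih_cong_def split: dih.splits)
qed

lemma dih_cong_swap: "dih_cong (dih_swap g) (dih_swap h) \<longleftrightarrow> dih_cong g h"
proof -
  have "int n dvd - j' - c - (- j - c) \<longleftrightarrow> int n dvd j' - j" for j j' c
  proof -
    have "- j' - c - (- j - c) = - (j' - j)" by simp
    then show ?thesis by (simp only: dvd_minus_iff)
  qed
  then show ?thesis
    by (cases g; cases h) (auto simp: dih_cong_def dvd_diff_commute)
qed

lemma dih_cong_add: "\<lbrakk>dih_cong g g'; dih_cong h h'\<rbrakk> \<Longrightarrow> dih_cong (g + h) (g' + h')"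
proof -
  have "m dvd a' + b' - (a + b)" "m dvd a' - b' - (a - b)" "m dvd a' + b' + 1 - (a + b + 1)"
    if "m dvd a' - a" "m dvd b' - b" for m a a' b b' :: int
    using dvd_add[OF that] dvd_diff[OF that] by (simp_all add: algebra_simps)
  then show "\<lbrakk>dih_cong g g'; dih_cong h h'\<rbrakk> \<Longrightarrow> dih_cong (g + h) (g' + h')"
    by (cases g; cases g'; cases h; cases h') (auto simp: dih_cong_def)
qed

text \<open>The swap negates the difference \<open>j' - j\<close>; the sign depends only on the
  parity of the number of shifts, which negation preserves.\<close>

lemma delta_swap: "delta (dih_swap g) d (dih_swap h) d' = delta g d h d'"
proof -
  obtain i j e where g: "g = Dih i j e" by (cases g)
  obtain i' j' e' where h: "h = Dih i' j' e'" by (cases h)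
  have diff: "(- j' - c) - (- j - c) = - (j' - j)" for c by simp
  have "sign_power lam d (- (j' - j) div int n) = sign_power lam d ((j' - j) div int n)" if dvd: "int n dvd j' - j"
  proof -
    from dvd obtain k where "j' - j = int n * k" by (rule dvdE)
    then have "(j' - j) div int n = k" "- (j' - j) div int n = - k"
      using n by (simp_all flip: mult_minus_right)
    then show ?thesis by (simp add: sign_power_def)
  qed
  then show ?thesis
    unfolding g h by (cases "e = e'") (auto simp: delta_def diff simp del: minus_diff_eq)
qed

lemma quasi_periodic_cong:
  assumes F: "quasi_periodic F" and "dih_cong g h"
  shows "F h d = delta g d h d * F g d"
proof -
  obtain i j e where g: "g = Dih i j e" by (cases g)
  obtain i' j' e' where h: "h = Dih i' j' e'" by (cases h)
  from assms(2) have e: "e' = e" and "int N dvd i' - i" "int n dvd j' - j" by (auto simp: dih_cong_def g h)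
  then obtain k l where k: "i' - i = k * int N" and l: "j' - j = l * int n" by (metis dvdE mult.commute)
  have "elt h d = (sign_power mu d k * sign_power lam d l) \<odot>\<^bsub>A\<^esub> elt g d"
    unfolding g h e using k l by (intro elt_congruent) auto
  moreover have "delta g d h d = sign_power mu d k * sign_power lam d l"
    using N n by (simp add: delta_def g h e k l)
  ultimately have "coord F (elt h d) = delta g d h d * coord F (elt g d)"
    using F by (simp only: coord_smult A.closed)
  then show ?thesis using F by simp
qed

lemma coord_linear:
  assumes "quasi_periodic F" "quasi_periodic G" "a \<in> carrier A"
  shows "coord (\<lambda>g d. r * F g d + s * G g d) a = r * coord F a + s * coord G a"
    and "quasi_periodic (\<lambda>g d. r * F g d + s * G g d)"
proof -
  have lin: "linear_functional A (\<lambda>a. r * coord F a + s * coord G a)"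
    using assms(1,2) by (auto simp: linear_functional_def coord_add coord_smult algebra_simps)
  show "coord (\<lambda>g d. r * F g d + s * G g d) a = r * coord F a + s * coord G a"
    using functional_eq_coord[OF lin assms(3)] assms(1,2) by simp
  show "quasi_periodic (\<lambda>g d. r * F g d + s * G g d)"
    using quasi_periodic_functional[OF lin] assms(1,2) by simp
qed

lemma coord_zero: "a \<in> carrier A \<Longrightarrow> coord (\<lambda>g d. 0) a = 0"
  using functional_eq_coord[of "\<lambda>_. 0" a] by (simp add: linear_functional_def)

text \<open>\<open>delta g False\<close> restricts a factor on its right to the class of
  \<open>g\<close>; standing to the right of a functional of the second component, it tests the
  swapped class instead. Two functionals of the second component multiply into the first one, where
  the signs cancel by \<open>delta_square\<close>.\<close>

lemma conv_delta:
  "conv (delta g False) (delta h d) = (if dih_cong g h then delta h d else (\<lambda>_ _. 0))"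
  "conv (delta h True) (delta g False) = (if dih_cong g (dih_swap h) then delta h True else (\<lambda>_ _. 0))"
  "conv (delta g True) (delta (dih_swap g) True) = delta g False"
proof -
  show "conv (delta g False) (delta h d) = (if dih_cong g h then delta h d else (\<lambda>_ _. 0))"
  proof (intro ext)
    fix x d'
    show "conv (delta g False) (delta h d) x d' = (if dih_cong g h then delta h d else (\<lambda>_ _. 0)) x d'"
      using delta_not_cong[of h x d d'] dih_cong_trans[of g h x] dih_cong_trans[of g x h] dih_cong_sym[of h x]
      by (auto simp: conv_def delta_False)
  qed
  show "conv (delta h True) (delta g False) = (if dih_cong g (dih_swap h) then delta h True else (\<lambda>_ _. 0))"
  proof (intro ext)
    fix x d'
    have "dih_cong g (dih_swap x) \<longleftrightarrow> dih_cong g (dih_swap h)" if "dih_cong h x"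
      using that dih_cong_trans dih_cong_sym dih_cong_swap by blast
    then show "conv (delta h True) (delta g False) x d' =
        (if dih_cong g (dih_swap h) then delta h True else (\<lambda>_ _. 0)) x d'"
      using delta_not_cong[of h x True True] by (cases d') (auto simp: conv_def delta_False)
  qed
  show "conv (delta g True) (delta (dih_swap g) True) = delta g False"
  proof (intro ext)
    fix x d'
    show "conv (delta g True) (delta (dih_swap g) True) x d' = delta g False x d'"
      by (cases d') (auto simp: conv_def delta_swap delta_square delta_False)
  qed
qed

lemma coord_elt_mult:
  assumes F: "quasi_periodic F" and a: "a \<in> carrier A"
  shows "coord F (elt g d \<otimes>\<^bsub>A\<^esub> a) = coord (\<lambda>h d'. if d = d' then F (g + h) d' else 0) a"
proof -
  have lin: "linear_functional A (\<lambda>a. coord F (elt g d \<otimes>\<^bsub>A\<^esub> a))"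
    using F by (auto simp: linear_functional_def A.r_distr A.smult_mult_right coord_add coord_smult)
  have "coord F (elt g d \<otimes>\<^bsub>A\<^esub> elt h d') = (if d = d' then F (g + h) d' else 0)" for h d'
    using F coord_smult[OF F A.closed, of 0] by (cases "d = d'") auto
  then show ?thesis using functional_eq_coord[OF lin a] by simp
qed

lemma elt_smult_cancel:
  assumes "c \<odot>\<^bsub>A\<^esub> elt g d = c' \<odot>\<^bsub>A\<^esub> elt g d"
  shows "c = c'"
proof -
  have "coord (delta g d) (c \<odot>\<^bsub>A\<^esub> elt g d) = coord (delta g d) (c' \<odot>\<^bsub>A\<^esub> elt g d)" by (simp only: assms)
  then show ?thesis by (simp add: coord_smult quasi_periodic_delta)
qed

lemma coord_product:
  assumes F: "quasi_periodic F" and g: "g = Dih i j True"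
  shows "coord F (((p \<odot>\<^bsub>A\<^esub> elt g False \<oplus>\<^bsub>A\<^esub> q \<odot>\<^bsub>A\<^esub> elt (dih_swap g) False) \<oplus>\<^bsub>A\<^esub>
        (r \<odot>\<^bsub>A\<^esub> elt g True \<oplus>\<^bsub>A\<^esub> t \<odot>\<^bsub>A\<^esub> elt (dih_swap g) True)) \<otimes>\<^bsub>A\<^esub>
      ((p' \<odot>\<^bsub>A\<^esub> elt g False \<oplus>\<^bsub>A\<^esub> q' \<odot>\<^bsub>A\<^esub> elt (dih_swap g) False) \<oplus>\<^bsub>A\<^esub>
        (r' \<odot>\<^bsub>A\<^esub> elt g True \<oplus>\<^bsub>A\<^esub> t' \<odot>\<^bsub>A\<^esub> elt (dih_swap g) True))) =
    (p * p' + q * q') * F (Dih (2 * i + 1) 0 False) False +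
    (p * q' * F (Dih (2 * i + 1) (2 * j + 1) False) False + q * p' * F (Dih (2 * i + 1) (- (2 * j + 1)) False) False) +
    ((r * r' + t * t') * F (Dih (2 * i + 1) 0 False) True +
    (r * t' * F (Dih (2 * i + 1) (2 * j + 1) False) True + t * r' * F (Dih (2 * i + 1) (- (2 * j + 1)) False) True))"
proof -
  have sums: "g + g = Dih (2 * i + 1) 0 False" "g + dih_swap g = Dih (2 * i + 1) (2 * j + 1) False"
    "dih_swap g + g = Dih (2 * i + 1) (- (2 * j + 1)) False" "dih_swap g + dih_swap g = Dih (2 * i + 1) 0 False"
    by (simp_all add: g)
  show ?thesis
    using F by (simp add: A.l_distr A.r_distr A.smult_mult_left A.smult_mult_right A.smult_smult sums coord_add coord_smult)
      (simp add: algebra_simps)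
qed

end

section \<open>The support of an automorphism\<close>

locale suzuki_auto = suzuki_parameters N n mu lam for N n and mu lam :: "'k::field_char_0" +
  fixes \<phi> :: "((nat \<times> nat) list \<Rightarrow>\<^sub>0 'k) set \<Rightarrow> ((nat \<times> nat) list \<Rightarrow>\<^sub>0 'k) set"
  assumes auto: "\<phi> \<in> hopf_auto H"
begin

lemma hom: "\<phi> \<in> algebra_hom A A"
  using auto by (simp add: hopf_auto_iff)

sublocale \<phi>: algebra_map A A \<phi>
  by (rule algebra_map_A[OF assoc_algebra_suzuki_algebra hom])

lemma surj: "\<phi> ` carrier A = carrier A"
  using auto by (auto simp: hopf_auto_iff Bij_def bij_betw_def)

definition rho :: "(dih \<Rightarrow> bool \<Rightarrow> 'k) \<Rightarrow> nat \<Rightarrow> nat \<Rightarrow> 'k" where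
  "rho F i j = coord F (\<phi> (gen i j))"

lemma image_closed [simp]: "\<lbrakk>i \<in> {1, 2}; j \<in> {1, 2}\<rbrakk> \<Longrightarrow> \<phi> (gen i j) \<in> carrier A"
  using gen_closed by simp

lemma rho_conv:
  assumes "quasi_periodic F" "quasi_periodic G" "i \<in> {1, 2}" "j \<in> {1, 2}"
  shows "rho (conv F G) i j = rho F i 1 * rho G 1 j + rho F i 2 * rho G 2 j"
proof -
  have "\<forall>a\<in>carrier A. comult H (\<phi> a) = tensor_map A A A A \<phi> \<phi> (comult H a)"
    using auto by (simp add: hopf_auto_iff)
  then show ?thesis
    using assms unfolding comult_commute_iff[OF hom] rho_def by blast
qed

text \<open>Functionals that vanish on the second component and on \<open>S\<close> in the first
  kill the images of the generators, and therefore the whole image of \<phi>. By surjectivity there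
  is no nonzero functional of this kind, so \<open>S\<close> is the whole group.\<close>

lemma support:
  assumes add: "\<And>g h. \<lbrakk>g \<in> S; h \<in> S\<rbrakk> \<Longrightarrow> g + h \<in> S" and "0 \<in> S"
    and cong: "\<And>g h. \<lbrakk>g \<in> S; dih_cong g h\<rbrakk> \<Longrightarrow> h \<in> S"
    and supp: "\<And>g i j. \<lbrakk>g \<notin> S; i \<in> {1, 2}; j \<in> {1, 2}\<rbrakk> \<Longrightarrow> rho (delta g False) i j = 0"
  shows "dih_u \<in> S" "dih_v \<in> S"
proof -
  define vanishing where "vanishing F \<longleftrightarrow> quasi_periodic F \<and> (\<forall>g\<in>S. F g False = 0) \<and> (\<forall>g. F g True = 0)" for F
  have gens: "coord F (\<phi> (gen i j)) = 0" if F: "vanishing F" and ij: "i \<in> {1, 2}" "j \<in> {1, 2}" for F i j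
  proof -
    have qF: "quasi_periodic F" using F by (simp add: vanishing_def)
    have "coord (delta' p) (\<phi> (gen i j)) * F (fst p) (snd p) = 0" for p
    proof (cases "snd p \<or> fst p \<in> S")
      case True
      then have "F (fst p) (snd p) = 0" using F unfolding vanishing_def by (cases "snd p") auto
      then show ?thesis by simp
    next
      case False
      then show ?thesis using supp[OF _ ij, of "fst p"] by (simp add: rho_def)
    qed
    then have "(\<Sum>p\<in>reps \<times> UNIV. coord (delta' p) (\<phi> (gen i j)) * coord F (elt' p)) = 0"
      using qF by (intro sum.neutral) simp
    then show ?thesis
      using functional_expansion[OF linear_functional_coord[OF qF] image_closed[OF ij]] by simp
  qed
  have all: "\<forall>F. vanishing F \<longrightarrow> coord F (\<phi> a) = 0" if "a \<in> carrier A" for a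
    using that
  proof (induct a rule: suzuki_algebra_induct)
    case (add a a')
    then show ?case by (auto simp: vanishing_def \<phi>.add coord_add)
  next
    case (smult c a)
    then show ?case by (auto simp: vanishing_def \<phi>.smult coord_smult)
  next
    case one
    show ?case using \<open>0 \<in> S\<close> by (simp add: vanishing_def coord_one)
  next
    case (mult i j a)
    show ?case
    proof (intro allI impI)
      fix F assume F: "vanishing F"
      then have qF: "quasi_periodic F" by (simp add: vanishing_def)
      have lin: "linear_functional A (\<lambda>z. coord F (z \<otimes>\<^bsub>A\<^esub> \<phi> a))"
        using qF mult(3) by (auto simp: linear_functional_def A.l_distr A.smult_mult_left coord_add coord_smult)
      \<comment> \<open>At a point of \<open>S\<close> the value is a translate of \<open>F\<close>
        applied to \<open>\<phi> a\<close>. The translate is again vanishing because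
        \<open>S\<close> is closed under addition, so the induction hypothesis applies.\<close>
      have "vanishing (\<lambda>g d. coord F (elt g d \<otimes>\<^bsub>A\<^esub> \<phi> a))"
        unfolding vanishing_def
      proof (intro conjI ballI allI)
        show "quasi_periodic (\<lambda>g d. coord F (elt g d \<otimes>\<^bsub>A\<^esub> \<phi> a))"
          by (rule quasi_periodic_functional[OF lin])
        show "coord F (elt g False \<otimes>\<^bsub>A\<^esub> \<phi> a) = 0" if "g \<in> S" for g
        proof -
          have "vanishing (\<lambda>h d'. if False = d' then F (g + h) d' else 0)"
            using F quasi_periodic_translate(1)[OF qF, of "\<lambda>d. False = d" g] assms(1)[OF that]
            by (simp add: vanishing_def)
          then show ?thesis using mult(3,4) by (simp only: coord_elt_mult[OF qF \<phi>.closed])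
        qed
        show "coord F (elt g True \<otimes>\<^bsub>A\<^esub> \<phi> a) = 0" for g
        proof -
          have "(\<lambda>h d'. if True = d' then F (g + h) d' else 0) = (\<lambda>_ _. 0)"
            using F by (auto simp: vanishing_def fun_eq_iff)
          then show ?thesis using mult(3) by (simp only: coord_elt_mult[OF qF \<phi>.closed] coord_zero \<phi>.closed)
        qed
      qed
      then have "coord (\<lambda>g d. coord F (elt g d \<otimes>\<^bsub>A\<^esub> \<phi> a)) (\<phi> (gen i j)) = 0"
        using gens mult(1,2) by blast
      then have "coord F (\<phi> (gen i j) \<otimes>\<^bsub>A\<^esub> \<phi> a) = 0"
        using functional_eq_coord[OF lin image_closed[OF mult(1,2)]] by simp
      then show "coord F (\<phi> (gen i j \<otimes>\<^bsub>A\<^esub> a)) = 0"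
        using mult(1-3) gen_closed by (simp only: \<phi>.mult)
    qed
  qed
  have "g \<in> S" for g
  proof (rule ccontr)
    assume g: "g \<notin> S"
    have "elt g False \<in> \<phi> ` carrier A" by (simp add: surj)
    then obtain a where a: "a \<in> carrier A" "\<phi> a = elt g False" by (elim imageE) simp
    have "vanishing (delta g False)"
      unfolding vanishing_def delta_False
      using quasi_periodic_delta cong dih_cong_sym g by (auto simp: delta_False)
    then have "coord (delta g False) (elt g False) = 0" using all[OF a(1)] a(2) by metis
    then show False by (simp add: quasi_periodic_delta)
  qed
  then show "dih_u \<in> S" "dih_v \<in> S" by auto
qed

abbreviation "Pr g \<equiv> rho (delta g False)"
abbreviation "Th g \<equiv> rho (delta g True)"

lemma rho_zero: "\<lbrakk>i \<in> {1, 2}; j \<in> {1, 2}\<rbrakk> \<Longrightarrow> rho (\<lambda>_ _. 0) i j = 0"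
  by (simp add: rho_def coord_zero)

lemma rho_delta:
  assumes "i \<in> {1, 2}" "j \<in> {1, 2}"
  shows "Pr g i 1 * rho (delta h d) 1 j + Pr g i 2 * rho (delta h d) 2 j = (if dih_cong g h then rho (delta h d) i j else 0)"
    and "Th h i 1 * Pr g 1 j + Th h i 2 * Pr g 2 j = (if dih_cong g (dih_swap h) then Th h i j else 0)"
    and "Th g i 1 * Th (dih_swap g) 1 j + Th g i 2 * Th (dih_swap g) 2 j = Pr g i j"
  using rho_conv[OF quasi_periodic_delta quasi_periodic_delta assms, of g False h d]
    rho_conv[OF quasi_periodic_delta quasi_periodic_delta assms, of h True g False]
    rho_conv[OF quasi_periodic_delta quasi_periodic_delta assms, of g True "dih_swap g" True]
  by (auto simp: conv_delta rho_zero[OF assms])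

text \<open>The group elements in the support of the first component of \<open>\<phi>\<close> that the swap moves.\<close>

definition moved :: "dih \<Rightarrow> bool" where
  "moved g \<longleftrightarrow> \<not> dih_cong g (dih_swap g) \<and> (\<exists>i\<in>{1, 2}. \<exists>j\<in>{1, 2}. Pr g i j \<noteq> 0)"

text \<open>The points fixed by the swap modulo congruence are closed under addition. They do not
  contain \<open>u\<close>, because \<open>u\<close> and \<open>v\<close> differ by a power of
  \<open>r\<close> that is nontrivial modulo \<open>n\<close>.\<close>

lemma moved_exists: "\<exists>g. moved g"
proof (rule ccontr)
  assume none: "\<nexists>g. moved g"
  let ?S = "{g. dih_cong g (dih_swap g)}"
  have "dih_u \<in> ?S"
  proof (rule support)
    show "g + h \<in> ?S" if "g \<in> ?S" "h \<in> ?S" for g h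
      using that by (simp add: dih_swap_add dih_cong_add)
    show "h \<in> ?S" if "g \<in> ?S" "dih_cong g h" for g h
      using that dih_cong_sym[OF that(2)] dih_cong_swap[of g h] dih_cong_trans by blast
    show "Pr g i j = 0" if "g \<notin> ?S" "i \<in> {1, 2}" "j \<in> {1, 2}" for g i j
      using none that unfolding moved_def by blast
  qed simp
  then have "int n dvd - 1" by (simp add: dih_cong_def dih_defs)
  then show False using n by simp
qed

lemma moved_cong:
  assumes "moved g" "dih_cong g h"
  shows "moved h"
proof -
  have "delta g False = delta h False"
  proof (intro ext)
    fix x d
    have "dih_cong g x \<longleftrightarrow> dih_cong h x"
      using dih_cong_trans[OF assms(2), of x] dih_cong_trans[OF dih_cong_sym[OF assms(2)], of x] by blast
    then show "delta g False x d = delta h False x d"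
      using delta_False[of g x] delta_False[of h x] by (cases d) (simp_all add: delta_def split: dih.splits)
  qed
  moreover have "\<not> dih_cong h (dih_swap h)"
    using assms dih_cong_trans[OF assms(2), of "dih_swap h"]
      dih_cong_trans[of g "dih_swap h" "dih_swap g"] dih_cong_sym[of "dih_swap g" "dih_swap h"]
      dih_cong_swap[of g h] unfolding moved_def by blast
  ultimately show ?thesis using assms(1) by (simp add: moved_def)
qed

text \<open>\<open>Pr g\<close> is the product of \<open>Th g\<close> and
  \<open>Th (dih_swap g)\<close>, and the latter is fixed by left multiplication with
  \<open>Pr (dih_swap g)\<close>. If that projection were zero, \<open>Pr g\<close> would vanish as
  well.\<close>

lemma moved_swap:
  assumes "moved g"
  shows "moved (dih_swap g)"
proof -
  have "\<exists>i\<in>{1, 2}. \<exists>j\<in>{1, 2}. Pr (dih_swap g) i j \<noteq> 0"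
  proof (rule ccontr)
    assume "\<not> ?thesis"
    then have "Th (dih_swap g) i j = 0" if "i \<in> {1, 2}" "j \<in> {1, 2}" for i j
      using rho_delta(1)[OF that, of "dih_swap g" "dih_swap g" True] that by auto
    then have "Pr g i j = 0" if "i \<in> {1, 2}" "j \<in> {1, 2}" for i j
      using rho_delta(3)[OF that, of g] that by simp
    then show False using assms by (auto simp: moved_def)
  qed
  then show ?thesis using assms dih_cong_sym by (auto simp: moved_def)
qed

lemma moved_Pr:
  assumes "moved g"
  shows "Pr g 1 1 + Pr g 2 2 = 1" "Pr g 1 1 * Pr g 2 2 = Pr g 1 2 * Pr g 2 1"
    "Pr (dih_swap g) 1 1 = Pr g 2 2" "Pr (dih_swap g) 2 2 = Pr g 1 1"
    "Pr (dih_swap g) 1 2 = - Pr g 1 2" "Pr (dih_swap g) 2 1 = - Pr g 2 1"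
proof -
  have "\<not> dih_cong g (dih_swap g)" "\<not> dih_cong (dih_swap g) g"
    using assms dih_cong_sym by (auto simp: moved_def)
  note orth = rho_delta(1)[where d = False] this
  have "Pr g i 1 * Pr g 1 j + Pr g i 2 * Pr g 2 j = Pr g i j"
    "Pr (dih_swap g) i 1 * Pr (dih_swap g) 1 j + Pr (dih_swap g) i 2 * Pr (dih_swap g) 2 j = Pr (dih_swap g) i j"
    "Pr g i 1 * Pr (dih_swap g) 1 j + Pr g i 2 * Pr (dih_swap g) 2 j = 0"
    "Pr (dih_swap g) i 1 * Pr g 1 j + Pr (dih_swap g) i 2 * Pr g 2 j = 0"
    if "i \<in> {1, 2}" "j \<in> {1, 2}" for i j
    using orth(1)[OF that] orth(2,3) by simp_all
  note * = orthogonal_idempotents_two[of "Pr g" "Pr (dih_swap g)", OF this]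
  show "Pr g 1 1 + Pr g 2 2 = 1" "Pr g 1 1 * Pr g 2 2 = Pr g 1 2 * Pr g 2 1"
    "Pr (dih_swap g) 1 1 = Pr g 2 2" "Pr (dih_swap g) 2 2 = Pr g 1 1"
    "Pr (dih_swap g) 1 2 = - Pr g 1 2" "Pr (dih_swap g) 2 1 = - Pr g 2 1"
    using * assms moved_swap[OF assms] unfolding moved_def by blast+
qed

text \<open>The point functionals at \<open>g\<close> and its swap add up to a functional
  \<open>E\<close> whose matrix is the identity. So \<open>F\<close> and \<open>conv E F\<close>
  have the same matrix, and \<open>conv E F\<close> depends only on the values of \<open>F\<close>
  at the two points.\<close>

lemma rho_expansion:
  assumes g: "moved g" and F: "quasi_periodic F" and ij: "i \<in> {1, 2}" "j \<in> {1, 2}"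
  shows "rho F i j = (F g False * Pr g i j + F (dih_swap g) False * Pr (dih_swap g) i j) +
    (F g True * Th g i j + F (dih_swap g) True * Th (dih_swap g) i j)"
proof -
  let ?h = "dih_swap g"
  note q = quasi_periodic_delta
  define E where "E = (\<lambda>x d. 1 * delta g False x d + 1 * delta ?h False x d)"
  have qE: "quasi_periodic E" unfolding E_def by (rule coord_linear(2)[OF q q A.one_closed])
  have 12: "1 \<in> {1, 2::nat}" "2 \<in> {1, 2::nat}" by simp_all
  have E: "rho E i j = (if i = j then 1 else 0)" if "i \<in> {1, 2}" "j \<in> {1, 2}" for i j
    unfolding E_def rho_def coord_linear(1)[OF q q image_closed[OF that]]
    using moved_Pr[OF g] that by (auto simp: rho_def add.commute)
  have "rho F i j = rho (conv E F) i j"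
    using rho_conv[OF qE F ij] ij by (auto simp: E simp del: One_nat_def)
  also have "conv E F = (\<lambda>x d. 1 * (F g False * delta g False x d + F ?h False * delta ?h False x d) +
      1 * (F g True * delta g True x d + F ?h True * delta ?h True x d))"
  proof (intro ext)
    fix x d
    have excl: "\<not> (dih_cong g x \<and> dih_cong ?h x)"
      using g dih_cong_trans[of g x ?h] dih_cong_sym[of ?h x] unfolding moved_def by blast
    have "F x d = delta g d x d * F g d" if "dih_cong g x" by (rule quasi_periodic_cong[OF F that])
    moreover have "F x d = delta ?h d x d * F ?h d" if "dih_cong ?h x" by (rule quasi_periodic_cong[OF F that])
    ultimately show "conv E F x d = 1 * (F g False * delta g False x d + F ?h False * delta ?h False x d) +
      1 * (F g True * delta g True x d + F ?h True * delta ?h True x d)"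
      using excl delta_not_cong[of g x] delta_not_cong[of ?h x]
      by (cases "dih_cong g x"; cases "dih_cong ?h x"; cases d) (auto simp: conv_def E_def delta_False)
  qed
  also have "rho \<dots> i j = (F g False * Pr g i j + F ?h False * Pr ?h i j) +
    (F g True * Th g i j + F ?h True * Th ?h i j)"
    unfolding rho_def
    by (subst coord_linear(1)[OF coord_linear(2)[OF q q A.one_closed] coord_linear(2)[OF q q A.one_closed] image_closed[OF ij]])
      (simp only: coord_linear(1)[OF q q image_closed[OF ij]] mult_1)
  finally show ?thesis .
qed

lemma image_expansion:
  assumes g: "moved g" and ij: "i \<in> {1, 2}" "j \<in> {1, 2}"
  shows "\<phi> (gen i j) = (Pr g i j \<odot>\<^bsub>A\<^esub> elt g False \<oplus>\<^bsub>A\<^esub> Pr (dih_swap g) i j \<odot>\<^bsub>A\<^esub> elt (dih_swap g) False) \<oplus>\<^bsub>A\<^esub>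
    (Th g i j \<odot>\<^bsub>A\<^esub> elt g True \<oplus>\<^bsub>A\<^esub> Th (dih_swap g) i j \<odot>\<^bsub>A\<^esub> elt (dih_swap g) True)"
  by (rule coord_ext)
    (use rho_expansion[OF g _ ij] image_closed[OF ij] in \<open>simp_all add: coord_add coord_smult rho_def mult.commute\<close>)

text \<open>Only the classes of \<open>g\<close> and its swap carry a nonzero projection. Hence
  these two points generate the group modulo \<open>z^N\<close> and \<open>r^n\<close>, and suitable
  sets \<open>S\<close> turn this into arithmetic conditions on \<open>g\<close>.\<close>

lemma moved_support:
  assumes g: "moved g" and add: "\<And>g h. \<lbrakk>g \<in> S; h \<in> S\<rbrakk> \<Longrightarrow> g + h \<in> S" and "0 \<in> S"
    and cong: "\<And>g h. \<lbrakk>g \<in> S; dih_cong g h\<rbrakk> \<Longrightarrow> h \<in> S" and "g \<in> S" "dih_swap g \<in> S"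
  shows "dih_u \<in> S \<and> dih_v \<in> S"
proof -
  have supp: "Pr h i j = 0" if "h \<notin> S" "i \<in> {1, 2}" "j \<in> {1, 2}" for h i j
  proof -
    have "\<not> dih_cong h g" "\<not> dih_cong h (dih_swap g)"
      using that(1) assms(5,6) cong dih_cong_sym by blast+
    then show ?thesis
      using rho_expansion[OF g quasi_periodic_delta that(2,3), of h False] by (simp add: delta_False)
  qed
  show ?thesis
    by (intro conjI support[where S = S]; (rule \<open>0 \<in> S\<close> | rule add | rule supp | erule cong); assumption)
qed

text \<open>Two maps detect a failure to generate: the degree modulo a common divisor, and a crossed
  homomorphism measuring the second coordinate relative to \<open>g\<close>.\<close>

lemma moved_coprime:
  assumes "moved g"
  obtains i j where "g = Dih i j True" "coprime (2 * i + 1) (int N)" "coprime (2 * j + 1) (int n)"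
proof -
  obtain i j e where g: "g = Dih i j e" by (cases g)
  \<comment> \<open>The degree counts letters, with \<open>z\<close> of degree 2. The points
    \<open>g\<close> and its swap have the same degree, \<open>z^N\<close> has degree
    \<open>2 * N\<close>, and \<open>u\<close> has degree 1; so the common divisor is 1, and the
    degree of \<open>g\<close> is odd.\<close>
  define D where "D = gcd (2 * i + (if e then 1 else 0)) (2 * int N)"
  let ?deg = "\<lambda>g. case g of Dih i j e \<Rightarrow> 2 * i + (if e then 1 else 0 :: int)"
  let ?S = "{g. D dvd ?deg g}"
  have deg_add: "?deg (g + h) = ?deg g + ?deg h" for g h by (cases g; cases h) auto
  have "dih_u \<in> ?S \<and> dih_v \<in> ?S"
  proof (rule moved_support[OF assms])
    show "g + h \<in> ?S" if "g \<in> ?S" "h \<in> ?S" for g h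
      using that by (simp only: mem_Collect_eq deg_add dvd_add)
    show "h \<in> ?S" if "g \<in> ?S" "dih_cong g h" for g h
    proof -
      obtain p q f where gh: "g = Dih p q f" by (cases g)
      obtain p' q' f' where hh: "h = Dih p' q' f'" by (cases h)
      have "int N dvd p' - p" using that(2) by (simp add: dih_cong_def gh hh)
      then have "2 * int N dvd 2 * (p' - p)" by (rule mult_dvd_mono[OF dvd_refl])
      then have "D dvd 2 * (p' - p)" unfolding D_def by (meson dvd_trans gcd_dvd2)
      from dvd_add[OF _ this, of "?deg g"] that show ?thesis
        by (auto simp: gh hh dih_cong_def algebra_simps)
    qed
    show "g \<in> ?S" "dih_swap g \<in> ?S" by (simp_all add: g D_def)
  qed (simp add: zero_dih_def)
  then have "D dvd 1" by (simp add: dih_defs)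
  then have cop: "coprime (2 * i + (if e then 1 else 0)) (2 * int N)"
    by (simp add: D_def coprime_iff_gcd_eq_1)
  then have e: e by (cases e) auto
  have "coprime (2 * i + 1) (int N)" using cop e by simp
  moreover have "coprime (2 * j + 1) (int n)"
  proof -
    define D where "D = gcd (2 * j + 1) (int n)"
    \<comment> \<open>The offset is additive up to sign, vanishes at \<open>g\<close> and equals
      \<open>- (2 * j + 1)\<close> at its swap. Its values at \<open>u\<close> and \<open>v\<close>
      differ by 1, so a common divisor of \<open>2 * j + 1\<close> and \<open>n\<close> divides
      1.\<close>
    let ?off = "\<lambda>g. case g of Dih p q f \<Rightarrow> q - (if f then j else 0)"
    let ?S = "{g. D dvd ?off g}"
    have D: "D dvd 2 * j + 1" "D dvd int n" by (simp_all add: D_def)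
    have "dih_u \<in> ?S \<and> dih_v \<in> ?S"
    proof (rule moved_support[OF assms])
      show "g + h \<in> ?S" if "g \<in> ?S" "h \<in> ?S" for g h
      proof -
        have "?off (g + h) = ?off g + ?off h \<or> ?off (g + h) = ?off g - ?off h"
          by (cases g; cases h) auto
        then show ?thesis using that dvd_add[of D "?off g" "?off h"] dvd_diff[of D "?off g" "?off h"] by auto
      qed
      show "h \<in> ?S" if "g \<in> ?S" "dih_cong g h" for g h
      proof -
        obtain p q f where gh: "g = Dih p q f" by (cases g)
        obtain p' q' f' where hh: "h = Dih p' q' f'" by (cases h)
        have "D dvd q' - q" using that(2) D(2) by (auto simp: dih_cong_def gh hh intro: dvd_trans)
        from dvd_add[OF _ this, of "?off g"] that show ?thesis
          by (auto simp: gh hh dih_cong_def algebra_simps)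
      qed
      have "D dvd - j - 1 - j" using D(1) by (metis dvd_minus_iff minus_add_distrib minus_diff_eq mult_2 diff_minus_eq_add uminus_add_conv_diff diff_diff_eq add.commute add.assoc)
      then show "g \<in> ?S" "dih_swap g \<in> ?S" using e by (simp_all add: g)
    qed (simp add: zero_dih_def)
    then have "D dvd - j" "D dvd - 1 - j" by (simp_all add: dih_defs)
    then have "D dvd - j - (- 1 - j)" by (rule dvd_diff)
    then show ?thesis by (simp add: D_def coprime_iff_gcd_eq_1)
  qed
  ultimately show thesis using that g e by simp
qed

text \<open>The swap replaces the second coordinate \<open>r\<close> modulo \<open>n\<close> by
  \<open>n - 1 - r\<close>, so one of the two points has \<open>2 * r + 1\<close> at most
  \<open>n\<close>; equality is impossible by coprimality. This point is \<open>z^s\<close> times an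
  alternating word with \<open>t = 2 * k + 1\<close> letters.\<close>

lemma moved_word_point:
  obtains s k where "s \<in> {1..N}" "2 * k + 1 \<in> {1..n - 1}" "moved (Dih (int (s + k)) (int k) True)"
proof -
  obtain g where g: "moved g" using moved_exists by blast
  obtain i j where ij: "g = Dih i j True" "coprime (2 * i + 1) (int N)" "coprime (2 * j + 1) (int n)"
    by (rule moved_coprime[OF g])
  have shift: "thesis" if "moved (Dih i (int k) True)" "2 * k + 1 \<in> {1..n - 1}" for i k
  proof -
    \<comment> \<open>The offset by one places \<open>s\<close> in \<open>1, ..., N\<close> instead
      of \<open>0, ..., N - 1\<close>.\<close>
    define s where "s = nat ((i - int k - 1) mod int N) + 1"
    have s: "int s = (i - int k - 1) mod int N + 1" using N by (simp add: s_def)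
    have "s \<in> {1..N}" using N pos_mod_bound[of "int N" "i - int k - 1"] pos_mod_sign[of "int N" "i - int k - 1"] s unfolding atLeastAtMost_iff by linarith
    moreover have "dih_cong (Dih i (int k) True) (Dih (int (s + k)) (int k) True)"
    proof -
      have "int (s + k) - i = (i - int k - 1) mod int N - (i - int k - 1)" by (simp add: s)
      also have "int N dvd \<dots>" by (simp add: mod_eq_dvd_iff[symmetric])
      finally show ?thesis by (simp add: dih_cong_def)
    qed
    ultimately show thesis
      using \<open>\<And>s k. \<lbrakk>s \<in> {1..N}; 2 * k + 1 \<in> {1..n - 1}; moved (Dih (int (s + k)) (int k) True)\<rbrakk> \<Longrightarrow> thesis\<close>
        moved_cong[OF that(1)] that(2) by blast
  qed
  define r where "r = j mod int n"
  have r: "0 \<le> r" "r < int n" "int n dvd r - j" using n by (simp_all add: r_def mod_eq_dvd_iff[symmetric])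
  \<comment> \<open>The fixed point of \<open>r\<close> going to \<open>n - 1 - r\<close>, where
    neither of the two points would give \<open>t < n\<close>.\<close>
  have ne: "2 * r + 1 \<noteq> int n"
  proof
    assume rn: "2 * r + 1 = int n"
    have "2 * j + 1 = int n - 2 * (r - j)" using rn by simp
    then have "int n dvd 2 * j + 1" using r(3) by (simp only: dvd_diff dvd_refl dvd_mult)
    then have "is_unit (int n)" using ij(3) by (meson coprime_common_divisor dvd_refl)
    then show False using n by simp
  qed
  show thesis
  proof (cases "2 * r + 1 < int n")
    case True
    define k where "k = nat r"
    have "dih_cong g (Dih i (int k) True)" using r by (simp add: dih_cong_def ij(1) k_def)
    moreover have "2 * k + 1 \<in> {1..n - 1}" using True r(1) by (simp add: k_def)
    ultimately show thesis using shift moved_cong[OF g] by blast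
  next
    case False
    define k where "k = nat (int n - 1 - r)"
    have k: "int k = int n - 1 - r" using r by (simp add: k_def)
    have "int n dvd int k - (- j - 1)"
    proof -
      have "int k - (- j - 1) = int n - (r - j)" by (simp add: k)
      then show ?thesis using r(3) by (metis dvd_diff dvd_refl)
    qed
    then have "dih_cong (dih_swap g) (Dih i (int k) True)" by (simp add: dih_cong_def ij(1))
    moreover have "2 * k + 1 \<in> {1..n - 1}" using False ne r k unfolding atLeastAtMost_iff by linarith
    ultimately show thesis using shift moved_cong[OF moved_swap[OF g]] by blast
  qed
qed

section \<open>Consequences of the relations for the images of the generators\<close>

lemma image_product:
  assumes g: "moved g" "g = Dih i j True" and F: "quasi_periodic F"
    and kl: "k \<in> {1, 2}" "l \<in> {1, 2}" "k' \<in> {1, 2}" "l' \<in> {1, 2}"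
  shows "coord F (\<phi> (gen k l) \<otimes>\<^bsub>A\<^esub> \<phi> (gen k' l')) =
    (Pr g k l * Pr g k' l' + Pr (dih_swap g) k l * Pr (dih_swap g) k' l') * F (Dih (2 * i + 1) 0 False) False +
    (Pr g k l * Pr (dih_swap g) k' l' * F (Dih (2 * i + 1) (2 * j + 1) False) False +
      Pr (dih_swap g) k l * Pr g k' l' * F (Dih (2 * i + 1) (- (2 * j + 1)) False) False) +
    ((Th g k l * Th g k' l' + Th (dih_swap g) k l * Th (dih_swap g) k' l') * F (Dih (2 * i + 1) 0 False) True +
    (Th g k l * Th (dih_swap g) k' l' * F (Dih (2 * i + 1) (2 * j + 1) False) True +
      Th (dih_swap g) k l * Th g k' l' * F (Dih (2 * i + 1) (- (2 * j + 1)) False) True))"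
  unfolding image_expansion[OF g(1) kl(1,2)] image_expansion[OF g(1) kl(3,4)]
  by (rule coord_product[OF F g(2)])

lemma image_gen_mult:
  assumes "k \<in> {1, 2}" "l \<in> {1, 2}" "k' \<in> {1, 2}" "l' \<in> {1, 2}"
  shows "\<phi> (gen k l) \<otimes>\<^bsub>A\<^esub> \<phi> (gen k' l') = \<phi> (gen k l \<otimes>\<^bsub>A\<^esub> gen k' l')"
  using assms gen_closed by (simp only: \<phi>.mult)

lemma image_gen_mult_zero:
  assumes "k \<in> {1, 2}" "l \<in> {1, 2}" "k' \<in> {1, 2}" "l' \<in> {1, 2}" "(k = l) \<noteq> (k' = l')"
  shows "\<phi> (gen k l) \<otimes>\<^bsub>A\<^esub> \<phi> (gen k' l') = \<zero>\<^bsub>A\<^esub>"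
proof -
  have "gen k l \<otimes>\<^bsub>A\<^esub> gen k' l' = \<zero>\<^bsub>A\<^esub>"
    unfolding gen_eq[OF assms(1,2)] gen_eq[OF assms(3,4)] by (rule A.mult_zero') (use assms(5) in auto)
  then show ?thesis by (simp only: image_gen_mult[OF assms(1-4)] \<phi>.zero)
qed

text \<open>The product of \<open>x 1 1\<close> with \<open>x 1 2\<close> or \<open>x 2 1\<close> is
  zero. At \<open>z^(2i+1)\<close> this gives \<open>Pr g 1 1 = Pr g 2 2\<close>, and the trace is
  1. If \<open>n\<close> were not 2, then \<open>r^(2j+1)\<close> and its inverse would be distinct
  points, and the coefficient \<open>- Pr g 1 1 * Pr g k l\<close> at one of them could not
  vanish.\<close>

lemma moved_off_diagonal:
  assumes g: "moved g" "g = Dih i j True" and j: "coprime (2 * j + 1) (int n)"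
    and kl: "(k, l) = (1, 2) \<or> (k, l) = (2, 1)" and nz: "Pr g k l \<noteq> 0"
  shows "n = 2" "Pr g 1 1 = 1 / 2" "Pr g 2 2 = 1 / 2"
proof -
  have kl': "1 \<in> {1, 2::nat}" "k \<in> {1, 2}" "l \<in> {1, 2}" "(1 = (1::nat)) \<noteq> (k = l)" using kl by auto
  have zero: "coord F (\<phi> (gen 1 1) \<otimes>\<^bsub>A\<^esub> \<phi> (gen k l)) = 0" if "quasi_periodic F" for F
    unfolding image_gen_mult_zero[OF kl'(1) kl'(1) kl'(2-)] using that coord_smult[OF that A.one_closed, of 0] by simp
  have swap: "Pr (dih_swap g) 1 1 = Pr g 2 2" "Pr (dih_swap g) k l = - Pr g k l"
    using moved_Pr[OF g(1)] kl by auto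
  note prod = image_product[OF g _ kl'(1) kl'(1) kl'(2,3), unfolded swap]
  have sum: "Pr g 1 1 + Pr g 2 2 = 1" by (rule moved_Pr(1)[OF g(1)])
  \<comment> \<open>\<open>2 * j + 1\<close> is invertible modulo \<open>n\<close>, so the point
    \<open>r^(2j+1)\<close> is different from the neutral one.\<close>
  have not_dvd: "\<not> int n dvd 2 * j + 1"
    using coprime_common_divisor[OF j _ dvd_refl] n by auto
  moreover have "- 1 - j * 2 = - (2 * j + 1)" by simp
  ultimately have not_dvd': "\<not> int n dvd - 1 - j * 2" by (simp only: dvd_minus_iff) simp
  have "(Pr g 1 1 - Pr g 2 2) * Pr g k l = 0"
    using zero[OF quasi_periodic_delta] prod[OF quasi_periodic_delta, of "Dih (2 * i + 1) 0 False" False] not_dvd not_dvd'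
    by (auto simp: delta_False dih_cong_def algebra_simps)
  with nz sum show *: "Pr g 1 1 = 1 / 2" "Pr g 2 2 = 1 / 2" by (auto simp: field_simps)
  show "n = 2"
  proof (rule ccontr)
    assume "n \<noteq> 2"
    then have "\<not> int n dvd 2" using n by (auto dest: zdvd_imp_le)
    then have "\<not> int n dvd 2 * (2 * j + 1)"
      using coprime_dvd_mult_left_iff[of "int n" "2 * j + 1" 2] j by (simp add: coprime_commute)
    moreover have "- (2 * j + 1) - (2 * j + 1) = - (2 * (2 * j + 1))" by simp
    ultimately have "\<not> int n dvd - (2 * j + 1) - (2 * j + 1)" by (simp only: dvd_minus_iff) simp
    then have "Pr g 1 1 * Pr g k l = 0"
      using zero[OF quasi_periodic_delta] prod[OF quasi_periodic_delta, of "Dih (2 * i + 1) (2 * j + 1) False" False]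
        not_dvd not_dvd' by (simp add: delta_False dih_cong_def algebra_simps)
    then show False using nz * by simp
  qed
qed

text \<open>The two projections are the diagonal matrix units. Multiplying \<open>Th g\<close> and
  \<open>Th (dih_swap g)\<close> by them on both sides leaves one off-diagonal entry each, and the
  product rule makes these entries inverse to each other.\<close>

lemma monomial_of_diagonal:
  assumes g: "moved g" and Pr: "Pr g 1 1 = 1" "Pr g 1 2 = 0" "Pr g 2 1 = 0"
  obtains d where "d \<noteq> 0" "monomial_auto g d \<phi>"
proof -
  let ?h = "dih_swap g"
  have 12: "1 \<in> {1, 2::nat}" "2 \<in> {1, 2::nat}" by simp_all
  note Prs = Pr moved_Pr(1)[OF g] moved_Pr(3-)[OF g]
  have Pr22: "Pr g 2 2 = 0" using Prs by simp
  have cong: "\<not> dih_cong g ?h" using g by (simp add: moved_def)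
  note left = rho_delta(1)[where d = True] and right = rho_delta(2)
  have "Th g 2 j = 0" if "j \<in> {1, 2}" for j
    using left[OF 12(2) that, of g g] Prs Pr22 by simp
  moreover have "Th g i 1 = 0" if "i \<in> {1, 2}" for i
    using right[OF that 12(1), of g ?h] Prs Pr22 by simp
  moreover have "Th ?h 1 j = 0" if "j \<in> {1, 2}" for j
    using left[OF 12(1) that, of ?h ?h] Prs Pr22 by simp
  moreover have "Th ?h i 2 = 0" if "i \<in> {1, 2}" for i
    using right[OF that 12(2), of ?h g] Prs Pr22 by simp
  moreover have "Th g 1 1 * Th ?h 1 1 + Th g 1 2 * Th ?h 2 1 = 1"
    using rho_delta(3)[OF 12(1) 12(1), of g] Prs by simp
  ultimately have Th: "Th g 1 1 = 0" "Th g 2 1 = 0" "Th g 2 2 = 0" "Th ?h 1 1 = 0" "Th ?h 1 2 = 0" "Th ?h 2 2 = 0"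
    and d: "Th g 1 2 * Th ?h 2 1 = 1" using 12 by auto
  have inv: "Th ?h 2 1 = inverse (Th g 1 2)" using inverse_unique[OF d] by simp
  show thesis
  proof
    show "Th g 1 2 \<noteq> 0" using d by auto
    show "monomial_auto g (Th g 1 2) \<phi>"
      unfolding monomial_auto_def image_expansion[OF g 12(1) 12(1)] image_expansion[OF g 12(1) 12(2)]
        image_expansion[OF g 12(2) 12(1)] image_expansion[OF g 12(2) 12(2)] Th inv Prs Pr22
      using auto by simp
  qed
qed

text \<open>In the second component \<open>u u = v v\<close> gives
  \<open>d * d = inverse d * inverse d\<close>, and comparing \<open>z^(N+1)\<close> with
  \<open>mu z\<close> gives \<open>d ^ (2 * N) = 1\<close>. Finally \<open>u v\<close> is mapped
  with scalar 1, while its \<open>n\<close>-th power is \<open>lam z^n\<close>, whose image carries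
  \<open>d ^ (2 * n)\<close>.\<close>

lemma monomial_auto_scalar:
  assumes g: "g = Dih i j True" and d: "d \<noteq> 0" and mono: "monomial_auto g d \<phi>"
  shows "d ^ 4 = 1" "d ^ (2 * N) = 1" "d ^ (2 * n) = 1"
proof -
  have u: "\<phi> (elt dih_u True) = d \<odot>\<^bsub>A\<^esub> elt g True" and v: "\<phi> (elt dih_v True) = inverse d \<odot>\<^bsub>A\<^esub> elt (dih_swap g) True"
    using mono by (simp_all add: monomial_auto_def gen_simps)
  have add: "\<phi> (elt (x + y) True) = (c * c') \<odot>\<^bsub>A\<^esub> elt (x' + y') True"
    if "\<phi> (elt x True) = c \<odot>\<^bsub>A\<^esub> elt x' True" "\<phi> (elt y True) = c' \<odot>\<^bsub>A\<^esub> elt y' True" for x y x' y' c c'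
  proof -
    have "\<phi> (elt (x + y) True) = \<phi> (elt x True) \<otimes>\<^bsub>A\<^esub> \<phi> (elt y True)"
      by (simp flip: \<phi>.mult)
    then show ?thesis unfolding that by (simp add: A.smult_mult_left A.smult_mult_right A.smult_smult mult.commute)
  qed
  have uu: "\<phi> (elt (Dih 1 0 False) True) = (d * d) \<odot>\<^bsub>A\<^esub> elt (Dih (2 * i + 1) 0 False) True"
    using add[OF u u] by (simp add: g dih_defs)
  have vv: "\<phi> (elt (Dih 1 0 False) True) = (inverse d * inverse d) \<odot>\<^bsub>A\<^esub> elt (Dih (2 * i + 1) 0 False) True"
    using add[OF v v] by (simp add: g dih_defs)
  have uv: "\<phi> (elt (Dih 1 1 False) True) = 1 \<odot>\<^bsub>A\<^esub> elt (Dih (2 * i + 1) (2 * j + 1) False) True"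
    using add[OF u v] d by (simp add: g dih_defs)
  have "d * d = inverse d * inverse d" by (rule elt_smult_cancel[OF trans[OF uu[symmetric] vv]])
  then show "d ^ 4 = 1" using d by (simp add: field_simps power4_eq_xxxx)
  have pow_uu: "\<phi> (elt (Dih (int (Suc m)) 0 False) True) =
      d ^ (2 * Suc m) \<odot>\<^bsub>A\<^esub> elt (Dih (int (Suc m) * (2 * i + 1)) 0 False) True" for m
  proof (induct m)
    case (Suc m)
    then show ?case using add[OF uu Suc] by (simp add: algebra_simps)
  qed (use uu in \<open>simp add: power2_eq_square\<close>)
  have pow_uv: "\<phi> (elt (Dih (int (Suc m)) (int (Suc m)) False) True) =
      1 \<odot>\<^bsub>A\<^esub> elt (Dih (int (Suc m) * (2 * i + 1)) (int (Suc m) * (2 * j + 1)) False) True" for m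
  proof (induct m)
    case (Suc m)
    then show ?case using add[OF uv Suc] by (simp add: algebra_simps)
  qed (use uv in simp)
  have sign_odd: "sign_power m True (2 * k + 1) = m" "sign_power m True (k * 2 + 1) = m" "sign_power m True (1 + k * 2) = m" "sign_power m True 1 = m" for m k
    by (simp_all add: sign_power_def component_sign_def)
  have sign_zero: "sign_power m True 0 = 1" for m
    by (simp add: sign_power_def component_sign_def)
  have units: "mu \<noteq> 0" "lam \<noteq> 0"
    using sign_nonzero[where d = True] by (simp_all add: component_sign_def)
  have "(mu * (d * d)) \<odot>\<^bsub>A\<^esub> elt (Dih (2 * i + 1) 0 False) True = \<phi> (elt (Dih (int (Suc N)) 0 False) True)"
    using elt_congruent[of "int (Suc N)" 1 1 0 0 0 False True] by (simp add: sign_odd sign_zero \<phi>.smult uu A.smult_smult)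
  also have "\<dots> = (d ^ (2 * Suc N) * mu) \<odot>\<^bsub>A\<^esub> elt (Dih (2 * i + 1) 0 False) True"
    unfolding pow_uu
    using elt_congruent[of "int (Suc N) * (2 * i + 1)" "2 * i + 1" "2 * i + 1" 0 0 0 False True]
    by (simp add: algebra_simps sign_odd sign_zero A.smult_smult)
  finally have "mu * (d * d) = d ^ (2 * Suc N) * mu" by (rule elt_smult_cancel)
  then show "d ^ (2 * N) = 1" using units d by simp
  obtain m where m: "n = Suc m" using n by (cases n) auto
  have "lam \<odot>\<^bsub>A\<^esub> elt (Dih (int n * (2 * i + 1)) 0 False) True = \<phi> (elt (Dih (int n) (int n) False) True)"
    using pow_uv[of m] elt_congruent[of "int n * (2 * i + 1)" "int n * (2 * i + 1)" 0 "int n * (2 * j + 1)" 0 "2 * j + 1" False True]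
    by (simp add: m[symmetric] mult.commute sign_odd sign_zero del: of_nat_Suc)
  also have "\<dots> = (lam * d ^ (2 * n)) \<odot>\<^bsub>A\<^esub> elt (Dih (int n * (2 * i + 1)) 0 False) True"
    using pow_uu[of m] elt_congruent[of "int n" "int n" 0 "int n" 0 1 False True]
    by (simp add: m[symmetric] \<phi>.smult A.smult_smult sign_odd sign_zero del: of_nat_Suc)
  finally have "lam = lam * d ^ (2 * n)" by (rule elt_smult_cancel)
  then show "d ^ (2 * n) = 1" using units by simp
qed

text \<open>\<open>Pr g\<close> and its complement have rank one and depend on a single parameter
  \<open>a\<close>. Invariance under one of them from the left and the other from the right
  determines each \<open>Th\<close> up to a scalar, and the product rule for \<open>Th\<close> gives
  \<open>\<gamma> * \<delta> = 1 / 4\<close>.\<close>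

lemma gamma_matrices:
  assumes g: "moved g" and Pr: "Pr g 1 1 = 1 / 2" "Pr g 2 2 = 1 / 2"
  obtains a \<gamma> \<delta> where "a \<noteq> 0" "\<gamma> * \<delta> = 1 / 4"
    "Pr g 1 2 = a / 2" "Pr g 2 1 = inverse a / 2"
    "Th g 1 1 = \<gamma>" "Th g 1 2 = - a * \<gamma>" "Th g 2 1 = inverse a * \<gamma>" "Th g 2 2 = - \<gamma>"
    "Th (dih_swap g) 1 1 = \<delta>" "Th (dih_swap g) 1 2 = a * \<delta>"
    "Th (dih_swap g) 2 1 = - inverse a * \<delta>" "Th (dih_swap g) 2 2 = - \<delta>"
proof -
  let ?h = "dih_swap g"
  have 12: "1 \<in> {1, 2::nat}" "2 \<in> {1, 2::nat}" by simp_all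
  define a where "a = 2 * Pr g 1 2"
  have prod: "Pr g 1 2 * Pr g 2 1 = 1 / 4" using moved_Pr(2)[OF g, unfolded Pr] by simp
  then have a: "a \<noteq> 0" by (auto simp: a_def)
  have P12: "Pr g 1 2 = a / 2" by (simp add: a_def)
  have "a * (2 * Pr g 2 1) = 1" using prod by (simp add: a_def field_simps)
  then have P21: "Pr g 2 1 = inverse a / 2" by (simp add: inverse_unique)
  have Pr': "Pr ?h 1 1 = 1 / 2" "Pr ?h 2 2 = 1 / 2" "Pr ?h 1 2 = - (a / 2)" "Pr ?h 2 1 = - (inverse a / 2)"
    by (simp_all only: moved_Pr(3-)[OF g] Pr P12 P21)
  note Ps = Pr P12 P21 Pr'
  note left = rho_delta(1)[where d = True] and right = rho_delta(2)
  have solve: "1 / 2 * x + a / 2 * y = x \<Longrightarrow> y = inverse a * x" "1 / 2 * x + - (a / 2) * y = x \<Longrightarrow> y = - inverse a * x"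
    "x * (1 / 2) + y * - (inverse a / 2) = x \<Longrightarrow> y = - a * x" "x * (1 / 2) + y * (inverse a / 2) = x \<Longrightarrow> y = a * x" for x y
    using a by (auto simp: field_simps eq_neg_iff_add_eq_0)
  have T_rows: "Th g 2 j = inverse a * Th g 1 j" if "j \<in> {1, 2}" for j
    by (rule solve) (use left[OF 12(1) that, of g g, unfolded Ps] in simp)
  have T_cols: "Th g 1 2 = - a * Th g 1 1"
    by (rule solve) (use right[OF 12(1) 12(1), of g ?h, unfolded Ps] in simp)
  have U_rows: "Th ?h 2 j = - inverse a * Th ?h 1 j" if "j \<in> {1, 2}" for j
    by (rule solve) (use left[OF 12(1) that, of ?h ?h, unfolded Ps] in simp)
  have U_cols: "Th ?h 1 2 = a * Th ?h 1 1"
    by (rule solve) (use right[OF 12(1) 12(1), of ?h g, unfolded Ps] in simp)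
  have "Th g 1 1 * Th ?h 1 1 + Th g 1 2 * Th ?h 2 1 = 1 / 2"
    using rho_delta(3)[OF 12(1) 12(1), of g] Ps by simp
  then have "Th g 1 1 * Th ?h 1 1 = 1 / 4"
    using a unfolding T_cols U_rows[OF 12(1)] by (simp add: field_simps)
  then show thesis
    by (rule that[OF a _ P12 P21 refl T_cols _ _ refl U_cols])
      (use a T_rows[OF 12(1)] T_rows[OF 12(2)] U_rows[OF 12(1)] U_rows[OF 12(2)] T_cols U_cols in simp_all)
qed

text \<open>In the second component \<open>x 1 1\<close> times \<open>x 1 2\<close> vanishes: the
  coefficient at \<open>z^(2i+1)\<close> gives
  \<open>\<gamma> * \<gamma> = \<delta> * \<delta>\<close>, hence the fourth power of
  \<open>2 * \<gamma>\<close>, and the coefficient at \<open>r z^(2i+1)\<close> gives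
  \<open>lam = 1\<close>, since moving from \<open>r^-1\<close> to \<open>r\<close> costs the sign
  \<open>lam\<close>. The equality of the squares of \<open>x 1 2\<close> and \<open>x 2 1\<close>
  in the first component gives \<open>a ^ 4 = 1\<close>.\<close>

lemma gamma_parameters:
  assumes g: "moved g" "g = Dih i 0 True" and n2: "n = 2"
    and a: "a \<noteq> 0" and \<gamma>\<delta>: "\<gamma> * \<delta> = 1 / 4"
    and Pr: "Pr g 1 1 = 1 / 2" "Pr g 2 2 = 1 / 2" "Pr g 1 2 = a / 2" "Pr g 2 1 = inverse a / 2"
    and Th: "Th g 1 1 = \<gamma>" "Th g 1 2 = - a * \<gamma>" "Th (dih_swap g) 1 1 = \<delta>" "Th (dih_swap g) 1 2 = a * \<delta>"
  shows "lam = 1" "a ^ 4 = 1" "(2 * \<gamma>) ^ 4 = 1"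
proof -
  have 12: "1 \<in> {1, 2::nat}" "2 \<in> {1, 2::nat}" "(1 = (1::nat)) \<noteq> (1 = (2::nat))" by simp_all
  have zero: "coord F (\<phi> (gen 1 1) \<otimes>\<^bsub>A\<^esub> \<phi> (gen 1 2)) = 0" if "quasi_periodic F" for F
    unfolding image_gen_mult_zero[OF 12(1) 12(1) 12(1,2,3)]
    using that coord_smult[OF that A.one_closed, of 0] by simp
  have \<gamma>\<delta>0: "\<gamma> \<noteq> 0" "\<delta> \<noteq> 0" using \<gamma>\<delta> by auto
  have Pr': "Pr (dih_swap g) 1 1 = 1 / 2" "Pr (dih_swap g) 1 2 = - (a / 2)" "Pr (dih_swap g) 2 1 = - (inverse a / 2)"
    using moved_Pr(3-)[OF g(1)] Pr by simp_all
  note prod = image_product[OF g quasi_periodic_delta 12(1) 12(1) 12(1,2), unfolded Pr Pr' Th, symmetric,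
      unfolded zero[OF quasi_periodic_delta]]
  have sign: "sign_power m True 0 = 1" "sign_power m True (- 1) = m" for m
    by (simp_all add: sign_power_def component_sign_def)
  have vals: "delta (Dih p 0 False) True (Dih p 1 False) True = 0" "delta (Dih p 0 False) True (Dih p (- 1) False) True = 0"
    "delta (Dih p 1 False) True (Dih p 0 False) True = 0" "delta (Dih p 1 False) True (Dih p (- 1) False) True = lam" for p
    unfolding delta_def by (simp_all add: n2 sign)
  have "\<gamma> * (- a * \<gamma>) + \<delta> * (a * \<delta>) = 0"
    using prod[of "Dih (2 * i + 1) 0 False" True] by (simp add: vals)
  then have "a * (\<delta> * \<delta> - \<gamma> * \<gamma>) = 0" by (simp add: algebra_simps)
  then have sq: "\<gamma> * \<gamma> = \<delta> * \<delta>" using a by simp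
  have "(\<gamma> * \<gamma>) * (\<gamma> * \<gamma>) = (\<gamma> * \<delta>) * (\<gamma> * \<delta>)" using sq by (simp add: mult.assoc mult.left_commute)
  then show "(2 * \<gamma>) ^ 4 = 1" unfolding \<gamma>\<delta> by (simp add: power4_eq_xxxx field_simps)
  have "\<gamma> * (a * \<delta>) + \<delta> * (- a * \<gamma>) * lam = 0"
    using prod[of "Dih (2 * i + 1) 1 False" True] by (simp add: vals)
  then have "a * (\<gamma> * \<delta>) * (1 - lam) = 0" by (simp add: algebra_simps)
  then show "lam = 1" using a \<gamma>\<delta>0 by simp
  have "gen 1 2 \<otimes>\<^bsub>A\<^esub> gen 1 2 = gen 2 1 \<otimes>\<^bsub>A\<^esub> gen 2 1"
    by (simp add: gen_simps) (simp add: dih_defs)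
  then have "\<phi> (gen 1 2) \<otimes>\<^bsub>A\<^esub> \<phi> (gen 1 2) = \<phi> (gen 2 1) \<otimes>\<^bsub>A\<^esub> \<phi> (gen 2 1)"
    by (simp only: image_gen_mult[OF 12(1,2) 12(1,2)] image_gen_mult[OF 12(2,1) 12(2,1)])
  then have eq: "coord F (\<phi> (gen 1 2) \<otimes>\<^bsub>A\<^esub> \<phi> (gen 1 2)) = coord F (\<phi> (gen 2 1) \<otimes>\<^bsub>A\<^esub> \<phi> (gen 2 1))" for F
    by simp
  have not_cong: "\<not> dih_cong (Dih p 0 False) (Dih p 1 False)" "\<not> dih_cong (Dih p 0 False) (Dih p (- 1) False)" for p
    unfolding dih_cong_def by (simp_all add: n2)
  note q = quasi_periodic_delta[of "Dih (2 * i + 1) 0 False" False]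
  have "a / 2 * (a / 2) + a / 2 * (a / 2) = inverse a / 2 * (inverse a / 2) + inverse a / 2 * (inverse a / 2)"
    using eq[of "delta (Dih (2 * i + 1) 0 False) False",
        unfolded image_product[OF g q 12(1,2) 12(1,2)] image_product[OF g q 12(2,1) 12(2,1)] Pr Pr']
    by (simp add: delta_False not_cong)
  then show "a ^ 4 = 1" using a by (simp add: field_simps power4_eq_xxxx)
qed

text \<open>With fourth roots of unity at hand, the last relation yields
  \<open>mu * a ^ (2 * N) = 1 = mu * c ^ (2 * N)\<close>. For even \<open>N\<close> these powers are
  1, so \<open>mu = 1\<close>; for odd \<open>N\<close> they are the squares of \<open>a\<close> and
  \<open>c\<close>.\<close>

lemma gamma_classification:
  assumes n2: "n = 2" and g: "moved (Dih (int s) 0 True)"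
    and Pr: "Pr (Dih (int s) 0 True) 1 1 = 1 / 2" "Pr (Dih (int s) 0 True) 2 2 = 1 / 2" and s: "s \<ge> 1"
  obtains a c where "is_Gamma N n mu lam s a c \<phi>" "Gamma_condition N n mu lam s a c"
proof -
  define g where "g = Dih (int s) 0 True"
  note g' = g[folded g_def] and Pr' = Pr[folded g_def]
  have 12: "1 \<in> {1, 2::nat}" "2 \<in> {1, 2::nat}" by simp_all
  obtain a \<gamma> \<delta> where a: "a \<noteq> 0" and \<gamma>\<delta>: "\<gamma> * \<delta> = 1 / 4"
    and P: "Pr g 1 2 = a / 2" "Pr g 2 1 = inverse a / 2"
    and T: "Th g 1 1 = \<gamma>" "Th g 1 2 = - a * \<gamma>" "Th g 2 1 = inverse a * \<gamma>" "Th g 2 2 = - \<gamma>"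
    and U: "Th (dih_swap g) 1 1 = \<delta>" "Th (dih_swap g) 1 2 = a * \<delta>"
      "Th (dih_swap g) 2 1 = - inverse a * \<delta>" "Th (dih_swap g) 2 2 = - \<delta>"
    by (rule gamma_matrices[OF g' Pr'])
  define c where "c = 2 * \<gamma>"
  note params = gamma_parameters[OF g' g_def n2 a \<gamma>\<delta> Pr' P T(1,2) U(1,2), folded c_def]
  have "c * (2 * \<delta>) = 1" using \<gamma>\<delta> by (simp add: c_def field_simps)
  then have c: "c \<noteq> 0" and \<gamma>: "\<gamma> = c / 2" and \<delta>: "\<delta> = inverse c / 2"
    using inverse_unique[of c "2 * \<delta>"] by (auto simp: c_def[symmetric]) (simp add: c_def)
  have swap_P: "Pr (dih_swap g) 1 1 = 1 / 2" "Pr (dih_swap g) 2 2 = 1 / 2"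
    "Pr (dih_swap g) 1 2 = - (a / 2)" "Pr (dih_swap g) 2 1 = - (inverse a / 2)"
    by (simp_all only: moved_Pr(3-)[OF g'] Pr' P)
  interpret two: suzuki_two N n mu lam
    by unfold_locales (rule n2, rule params(1))
  have elts: "elt g False = cmb (int s) True 1 0 0 0" "elt (dih_swap g) False = cmb (int s) True 0 1 0 0"
    "elt g True = cmb (int s) True 0 0 1 0" "elt (dih_swap g) True = cmb (int s) True 0 0 0 1"
    by (simp_all add: g_def two.cmb_elt)
  have images: "\<forall>i\<in>{1, 2}. \<forall>j\<in>{1, 2}. \<phi> (gen i j) = two.Gamma_gen s a c i j"
  proof (intro ballI)
    fix i j :: nat assume ij: "i \<in> {1, 2}" "j \<in> {1, 2}"
    consider "i = 1" "j = 1" | "i = 1" "j = 2" | "i = 2" "j = 1" | "i = 2" "j = 2" using ij by auto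
    then show "\<phi> (gen i j) = two.Gamma_gen s a c i j"
    proof cases
      case 1
      show ?thesis unfolding 1 image_expansion[OF g' 12(1) 12(1)] elts Pr' P T U swap_P \<gamma> \<delta> two.Gamma_gen_def
        by (simp add: cmb_smult cmb_add)
    next
      case 2
      show ?thesis unfolding 2 image_expansion[OF g' 12(1) 12(2)] elts Pr' P T U swap_P \<gamma> \<delta> two.Gamma_gen_def
        by (simp add: cmb_smult cmb_add)
    next
      case 3
      show ?thesis unfolding 3 image_expansion[OF g' 12(2) 12(1)] elts Pr' P T U swap_P \<gamma> \<delta> two.Gamma_gen_def
        by (simp add: cmb_smult cmb_add)
    next
      case 4
      show ?thesis unfolding 4 image_expansion[OF g' 12(2) 12(2)] elts Pr' P T U swap_P \<gamma> \<delta> two.Gamma_gen_def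
        by (simp add: cmb_smult cmb_add)
    qed
  qed
  have Gamma: "is_Gamma N n mu lam s a c \<phi>"
    unfolding two.is_Gamma_iff[OF s] using auto images by blast
  have "gen 1 1 [^]\<^bsub>A\<^esub> (2 * N) \<oplus>\<^bsub>A\<^esub> mu \<odot>\<^bsub>A\<^esub> (gen 1 2 [^]\<^bsub>A\<^esub> (2 * N)) = \<one>\<^bsub>A\<^esub>"
    using suzuki_x_relations[of N n mu lam] by (simp only: suzuki_relations_def)
  moreover have pow: "\<phi> (x [^]\<^bsub>A\<^esub> m) = \<phi> x [^]\<^bsub>A\<^esub> m" if "x \<in> carrier A" for x and m :: nat
    using that by (induct m) (simp_all add: \<phi>.mult)
  ultimately have "\<phi> (gen 1 1) [^]\<^bsub>A\<^esub> (2 * N) \<oplus>\<^bsub>A\<^esub> mu \<odot>\<^bsub>A\<^esub> (\<phi> (gen 1 2) [^]\<^bsub>A\<^esub> (2 * N)) = \<one>\<^bsub>A\<^esub>"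
    using \<phi>.add[of "gen 1 1 [^]\<^bsub>A\<^esub> (2 * N)" "mu \<odot>\<^bsub>A\<^esub> (gen 1 2 [^]\<^bsub>A\<^esub> (2 * N))"]
      \<phi>.smult[of "gen 1 2 [^]\<^bsub>A\<^esub> (2 * N)" mu] gen_closed[OF 12(1) 12(1)] gen_closed[OF 12(1) 12(2)]
    by (simp del: One_nat_def)
  then have last: "cmb 0 False ((1 + mu * a ^ (2 * N)) / 2) ((1 - mu * a ^ (2 * N)) / 2)
      (mu * c ^ (2 * N) * (1 + mu * a ^ (2 * N)) / 2) (mu * c ^ (2 * (N - 1)) * (1 - mu * a ^ (2 * N)) / 2) =
      cmb 0 False 1 0 1 0"
    using images 12 by (simp only: two.Gamma_last_relation[OF params(3)] cmb_one)
  note coords = arg_cong[OF last, of "coord (delta h d)" for h d, unfolded coord_cmb[OF quasi_periodic_delta]]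
  have not_cong: "\<not> dih_cong (Dih 0 0 False) (Dih 0 1 False)"
    unfolding dih_cong_def by (simp add: n2)
  have "(1 + mu * a ^ (2 * N)) / 2 = 1"
    using coords[of "Dih 0 0 False" False] not_cong by (simp add: delta_False)
  then have mu_a: "mu * a ^ (2 * N) = 1" by (simp add: field_simps)
  have mu_c: "mu * c ^ (2 * N) = 1"
    using coords[of "Dih 0 0 False" True] delta_not_cong[OF not_cong, of True True] by (simp add: mu_a)
  obtain i j where "Dih (int s) 0 True = Dih i j True" "coprime (2 * i + 1) (int N)"
    by (rule moved_coprime[OF g])
  then have "coprime (int (2 * s + 1)) (int N)" by (simp add: add.commute)
  then have gcd: "gcd (2 * s + 1) N = 1" by (simp only: coprime_int_iff) (simp only: coprime_iff_gcd_eq_1)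
  have "Gamma_condition N n mu lam s a c"
  proof (cases "even N")
    case True
    then obtain m where "N = 2 * m" by auto
    then have "a ^ (2 * N) = (a ^ 4) ^ m" by (simp flip: power_mult)
    then have "mu = 1" using mu_a params(2) by simp
    then show ?thesis using True params gcd n2 by (simp add: Gamma_condition_def)
  next
    case False
    then obtain m where "N = 2 * m + 1" by (auto elim: oddE)
    then have pow: "x ^ (2 * N) = (x ^ 4) ^ m * x ^ 2" for x :: 'k
      by (simp add: power_add flip: power_mult) (simp add: power2_eq_square)
    have "mu * mu = 1" using mu by auto
    then have "mu * (mu * x) = x" for x by (simp flip: mult.assoc)
    then have "mu * x = 1 \<Longrightarrow> x = mu" for x by (metis mult_1_right)
    then have "a ^ 2 = mu" "c ^ 2 = mu" using mu_a mu_c params(2,3) by (simp_all add: pow)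
    then show ?thesis using False params gcd n2 by (simp add: Gamma_condition_def)
  qed
  with Gamma show thesis by (rule that)
qed

text \<open>If \<open>2 * t = n\<close>, then \<open>t\<close> divides \<open>gcd t n = 1\<close>,
  which leaves \<open>t = 1\<close> and alternative (b). For odd \<open>n\<close> the equations
  \<open>d ^ 4 = 1\<close> and \<open>d ^ (2 * n) = 1\<close> combine to
  \<open>d ^ 2 = 1\<close>.\<close>

lemma monomial_condition:
  assumes g: "Dih i j True = Dih (int (s + k)) (int k) True \<or> Dih i j True = Dih (int (s + k)) (- int k - 1) True"
    and cop: "coprime (2 * int (s + k) + 1) (int N)" "coprime (2 * int k + 1) (int n)"
    and d: "d \<noteq> 0" and mono: "monomial_auto (Dih i j True) d \<phi>"
  shows "Psi_Phi_condition N n s (2 * k + 1) d"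
proof -
  note scalar = monomial_auto_scalar[OF refl d mono]
  have "coprime (int (2 * s + (2 * k + 1))) (int N)" "coprime (int (2 * k + 1)) (int n)"
    using cop by (simp_all add: algebra_simps)
  then have gcd: "gcd N (2 * s + (2 * k + 1)) = 1" "gcd (2 * k + 1) n = 1"
    by (simp_all only: coprime_int_iff) (simp_all only: coprime_iff_gcd_eq_1 gcd.commute[of N])
  show ?thesis
  proof (cases "2 * (2 * k + 1) = n")
    case True
    then have "2 * k + 1 dvd gcd (2 * k + 1) n" by (metis dvd_triv_right dvd_refl gcd_greatest)
    then have "k = 0" using gcd by simp
    then show ?thesis using True gcd scalar by (simp add: Psi_Phi_condition_def gcd.commute)
  next
    case False
    have "d ^ 2 = 1" if odd: "odd n"
    proof -
      obtain m where "n = 2 * m + 1" using odd by (auto elim: oddE)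
      then have "d ^ (2 * n) = (d ^ 4) ^ m * d ^ 2"
        by (simp add: power_add flip: power_mult) (simp add: power2_eq_square)
      then show ?thesis using scalar by simp
    qed
    then show ?thesis using False gcd scalar by (simp add: Psi_Phi_condition_def)
  qed
qed

lemma classification:
  "(\<exists>s\<in>{1..N}. \<exists>t\<in>{1..n - 1}. \<exists>d. d \<noteq> 0 \<and> is_Psi N n mu lam s t d \<phi> \<and> Psi_Phi_condition N n s t d) \<or>
   (\<exists>s\<in>{1..N}. \<exists>t\<in>{1..n - 1}. \<exists>d. d \<noteq> 0 \<and> is_Phi N n mu lam s t d \<phi> \<and> Psi_Phi_condition N n s t d) \<or>
   (\<exists>s\<in>{1..N}. \<exists>a c. is_Gamma N n mu lam s a c \<phi> \<and> Gamma_condition N n mu lam s a c)"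
proof -
  obtain s k where s: "s \<in> {1..N}" and k: "2 * k + 1 \<in> {1..n - 1}"
    and moved: "moved (Dih (int (s + k)) (int k) True)"
    by (rule moved_word_point)
  define g where "g = Dih (int (s + k)) (int k) True"
  have g: "moved g" using moved by (simp only: g_def)
  have cop: "coprime (2 * int (s + k) + 1) (int N)" "coprime (2 * int k + 1) (int n)"
    using moved_coprime[OF moved] by (metis dih.inject)+
  have s1: "s \<ge> 1" and t1: "2 * k + 1 \<ge> 1" using s by simp_all
  have g_Psi: "word_point s (2 * k + 1) False = g" and g_Phi: "word_point s (2 * k + 1) True = dih_swap g"
    by (simp_all add: g_def word_point_def dih_alt_def)
  show ?thesis
  proof (cases "Pr g 1 2 = 0 \<and> Pr g 2 1 = 0")
    case True
    note Prs = moved_Pr[OF g]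
    \<comment> \<open>The diagonal entries have sum 1 and product 0. The first choice leads to
      \<Psi>; the second becomes the first after replacing \<open>g\<close> by its swap and leads to
      \<Phi>.\<close>
    have "Pr g 1 1 = 1 \<or> Pr g 2 2 = 1" using Prs(1,2) True by auto
    then show ?thesis
    proof
      assume "Pr g 1 1 = 1"
      then obtain d where d: "d \<noteq> 0" "monomial_auto g d \<phi>"
        using monomial_of_diagonal[OF g] True by blast
      then have "Psi_Phi_condition N n s (2 * k + 1) d"
        using monomial_condition[OF _ cop d(1)] unfolding g_def by blast
      moreover have "is_Psi N n mu lam s (2 * k + 1) d \<phi>"
        using d(2) by (simp only: is_Psi_iff[OF s1 t1] g_Psi)
      ultimately show ?thesis using d(1) s k by blast
    next
      assume "Pr g 2 2 = 1"
      then have "Pr (dih_swap g) 1 1 = 1" "Pr (dih_swap g) 1 2 = 0" "Pr (dih_swap g) 2 1 = 0"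
        using Prs(3-) True by simp_all
      then obtain d where d: "d \<noteq> 0" "monomial_auto (dih_swap g) d \<phi>"
        using monomial_of_diagonal[OF moved_swap[OF g]] by blast
      have sw: "dih_swap g = Dih (int (s + k)) (- int k - 1) True" by (simp add: g_def)
      have "Psi_Phi_condition N n s (2 * k + 1) d"
        using monomial_condition[OF _ cop d(1)] d(2) unfolding sw by blast
      moreover have "is_Phi N n mu lam s (2 * k + 1) d \<phi>"
        using d(2) by (simp only: is_Phi_iff[OF s1 t1] g_Phi)
      ultimately show ?thesis using d(1) s k by blast
    qed
  next
    case False
    then obtain i j where ij: "(i, j) = (1, 2) \<or> (i, j) = (2, 1)" "Pr g i j \<noteq> 0" by blast
    note off = moved_off_diagonal[OF g g_def cop(2) ij]
    \<comment> \<open>For \<open>n = 2\<close> the only odd \<open>t\<close> below \<open>n\<close>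
      is 1, so the base point is \<open>z^s u\<close>.\<close>
    have k0: "k = 0" using k off(1) by simp
    have "g = Dih (int s) 0 True" by (simp add: g_def k0)
    then obtain a c where "is_Gamma N n mu lam s a c \<phi>" "Gamma_condition N n mu lam s a c"
      using gamma_classification[OF off(1) _ _ _ s1] g off(2,3) by metis
    then show ?thesis using s by blast
  qed
qed

end

theorem theorem3p8:
  fixes N n :: nat and mu lam :: "'k::{alg_closed_field, field_char_0}"
  assumes "N \<ge> 1" and "n \<ge> 2" and "mu \<in> {1, -1}" and "lam \<in> {1, -1}"
  shows "(\<forall>\<phi> \<in> hopf_auto (suzuki N n mu lam).
            (\<exists>s\<in>{1..N}. \<exists>t\<in>{1..n-1}. \<exists>d\<^sub>2. d\<^sub>2 \<noteq> 0 \<and> is_Psi N n mu lam s t d\<^sub>2 \<phi> \<and>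
               Psi_Phi_condition N n s t d\<^sub>2) \<or>
            (\<exists>s\<in>{1..N}. \<exists>t\<in>{1..n-1}. \<exists>d\<^sub>3. d\<^sub>3 \<noteq> 0 \<and> is_Phi N n mu lam s t d\<^sub>3 \<phi> \<and>
               Psi_Phi_condition N n s t d\<^sub>3) \<or>
            (\<exists>s\<in>{1..N}. \<exists>\<zeta>\<^sub>1 \<zeta>\<^sub>2. is_Gamma N n mu lam s \<zeta>\<^sub>1 \<zeta>\<^sub>2 \<phi> \<and>
               Gamma_condition N n mu lam s \<zeta>\<^sub>1 \<zeta>\<^sub>2)) \<and>
         (\<forall>s\<in>{1..N}. \<forall>t\<in>{1..n-1}. \<forall>d\<^sub>2. d\<^sub>2 \<noteq> 0 \<and> Psi_Phi_condition N n s t d\<^sub>2 \<longrightarrow>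
            (\<exists>!\<phi>. is_Psi N n mu lam s t d\<^sub>2 \<phi>)) \<and>
         (\<forall>s\<in>{1..N}. \<forall>t\<in>{1..n-1}. \<forall>d\<^sub>3. d\<^sub>3 \<noteq> 0 \<and> Psi_Phi_condition N n s t d\<^sub>3 \<longrightarrow>
            (\<exists>!\<phi>. is_Phi N n mu lam s t d\<^sub>3 \<phi>)) \<and>
         (\<forall>s\<in>{1..N}. \<forall>\<zeta>\<^sub>1 \<zeta>\<^sub>2. Gamma_condition N n mu lam s \<zeta>\<^sub>1 \<zeta>\<^sub>2 \<longrightarrow>
            (\<exists>!\<phi>. is_Gamma N n mu lam s \<zeta>\<^sub>1 \<zeta>\<^sub>2 \<phi>))"
proof -
  interpret suzuki_parameters N n mu lam
    using assms by unfold_locales auto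
  have Gamma: "\<exists>!\<phi>. is_Gamma N n mu lam s a c \<phi>" if s: "s \<in> {1..N}" and cond: "Gamma_condition N n mu lam s a c" for s a c
  proof -
    have nl: "n = 2" "lam = 1" and gcd: "gcd (2 * s + 1) N = 1"
      using cond by (simp_all add: Gamma_condition_def)
    interpret two: suzuki_two N n mu lam by unfold_locales (rule nl)+
    have mu2: "mu ^ 2 = 1" using assms(3) by auto
    \<comment> \<open>Recovers the two uniform conditions from the case distinction on
      \<open>N\<close>: for even \<open>N\<close> the power \<open>x ^ (2 * N)\<close> is a power of
      \<open>x ^ 4\<close>, and for odd \<open>N\<close> it equals
      \<open>mu ^ N = mu\<close>.\<close>
    have roots: "x ^ 4 = 1 \<and> mu * x ^ (2 * N) = 1" if x: "if even N then x ^ 4 = 1 \<and> mu = 1 else x ^ 2 = mu" for x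
    proof (cases "even N")
      case True
      then obtain m where "N = 2 * m" by auto
      then have "x ^ (2 * N) = (x ^ 4) ^ m" by (simp flip: power_mult)
      then show ?thesis using x True by simp
    next
      case False
      then obtain m where m: "N = 2 * m + 1" by (auto elim: oddE)
      have x2: "x ^ 2 = mu" using x False by simp
      have "x ^ 4 = (x ^ 2) ^ 2" by (simp flip: power_mult)
      moreover have "x ^ (2 * N) = mu ^ N" by (simp only: power_mult x2)
      moreover have "mu ^ N = mu" by (simp add: m power_mult mu2)
      ultimately show ?thesis using mu2 by (simp only: x2) (simp add: power2_eq_square)
    qed
    have "coprime (int (2 * s + 1)) (int N)" unfolding coprime_int_iff using gcd by (simp only: coprime_iff_gcd_eq_1)
    then have "coprime (2 * int s + 1) (int N)" by (simp add: add.commute)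
    moreover have "a ^ 4 = 1 \<and> mu * a ^ (2 * N) = 1" "c ^ 4 = 1 \<and> mu * c ^ (2 * N) = 1"
      by (rule roots, use cond in \<open>simp add: Gamma_condition_def split: if_splits\<close>)+
    ultimately show ?thesis using s by (intro two.Gamma_exists) simp_all
  qed
  have auto: "suzuki_auto N n mu lam \<phi>" if "\<phi> \<in> hopf_auto (suzuki N n mu lam)" for \<phi>
    using that by unfold_locales
  show ?thesis
  proof (intro conjI ballI allI impI)
    fix s t and d :: 'k assume "s \<in> {1..N}" "t \<in> {1..n - 1}" "d \<noteq> 0 \<and> Psi_Phi_condition N n s t d"
    then have "s \<ge> 1" "t \<ge> 1" "Psi_Phi_condition N n s t d" by simp_all
    then show "\<exists>!\<phi>. is_Psi N n mu lam s t d \<phi>" "\<exists>!\<phi>. is_Phi N n mu lam s t d \<phi>"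
      by (fact Psi_exists, fact Phi_exists)
  qed (fact suzuki_auto.classification[OF auto] Gamma)+
qed

end
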